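(* Let $M$ be a $2$-dimensional complex manifold which is the union of an increasing sequence of open subsets $M_j\subset M_{j+1}$, each of which is biholomorphic to a fixed $C^\infty$-smoothly bounded strongly convex domain $\Omega\subset\mathbb{C}^2$. If $M$ is (Kobayashi) hyperbolic, then $M$ is biholomorphic to either $\Omega$ or the unit ball $\mathbb{B}^2\subset\mathbb{C}^2$. If $M$ is non-hyperbolic and the corank of $F_M$ is one, then $M$ is biholomorphic to $\Delta\times\mathbb{C}$.
   Context: $\Delta\subset\mathbb{C}$ is the unit disc. $F_M$ is the infinitesimal Kobayashi metric of $M$; its corank is the complex dimension of $\{v\in T_pM:F_M(p,v)=0\}$, which is independent of $p$ in this setting. *)

theory Defs
  imports "HOL-Analysis.Analysis" "HOL-Complex_Analysis.Complex_Analysis"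
    "HOL-Library.Function_Algebras"
begin

section \<open>Holomorphic maps between open subsets of complex coordinate spaces\<close>

text \<open>Complex differentiability at every point: the real derivative exists and is complex linear.
  Used for open \<open>S\<close> only.\<close>

definition holomorphic_vec_on ::
    "(complex^'m \<Rightarrow> complex^'n) \<Rightarrow> (complex^'m) set \<Rightarrow> bool" where
  "holomorphic_vec_on f S \<longleftrightarrow>
     (\<forall>z\<in>S. \<exists>D. (f has_derivative D) (at z) \<and> (\<forall>c v. D (c *s v) = c *s D v))"


section \<open>Complex manifolds\<close>

type_synonym ('a, 'n) chart = "'a set \<times> ('a \<Rightarrow> complex^'n)"

text \<open>A pair \<open>(U, \<phi>)\<close> is a coordinate domain with a coordinate map. The values of \<open>\<phi>\<close> outside \<open>U\<close>
  are irrelevant throughout, and so are the values of maps outside the underlying space.\<close>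

record ('a, 'n::finite) cmanifold =
  mtop :: "'a topology"
  charts :: "('a, 'n) chart set"

abbreviation points :: "('a, 'n::finite, 'z) cmanifold_scheme \<Rightarrow> 'a set" where
  "points M \<equiv> topspace (mtop M)"

definition transition :: "('a, 'n::finite) chart \<Rightarrow> ('a, 'n) chart \<Rightarrow> complex^'n \<Rightarrow> complex^'n" where
  "transition c d = snd d \<circ> inv_into (fst c) (snd c)"

definition complex_manifold :: "('a, 'n::finite) cmanifold \<Rightarrow> bool" where
  "complex_manifold M \<longleftrightarrow>
     Hausdorff_space (mtop M) \<and> second_countable (mtop M) \<and>
     (\<Union>(U, \<phi>)\<in>charts M. U) = points M \<and>
     (\<forall>(U, \<phi>)\<in>charts M. openin (mtop M) U \<and> open (\<phi> ` U) \<and>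
        homeomorphic_map (subtopology (mtop M) U) (top_of_set (\<phi> ` U)) \<phi>) \<and>
     (\<forall>(U, \<phi>)\<in>charts M. \<forall>(V, \<psi>)\<in>charts M.
        holomorphic_vec_on (transition (U, \<phi>) (V, \<psi>)) (\<phi> ` (U \<inter> V)))"

definition domain_manifold :: "(complex^'n) set \<Rightarrow> (complex^'n, 'n::finite) cmanifold" where
  "domain_manifold D = \<lparr>mtop = top_of_set D, charts = {(D, id)}\<rparr>"

definition open_submanifold ::
    "('a, 'n::finite) cmanifold \<Rightarrow> 'a set \<Rightarrow> ('a, 'n) cmanifold" where
  "open_submanifold M W =
     \<lparr>mtop = subtopology (mtop M) W, charts = {(U \<inter> W, \<phi>) |U \<phi>. (U, \<phi>) \<in> charts M}\<rparr>"

definition holomorphic_map ::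
    "('a, 'm::finite) cmanifold \<Rightarrow> ('b, 'n::finite) cmanifold \<Rightarrow> ('a \<Rightarrow> 'b) \<Rightarrow> bool" where
  "holomorphic_map M N f \<longleftrightarrow>
     continuous_map (mtop M) (mtop N) f \<and>
     (\<forall>(U, \<phi>)\<in>charts M. \<forall>(V, \<psi>)\<in>charts N.
        holomorphic_vec_on (\<psi> \<circ> f \<circ> inv_into U \<phi>) (\<phi> ` {x\<in>U. f x \<in> V}))"

definition biholomorphic ::
    "('a, 'm::finite) cmanifold \<Rightarrow> ('b, 'n::finite) cmanifold \<Rightarrow> bool" where
  "biholomorphic M N \<longleftrightarrow>
     (\<exists>f g. holomorphic_map M N f \<and> holomorphic_map N M g \<and>
        (\<forall>x\<in>points M. g (f x) = x) \<and> (\<forall>y\<in>points N. f (g y) = y))"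

lemma complex_manifold_domain_manifold:
  fixes D :: "(complex^'n::finite) set"
  assumes "open D"
  shows "complex_manifold (domain_manifold D)"
proof -
  have t: "transition (D, id) (D, id) x = x" if "x \<in> D" for x
    using that by (simp add: transition_def inv_into_f_f[of id D x, simplified])
  have "holomorphic_vec_on (transition (D, id) (D, id)) D"
    unfolding holomorphic_vec_on_def
  proof
    fix z assume z: "z \<in> D"
    have "(transition (D, id) (D, id) has_derivative (\<lambda>v. v)) (at z)"
      by (rule has_derivative_transform_within_open[OF has_derivative_ident assms z]) (simp add: t)
    then show "\<exists>E. (transition (D, id) (D, id) has_derivative E) (at z) \<and>
        (\<forall>c v. E (c *s v) = c *s E v)"
      by blast
  qed
  moreover have "second_countable (top_of_set D)"
  proof (rule second_countable_subtopology)
    obtain B :: "(complex^'n) set set" where B: "countable B" "topological_basis B"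
      using ex_countable_basis by blast
    show "second_countable (euclidean :: (complex^'n) topology)"
      unfolding second_countable_def
    proof (intro exI conjI allI impI)
      show "countable B" by (rule B)
      show "\<forall>V\<in>B. openin euclidean V"
        using topological_basis_open[OF B(2)] by simp
      fix U and x :: "complex^'n" assume "openin euclidean U \<and> x \<in> U"
      then show "\<exists>V\<in>B. x \<in> V \<and> V \<subseteq> U"
        using topological_basisE[OF B(2), of U x] by (metis open_openin)
    qed
  qed
  moreover have "Hausdorff_space (top_of_set D)"
    by (simp add: Hausdorff_space_subtopology)
  ultimately show ?thesis
    unfolding complex_manifold_def domain_manifold_def
    using assms by (simp add: homeomorphic_map_id[unfolded id_def] id_def subtopology_subtopology)
qed


section \<open>Tangent vectors\<close>

definition charts_at :: "('a, 'n::finite) cmanifold \<Rightarrow> 'a \<Rightarrow> ('a, 'n) chart set" where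
  "charts_at M p = {c \<in> charts M. p \<in> fst c}"

text \<open>A (holomorphic) tangent vector at \<open>p\<close> is a family of coordinate vectors, one for each chart
  around \<open>p\<close>, transforming by the derivatives of the transition maps. The entry at any other chart
  is set to zero, so that the vector space operations of \<open>T\<^sub>pM\<close> are the pointwise ones.\<close>

definition tangent_space ::
    "('a, 'n::finite) cmanifold \<Rightarrow> 'a \<Rightarrow> (('a, 'n) chart \<Rightarrow> complex^'n) set" where
  "tangent_space M p =
     {v. (\<forall>c. c \<notin> charts_at M p \<longrightarrow> v c = 0) \<and>
         (\<forall>c\<in>charts_at M p. \<forall>d\<in>charts_at M p.
            v d = frechet_derivative (transition c d) (at (snd c p)) (v c))}"

definition tangent_scale ::
    "complex \<Rightarrow> (('a, 'n::finite) chart \<Rightarrow> complex^'n) \<Rightarrow> (('a, 'n) chart \<Rightarrow> complex^'n)" where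
  "tangent_scale a v = (\<lambda>c. a *s v c)"

lemma vector_space_tangent_scale: "vector_space tangent_scale"
  by unfold_locales (auto simp: tangent_scale_def fun_eq_iff)


section \<open>Kobayashi metric and hyperbolicity\<close>

definition holomorphic_disc :: "('a, 'n::finite) cmanifold \<Rightarrow> (complex \<Rightarrow> 'a) \<Rightarrow> bool" where
  "holomorphic_disc M f \<longleftrightarrow>
     continuous_map (top_of_set (ball 0 1)) (mtop M) f \<and>
     (\<forall>(U, \<phi>)\<in>charts M. \<forall>i. (\<lambda>z. \<phi> (f z) $ i) holomorphic_on {z\<in>ball 0 1. f z \<in> U})"

text \<open>The tangent vector \<open>f'(0)\<close> at \<open>f 0\<close>.\<close>

definition disc_velocity ::
    "('a, 'n::finite) cmanifold \<Rightarrow> (complex \<Rightarrow> 'a) \<Rightarrow> ('a, 'n) chart \<Rightarrow> complex^'n" where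
  "disc_velocity M f =
     (\<lambda>c. if c \<in> charts_at M (f 0) then (\<chi> i. deriv (\<lambda>z. snd c (f z) $ i) 0) else 0)"

text \<open>\<open>F\<^sub>M(p, v) = inf {1 / \<alpha> : \<alpha> > 0, f : \<Delta> \<rightarrow> M holomorphic, f 0 = p, f'(0) = \<alpha> v}\<close>.\<close>

definition kobayashi_metric ::
    "('a, 'n::finite) cmanifold \<Rightarrow> 'a \<Rightarrow> (('a, 'n) chart \<Rightarrow> complex^'n) \<Rightarrow> ennreal" where
  "kobayashi_metric M p v =
     Inf {ennreal (1 / \<alpha>) |\<alpha> f. 0 < \<alpha> \<and> holomorphic_disc M f \<and> f 0 = p \<and>
            disc_velocity M f = tangent_scale (complex_of_real \<alpha>) v}"

text \<open>\<open>dim\<close> of a set is the dimension of its span. The null set of \<open>F\<^sub>M(p, -)\<close> is closed under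
  complex scalars, so \<open>kobayashi_corank M p = 1\<close> says precisely that it is a complex line.\<close>

definition kobayashi_corank :: "('a, 'n::finite) cmanifold \<Rightarrow> 'a \<Rightarrow> nat" where
  "kobayashi_corank M p =
     vector_space.dim tangent_scale {v \<in> tangent_space M p. kobayashi_metric M p v = 0}"

definition poincare_dist :: "complex \<Rightarrow> complex \<Rightarrow> real" where
  "poincare_dist a b = artanh (cmod ((a - b) / (1 - cnj a * b)))"

text \<open>Kobayashi pseudodistance: infimum of the lengths of chains of holomorphic discs
  \<open>f\<^sub>0, \<dots>, f\<^sub>n\<close> joining \<open>p\<close> to \<open>q\<close>; it is \<open>\<infinity>\<close> if there is no such chain.\<close>

definition kobayashi_dist :: "('a, 'n::finite) cmanifold \<Rightarrow> 'a \<Rightarrow> 'a \<Rightarrow> ennreal" where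
  "kobayashi_dist M p q =
     Inf {(\<Sum>i\<le>n. ennreal (poincare_dist (a i) (b i))) |n f a b.
            (\<forall>i\<le>n. holomorphic_disc M (f i) \<and> a i \<in> ball 0 1 \<and> b i \<in> ball 0 1) \<and>
            f 0 (a 0) = p \<and> f n (b n) = q \<and> (\<forall>i<n. f i (b i) = f (Suc i) (a (Suc i)))}"

definition kobayashi_hyperbolic :: "('a, 'n::finite) cmanifold \<Rightarrow> bool" where
  "kobayashi_hyperbolic M \<longleftrightarrow>
     (\<forall>p\<in>points M. \<forall>q\<in>points M. p \<noteq> q \<longrightarrow> kobayashi_dist M p q \<noteq> 0)"


section \<open>Smoothly bounded strongly convex domains\<close>

primrec Ck_on :: "nat \<Rightarrow> ('e::euclidean_space \<Rightarrow> real) \<Rightarrow> 'e set \<Rightarrow> bool" where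
  "Ck_on 0 r U \<longleftrightarrow> continuous_on U r"
| "Ck_on (Suc k) r U \<longleftrightarrow> (\<forall>x\<in>U. r differentiable (at x)) \<and>
     (\<forall>e\<in>Basis. Ck_on k (\<lambda>x. frechet_derivative r (at x) e) U)"

definition smooth_on :: "('e::euclidean_space \<Rightarrow> real) \<Rightarrow> 'e set \<Rightarrow> bool" where
  "smooth_on r U \<longleftrightarrow> (\<forall>k. Ck_on k r U)"

definition hessian_form :: "('e::euclidean_space \<Rightarrow> real) \<Rightarrow> 'e \<Rightarrow> 'e \<Rightarrow> real" where
  "hessian_form r x v =
     frechet_derivative (\<lambda>y. frechet_derivative r (at y) v) (at x) v"

definition smooth_defining_function ::
    "'e::euclidean_space set \<Rightarrow> 'e set \<Rightarrow> ('e \<Rightarrow> real) \<Rightarrow> bool" where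
  "smooth_defining_function D U r \<longleftrightarrow>
     open U \<and> frontier D \<subseteq> U \<and> smooth_on r U \<and> D \<inter> U = {x\<in>U. r x < 0} \<and>
     (\<forall>x\<in>frontier D. \<exists>v. frechet_derivative r (at x) v \<noteq> 0)"

text \<open>The last condition of the next definition is that all normal curvatures of the boundary are
  positive: the real Hessian of a defining function is positive definite on the real tangent space
  of the boundary at each of its points.\<close>

definition smooth_strongly_convex_domain :: "'e::euclidean_space set \<Rightarrow> bool" where
  "smooth_strongly_convex_domain D \<longleftrightarrow>
     D \<noteq> {} \<and> open D \<and> connected D \<and> bounded D \<and> convex D \<and>
     (\<exists>U r. smooth_defining_function D U r \<and>
        (\<forall>x\<in>frontier D. \<forall>v. v \<noteq> 0 \<and> frechet_derivative r (at x) v = 0 \<longrightarrow>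
           0 < hessian_form r x v))"


section \<open>Increasing unions\<close>

definition increasing_union_of_copies ::
    "('a, 'n::finite) cmanifold \<Rightarrow> (nat \<Rightarrow> 'a set) \<Rightarrow> (complex^'n) set \<Rightarrow> bool" where
  "increasing_union_of_copies M Mj D \<longleftrightarrow>
     (\<forall>j. openin (mtop M) (Mj j) \<and> Mj j \<subseteq> Mj (Suc j) \<and>
          biholomorphic (open_submanifold M (Mj j)) (domain_manifold D)) \<and>
     (\<Union>j. Mj j) = points M"

end

theory Submission
 imports Defs
begin

text \<open>Fix a point \<open>x\<close> of the manifold \<open>X\<close>. If the images of \<open>x\<close> under the inverses of the
 parametrizations stay away from the boundary of \<open>\<Omega>\<close> along a subsequence, put \<open>D = \<Omega>\<close>; otherwise a
 rescaling at the strongly convex limit point replaces \<open>\<Omega>\<close> by the ball \<open>D\<close>. Normal families give a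
 limit \<open>Phi : X \<rightarrow> D\<close>, and \<open>h\<close>, the limit of \<open>Phi\<close> composed with the parametrizations of \<open>X\<close> by \<open>D\<close>,
 is a holomorphic retraction of \<open>D\<close> with \<open>h \<circ> Phi = Phi\<close>. The metric vanishes exactly on the kernel of
 the derivative of \<open>Phi\<close>, so hyperbolicity makes \<open>Phi\<close> injective, hence onto \<open>D\<close>. For corank one the
 image of \<open>h\<close> is a disc and \<open>Phi\<close> a submersion onto it, whose fibres are increasing unions of discs of
 unbounded size. Normalized univalent fibre coordinates converge by the Koebe-type distortion bounds
 to local trivializations with fibre \<open>\<complex>\<close>, and an additive Cousin problem glues these over the disc.\<close>

text \<open>The coordinate maps \<open>phi n\<close> converge, but their inverses
  \<open>psi n\<close> take values in the unknown space; only \<open>Phi \<circ> psi n\<close> has a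
  limit in a known one. This limit \<open>h\<close> stands in for an inverse of \<open>Phi\<close>
  and measures how far \<open>Phi\<close> is from having one. When \<open>Phi\<close> drops rank,
  the image of \<open>h\<close> is at first just a fixed point set, visibly a curve only near one
  point. Convexity of \<open>D\<close> turns it into a disc: homotheties of \<open>D\<close>
  followed by \<open>h\<close> contract the retract towards that point, and their iterates transport
  the local coordinate to large parts of it. Over this disc the charts contain bidiscs whose fibre
  size is independent of \<open>n\<close>, while each given point of the space has fibre coordinate
  tending to zero; hence the limiting fibres are whole planes. At a boundary point of accumulation
  the nearest boundary points move with \<open>n\<close>, so strong convexity is used uniformly in a
  neighbourhood. The rescaled boundary tends to a quadric that need not be Hermitian; a polynomial
  shear removes the part \<open>Re (\<beta> * t\<^sup>2)\<close> before a Cayley transform leads to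
  the ball.\<close>

no_notation fps_nth (infixl "$" 75)

abbreviation eventually_seq :: "(nat \<Rightarrow> bool) \<Rightarrow> bool"  (binder "\<forall>\<^sub>F" 10) where
 "eventually_seq P \<equiv> eventually P sequentially"

text \<open>A common class for \<open>complex\<close> and \<open>complex^'n\<close>, so that one
  calculus based on real derivatives covers functions, discs and maps alike. \<open>norm_cs\<close>
  controls distances along complex lines, on which the Cauchy estimates rely.\<close>

class complex_euclidean = euclidean_space +
 fixes cs :: "complex \<Rightarrow> 'a \<Rightarrow> 'a"
 assumes cs_add_right: "cs a (x + y) = cs a x + cs a y"
  and cs_add_left: "cs (a + b) x = cs a x + cs b x"
  and cs_cs: "cs a (cs b x) = cs (a * b) x"
  and cs_of_real: "cs (complex_of_real r) x = r *\<^sub>R x"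
  and norm_cs: "norm (cs a x) = cmod a * norm x"

lemma cs_1 [simp]: "cs 1 (x::'a::complex_euclidean) = x"
 using cs_of_real[of 1 x] by simp

lemma cs_0 [simp]: "cs 0 (x::'a::complex_euclidean) = 0"
 using cs_of_real[of 0 x] by simp

lemma cs_zero_right [simp]: "cs a (0::'a::complex_euclidean) = 0"
 using cs_add_right[of a 0 "0::'a"] by simp

lemma cs_scaleR_right: "cs a (r *\<^sub>R (x::'a::complex_euclidean)) = r *\<^sub>R cs a x"
 by (metis cs_cs cs_of_real mult.commute)

instantiation complex :: complex_euclidean
begin
definition cs_complex :: "complex \<Rightarrow> complex \<Rightarrow> complex" where "cs_complex a x = a * x"
instance by standard (auto simp: cs_complex_def algebra_simps norm_mult scaleR_conv_of_real)
end

instantiation vec :: (complex_euclidean, finite) complex_euclidean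
begin
definition cs_vec :: "complex \<Rightarrow> 'a ^ 'b \<Rightarrow> 'a ^ 'b" where
 "cs_vec a x = (\<chi> i. cs a (x $ i))"
instance
proof
 fix a :: complex and x :: "'a ^ 'b"
 show "norm (cs a x) = cmod a * norm x"
  by (simp add: cs_vec_def norm_vec_def norm_cs L2_set_right_distrib)
qed (auto simp: cs_vec_def cs_add_right cs_add_left cs_cs cs_of_real vec_eq_iff)
end

lemma cs_vec_eq: "cs a (x :: complex ^ 'n) = a *s x"
 by (simp add: cs_vec_def cs_complex_def vector_scalar_mult_def)

lemma bounded_bilinear_cs: "bounded_bilinear (cs :: complex \<Rightarrow> 'a \<Rightarrow> 'a::complex_euclidean)"
proof
 fix r :: real and a :: complex and b :: 'a
 show "cs (r *\<^sub>R a) b = r *\<^sub>R cs a b"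
  by (simp add: scaleR_conv_of_real flip: cs_cs cs_of_real)
 show "\<exists>K. \<forall>(a::complex) (b::'a). norm (cs a b) \<le> norm a * norm b * K"
  by (rule exI[of _ 1]) (simp add: norm_cs)
qed (auto simp: cs_add_right cs_add_left cs_scaleR_right)

interpretation cs: bounded_bilinear "cs :: complex \<Rightarrow> 'a \<Rightarrow> 'a::complex_euclidean"
 by (rule bounded_bilinear_cs)

section \<open>Complex linear maps and holomorphy\<close>

definition clinear :: "('a::complex_euclidean \<Rightarrow> 'b::complex_euclidean) \<Rightarrow> bool" where
 "clinear D \<longleftrightarrow> bounded_linear D \<and> (\<forall>c v. D (cs c v) = cs c (D v))"

lemma clinearD: "clinear D \<Longrightarrow> bounded_linear D" "clinear D \<Longrightarrow> D (cs c v) = cs c (D v)"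
 by (auto simp: clinear_def)

text \<open>The definition of \<open>holomorphic_vec_on\<close> carried over to the class, so that
  it also applies to discs and scalar functions; \<open>holo_vec_iff\<close> is the bridge to the
  statement.\<close>

definition holo :: "('a::complex_euclidean \<Rightarrow> 'b::complex_euclidean) \<Rightarrow> 'a set \<Rightarrow> bool" where
 "holo f S \<longleftrightarrow> (\<forall>z\<in>S. \<exists>D. (f has_derivative D) (at z) \<and> (\<forall>c v. D (cs c v) = cs c (D v)))"

abbreviation cder :: "('a::complex_euclidean \<Rightarrow> 'b::complex_euclidean) \<Rightarrow> 'a \<Rightarrow> 'a \<Rightarrow> 'b" where
 "cder f z \<equiv> frechet_derivative f (at z)"

lemma cder_eqI: "(f has_derivative D) (at z) \<Longrightarrow> cder f z = D"
 by (rule frechet_derivative_at[symmetric])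

lemma holoD:
 assumes "holo f S" "z \<in> S"
 shows "(f has_derivative cder f z) (at z)" "clinear (cder f z)"
proof -
 obtain D where D: "(f has_derivative D) (at z)" "\<forall>c v. D (cs c v) = cs c (D v)"
  using assms unfolding holo_def by blast
 have "D = cder f z" using D(1) by (rule frechet_derivative_at)
 thus "(f has_derivative cder f z) (at z)" "clinear (cder f z)"
  using D has_derivative_bounded_linear by (auto simp: clinear_def)
qed

lemma holoI: "(\<And>z. z \<in> S \<Longrightarrow> (f has_derivative D z) (at z)) \<Longrightarrow> (\<And>z. z \<in> S \<Longrightarrow> clinear (D z)) \<Longrightarrow> holo f S"
 unfolding holo_def clinear_def by blast

lemma holo_iff_clinear:
 "holo f S \<longleftrightarrow> (\<forall>z\<in>S. \<exists>D. (f has_derivative D) (at z) \<and> clinear D)"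
 unfolding holo_def clinear_def by (blast dest: has_derivative_bounded_linear)

lemma holo_vec_iff: "holomorphic_vec_on f S \<longleftrightarrow> holo f S"
 by (simp add: holomorphic_vec_on_def holo_def cs_vec_eq)

lemma holo_subset: "holo f S \<Longrightarrow> T \<subseteq> S \<Longrightarrow> holo f T"
 unfolding holo_def by blast

lemma holo_local: "(\<And>z. z \<in> S \<Longrightarrow> \<exists>T. z \<in> T \<and> holo f T) \<Longrightarrow> holo f S"
 unfolding holo_def by blast

lemma holo_cong:
 assumes "holo f S" "open S" "\<And>x. x \<in> S \<Longrightarrow> f x = g x"
 shows "holo g S"
 unfolding holo_def
proof
 fix z assume z: "z \<in> S"
 then obtain D where "(f has_derivative D) (at z)" "\<forall>c v. D (cs c v) = cs c (D v)"
  using assms(1) unfolding holo_def by blast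
 thus "\<exists>D. (g has_derivative D) (at z) \<and> (\<forall>c v. D (cs c v) = cs c (D v))"
  using has_derivative_transform_within_open[OF _ assms(2) z] assms(3) by blast
qed

lemma holo_isCont: "holo f S \<Longrightarrow> z \<in> S \<Longrightarrow> isCont f z"
 using holoD(1) has_derivative_continuous by blast

lemma holo_continuous_on: "holo f S \<Longrightarrow> continuous_on S f"
 by (simp add: continuous_at_imp_continuous_on holo_isCont)

lemma clinear_compose: "clinear f \<Longrightarrow> clinear g \<Longrightarrow> clinear (\<lambda>x. g (f x))"
 unfolding clinear_def by (simp add: bounded_linear_compose[of g f])

lemma holo_compose:
 assumes "holo f S" "holo g T" "f ` S \<subseteq> T"
 shows "holo (\<lambda>x. g (f x)) S"
proof (rule holoI)
 fix z assume z: "z \<in> S"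
 hence fz: "f z \<in> T" using assms by auto
 show "((\<lambda>x. g (f x)) has_derivative (\<lambda>v. cder g (f z) (cder f z v))) (at z)"
  by (rule has_derivative_compose[OF holoD(1)[OF assms(1) z] holoD(1)[OF assms(2) fz]])
 show "clinear (\<lambda>v. cder g (f z) (cder f z v))"
  by (rule clinear_compose[OF holoD(2)[OF assms(1) z] holoD(2)[OF assms(2) fz]])
qed

lemma cder_compose:
 assumes "holo f S" "holo g T" "z \<in> S" "f z \<in> T"
 shows "cder (\<lambda>x. g (f x)) z v = cder g (f z) (cder f z v)"
proof -
 have "((\<lambda>x. g (f x)) has_derivative (\<lambda>v. cder g (f z) (cder f z v))) (at z)"
  by (rule has_derivative_compose[OF holoD(1)[OF assms(1,3)] holoD(1)[OF assms(2,4)]])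
 from cder_eqI[OF this] show ?thesis by simp
qed

lemma cder_cong:
 assumes "open S" "z \<in> S" "\<And>x. x \<in> S \<Longrightarrow> f x = g x" "holo f S"
 shows "cder f z = cder g z"
 by (rule sym, rule cder_eqI, rule has_derivative_transform_within_open[OF holoD(1)[OF assms(4,2)] assms(1,2)],
   erule assms(3))

lemma clinear_holo: "clinear L \<Longrightarrow> holo L S"
 by (rule holoI[where D="\<lambda>_. L"]) (simp_all add: bounded_linear_imp_has_derivative clinearD(1))

lemma holo_const [intro,simp]: "holo (\<lambda>x. c) S"
 by (rule holoI[where D="\<lambda>_ _. 0"]) (auto simp: clinear_def)

lemma holo_ident [intro,simp]: "holo (\<lambda>x. x) S"
 by (rule holoI[where D="\<lambda>_ v. v"]) (auto simp: clinear_def)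

lemma holo_add: "holo f S \<Longrightarrow> holo g S \<Longrightarrow> holo (\<lambda>x. f x + g x) S"
 by (rule holoI[where D="\<lambda>z v. cder f z v + cder g z v"])
   (auto simp: clinear_def cs_add_right clinearD(2)[OF holoD(2)]
    intro!: has_derivative_add bounded_linear_add holoD clinearD(1)[OF holoD(2)])

lemma holo_diff: "holo f S \<Longrightarrow> holo g S \<Longrightarrow> holo (\<lambda>x. f x - g x) S"
 by (rule holoI[where D="\<lambda>z v. cder f z v - cder g z v"])
   (auto simp: clinear_def cs.diff_right clinearD(2)[OF holoD(2)]
    intro!: has_derivative_diff bounded_linear_sub holoD clinearD(1)[OF holoD(2)])

lemma cs_scaleR_left: "cs (r *\<^sub>R a) x = r *\<^sub>R cs a x"
 by (rule cs.scaleR_left)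

lemma holo_cs:
 assumes "holo a S" "holo f S"
 shows "holo (\<lambda>x. cs (a x) (f x)) S"
 unfolding holo_def
proof
 fix z assume z: "z \<in> S"
 let ?D = "\<lambda>v. cs (a z) (cder f z v) + cs (cder a z v) (f z)"
 have "((\<lambda>x. cs (a x) (f x)) has_derivative ?D) (at z)"
  by (rule cs.FDERIV[OF holoD(1)[OF assms(1) z] holoD(1)[OF assms(2) z]])
 moreover have "?D (cs c v) = cs c (?D v)" for c v
  using clinearD(2)[OF holoD(2)[OF assms(1) z]] clinearD(2)[OF holoD(2)[OF assms(2) z]]
  by (simp add: cs_add_right cs_cs mult_ac cs_complex_def)
 ultimately show "\<exists>D. ((\<lambda>x. cs (a x) (f x)) has_derivative D) (at z) \<and> (\<forall>c v. D (cs c v) = cs c (D v))"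
  by blast
qed

lemma holo_mult: "holo a S \<Longrightarrow> holo b S \<Longrightarrow> holo (\<lambda>x. a x * b x :: complex) S"
 using holo_cs[of a S b] by (simp add: cs_complex_def)

lemma clinear_vec_nth: "clinear (\<lambda>x :: complex ^ 'n. x $ i)"
 by (auto simp: clinear_def bounded_linear_vec_nth cs_vec_def cs_complex_def)

lemma holo_vec_nth: "holo f S \<Longrightarrow> holo (\<lambda>x. f x $ i :: complex) S"
 by (drule holo_compose[OF _ clinear_holo[OF clinear_vec_nth[of i], of UNIV]]) auto

lemma holo_vec_lambda:
 fixes f :: "'a::complex_euclidean \<Rightarrow> complex ^ 'n"
 assumes "\<And>i. holo (\<lambda>x. f x $ i) S"
 shows "holo f S"
proof (rule holoI)
 fix z assume z: "z \<in> S"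
 let ?D = "\<lambda>v. (\<chi> i. cder (\<lambda>x. f x $ i) z v)"
 have d: "((\<lambda>x. f x $ i) has_derivative (\<lambda>v. cder (\<lambda>x. f x $ i) z v)) (at z)" for i
  using holoD(1)[OF assms z] by simp
 show "(f has_derivative ?D) (at z)"
  unfolding has_derivative_componentwise_within[of f]
 proof
  fix b :: "complex ^ 'n" assume "b \<in> Basis"
  then obtain i u where b: "b = axis i u" "u \<in> Basis" by (auto simp: Basis_vec_def)
  show "((\<lambda>x. f x \<bullet> b) has_derivative (\<lambda>v. ?D v \<bullet> b)) (at z)"
   by (simp add: b inner_axis has_derivative_inner_left[OF d])
 qed
 show "clinear ?D"
  unfolding clinear_def
 proof
  show "bounded_linear ?D"
   using \<open>(f has_derivative ?D) (at z)\<close> has_derivative_bounded_linear by blast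
  show "\<forall>c v. ?D (cs c v) = cs c (?D v)"
   using clinearD(2)[OF holoD(2)[OF assms z]] by (auto simp: vec_eq_iff cs_vec_def)
 qed
qed

lemma holo_iff_holomorphic_on:
 fixes f :: "complex \<Rightarrow> complex"
 assumes "open S"
 shows "holo f S \<longleftrightarrow> f holomorphic_on S"
proof
 assume h: "holo f S"
 show "f holomorphic_on S"
  unfolding holomorphic_on_open[OF assms]
 proof
  fix z assume z: "z \<in> S"
  have "cder f z v = cder f z 1 * v" for v
   using clinearD(2)[OF holoD(2)[OF h z], of v 1] by (simp add: cs_complex_def mult_ac)
  hence "cder f z = (*) (cder f z 1)" by (rule ext)
  with holoD(1)[OF h z] have "(f has_field_derivative cder f z 1) (at z)"
   by (simp add: has_field_derivative_def)
  thus "\<exists>f'. (f has_field_derivative f') (at z)" ..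
 qed
next
 assume h: "f holomorphic_on S"
 show "holo f S"
  unfolding holo_def
 proof
  fix z assume z: "z \<in> S"
  have "(f has_field_derivative deriv f z) (at z)"
   using h z assms holomorphic_derivI by blast
  thus "\<exists>D. (f has_derivative D) (at z) \<and> (\<forall>c v. D (cs c v) = cs c (D v))"
   unfolding has_field_derivative_def by (intro exI[of _ "(*) (deriv f z)"]) (simp add: cs_complex_def)
 qed
qed

lemma cder_complex:
 fixes f :: "complex \<Rightarrow> complex"
 assumes "holo f S" "z \<in> S"
 shows "(f has_field_derivative cder f z 1) (at z)" "deriv f z = cder f z 1" "cder f z v = cder f z 1 * v"
proof -
 have *: "cder f z v = cder f z 1 * v" for v
  using clinearD(2)[OF holoD(2)[OF assms], of v 1] by (simp add: cs_complex_def mult_ac)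
 hence "cder f z = (*) (cder f z 1)" by (rule ext)
 with holoD(1)[OF assms] show "(f has_field_derivative cder f z 1) (at z)"
  by (simp add: has_field_derivative_def)
 thus "deriv f z = cder f z 1" by (rule DERIV_imp_deriv)
 show "cder f z v = cder f z 1 * v" by (rule *)
qed

lemma holo_comp_holomorphic:
 assumes "holo f S" "g holomorphic_on T" "open T" "f ` S \<subseteq> T"
 shows "holo (\<lambda>x. g (f x) :: complex) S"
 by (rule holo_compose[OF assms(1) _ assms(4)]) (simp add: holo_iff_holomorphic_on assms)

lemma holo_inverse:
 assumes "holo f S" "\<And>x. x \<in> S \<Longrightarrow> f x \<noteq> (0::complex)"
 shows "holo (\<lambda>x. inverse (f x)) S"
 by (rule holo_comp_holomorphic[OF assms(1), of inverse "-{0}"])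
   (use assms(2) in \<open>auto intro!: holomorphic_intros\<close>)

lemma holo_divide:
 "holo f S \<Longrightarrow> holo g S \<Longrightarrow> (\<And>x. x \<in> S \<Longrightarrow> g x \<noteq> (0::complex)) \<Longrightarrow> holo (\<lambda>x. f x / g x) S"
 unfolding divide_inverse by (intro holo_mult holo_inverse)

subsection \<open>Complex functionals and slices\<close>

text \<open>The complex linear functional whose real part is the inner product with
  \<open>w\<close>; complex linearity forces the sign of the imaginary part. These functionals
  separate points and so reduce vector valued maps to scalar ones.\<close>

definition cfun :: "'a::complex_euclidean \<Rightarrow> 'a \<Rightarrow> complex" where
 "cfun w x = Complex (x \<bullet> w) (- (cs \<i> x \<bullet> w))"

lemma cs_ii: "cs \<i> (cs \<i> x) = - x"
 using cs_of_real[of "-1" x] by (simp add: cs_cs)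

lemma clinear_cfun: "clinear (cfun w)"
 unfolding clinear_def
proof
 have "bounded_linear (\<lambda>x. of_real (x \<bullet> w) - \<i> * of_real (cs \<i> x \<bullet> w) :: complex)"
  by (intro bounded_linear_sub bounded_linear_const_mult
    bounded_linear_compose[OF bounded_linear_of_real]
    bounded_linear_inner_left_comp bounded_linear_ident cs.bounded_linear_right)
 moreover have "(\<lambda>x. of_real (x \<bullet> w) - \<i> * of_real (cs \<i> x \<bullet> w)) = cfun w"
  by (auto simp: cfun_def complex_eq_iff)
 ultimately show bl: "bounded_linear (cfun w)" by simp
 show "\<forall>c v. cfun w (cs c v) = cs c (cfun w v)"
 proof (intro allI)
  fix c and v :: 'a
  have i: "cfun w (cs \<i> v) = \<i> * cfun w v" for v :: 'a
   by (simp add: cfun_def cs_ii complex_eq_iff)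
  have "c = complex_of_real (Re c) + complex_of_real (Im c) * \<i>"
   by (simp add: complex_eq_iff)
  hence "cs c v = Re c *\<^sub>R v + Im c *\<^sub>R cs \<i> v"
   by (metis cs_add_left cs_cs cs_of_real)
  hence "cfun w (cs c v) = Re c *\<^sub>R cfun w v + Im c *\<^sub>R (\<i> * cfun w v)"
   using bl by (simp add: bounded_linear.linear linear_add linear_scale i)
  also have "\<dots> = c * cfun w v"
   by (simp add: complex_eq_iff)
  finally show "cfun w (cs c v) = cs c (cfun w v)" by (simp add: cs_complex_def)
 qed
qed

lemma Re_cfun [simp]: "Re (cfun w x) = x \<bullet> w"
 by (simp add: cfun_def)

lemma norm_cfun: "cmod (cfun w x) \<le> 2 * norm w * norm x"
proof -
 have "cmod (cfun w x) \<le> \<bar>x \<bullet> w\<bar> + \<bar>cs \<i> x \<bullet> w\<bar>"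
  using cmod_le[of "cfun w x"] by (simp add: cfun_def)
 also have "\<dots> \<le> norm x * norm w + norm x * norm w"
  using Cauchy_Schwarz_ineq2[of x w] Cauchy_Schwarz_ineq2[of "cs \<i> x" w] by (intro add_mono) (simp_all add: norm_cs)
 finally show ?thesis by (simp add: mult_ac)
qed

lemma holo_cfun: "holo f S \<Longrightarrow> holo (\<lambda>x. cfun w (f x)) S"
 by (drule holo_compose[OF _ clinear_holo[OF clinear_cfun[of w], of UNIV]]) auto

lemma holo_line: "holo (\<lambda>t::complex. a + cs t b) T"
 by (intro holo_add holo_cs) auto

lemma cder_line: "((\<lambda>t::complex. a + cs t b) has_derivative (\<lambda>s. cs s b)) (at t)"
 using has_derivative_add[OF has_derivative_const[of a] bounded_linear_imp_has_derivative[OF cs.bounded_linear_left[of b]]]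
 by simp

lemma open_slice: "open S \<Longrightarrow> open {t::complex. a + cs t b \<in> S}"
 using continuous_open_preimage[OF holo_continuous_on[OF holo_line[of a b UNIV]] open_UNIV]
 by (simp add: vimage_def)

lemma convex_slice: "convex S \<Longrightarrow> convex {t::complex. a + cs t b \<in> S}"
 unfolding convex_def
proof (clarsimp)
 fix x y :: complex and u v :: real
 assume *: "\<forall>x\<in>S. \<forall>y\<in>S. \<forall>u\<ge>0. \<forall>v\<ge>0. u + v = 1 \<longrightarrow> u *\<^sub>R x + v *\<^sub>R y \<in> S"
  "a + cs x b \<in> S" "a + cs y b \<in> S" "0 \<le> u" "0 \<le> v" "u + v = 1"
 have "a + cs (u *\<^sub>R x + v *\<^sub>R y) b = u *\<^sub>R (a + cs x b) + v *\<^sub>R (a + cs y b)"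
  using \<open>u + v = 1\<close>
  by (simp add: cs_add_left cs_scaleR_left scaleR_add_right algebra_simps flip: scaleR_add_left)
 thus "a + cs (u *\<^sub>R x + v *\<^sub>R y) b \<in> S" using * by simp
qed

text \<open>One-variable theory enters here: a map is restricted to a complex line in the source and
  tested with a functional in the target.\<close>

lemma holo_slice:
 assumes "holo f S" "open S"
 shows "(\<lambda>t. cfun w (f (a + cs t b))) holomorphic_on {t. a + cs t b \<in> S}"
proof -
 have "holo (\<lambda>t. cfun w (f (a + cs t b))) {t. a + cs t b \<in> S}"
  by (rule holo_compose[OF holo_line holo_cfun[OF assms(1)]]) auto
 thus ?thesis using holo_iff_holomorphic_on open_slice[OF assms(2)] by blast
qed

lemma cfun_eqI: "(\<And>w. cfun w x = cfun w y) \<Longrightarrow> x = y"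
 by (metis Re_cfun inner_commute vector_eq_rdot)

subsection \<open>Cauchy estimates\<close>

text \<open>Cauchy's inequality on the complex line through \<open>z\<close> in direction
  \<open>v\<close>. One factor two comes from \<open>norm_cfun\<close>, the other from working at
  half the admissible radius.\<close>

lemma holo_deriv_bound:
 assumes f: "holo f (ball z r)" and r: "r > 0" and B: "\<And>x. x \<in> ball z r \<Longrightarrow> norm (f x) \<le> B"
 shows "norm (cder f z v) \<le> 4 * B / r * norm v"
proof (cases "v = 0 \<or> cder f z v = 0")
 case True
 thus ?thesis
 proof
  assume "v = 0"
  thus ?thesis
   using f r linear_0[OF bounded_linear.linear[OF clinearD(1)[OF holoD(2)[OF f]]]] by simp
 next
  have "B \<ge> 0" using B[of z] r by (metis centre_in_ball norm_ge_zero order_trans)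
  moreover assume "cder f z v = 0"
  ultimately show ?thesis using r by simp
 qed
next
 case False
 \<comment> \<open>The derivative is tested against itself: the real part of \<open>cfun w w\<close>
   is the square of \<open>norm w\<close>, so one factor cancels at the end.\<close>
 define w where "w = cder f z v"
 define s where "s = r / (2 * norm v)"
 have s: "s > 0" using False r by (simp add: s_def)
 let ?g = "\<lambda>t. cfun w (f (z + cs t v))"
 have in_ball: "z + cs t v \<in> ball z r" if "cmod t \<le> s" for t
 proof -
  have "cmod t * norm v \<le> s * norm v" using that by (simp add: mult_right_mono)
  also have "\<dots> = r / 2" using False by (simp add: s_def)
  finally show ?thesis using r by (simp add: dist_norm norm_cs)
 qed
 have hol: "?g holomorphic_on {t. z + cs t v \<in> ball z r}"
  by (rule holo_slice[OF f]) simp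
 have h0: "0 \<in> {t::complex. z + cs t v \<in> ball z r}" using r by simp
 have "(?g has_derivative (\<lambda>t. cfun w (cder f z (cs t v)))) (at 0)"
  using has_derivative_compose[OF has_derivative_compose[OF cder_line[of z v 0], of f "cder f z"]
    bounded_linear_imp_has_derivative[OF clinearD(1)[OF clinear_cfun[of w]]]]
   holoD(1)[OF f, of z] r by simp
 moreover have "(\<lambda>t. cfun w (cder f z (cs t v))) = (*) (cfun w (cder f z v))"
  using clinearD(2)[OF holoD(2)[OF f, of z]] clinearD(2)[OF clinear_cfun[of w]] r
  by (auto simp: cs_complex_def fun_eq_iff mult_ac)
 ultimately have "(?g has_field_derivative cfun w w) (at 0)"
  by (simp add: w_def has_field_derivative_def)
 hence d: "deriv ?g 0 = cfun w w" by (rule DERIV_imp_deriv)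
 have "norm ((deriv ^^ 1) ?g 0) \<le> fact 1 * (2 * norm w * B) / s ^ 1"
 proof (rule Cauchy_inequality)
  show "?g holomorphic_on ball 0 s"
   by (rule holomorphic_on_subset[OF hol]) (use in_ball in \<open>force simp: dist_norm\<close>)
  show "continuous_on (cball 0 s) ?g"
   by (rule holomorphic_on_imp_continuous_on[OF holomorphic_on_subset[OF hol]])
     (use in_ball in \<open>force simp: dist_norm\<close>)
  show "0 < s" by (rule s)
  fix t assume "cmod (0 - t) = s"
  hence "norm (f (z + cs t v)) \<le> B" using B in_ball by simp
  hence "2 * norm w * norm (f (z + cs t v)) \<le> 2 * norm w * B"
   by (intro mult_left_mono) auto
  thus "cmod (?g t) \<le> 2 * norm w * B"
   using norm_cfun order_trans by blast
 qed
 hence "cmod (cfun w w) \<le> 2 * norm w * B / s" using d by simp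
 moreover have "norm w * norm w \<le> cmod (cfun w w)"
  using complex_Re_le_cmod[of "cfun w w"] by (simp add: power2_norm_eq_inner[symmetric] power2_eq_square)
 ultimately have "norm w * norm w \<le> norm w * (2 * B / s)" by (simp add: mult_ac)
 hence "norm w \<le> 2 * B / s" using False by (metis mult_le_cancel_left_pos w_def zero_less_norm_iff)
 thus ?thesis using s False by (simp add: w_def s_def field_simps)
qed

lemma cder_diff:
 assumes "holo f S" "holo g S" "z \<in> S"
 shows "cder (\<lambda>x. f x - g x) z v = cder f z v - cder g z v"
 using cder_eqI[OF has_derivative_diff[OF holoD(1)[OF assms(1,3)] holoD(1)[OF assms(2,3)]]] by simp

lemma holo_deriv_diff_bound:
 assumes "holo f (ball z r)" "holo g (ball z r)" "r > 0"
  and "\<And>x. x \<in> ball z r \<Longrightarrow> norm (f x - g x) \<le> e"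
 shows "norm (cder f z v - cder g z v) \<le> 4 * e / r * norm v"
 using holo_deriv_bound[OF holo_diff[OF assms(1,2)] assms(3,4)] assms(3)
 by (simp add: cder_diff[OF assms(1,2)])

text \<open>The mean value inequality on the convex set \<open>K\<close>, with the derivative
  controlled by Cauchy estimates on balls of radius \<open>r\<close> inside the larger set
  \<open>S\<close>.\<close>

lemma holo_lipschitz:
 assumes "convex K" "\<And>x. x \<in> K \<Longrightarrow> ball x r \<subseteq> S" "r > 0" "holo f S"
  and "\<And>x. x \<in> S \<Longrightarrow> norm (f x) \<le> B" "x \<in> K" "y \<in> K"
 shows "norm (f x - f y) \<le> 4 * B / r * norm (x - y)"
proof (rule differentiable_bound[OF assms(1) _ _ assms(6,7)])
 fix u assume u: "u \<in> K"
 hence uS: "u \<in> S" using assms(2)[OF u] assms(3) by auto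
 show "(f has_derivative cder f u) (at u within K)"
  using holoD(1)[OF assms(4) uS] has_derivative_at_withinI by blast
 show "onorm (cder f u) \<le> 4 * B / r"
 proof (rule onorm_le)
  fix v show "norm (cder f u v) \<le> 4 * B / r * norm v"
   by (rule holo_deriv_bound) (use assms u holo_subset in blast)+
 qed
qed

section \<open>Locally uniform convergence\<close>

text \<open>Uniformity is asked on a neighbourhood of each point intersected with \<open>S\<close>,
  so that arbitrary values outside \<open>S\<close> do no harm.\<close>

definition luc :: "'a::metric_space set \<Rightarrow> (nat \<Rightarrow> 'a \<Rightarrow> 'b::metric_space) \<Rightarrow> ('a \<Rightarrow> 'b) \<Rightarrow> bool" where
 "luc S f g \<longleftrightarrow> (\<forall>z\<in>S. \<forall>e>0. \<exists>d>0. \<forall>\<^sub>F n. \<forall>x\<in>ball z d \<inter> S. dist (f n x) (g x) < e)"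

text \<open>Charts live on increasing sets, so the members of a sequence are holomorphic near a
  given point only from some index on, and this index depends on the point.\<close>

definition evholo :: "'a::complex_euclidean set \<Rightarrow> (nat \<Rightarrow> 'a \<Rightarrow> 'b::complex_euclidean) \<Rightarrow> bool" where
 "evholo S f \<longleftrightarrow> (\<forall>z\<in>S. \<exists>r>0. \<forall>\<^sub>F n. holo (f n) (ball z r))"

lemma lucD: "luc S f g \<Longrightarrow> z \<in> S \<Longrightarrow> e > 0 \<Longrightarrow>
  \<exists>d>0. \<forall>\<^sub>F n. \<forall>x\<in>ball z d \<inter> S. dist (f n x) (g x) < e"
 by (auto simp: luc_def)

lemma luc_uniform:
 assumes "luc S f g" "compact K" "K \<subseteq> S"
 shows "uniform_limit K f g sequentially"
 unfolding uniform_limit_iff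
proof (intro allI impI)
 fix e :: real assume e: "e > 0"
 have "\<forall>z\<in>K. \<exists>d>0. \<forall>\<^sub>F n. \<forall>x\<in>ball z d \<inter> S. dist (f n x) (g x) < e"
  using lucD[OF assms(1) _ e] assms(3) by blast
 then obtain d where d: "\<And>z. z \<in> K \<Longrightarrow> d z > 0"
  "\<And>z. z \<in> K \<Longrightarrow> \<forall>\<^sub>F n. \<forall>x\<in>ball z (d z) \<inter> S. dist (f n x) (g x) < e"
  by (auto dest!: bchoice)
 obtain C where C: "C \<subseteq> K" "finite C" "K \<subseteq> (\<Union>z\<in>C. ball z (d z))"
  by (rule compactE_image[OF assms(2), of K "\<lambda>z. ball z (d z)"]) (use d(1) in force)+
 have "\<forall>\<^sub>F n. \<forall>z\<in>C. \<forall>x\<in>ball z (d z) \<inter> S. dist (f n x) (g x) < e"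
  using d(2) C by (intro eventually_ball_finite) auto
 thus "\<forall>\<^sub>F n. \<forall>x\<in>K. dist (f n x) (g x) < e"
  by (rule eventually_mono) (use C assms(3) in blast)
qed

lemma luc_pointwise: "luc S f g \<Longrightarrow> x \<in> S \<Longrightarrow> (\<lambda>n. f n x) \<longlonglongrightarrow> g x"
 unfolding tendsto_iff
proof (intro allI impI)
 fix e :: real assume *: "luc S f g" "x \<in> S" "e > 0"
 obtain d where "d > 0" "\<forall>\<^sub>F n. \<forall>y\<in>ball x d \<inter> S. dist (f n y) (g y) < e"
  using lucD[OF *] by blast
 thus "\<forall>\<^sub>F n. dist (f n x) (g x) < e"
  using *(2) by (auto elim!: eventually_mono)
qed

lemma luc_moving:
 assumes "luc S f g" "continuous_on S g" "x \<longlonglongrightarrow> z" "z \<in> S" "\<forall>\<^sub>F n. x n \<in> S"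
 shows "(\<lambda>n. f n (x n)) \<longlonglongrightarrow> g z"
proof -
 have gx: "(\<lambda>n. g (x n)) \<longlonglongrightarrow> g z"
  by (rule continuous_on_tendsto_compose[OF assms(2-5)])
 show ?thesis
  unfolding tendsto_iff
 proof (intro allI impI)
  fix e :: real assume e: "e > 0"
  obtain d where d: "d > 0" "\<forall>\<^sub>F n. \<forall>y\<in>ball z d \<inter> S. dist (f n y) (g y) < e/2"
   using lucD[OF assms(1,4), of "e/2"] e by auto
  have "\<forall>\<^sub>F n. x n \<in> ball z d"
   using assms(3) d(1) by (auto simp: tendsto_iff dist_commute)
  moreover have "\<forall>\<^sub>F n. dist (g (x n)) (g z) < e/2"
   using gx e half_gt_zero unfolding tendsto_iff by blast
  ultimately show "\<forall>\<^sub>F n. dist (f n (x n)) (g z) < e"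
   using d(2) assms(5)
  proof eventually_elim
   case (elim n)
   hence "dist (f n (x n)) (g (x n)) < e/2" by blast
   with elim(2) show ?case using dist_triangle[of "f n (x n)" "g z" "g (x n)"] by linarith
  qed
 qed
qed

lemma luc_subset: "luc S f g \<Longrightarrow> T \<subseteq> S \<Longrightarrow> luc T f g"
 unfolding luc_def
proof (intro ballI allI impI)
 fix z and e :: real assume *: "\<forall>z\<in>S. \<forall>e>0. \<exists>d>0. \<forall>\<^sub>F n. \<forall>x\<in>ball z d \<inter> S. dist (f n x) (g x) < e"
  "T \<subseteq> S" "z \<in> T" "e > 0"
 then obtain d where "d > 0" "\<forall>\<^sub>F n. \<forall>x\<in>ball z d \<inter> S. dist (f n x) (g x) < e" by blast
 thus "\<exists>d>0. \<forall>\<^sub>F n. \<forall>x\<in>ball z d \<inter> T. dist (f n x) (g x) < e"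
  using *(2) by (intro exI[of _ d]) (auto elim!: eventually_mono)
qed

lemma eventually_strict_mono:
 "strict_mono (r::nat\<Rightarrow>nat) \<Longrightarrow> eventually P sequentially \<Longrightarrow> \<forall>\<^sub>F n. P (r n)"
 using eventually_subseq by blast

lemma luc_subseq: "luc S f g \<Longrightarrow> strict_mono r \<Longrightarrow> luc S (\<lambda>n. f (r n)) g"
 unfolding luc_def using eventually_strict_mono[of r] by fast

lemma evholo_subseq: "evholo S f \<Longrightarrow> strict_mono r \<Longrightarrow> evholo S (\<lambda>n. f (r n))"
 unfolding evholo_def using eventually_strict_mono[of r] by fast

lemma luc_compose:
 assumes "luc S f g" "luc T p q" "open T" "g ` S \<subseteq> T" "continuous_on S g" "continuous_on T q"
 shows "luc S (\<lambda>n x. p n (f n x)) (\<lambda>x. q (g x))"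
 unfolding luc_def
proof (intro ballI allI impI)
 fix z and e :: real assume z: "z \<in> S" and e: "e > 0"
 have gz: "g z \<in> T" using z assms(4) by auto
 obtain d1 where d1: "d1 > 0" "\<forall>\<^sub>F n. \<forall>x\<in>ball (g z) d1 \<inter> T. dist (p n x) (q x) < e/2"
  using lucD[OF assms(2) gz, of "e/2"] e by auto
 obtain d2 where d2: "d2 > 0" "ball (g z) d2 \<subseteq> T"
  using assms(3) gz open_contains_ball by blast
 obtain d3 where d3: "d3 > 0" "\<And>y. y \<in> T \<Longrightarrow> dist y (g z) < d3 \<Longrightarrow> dist (q y) (q (g z)) < e/4"
  using assms(6) gz e unfolding continuous_on_iff by (metis zero_less_divide_iff zero_less_numeral)
 define m where "m = min d1 (min d2 d3)"
 have m: "m > 0" using d1 d2 d3 by (auto simp: m_def)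
 obtain d4 where d4: "d4 > 0" "\<forall>\<^sub>F n. \<forall>x\<in>ball z d4 \<inter> S. dist (f n x) (g x) < m/2"
  using lucD[OF assms(1) z, of "m/2"] m by auto
 obtain d5 where d5: "d5 > 0" "\<And>x. x \<in> S \<Longrightarrow> dist x z < d5 \<Longrightarrow> dist (g x) (g z) < m/2"
  using assms(5) z m unfolding continuous_on_iff by (metis half_gt_zero)
 show "\<exists>d>0. \<forall>\<^sub>F n. \<forall>x\<in>ball z d \<inter> S. dist (p n (f n x)) (q (g x)) < e"
 proof (intro exI conjI)
  show "min d4 d5 > 0" using d4 d5 by auto
  show "\<forall>\<^sub>F n. \<forall>x\<in>ball z (min d4 d5) \<inter> S. dist (p n (f n x)) (q (g x)) < e"
   using d1(2) d4(2)
  proof eventually_elim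
   case (elim n)
   show ?case
   proof
    fix x assume x: "x \<in> ball z (min d4 d5) \<inter> S"
    have a: "dist (f n x) (g x) < m/2" using elim(2) x by auto
    have b: "dist (g x) (g z) < m/2" using d5(2)[of x] x by (auto simp: dist_commute)
    have c: "dist (f n x) (g z) < m" using a b dist_triangle[of "f n x" "g z" "g x"] by linarith
    have fT: "f n x \<in> T" "g x \<in> T" using c d2(2) x assms(4) by (auto simp: m_def dist_commute)
    have "dist (p n (f n x)) (q (f n x)) < e/2"
     using elim(1) c fT by (auto simp: m_def dist_commute)
    moreover have "dist (q (f n x)) (q (g z)) < e/4" using d3(2) fT c by (auto simp: m_def)
    moreover have "dist (q (g x)) (q (g z)) < e/4"
     using d3(2)[of "g x"] fT b m by (auto simp: m_def)
    ultimately show "dist (p n (f n x)) (q (g x)) < e"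
     using dist_triangle[of "p n (f n x)" "q (g x)" "q (f n x)"]
      dist_triangle2[of "q (f n x)" "q (g x)" "q (g z)"] by linarith
   qed
  qed
 qed
qed

lemma luc_const: "luc S (\<lambda>n. f) f"
 unfolding luc_def by (auto intro!: exI[of _ 1])

lemma luc_cong:
 assumes "luc S f g" "\<And>z. z \<in> S \<Longrightarrow> \<exists>d>0. \<forall>\<^sub>F n. \<forall>x\<in>ball z d \<inter> S. f n x = f' n x"
  "\<And>x. x \<in> S \<Longrightarrow> g x = g' x"
 shows "luc S f' g'"
 unfolding luc_def
proof (intro ballI allI impI)
 fix z and e :: real assume z: "z \<in> S" and e: "e > 0"
 obtain d1 where d1: "d1 > 0" "\<forall>\<^sub>F n. \<forall>x\<in>ball z d1 \<inter> S. dist (f n x) (g x) < e"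
  using lucD[OF assms(1) z e] by blast
 obtain d2 where d2: "d2 > 0" "\<forall>\<^sub>F n. \<forall>x\<in>ball z d2 \<inter> S. f n x = f' n x"
  using assms(2)[OF z] by blast
 show "\<exists>d>0. \<forall>\<^sub>F n. \<forall>x\<in>ball z d \<inter> S. dist (f' n x) (g' x) < e"
 proof (intro exI conjI)
  show "min d1 d2 > 0" using d1 d2 by auto
  show "\<forall>\<^sub>F n. \<forall>x\<in>ball z (min d1 d2) \<inter> S. dist (f' n x) (g' x) < e"
   using d1(2) d2(2) by eventually_elim (use assms(3) in force)
 qed
qed

lemma linear_cder: "holo f S \<Longrightarrow> z \<in> S \<Longrightarrow> linear (cder f z)"
 using clinearD(1)[OF holoD(2)] bounded_linear.linear by blast

text \<open>Cauchy estimates for differences make the derivatives uniformly Cauchy on a smaller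
  ball, which permits differentiation of the limit; complex linearity survives pointwise
  limits.\<close>

lemma luc_holo:
 fixes f :: "nat \<Rightarrow> 'a::complex_euclidean \<Rightarrow> 'b::complex_euclidean"
 assumes "open S" "luc S f g" "evholo S f"
 shows "holo g S"
proof (rule holo_local)
 fix z assume z: "z \<in> S"
 obtain r0 where r0: "r0 > 0" "ball z r0 \<subseteq> S" using assms(1) z open_contains_ball by blast
 obtain r1 where r1: "r1 > 0" "\<forall>\<^sub>F n. holo (f n) (ball z r1)"
  using assms(3) z unfolding evholo_def by blast
 define s where "s = min r0 r1 / 4"
 have s: "s > 0" using r0 r1 by (simp add: s_def)
 have "cball z (2 * s) \<subseteq> S"
  using r0 s by (force simp: s_def)
 hence ul: "uniform_limit (cball z (2 * s)) f g sequentially"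
  by (intro luc_uniform[OF assms(2)]) auto
 obtain N0 where N0: "\<And>n. n \<ge> N0 \<Longrightarrow> holo (f n) (ball z r1)"
  using r1(2) unfolding eventually_sequentially by blast
 have sub: "ball z (2 * s) \<subseteq> ball z r1" using s r1 r0 by (auto simp: s_def)
 \<comment> \<open>Without the first terms all maps are holomorphic on one ball, as the criterion
   for derivatives of sequences demands.\<close>
 define F where "F = (\<lambda>n. f (n + N0))"
 have hF: "holo (F n) (ball z (2 * s))" for n
  using holo_subset[OF N0[of "n+N0"] sub] by (simp add: F_def)
 have xs: "ball x s \<subseteq> ball z (2 * s)" if "x \<in> ball z s" for x
  using that dist_triangle[of z _ x] by (fastforce simp: subset_eq intro: order.strict_trans1)
 have unif: "\<exists>N. \<forall>n\<ge>N. \<forall>x\<in>ball z (2 * s). norm (F n x - g x) \<le> e" if "e > 0" for e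
 proof -
  from ul[unfolded uniform_limit_iff, rule_format, OF that] obtain N where
   "\<And>n x. n \<ge> N \<Longrightarrow> x \<in> cball z (2 * s) \<Longrightarrow> dist (f n x) (g x) < e"
   unfolding eventually_sequentially by blast
  thus ?thesis
   by (intro exI[of _ N]) (force simp: F_def dist_norm less_imp_le)
 qed
 have cauchy: "\<exists>N. \<forall>n\<ge>N. \<forall>m\<ge>N. \<forall>x\<in>ball z s. \<forall>h. norm (cder (F n) x h - cder (F m) x h) \<le> e * norm h"
  if e: "e > 0" for e
 proof -
  have "e * s / 8 > 0" using e s by simp
  then obtain N where N: "\<And>n x. n \<ge> N \<Longrightarrow> x \<in> ball z (2 * s) \<Longrightarrow> norm (F n x - g x) \<le> e * s / 8"
   using unif by blast
  show ?thesis
  proof (intro exI[of _ N] allI impI ballI)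
   fix n m x h assume *: "n \<ge> N" "m \<ge> N" "x \<in> ball z s"
   have "norm (F n y - F m y) \<le> e * s / 4" if "y \<in> ball x s" for y
   proof -
    have "y \<in> ball z (2 * s)" using that xs[OF *(3)] by blast
    thus ?thesis
     using N[OF *(1), of y] N[OF *(2), of y] norm_triangle_ineq4[of "F n y - g y" "F m y - g y"] by simp
   qed
   hence "norm (cder (F n) x h - cder (F m) x h) \<le> 4 * (e * s / 4) / s * norm h"
    by (intro holo_deriv_diff_bound holo_subset[OF hF xs[OF *(3)]] s)
   thus "norm (cder (F n) x h - cder (F m) x h) \<le> e * norm h" using s by simp
  qed
 qed
 have conv: "convergent (\<lambda>n. cder (F n) x h)" if x: "x \<in> ball z s" for x h
  unfolding Cauchy_convergent_iff[symmetric] Cauchy_iff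
 proof (intro allI impI)
  fix e :: real assume e: "e > 0"
  define a where "a = norm h + 1"
  have a: "a > 0" "norm h \<le> a" by (simp_all add: a_def add_nonneg_pos)
  have "e / (2 * a) > 0" using e a by simp
  then obtain N where N: "\<And>n m. n \<ge> N \<Longrightarrow> m \<ge> N \<Longrightarrow>
    norm (cder (F n) x h - cder (F m) x h) \<le> e / (2 * a) * norm h"
   using cauchy x by meson
  have "e / (2 * a) * norm h \<le> e / (2 * a) * a" using e a by (intro mult_left_mono) auto
  also have "\<dots> < e" using e a by simp
  finally have "e / (2 * a) * norm h < e" .
  thus "\<exists>M. \<forall>m\<ge>M. \<forall>n\<ge>M. norm (cder (F m) x h - cder (F n) x h) < e"
   using N by (intro exI[of _ N]) (meson order.strict_trans1)
 qed
 define G where "G = (\<lambda>x h. lim (\<lambda>n. cder (F n) x h))"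
 have limG: "(\<lambda>n. cder (F n) x h) \<longlonglongrightarrow> G x h" if "x \<in> ball z s" for x h
  using conv[OF that] by (simp add: G_def convergent_LIMSEQ_iff)
 have nle: "\<forall>\<^sub>F n. \<forall>x\<in>ball z s. \<forall>h. norm (cder (F n) x h - G x h) \<le> e * norm h"
  if e: "e > 0" for e
 proof -
  obtain N where N: "\<And>n m x h. n \<ge> N \<Longrightarrow> m \<ge> N \<Longrightarrow> x \<in> ball z s \<Longrightarrow>
    norm (cder (F n) x h - cder (F m) x h) \<le> e * norm h"
   using cauchy[OF e] by blast
  have "norm (cder (F n) x h - G x h) \<le> e * norm h" if "n \<ge> N" "x \<in> ball z s" for n x h
  proof (rule Lim_norm_ubound[OF sequentially_bot])
   show "(\<lambda>m. cder (F n) x h - cder (F m) x h) \<longlonglongrightarrow> cder (F n) x h - G x h"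
    by (intro tendsto_intros limG that)
   show "\<forall>\<^sub>F m. norm (cder (F n) x h - cder (F m) x h) \<le> e * norm h"
    using N that eventually_sequentially by blast
  qed
  thus ?thesis unfolding eventually_sequentially by blast
 qed
 have Fg: "(\<lambda>n. F n x) \<longlonglongrightarrow> g x" if "x \<in> ball z (2 * s)" for x
 proof -
  have "x \<in> S" using that \<open>cball z (2 * s) \<subseteq> S\<close> by auto
  from luc_pointwise[OF assms(2) this] show ?thesis unfolding F_def by (rule LIMSEQ_ignore_initial_segment)
 qed
 have zs: "z \<in> ball z s" and z2: "z \<in> ball z (2 * s)" using s by auto
 have der: "(F n has_derivative cder (F n) x) (at x within ball z s)" if "x \<in> ball z s" for n x
  by (rule has_derivative_at_withinI[OF holoD(1)[OF hF]]) (use that s in auto)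
 obtain g2 where g2: "\<forall>x\<in>ball z s. (\<lambda>n. F n x) \<longlonglongrightarrow> g2 x \<and> (g2 has_derivative G x) (at x within ball z s)"
  using has_derivative_sequence[OF convex_ball der nle zs Fg[OF z2]] by blast
 have gg: "g2 x = g x" if "x \<in> ball z s" for x
  using g2 that Fg[of x] LIMSEQ_unique s by fastforce
 have "holo g2 (ball z s)"
 proof (rule holoI[where D=G])
  fix x assume x: "x \<in> ball z s"
  show d: "(g2 has_derivative G x) (at x)"
   using g2 x at_within_open[OF x open_ball] by metis
  show "clinear (G x)"
   unfolding clinear_def
  proof (intro conjI allI)
   show "bounded_linear (G x)" using d has_derivative_bounded_linear by blast
   fix c v
   have "x \<in> ball z (2 * s)" using x s by auto
   hence "cder (F n) x (cs c v) = cs c (cder (F n) x v)" for n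
    using clinearD(2)[OF holoD(2)[OF hF]] by blast
   hence "(\<lambda>n. cs c (cder (F n) x v)) \<longlonglongrightarrow> G x (cs c v)"
    using limG[OF x, of "cs c v"] by simp
   moreover have "(\<lambda>n. cs c (cder (F n) x v)) \<longlonglongrightarrow> cs c (G x v)"
    by (intro cs.tendsto tendsto_const limG x)
   ultimately show "G x (cs c v) = cs c (G x v)" by (rule LIMSEQ_unique)
  qed
 qed
 hence "holo g (ball z s)" by (rule holo_cong) (auto simp: gg)
 with zs show "\<exists>T. z \<in> T \<and> holo g T" by blast
qed

text \<open>A second order estimate without second derivatives: the Cauchy bound is applied to the
  difference of \<open>g\<close> and its translate by \<open>y - x\<close>, which is small because
  \<open>g\<close> is Lipschitz.\<close>

lemma cder_lipschitz_local:
 fixes g :: "'a::complex_euclidean \<Rightarrow> 'b::complex_euclidean"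
 assumes "open S" "holo g S" "z \<in> S"
 obtains r C where "r > 0" "ball z r \<subseteq> S" "C \<ge> 0"
  "\<And>x y v. x \<in> ball z r \<Longrightarrow> y \<in> ball z r \<Longrightarrow> norm (cder g x v - cder g y v) \<le> C * norm (x - y) * norm v"
  "\<And>x y. x \<in> ball z r \<Longrightarrow> y \<in> ball z r \<Longrightarrow> norm (g x - g y) \<le> C * norm (x - y)"
proof -
 obtain r0 where r0: "r0 > 0" "cball z r0 \<subseteq> S" using assms(1,3) open_contains_cball by blast
 define s where "s = r0 / 4"
 have s: "s > 0" using r0 by (simp add: s_def)
 have "compact (g ` cball z r0)"
  by (intro compact_continuous_image continuous_on_subset[OF holo_continuous_on[OF assms(2)] r0(2)]) auto
 then obtain B where B: "\<And>x. x \<in> cball z r0 \<Longrightarrow> norm (g x) \<le> B"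
  using compact_imp_bounded bounded_iff by (metis imageI)
 have B0: "B \<ge> 0" using B[of z] r0 by (metis centre_in_cball less_imp_le norm_ge_zero order_trans)
 have hg: "holo g (ball z r0)" using holo_subset[OF assms(2)] r0(2) by (meson ball_subset_cball order_trans)
 define L where "L = 4 * B / s"
 have L0: "L \<ge> 0" using B0 s by (simp add: L_def)
 have lip: "norm (g x - g y) \<le> L * norm (x - y)" if "x \<in> ball z (3 * s)" "y \<in> ball z (3 * s)" for x y
  unfolding L_def
 proof (rule holo_lipschitz[OF convex_ball[of z "3 * s"] _ s hg])
  fix x assume "x \<in> ball z (3 * s)"
  thus "ball x s \<subseteq> ball z r0"
   using dist_triangle[of z _ x] by (fastforce simp: subset_eq s_def intro: order.strict_trans1)
 qed (use that B in auto)
 have "norm (cder g x v - cder g y v) \<le> (4 * L / s) * norm (x - y) * norm v"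
  if x: "x \<in> ball z s" and y: "y \<in> ball z s" for x y v
 proof -
  let ?t = "\<lambda>u. u + (y - x)"
  have dxy: "dist x y < 2 * s" using x y dist_triangle2[of x y z] by (simp add: dist_commute)
  have mem: "u \<in> ball z (3 * s) \<and> ?t u \<in> ball z (3 * s) \<and> u \<in> ball z r0 \<and> ?t u \<in> ball z r0" if "u \<in> ball x s" for u
  proof -
   have 1: "dist z u < 2 * s" using that x dist_triangle[of z u x] by simp
   have "dist y (?t u) = dist x u" by (simp add: dist_norm algebra_simps)
   hence "dist z (?t u) < 2 * s" using that y dist_triangle[of z "?t u" y] by simp
   with 1 s show ?thesis by (simp add: s_def)
  qed
  have t: "holo ?t UNIV" by (intro holo_add) auto
  have hgt: "holo (\<lambda>u. g (?t u)) (ball x s)"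
   by (rule holo_compose[OF holo_subset[OF t] hg]) (use mem in auto)
  have hgx: "holo g (ball x s)" using holo_subset[OF hg] mem by blast
  have "norm (cder g x v - cder (\<lambda>u. g (?t u)) x v) \<le> 4 * (L * norm (x - y)) / s * norm v"
  proof (rule holo_deriv_diff_bound[OF hgx hgt s])
   fix u assume "u \<in> ball x s"
   hence "norm (g u - g (?t u)) \<le> L * norm (u - ?t u)" using mem by (intro lip) auto
   thus "norm (g u - g (?t u)) \<le> L * norm (x - y)" by (simp add: algebra_simps norm_minus_commute)
  qed
  moreover have "cder (\<lambda>u. g (?t u)) x v = cder g y v"
  proof -
   have "(?t has_derivative (\<lambda>v. v)) (at x)" by (auto intro!: derivative_eq_intros)
   moreover have "(g has_derivative cder g (?t x)) (at (?t x))"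
    using holoD(1)[OF hg, of y] y s by (auto simp: s_def)
   ultimately have "((\<lambda>u. g (?t u)) has_derivative (\<lambda>v. cder g (?t x) v)) (at x)"
    using has_derivative_compose by blast
   from cder_eqI[OF this] show ?thesis by simp
  qed
  ultimately show ?thesis by (simp add: mult_ac)
 qed
 moreover have "norm (g x - g y) \<le> L * norm (x - y)" if "x \<in> ball z s" "y \<in> ball z s" for x y
  using that s by (intro lip) auto
 moreover have "ball z s \<subseteq> S" using r0 by (auto simp: s_def subset_eq)
 ultimately show ?thesis
 proof (intro that[of s "L + 4 * L / s"], goal_cases)
  case (4 x y v)
  have "norm (cder g x v - cder g y v) \<le> (4 * L / s) * norm (x - y) * norm v" using 4 by blast
  also have "\<dots> \<le> (L + 4 * L / s) * norm (x - y) * norm v"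
   using L0 by (intro mult_right_mono) auto
  finally show ?case .
 next
  case (5 x y)
  have "norm (g x - g y) \<le> L * norm (x - y)" using 5 by blast
  also have "\<dots> \<le> (L + 4 * L / s) * norm (x - y)"
   using L0 s by (intro mult_right_mono) auto
  finally show ?case .
 qed (use s L0 in auto)
qed

lemma cder_continuous_on:
 fixes g :: "'a::complex_euclidean \<Rightarrow> 'b::complex_euclidean"
 assumes "open S" "holo g S"
 shows "continuous_on S (\<lambda>x. cder g x v)"
proof (rule continuous_at_imp_continuous_on, rule ballI)
 fix z assume z: "z \<in> S"
 obtain r C where rC: "r > 0" "ball z r \<subseteq> S" "C \<ge> 0"
  "\<And>x y v. x \<in> ball z r \<Longrightarrow> y \<in> ball z r \<Longrightarrow> norm (cder g x v - cder g y v) \<le> C * norm (x - y) * norm v"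
  by (rule cder_lipschitz_local[OF assms z]) blast
 have "((\<lambda>x. cder g x v - cder g z v) \<longlongrightarrow> 0) (at z)"
 proof (rule Lim_null_comparison)
  show "\<forall>\<^sub>F x in at z. norm (cder g x v - cder g z v) \<le> C * norm (x - z) * norm v"
   unfolding eventually_at_topological
   by (rule exI[of _ "ball z r"]) (use rC in auto)
  show "((\<lambda>x. C * norm (x - z) * norm v) \<longlongrightarrow> 0) (at z)"
   by (auto intro!: tendsto_eq_intros)
 qed
 thus "isCont (\<lambda>x. cder g x v) z"
  unfolding isCont_def by (rule LIM_zero_cancel)
qed

lemma luc_cder:
 fixes f :: "nat \<Rightarrow> 'a::complex_euclidean \<Rightarrow> 'b::complex_euclidean"
 assumes "open S" "luc S f g" "evholo S f"
 shows "luc S (\<lambda>n x. cder (f n) x v) (\<lambda>x. cder g x v)"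
 unfolding luc_def
proof (intro ballI allI impI)
 fix z and e :: real assume z: "z \<in> S" and e: "e > 0"
 have hg: "holo g S" by (rule luc_holo[OF assms])
 obtain r0 where r0: "r0 > 0" "ball z r0 \<subseteq> S" using assms(1) z open_contains_ball by blast
 obtain r1 where r1: "r1 > 0" "\<forall>\<^sub>F n. holo (f n) (ball z r1)"
  using assms(3) z unfolding evholo_def by blast
 define s where "s = min r0 r1 / 4"
 have s: "s > 0" using r0 r1 by (simp add: s_def)
 define m where "m = norm v + 1"
 have m: "m > 0" "norm v \<le> m" by (simp_all add: m_def add_nonneg_pos)
 define e' where "e' = e * s / (8 * m)"
 have e': "e' > 0" using e s m by (simp add: e'_def)
 have "cball z (2 * s) \<subseteq> S" using r0 s by (force simp: s_def)
 hence "uniform_limit (cball z (2 * s)) f g sequentially"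
  by (intro luc_uniform[OF assms(2)]) auto
 hence "\<forall>\<^sub>F n. \<forall>x\<in>cball z (2 * s). dist (f n x) (g x) < e'"
  using e' by (simp add: uniform_limit_iff)
 hence "\<forall>\<^sub>F n. \<forall>x\<in>ball z s \<inter> S. dist (cder (f n) x v) (cder g x v) < e"
  using r1(2)
 proof eventually_elim
  case (elim n)
  show ?case
  proof
   fix x assume "x \<in> ball z s \<inter> S"
   hence sub: "ball x s \<subseteq> ball z (2 * s)"
    using dist_triangle[of z _ x] by (fastforce simp: subset_eq intro: order.strict_trans1)
   have "norm (cder (f n) x v - cder g x v) \<le> 4 * e' / s * norm v"
   proof (rule holo_deriv_diff_bound[OF _ _ s])
    show "holo (f n) (ball x s)"
     by (rule holo_subset[OF elim(2)]) (use sub s r0 r1 in \<open>auto simp: s_def subset_eq\<close>)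
    show "holo g (ball x s)"
     by (rule holo_subset[OF hg]) (use sub \<open>cball z (2 * s) \<subseteq> S\<close> ball_subset_cball in blast)
    show "norm (f n y - g y) \<le> e'" if "y \<in> ball x s" for y
     using elim(1) that sub ball_subset_cball[of z "2 * s"] by (fastforce simp: dist_norm less_imp_le)
   qed
   also have "\<dots> = e / 2 * (norm v / m)" using s m by (simp add: e'_def field_simps)
   also have "\<dots> \<le> e / 2 * 1"
    using e m by (intro mult_left_mono) auto
   finally show "dist (cder (f n) x v) (cder g x v) < e" using e by (simp add: dist_norm)
  qed
 qed
 with s show "\<exists>d>0. \<forall>\<^sub>F n. \<forall>x\<in>ball z d \<inter> S. dist (cder (f n) x v) (cder g x v) < e"
  by blast
qed

lemma luc_cder_moving:
 assumes "open S" "luc S f g" "evholo S f" "x \<longlonglongrightarrow> z" "z \<in> S"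
 shows "(\<lambda>n. cder (f n) (x n) v) \<longlonglongrightarrow> cder g z v"
proof (rule luc_moving[OF luc_cder[OF assms(1-3)] _ assms(4,5)])
 show "continuous_on S (\<lambda>x. cder g x v)"
  by (rule cder_continuous_on[OF assms(1) luc_holo[OF assms(1-3)]])
 show "\<forall>\<^sub>F n. x n \<in> S"
  using topological_tendstoD[OF assms(4,1,5)] .
qed

text \<open>The mean value inequality for \<open>g\<close> minus its linear part at
  \<open>x\<close>, whose derivative is small by \<open>cder_lipschitz_local\<close>.\<close>

lemma holo_taylor_local:
 fixes g :: "'a::complex_euclidean \<Rightarrow> 'b::complex_euclidean"
 assumes "open S" "holo g S" "z \<in> S"
 obtains r C where "r > 0" "ball z r \<subseteq> S" "C \<ge> 0"
  "\<And>x y. x \<in> ball z r \<Longrightarrow> y \<in> ball z r \<Longrightarrow> norm (g y - g x - cder g x (y - x)) \<le> C * norm (y - x) ^ 2"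
proof -
 obtain r C where rC: "r > 0" "ball z r \<subseteq> S" "C \<ge> 0"
  "\<And>x y v. x \<in> ball z r \<Longrightarrow> y \<in> ball z r \<Longrightarrow> norm (cder g x v - cder g y v) \<le> C * norm (x - y) * norm v"
  by (rule cder_lipschitz_local[OF assms]) blast
 have "norm (g y - g x - cder g x (y - x)) \<le> C * norm (y - x) ^ 2" if xy: "x \<in> ball z r" "y \<in> ball z r" for x y
 proof -
  have seg: "closed_segment x y \<subseteq> ball z r" using xy by (simp add: closed_segment_subset)
  have xS: "x \<in> S" using xy rC by blast
  let ?h = "\<lambda>u. g u - cder g x u"
  have "norm (?h y - ?h x) \<le> C * norm (y - x) * norm (y - x)"
  proof (rule differentiable_bound[OF convex_closed_segment[of x y]])
   fix u assume u: "u \<in> closed_segment x y"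
   have uS: "u \<in> S" using u seg rC by blast
   show "(?h has_derivative (\<lambda>v. cder g u v - cder g x v)) (at u within closed_segment x y)"
    by (rule has_derivative_at_withinI[OF has_derivative_diff[OF holoD(1)[OF assms(2) uS]
      bounded_linear_imp_has_derivative[OF clinearD(1)[OF holoD(2)[OF assms(2) xS]]]]])
   show "onorm (\<lambda>v. cder g u v - cder g x v) \<le> C * norm (y - x)"
   proof (rule onorm_le)
    fix v
    have "norm (cder g u v - cder g x v) \<le> C * norm (u - x) * norm v" using u seg xy rC(4) by blast
    also have "\<dots> \<le> C * norm (y - x) * norm v"
     using rC(3) segment_bound(1)[OF u] by (intro mult_right_mono mult_left_mono) auto
    finally show "norm (cder g u v - cder g x v) \<le> C * norm (y - x) * norm v" .
   qed
  qed auto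
  moreover have "?h y - ?h x = g y - g x - cder g x (y - x)"
   using linear_diff[OF linear_cder[OF assms(2) xS], of y x] by simp
  ultimately show ?thesis by (simp add: power2_eq_square mult_ac)
 qed
 thus ?thesis by (rule that[OF rC(1-3)])
qed

text \<open>Difference quotients with steps \<open>1 / Suc n\<close> are holomorphic and converge
  locally uniformly by the Taylor estimate.\<close>

lemma holo_cder:
 fixes g :: "'a::complex_euclidean \<Rightarrow> 'b::complex_euclidean"
 assumes "open S" "holo g S"
 shows "holo (\<lambda>z. cder g z v) S"
proof (rule luc_holo[OF assms(1)])
 define q where "q = (\<lambda>n z. real (Suc n) *\<^sub>R (g (z + (1 / real (Suc n)) *\<^sub>R v) - g z))"
 have small: "\<forall>\<^sub>F n. norm ((1 / real (Suc n)) *\<^sub>R v) < e" if "e > 0" for e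
 proof -
  have "(\<lambda>n. (1 / real (Suc n)) *\<^sub>R v) \<longlonglongrightarrow> 0 *\<^sub>R v"
   by (intro tendsto_intros LIMSEQ_Suc[OF lim_1_over_n])
  thus ?thesis using that by (simp add: tendsto_iff)
 qed
 show "luc S q (\<lambda>z. cder g z v)"
  unfolding luc_def
 proof (intro ballI allI impI)
  fix z and e :: real assume z: "z \<in> S" and e: "e > 0"
  obtain r C where rC: "r > 0" "ball z r \<subseteq> S" "C \<ge> 0"
   "\<And>x y. x \<in> ball z r \<Longrightarrow> y \<in> ball z r \<Longrightarrow> norm (g y - g x - cder g x (y - x)) \<le> C * norm (y - x) ^ 2"
   by (rule holo_taylor_local[OF assms z]) blast
  have ev2: "\<forall>\<^sub>F n. norm ((1 / real (Suc n)) *\<^sub>R v) < e / (C * norm v + 1)"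
   by (rule small) (use e rC in \<open>auto intro!: divide_pos_pos add_nonneg_pos\<close>)
  have ev1: "\<forall>\<^sub>F n. norm ((1 / real (Suc n)) *\<^sub>R v) < r / 2"
   by (rule small) (use rC in auto)
  have "\<forall>\<^sub>F n. \<forall>x\<in>ball z (r/2) \<inter> S. dist (q n x) (cder g x v) < e"
   using ev1 ev2
  proof eventually_elim
   case (elim n)
   show ?case
   proof
    fix x assume x: "x \<in> ball z (r/2) \<inter> S"
    define t where "t = 1 / real (Suc n)"
    have t: "t > 0" by (simp add: t_def)
    have "dist z (x + t *\<^sub>R v) < r"
    proof -
     have "dist x (x + t *\<^sub>R v) < r/2" using elim(1) by (simp add: t_def dist_norm)
     thus ?thesis using x dist_triangle[of z "x + t *\<^sub>R v" x] by simp
    qed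
    hence *: "norm (g (x + t *\<^sub>R v) - g x - cder g x (t *\<^sub>R v)) \<le> C * norm (t *\<^sub>R v) ^ 2"
     using rC(4)[of x "x + t *\<^sub>R v"] x rC(1) by (auto simp del: norm_scaleR)
    have "q n x - cder g x v = (1 / t) *\<^sub>R (g (x + t *\<^sub>R v) - g x - cder g x (t *\<^sub>R v))"
     using t linear_scale[OF linear_cder[OF assms(2)], of x t v] x
     by (simp add: q_def t_def scaleR_diff_right)
    hence "norm (q n x - cder g x v) \<le> (1 / t) * (C * norm (t *\<^sub>R v) ^ 2)"
     using * t by (simp add: divide_right_mono)
    also have "\<dots> = C * norm v * norm (t *\<^sub>R v)" using t by (simp add: power2_eq_square)
    also have "\<dots> \<le> (C * norm v + 1) * norm (t *\<^sub>R v)" by (simp add: algebra_simps)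
    also have "\<dots> < e"
    proof -
     have "C * norm v + 1 > 0" using rC(3) by (simp add: add_nonneg_pos)
     thus ?thesis using elim(2) by (simp add: t_def pos_less_divide_eq mult_ac)
    qed
    finally show "dist (q n x) (cder g x v) < e" by (simp add: dist_norm)
   qed
  qed
  thus "\<exists>d>0. \<forall>\<^sub>F n. \<forall>x\<in>ball z d \<inter> S. dist (q n x) (cder g x v) < e"
   using rC(1) by (intro exI[of _ "r/2"]) auto
 qed
 show "evholo S q"
  unfolding evholo_def
 proof
  fix z assume "z \<in> S"
  then obtain r where r: "r > 0" "ball z r \<subseteq> S" using assms(1) open_contains_ball by blast
  have r2: "r / 2 > 0" using r by simp
  have "\<forall>\<^sub>F n. holo (q n) (ball z (r/2))"
   using small[OF r2]
  proof eventually_elim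
   case (elim n)
   have "x \<in> S \<and> x + (1 / real (Suc n)) *\<^sub>R v \<in> S" if "x \<in> ball z (r/2)" for x
   proof -
    have "dist z (x + (1 / real (Suc n)) *\<^sub>R v) < r"
    proof -
     have "dist x (x + (1 / real (Suc n)) *\<^sub>R v) < r/2" using elim by (simp add: dist_norm)
     thus ?thesis using that dist_triangle[of z "x + (1 / real (Suc n)) *\<^sub>R v" x] by simp
    qed
    thus ?thesis using that r by (auto simp: subset_eq)
   qed
   hence sub: "ball z (r/2) \<subseteq> S" "(\<lambda>x. x + (1 / real (Suc n)) *\<^sub>R v) ` ball z (r/2) \<subseteq> S" by auto
   have "holo (\<lambda>x. cs (of_real (real (Suc n))) (g (x + (1 / real (Suc n)) *\<^sub>R v) - g x)) (ball z (r/2))"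
    by (intro holo_cs holo_const holo_diff holo_subset[OF assms(2) sub(1)]
      holo_compose[OF _ assms(2) sub(2)] holo_add holo_ident)
   thus ?case unfolding q_def cs_of_real .
  qed
  thus "\<exists>r>0. \<forall>\<^sub>F n. holo (q n) (ball z r)"
   using r(1) by (intro exI[of _ "r/2"]) auto
 qed
qed

section \<open>Compactness, identity and maximum principles\<close>

definition locbdd :: "'a::complex_euclidean set \<Rightarrow> (nat \<Rightarrow> 'a \<Rightarrow> 'b::complex_euclidean) \<Rightarrow> bool" where
 "locbdd S f \<longleftrightarrow> (\<forall>z\<in>S. \<exists>r>0. \<exists>B. \<forall>\<^sub>F n. holo (f n) (ball z r) \<and> (\<forall>x\<in>ball z r. norm (f n x) \<le> B))"

lemma locbdd_evholo: "locbdd S f \<Longrightarrow> evholo S f"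
 unfolding locbdd_def evholo_def
proof
 fix z assume "\<forall>z\<in>S. \<exists>r>0. \<exists>B. \<forall>\<^sub>F n. holo (f n) (ball z r) \<and> (\<forall>x\<in>ball z r. norm (f n x) \<le> B)" "z \<in> S"
 then obtain r B where "r > 0" "\<forall>\<^sub>F n. holo (f n) (ball z r) \<and> (\<forall>x\<in>ball z r. norm (f n x) \<le> B)" by blast
 thus "\<exists>r>0. \<forall>\<^sub>F n. holo (f n) (ball z r)"
  by (auto elim!: eventually_mono)
qed

lemma locbdd_subseq:
 assumes "locbdd S f" "strict_mono r"
 shows "locbdd S (\<lambda>n. f (r n))"
 unfolding locbdd_def
proof
 fix z assume "z \<in> S"
 then obtain s B where "s > 0"
  "\<forall>\<^sub>F n. holo (f n) (ball z s) \<and> (\<forall>x\<in>ball z s. norm (f n x) \<le> B)"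
  using assms(1) unfolding locbdd_def by blast
 thus "\<exists>s>0. \<exists>B. \<forall>\<^sub>F n. holo (f (r n)) (ball z s) \<and> (\<forall>x\<in>ball z s. norm (f (r n) x) \<le> B)"
  using eventually_strict_mono[OF assms(2)] by blast
qed

text \<open>Local boundedness gives local Lipschitz bounds, which spread convergence from a dense
  set. The choice of a subsequence is left to the caller: on the union a single one must serve
  countably many coordinate systems.\<close>

lemma luc_vitali:
 fixes f :: "nat \<Rightarrow> 'a::complex_euclidean \<Rightarrow> 'b::complex_euclidean"
 assumes "open S" "S \<subseteq> closure Q" "locbdd S f" "\<And>q. q \<in> Q \<Longrightarrow> q \<in> S \<Longrightarrow> convergent (\<lambda>n. f n q)"
 obtains g where "luc S f g"
proof -
 have cauchy: "\<exists>d>0. \<exists>N. \<forall>m\<ge>N. \<forall>n\<ge>N. \<forall>x\<in>ball z d \<inter> S. dist (f m x) (f n x) < e"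
  if z: "z \<in> S" and e: "e > 0" for z e
 proof -
  obtain r B where r: "r > 0" and "\<forall>\<^sub>F n. holo (f n) (ball z r) \<and> (\<forall>x\<in>ball z r. norm (f n x) \<le> B)"
   using assms(3) z unfolding locbdd_def by blast
  then obtain N1 where N1: "\<And>n. n \<ge> N1 \<Longrightarrow> holo (f n) (ball z r)"
    "\<And>n x. n \<ge> N1 \<Longrightarrow> x \<in> ball z r \<Longrightarrow> norm (f n x) \<le> B"
   unfolding eventually_sequentially by blast
  have B0: "B \<ge> 0" using order_trans[OF norm_ge_zero N1(2)[of N1 z]] r by simp
  define L where "L = 4 * B / (r/2)"
  have L0: "L \<ge> 0" using B0 r by (simp add: L_def)
  have lip: "norm (f n x - f n y) \<le> L * norm (x - y)" if "n \<ge> N1" "x \<in> ball z (r/2)" "y \<in> ball z (r/2)" for n x y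
   unfolding L_def
  proof (rule holo_lipschitz[OF convex_ball[of z "r/2"] _ _ N1(1)[OF that(1)]])
   fix u assume "u \<in> ball z (r/2)"
   thus "ball u (r/2) \<subseteq> ball z r"
    using dist_triangle[of z _ u] by (fastforce simp: subset_eq intro: order.strict_trans1)
  qed (use that r N1(2) in auto)
  \<comment> \<open>Over a ball of radius \<open>2 * d\<close> the oscillation is then at most
    \<open>e / 4\<close>; \<open>L + 1\<close> avoids division by zero.\<close>
  define d where "d = min (r/2) (e / (8 * (L + 1)))"
  have d: "d > 0" "d \<le> r/2" using e r L0 unfolding d_def by (simp, intro min.cobounded1)
  have dL: "L * (2 * d) \<le> e / 4"
  proof -
   have "L * (2 * d) \<le> (L + 1) * (2 * d)" using d by (intro mult_right_mono) auto
   also have "\<dots> \<le> (L + 1) * (2 * (e / (8 * (L + 1))))"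
    using L0 by (intro mult_left_mono) (auto simp: d_def)
   also have "\<dots> = e / 4" using L0 by (simp add: field_simps)
   finally show ?thesis .
  qed
  obtain s where s: "s > 0" "ball z s \<subseteq> S" using assms(1) z open_contains_ball by blast
  have "z \<in> closure Q" "min d s > 0" using assms(2) z d s by auto
  then obtain q where q: "q \<in> Q" "dist q z < min d s"
   unfolding closure_approachable by blast
  have qS: "q \<in> S" using q(2) s(2) by (auto simp: subset_eq dist_commute)
  have "Cauchy (\<lambda>n. f n q)" using assms(4)[OF q(1) qS] by (simp add: Cauchy_convergent_iff)
  then obtain N2 where N2: "\<And>m n. m \<ge> N2 \<Longrightarrow> n \<ge> N2 \<Longrightarrow> dist (f m q) (f n q) < e / 2"
   using e unfolding Cauchy_def by (meson half_gt_zero)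
  show ?thesis
  proof (intro exI conjI allI impI ballI)
   show "d > 0" by (rule d)
   fix m n x assume mn: "max N1 N2 \<le> m" "max N1 N2 \<le> n" and x: "x \<in> ball z d \<inter> S"
   have "dist x q \<le> 2 * d"
    using x q(2) dist_triangle[of x q z] by (simp add: dist_commute)
   hence xq: "norm (x - q) \<le> 2 * d" by (simp add: dist_norm)
   have "norm (f k x - f k q) \<le> e / 4" if "k \<ge> N1" for k
   proof -
    have "norm (f k x - f k q) \<le> L * norm (x - q)"
     using that x q(2) d by (intro lip) (auto simp: dist_commute)
    also have "\<dots> \<le> L * (2 * d)" using xq L0 by (intro mult_left_mono) auto
    finally show ?thesis using dL by simp
   qed
   hence "dist (f m x) (f m q) \<le> e/4" "dist (f n x) (f n q) \<le> e/4" using mn by (auto simp: dist_norm)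
   moreover have "dist (f m q) (f n q) < e/2" using N2 mn by auto
   ultimately show "dist (f m x) (f n x) < e"
    using dist_triangle[of "f m x" "f n x" "f m q"] dist_triangle[of "f m q" "f n x" "f n q"]
    by (simp add: dist_commute)
  qed
 qed
 define g where "g = (\<lambda>x. lim (\<lambda>n. f n x))"
 have lim: "(\<lambda>n. f n x) \<longlonglongrightarrow> g x" if x: "x \<in> S" for x
 proof -
  have "Cauchy (\<lambda>n. f n x)"
   unfolding Cauchy_def
  proof (intro allI impI)
   fix e :: real assume "e > 0"
   from cauchy[OF x this] obtain d N where "d > 0" "\<forall>m\<ge>N. \<forall>n\<ge>N. \<forall>y\<in>ball x d \<inter> S. dist (f m y) (f n y) < e" by blast
   thus "\<exists>M. \<forall>m\<ge>M. \<forall>n\<ge>M. dist (f m x) (f n x) < e" using x by (intro exI[of _ N]) simp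
  qed
  thus ?thesis by (simp add: g_def Cauchy_convergent_iff convergent_LIMSEQ_iff)
 qed
 have "luc S f g"
  unfolding luc_def
 proof (intro ballI allI impI)
  fix z and e :: real assume z: "z \<in> S" and e: "e > 0"
  obtain d N where d: "d > 0" and N: "\<And>m n x. m \<ge> N \<Longrightarrow> n \<ge> N \<Longrightarrow> x \<in> ball z d \<inter> S \<Longrightarrow> dist (f m x) (f n x) < e/2"
   using cauchy[OF z, of "e/2"] e by (meson half_gt_zero)
  have "dist (f m x) (g x) < e" if "m \<ge> N" "x \<in> ball z d \<inter> S" for m x
  proof -
   have "dist (f m x) (g x) \<le> e/2"
   proof (rule tendsto_upperbound[of "\<lambda>n. dist (f m x) (f n x)"])
    show "(\<lambda>n. dist (f m x) (f n x)) \<longlonglongrightarrow> dist (f m x) (g x)"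
     using lim that(2) by (intro tendsto_intros) auto
    show "\<forall>\<^sub>F n. dist (f m x) (f n x) \<le> e/2"
     unfolding eventually_sequentially using N[OF that(1) _ that(2)] by (meson less_imp_le)
   qed simp
   thus ?thesis using e by simp
  qed
  thus "\<exists>d>0. \<forall>\<^sub>F n. \<forall>x\<in>ball z d \<inter> S. dist (f n x) (g x) < e"
   using d unfolding eventually_sequentially by blast
 qed
 thus ?thesis by (rule that)
qed

text \<open>The bound depends on the point. Dividing by it brings all values into the unit ball,
  where the diagonal argument applies; the limits are then scaled back.\<close>

lemma convergent_subsequence_countable:
 fixes f :: "nat \<Rightarrow> 'p \<Rightarrow> 'b::{real_normed_vector,heine_borel}"
 assumes "countable Q" "\<And>q. q \<in> Q \<Longrightarrow> \<exists>B. \<forall>\<^sub>F n. norm (f n q) \<le> B"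
 obtains r where "strict_mono (r :: nat \<Rightarrow> nat)" "\<And>q. q \<in> Q \<Longrightarrow> convergent (\<lambda>n. f (r n) q)"
proof -
 have "\<exists>B>0. \<forall>n. norm (f n q) \<le> B" if q: "q \<in> Q" for q
 proof -
  obtain B where "\<forall>\<^sub>F n. norm (f n q) \<le> B" using assms(2)[OF q] by blast
  hence "Bfun (\<lambda>n. f n q) sequentially" by (rule BfunI)
  thus ?thesis by (meson Bseq_def)
 qed
 then obtain B where B: "\<And>q. q \<in> Q \<Longrightarrow> B q > 0" "\<And>q n. q \<in> Q \<Longrightarrow> norm (f n q) \<le> B q" by metis
 obtain r where r: "strict_mono (r :: nat \<Rightarrow> nat)" "\<And>q. q \<in> Q \<Longrightarrow> \<exists>l. (\<lambda>n. (1 / B q) *\<^sub>R f (r n) q) \<longlonglongrightarrow> l"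
 proof (rule function_convergent_subsequence[OF assms(1), of "\<lambda>n q. (1 / B q) *\<^sub>R f n q" 1])
  show "norm ((1 / B x) *\<^sub>R f n x) \<le> 1" if "x \<in> Q" for n x
   using B[OF that] by (simp add: divide_le_eq)
 qed (use that in blast)
 have "convergent (\<lambda>n. f (r n) q)" if q: "q \<in> Q" for q
 proof -
  obtain l where "(\<lambda>n. (1 / B q) *\<^sub>R f (r n) q) \<longlonglongrightarrow> l" using r(2)[OF q] by blast
  hence "(\<lambda>n. B q *\<^sub>R (1 / B q) *\<^sub>R f (r n) q) \<longlonglongrightarrow> B q *\<^sub>R l" by (intro tendsto_intros)
  thus ?thesis using B(1)[OF q] by (auto simp: convergent_def)
 qed
 with r(1) show ?thesis by (rule that)
qed

lemma montel:
 fixes f :: "nat \<Rightarrow> 'a::complex_euclidean \<Rightarrow> 'b::complex_euclidean"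
 assumes "open S" "locbdd S f"
 obtains r g where "strict_mono (r :: nat \<Rightarrow> nat)" "luc S (\<lambda>n. f (r n)) g"
proof -
 obtain Q :: "'a set" where Q: "countable Q" "Q \<subseteq> S" "S \<subseteq> closure Q"
  using separable[of S] by blast
 obtain r where r: "strict_mono (r :: nat \<Rightarrow> nat)" "\<And>q. q \<in> Q \<Longrightarrow> convergent (\<lambda>n. f (r n) q)"
 proof (rule convergent_subsequence_countable[OF Q(1), of f])
  fix q assume "q \<in> Q"
  then obtain s B where "s > 0" "\<forall>\<^sub>F n. holo (f n) (ball q s) \<and> (\<forall>x\<in>ball q s. norm (f n x) \<le> B)"
   using assms(2) Q unfolding locbdd_def by blast
  thus "\<exists>B. \<forall>\<^sub>F n. norm (f n q) \<le> B"
   by (intro exI[of _ B]) (auto elim!: eventually_mono)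
 qed (use that in blast)
 obtain g where "luc S (\<lambda>n. f (r n)) g"
  by (rule luc_vitali[OF assms(1) Q(3) locbdd_subseq[OF assms(2) r(1)]]) (use r in auto)
 with r(1) show ?thesis by (rule that)
qed

text \<open>Along the complex line joining \<open>x0\<close> and \<open>x\<close> the slice of
  \<open>S\<close> is convex, hence connected, and ordinary analytic continuation applies.\<close>

lemma holo_identity:
 assumes "open S" "convex S" "holo f S" "holo g S" "x0 \<in> S" "r > 0"
  "\<And>x. x \<in> ball x0 r \<Longrightarrow> f x = g x" "x \<in> S"
 shows "f x = g x"
proof (rule cfun_eqI)
 fix w
 define T where "T = {t::complex. x0 + cs t (x - x0) \<in> S}"
 define U where "U = T \<inter> {t::complex. x0 + cs t (x - x0) \<in> ball x0 r}"
 have oT: "open T" "connected T"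
  unfolding T_def by (intro open_slice assms convex_connected convex_slice)+
 have "cfun w (f (x0 + cs 1 (x - x0))) = cfun w (g (x0 + cs 1 (x - x0)))"
 proof (rule analytic_continuation_open[of U T "\<lambda>t. cfun w (f (x0 + cs t (x - x0)))" "\<lambda>t. cfun w (g (x0 + cs t (x - x0)))" 1])
  show "open U" unfolding U_def by (intro open_Int oT open_slice open_ball)
  have "0 \<in> U" using assms by (simp add: U_def T_def)
  thus "U \<noteq> {}" by blast
  show "(\<lambda>t. cfun w (f (x0 + cs t (x - x0)))) holomorphic_on T"
   "(\<lambda>t. cfun w (g (x0 + cs t (x - x0)))) holomorphic_on T"
   unfolding T_def by (intro holo_slice assms)+
  show "1 \<in> T" using assms by (simp add: T_def)
 qed (use oT assms in \<open>auto simp: U_def\<close>)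
 thus "cfun w (f x) = cfun w (g x)" by simp
qed

text \<open>If \<open>f y\<close> were outside \<open>E\<close>, a hyperplane supporting
  \<open>E\<close> at it would make the modulus of \<open>exp (- cfun a (f x))\<close> maximal at
  \<open>y\<close>; constancy along the complex line through \<open>x0\<close> contradicts that
  \<open>f x0\<close> is strictly inside.\<close>

lemma holo_max_principle:
 assumes "open S" "convex S" "holo f S" "f ` S \<subseteq> closure E" "open E" "convex E" "x0 \<in> S" "f x0 \<in> E" "y \<in> S"
 shows "f y \<in> E"
proof (rule ccontr)
 assume ny: "f y \<notin> E"
 obtain a b where ab: "a \<noteq> 0" "\<forall>x\<in>{f y}. a \<bullet> x \<le> b" "\<forall>x\<in>E. b \<le> a \<bullet> x"
  using separating_hyperplane_sets[of "{f y}" E] assms(6,8) ny by auto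
 have cl: "b \<le> a \<bullet> x" if "x \<in> closure E" for x
 proof -
  have "closure E \<subseteq> {x. b \<le> a \<bullet> x}"
   by (rule closure_minimal) (use ab closed_halfspace_ge[of b a] in auto)
  thus ?thesis using that by auto
 qed
 have fy: "a \<bullet> f y = b" using ab(2) cl[of "f y"] assms(4,9) by force
 have f0: "a \<bullet> f x0 > b"
 proof -
  obtain e where e: "e > 0" "cball (f x0) e \<subseteq> E" using assms(5,8) open_contains_cball by blast
  define z where "z = f x0 - (e / norm a) *\<^sub>R a"
  have "z \<in> E" using e ab(1) by (auto simp: z_def dist_norm intro!: subsetD[OF e(2)])
  hence "b \<le> a \<bullet> z" using ab(3) by blast
  hence "b \<le> a \<bullet> f x0 - e / norm a * (a \<bullet> a)" by (simp add: z_def inner_diff_right)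
  moreover have "e / norm a * (a \<bullet> a) > 0" using e ab(1) by simp
  ultimately show ?thesis by linarith
 qed
 define T where "T = {t::complex. x0 + cs t (y - x0) \<in> S}"
 define u where "u = (\<lambda>t. exp (- cfun a (f (x0 + cs t (y - x0)))))"
 have "u constant_on T"
 proof (rule maximum_modulus_principle[of u T T 1])
  show "u holomorphic_on T"
   unfolding u_def T_def by (intro holomorphic_intros holo_slice assms)
  show "open T" "connected T" "open T"
   unfolding T_def by (intro open_slice assms convex_connected convex_slice)+
  show "1 \<in> T" using assms by (simp add: T_def)
  fix t assume "t \<in> T"
  hence "f (x0 + cs t (y - x0)) \<in> closure E" using assms(4) by (auto simp: T_def)
  thus "cmod (u t) \<le> cmod (u 1)"
   using cl[of "f (x0 + cs t (y - x0))"] fy by (simp add: u_def inner_commute)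
 qed auto
 moreover have "0 \<in> T" "1 \<in> T" using assms by (auto simp: T_def)
 ultimately have "cmod (u 0) = cmod (u 1)" by (metis constant_on_def)
 thus False using f0 fy by (simp add: u_def inner_commute)
qed

text \<open>Invariance of domain gives continuity of the inverse, invertibility of the derivative
  then gives differentiability, and the inverse of a complex linear map is complex linear.\<close>

lemma holo_inverse_map:
 fixes f :: "'a::complex_euclidean \<Rightarrow> 'a"
 assumes "open S" "holo f S" "inj_on f S" "\<And>x. x \<in> S \<Longrightarrow> inj (cder f x)" "\<And>x. x \<in> S \<Longrightarrow> g (f x) = x"
 shows "open (f ` S)" "holo g (f ` S)"
proof -
 have cf: "continuous_on S f" by (rule holo_continuous_on[OF assms(2)])
 show o: "open (f ` S)" by (rule invariance_of_domain[OF cf assms(1,3)])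
 obtain k where k: "homeomorphism S (f ` S) f k"
  using invariance_of_domain_homeomorphism[OF assms(1) cf _ assms(3)] by auto
 have "continuous_on (f ` S) k" using k by (simp add: homeomorphism_def)
 moreover have "k y = g y" if "y \<in> f ` S" for y
  using k assms(5) that by (auto simp: homeomorphism_def)
 ultimately have cg: "continuous_on (f ` S) g" by (simp cong: continuous_on_cong)
 show "holo g (f ` S)"
  unfolding holo_iff_clinear
 proof
  fix y assume "y \<in> f ` S"
  then obtain x where x: "x \<in> S" "y = f x" by auto
  let ?D = "cder f x"
  have lin: "linear ?D" by (rule linear_cder[OF assms(2) x(1)])
  obtain g' where g': "linear g'" "\<And>v. g' (?D v) = v" "\<And>v. ?D (g' v) = v"
   using linear_injective_isomorphism[OF lin assms(4)[OF x(1)]] by auto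
  have bl: "bounded_linear g'" using g'(1) linear_conv_bounded_linear by blast
  have "(g has_derivative g') (at (f x))"
   by (rule has_derivative_inverse_dieudonne[OF assms(1) o cf cg assms(5) x(1) holoD(1)[OF assms(2) x(1)] bl])
     (auto simp: g' fun_eq_iff)
  moreover have "g' (cs c v) = cs c (g' v)" for c v
   using clinearD(2)[OF holoD(2)[OF assms(2) x(1)], of c "g' v"] g'(2)[of "cs c (g' v)"] g'(3)[of v] by simp
  ultimately show "\<exists>D. (g has_derivative D) (at y) \<and> clinear D"
   using bl x by (auto simp: clinear_def)
 qed
qed

text \<open>Brouwer's theorem for \<open>y - u x\<close>. It makes maps uniformly close to the
  identity cover a given point, in any dimension and without information on derivatives.\<close>

lemma perturbation_surj:
 fixes u :: "'a::euclidean_space \<Rightarrow> 'a"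
 assumes "continuous_on (cball y r) u" "\<And>x. x \<in> cball y r \<Longrightarrow> norm (u x) \<le> r" "r \<ge> 0"
 obtains x where "x \<in> cball y r" "x + u x = y"
proof -
 obtain x where "x \<in> cball y r" "y - u x = x"
 proof (rule brouwer[of "cball y r" "\<lambda>x. y - u x"])
  show "continuous_on (cball y r) (\<lambda>x. y - u x)" by (intro continuous_intros assms)
  show "(\<lambda>x. y - u x) \<in> cball y r \<rightarrow> cball y r"
   using assms(2) by (auto simp: dist_norm)
 qed (use assms in auto)
 thus ?thesis by (intro that[of x]) (auto simp: algebra_simps)
qed

section \<open>Increasing unions of copies of a domain\<close>

text \<open>The union stripped of its charts: what remains are the copies \<open>Mi i\<close>, their
  parametrizations \<open>g i\<close> and holomorphic transition maps. Topology and analysis on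
  \<open>X\<close> are read through the \<open>g i\<close>; the charts of the manifold return in
  \<open>manifold_union\<close>.\<close>

locale union_of_copies =
 fixes Om :: "'v::complex_euclidean set" and X :: "'a set" and Mi :: "nat \<Rightarrow> 'a set"
  and f :: "nat \<Rightarrow> 'a \<Rightarrow> 'v" and g :: "nat \<Rightarrow> 'v \<Rightarrow> 'a"
 assumes open_Om: "open Om" and convex_Om: "convex Om" and Om_nonempty: "Om \<noteq> {}"
  and Mi_Suc: "\<And>i. Mi i \<subseteq> Mi (Suc i)" and UN_Mi: "(\<Union>i. Mi i) = X"
  and f_in: "\<And>i x. x \<in> Mi i \<Longrightarrow> f i x \<in> Om" and g_in: "\<And>i y. y \<in> Om \<Longrightarrow> g i y \<in> Mi i"
  and gf: "\<And>i x. x \<in> Mi i \<Longrightarrow> g i (f i x) = x" and fg: "\<And>i y. y \<in> Om \<Longrightarrow> f i (g i y) = y"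
  and open_trans: "\<And>i k. open {y \<in> Om. g k y \<in> Mi i}"
  and holo_trans: "\<And>i k. holo (\<lambda>y. f i (g k y)) {y \<in> Om. g k y \<in> Mi i}"
begin

definition openM :: "'a set \<Rightarrow> bool" where
 "openM W \<longleftrightarrow> W \<subseteq> X \<and> (\<forall>i. open {y \<in> Om. g i y \<in> W})"

definition holo_out :: "('a \<Rightarrow> 'b::complex_euclidean) \<Rightarrow> 'a set \<Rightarrow> bool" where
 "holo_out F W \<longleftrightarrow> (\<forall>i. holo (\<lambda>y. F (g i y)) {y \<in> Om. g i y \<in> W})"

text \<open>Openness of the preimages of the copies encodes continuity: a map into \<open>X\<close>
  has coordinates only after its values have been localized in some \<open>Mi i\<close>.\<close>

definition holo_in :: "('b::complex_euclidean \<Rightarrow> 'a) \<Rightarrow> 'b set \<Rightarrow> bool" where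
 "holo_in G S \<longleftrightarrow> G ` S \<subseteq> X \<and>
   (\<forall>i. open {s \<in> S. G s \<in> Mi i} \<and> holo (\<lambda>s. f i (G s)) {s \<in> S. G s \<in> Mi i})"

definition lucM :: "'a set \<Rightarrow> (nat \<Rightarrow> 'a \<Rightarrow> 'b::complex_euclidean) \<Rightarrow> ('a \<Rightarrow> 'b) \<Rightarrow> bool" where
 "lucM W F F' \<longleftrightarrow> (\<forall>i. luc {y \<in> Om. g i y \<in> W} (\<lambda>n y. F n (g i y)) (\<lambda>y. F' (g i y)))"

text \<open>Exhaustion by neighbourhoods rather than by points, so that the \<open>n\<close>-th map
  is eventually defined near each point, as normal families require.\<close>

definition exhM :: "(nat \<Rightarrow> 'a set) \<Rightarrow> bool" where
 "exhM U \<longleftrightarrow> (\<forall>i. \<forall>y\<in>Om. \<exists>r>0. ball y r \<subseteq> Om \<and> (\<forall>\<^sub>F n. g i ` ball y r \<subseteq> U n))"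

lemma Mi_mono: "i \<le> k \<Longrightarrow> Mi i \<subseteq> Mi k"
 by (rule lift_Suc_mono_le[of Mi]) (use Mi_Suc in auto)

lemma Mi_X: "Mi i \<subseteq> X" using UN_Mi by auto

lemma X_E: assumes "x \<in> X" obtains i y where "x \<in> Mi i" "y \<in> Om" "x = g i y" "y = f i x"
 using assms UN_Mi f_in gf by (metis UN_E)

lemma openM_Mi: "openM (Mi i)"
 using open_trans Mi_X by (auto simp: openM_def)

lemma Om_X: "{y \<in> Om. g i y \<in> X} = Om"
 using g_in Mi_X by blast

lemma openM_X: "openM X"
 using open_Om by (simp add: openM_def Om_X)

lemma holo_out_f: "holo_out (f i) (Mi i)"
 using holo_trans by (auto simp: holo_out_def)

lemma holo_in_g: "holo_in (g i) Om"
 unfolding holo_in_def using holo_trans open_trans g_in Mi_X by blast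

lemma holo_out_subset: "holo_out F W \<Longrightarrow> V \<subseteq> W \<Longrightarrow> holo_out F V"
 unfolding holo_out_def by (blast intro: holo_subset)

lemma holo_in_subset:
 assumes "holo_in G S" "open T" "T \<subseteq> S"
 shows "holo_in G T"
proof -
 have eq: "{s \<in> T. G s \<in> Mi i} = T \<inter> {s \<in> S. G s \<in> Mi i}" for i using assms(3) by auto
 have "open {s \<in> T. G s \<in> Mi i}" for i
  unfolding eq using assms by (auto simp: holo_in_def)
 moreover have "holo (\<lambda>s. f i (G s)) {s \<in> T. G s \<in> Mi i}" for i
  by (rule holo_subset[of _ "{s \<in> S. G s \<in> Mi i}"]) (use assms in \<open>auto simp: holo_in_def\<close>)
 moreover have "G ` T \<subseteq> X" using assms by (auto simp: holo_in_def)
 ultimately show ?thesis by (simp add: holo_in_def)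
qed

lemma holo_in_D: "holo_in G S \<Longrightarrow> open {s \<in> S. G s \<in> Mi i}" "holo_in G S \<Longrightarrow> holo (\<lambda>s. f i (G s)) {s \<in> S. G s \<in> Mi i}"
 "holo_in G S \<Longrightarrow> s \<in> S \<Longrightarrow> G s \<in> X"
 by (auto simp: holo_in_def)

lemma holo_in_out:
 assumes "openM W" "holo_in G S" "holo_out F W" "G ` S \<subseteq> W"
 shows "holo (\<lambda>s. F (G s)) S"
proof (rule holo_local)
 fix s assume s: "s \<in> S"
 then obtain i where i: "G s \<in> Mi i" using assms(2) UN_Mi by (auto simp: holo_in_def)
 let ?T = "{s \<in> S. G s \<in> Mi i}"
 have "holo (\<lambda>s. F (g i (f i (G s)))) ?T"
 proof (rule holo_compose[OF holo_in_D(2)[OF assms(2), of i] assms(3)[unfolded holo_out_def, rule_format, of i]], rule)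
  fix y assume "y \<in> (\<lambda>s. f i (G s)) ` ?T"
  then obtain t where "t \<in> S" "G t \<in> Mi i" "y = f i (G t)" by blast
  thus "y \<in> {y \<in> Om. g i y \<in> W}" using f_in assms(4) by (simp add: gf image_subset_iff)
 qed
 hence "holo (\<lambda>s. F (G s)) ?T"
  by (rule holo_cong[OF _ holo_in_D(1)[OF assms(2)]]) (simp add: gf)
 with s i show "\<exists>T. s \<in> T \<and> holo (\<lambda>s. F (G s)) T" by (intro exI[of _ ?T]) simp
qed

lemma openM_vimage_in:
 assumes "holo_in G S" "openM W" "open S"
 shows "open {s \<in> S. G s \<in> W}"
proof -
 define T where "T i = {s \<in> S. G s \<in> Mi i} \<inter> (\<lambda>s. f i (G s)) -` {y \<in> Om. g i y \<in> W}" for i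
 have "open (T i)" for i
  unfolding T_def
  by (rule continuous_open_preimage[OF holo_continuous_on[OF holo_in_D(2)[OF assms(1)]] holo_in_D(1)[OF assms(1)]])
    (use assms(2) in \<open>simp add: openM_def\<close>)
 hence "open (\<Union>i. T i)" by blast
 moreover have "(\<Union>i. T i) = {s \<in> S. G s \<in> W}"
 proof
  show "(\<Union>i. T i) \<subseteq> {s \<in> S. G s \<in> W}"
  proof
   fix s assume "s \<in> (\<Union>i. T i)"
   then obtain i where "s \<in> S" "G s \<in> Mi i" "g i (f i (G s)) \<in> W" by (auto simp: T_def)
   thus "s \<in> {s \<in> S. G s \<in> W}" by (simp add: gf)
  qed
  show "{s \<in> S. G s \<in> W} \<subseteq> (\<Union>i. T i)"
  proof
   fix s assume s: "s \<in> {s \<in> S. G s \<in> W}"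
   then obtain i where i: "G s \<in> Mi i" using assms(2) UN_Mi unfolding openM_def by blast
   hence "s \<in> T i" using s f_in gf by (simp add: T_def)
   thus "s \<in> (\<Union>i. T i)" by blast
  qed
 qed
 ultimately show ?thesis by simp
qed

lemma holo_in_compose:
 assumes "holo_in G S" "holo u T" "open T" "open S" "u ` T \<subseteq> S"
 shows "holo_in (\<lambda>t. G (u t)) T"
 unfolding holo_in_def
proof (intro conjI allI)
 show "(\<lambda>t. G (u t)) ` T \<subseteq> X" using assms by (auto simp: holo_in_def)
 fix i
 have eq: "{s \<in> T. G (u s) \<in> Mi i} = T \<inter> u -` {s \<in> S. G s \<in> Mi i}" using assms(5) by auto
 show "open {s \<in> T. G (u s) \<in> Mi i}"
  unfolding eq by (rule continuous_open_preimage[OF holo_continuous_on[OF assms(2)] assms(3) holo_in_D(1)[OF assms(1)]])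
 show "holo (\<lambda>s. f i (G (u s))) {s \<in> T. G (u s) \<in> Mi i}"
  by (rule holo_compose[OF holo_subset[OF assms(2)] holo_in_D(2)[OF assms(1), of i]]) (use assms(5) in auto)
qed

lemma holo_out_compose:
 assumes "holo_out F W" "holo u T" "F ` W \<subseteq> T"
 shows "holo_out (\<lambda>x. u (F x)) W"
 unfolding holo_out_def
 by (intro allI holo_compose[OF assms(1)[unfolded holo_out_def, rule_format] assms(2)]) (use assms(3) in auto)

lemma openM_vimage_out:
 assumes "openM W" "holo_out F W" "open T"
 shows "openM {x \<in> W. F x \<in> T}"
 unfolding openM_def
proof (intro conjI allI)
 show "{x \<in> W. F x \<in> T} \<subseteq> X" using assms(1) by (auto simp: openM_def)
 fix i
 have eq: "{y \<in> Om. g i y \<in> {x \<in> W. F x \<in> T}} = {y \<in> Om. g i y \<in> W} \<inter> (\<lambda>y. F (g i y)) -` T" by auto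
 show "open {y \<in> Om. g i y \<in> {x \<in> W. F x \<in> T}}"
  unfolding eq
  by (rule continuous_open_preimage[OF holo_continuous_on]) (use assms in \<open>auto simp: openM_def holo_out_def\<close>)
qed

text \<open>A finite subcover replaces infinitely many thresholds by a maximum. The predicate is
  abstract because it serves inclusions of sets as well as uniform properties of their
  points.\<close>

lemma eventually_compact_ball:
 assumes "compact K" "\<And>s. s \<in> K \<Longrightarrow> \<exists>r>0. \<forall>\<^sub>F n. P n (ball s r)"
  "\<And>n A B. P n A \<Longrightarrow> P n B \<Longrightarrow> P n (A \<union> B)" "\<And>n A B. P n A \<Longrightarrow> B \<subseteq> A \<Longrightarrow> P n B" "\<And>n. P n {}"
 shows "\<forall>\<^sub>F n. P n K"
proof -
 obtain r where r: "\<And>s. s \<in> K \<Longrightarrow> r s > 0" "\<And>s. s \<in> K \<Longrightarrow> \<forall>\<^sub>F n. P n (ball s (r s))"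
  using bchoice[of K "\<lambda>s r. r > 0 \<and> (\<forall>\<^sub>F n. P n (ball s r))"] assms(2) by auto
 obtain C where C: "C \<subseteq> K" "finite C" "K \<subseteq> (\<Union>s\<in>C. ball s (r s))"
  by (rule compactE_image[OF assms(1), of K "\<lambda>s. ball s (r s)"]) (use r(1) in force)+
 have "\<forall>\<^sub>F n. \<forall>s\<in>C. P n (ball s (r s))"
  using r(2) C by (intro eventually_ball_finite) auto
 thus ?thesis
 proof eventually_elim
  case (elim n)
  have "P n (\<Union>s\<in>C. ball s (r s))" using C(2) elim
   by (induction C) (auto intro: assms(3,5))
  thus ?case using C(3) assms(4) by blast
 qed
qed

lemma lucM_in:
 assumes "lucM W F F'" "openM W" "holo_out F' W" "holo_in G S" "open S" "G ` S \<subseteq> W"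
 shows "luc S (\<lambda>n s. F n (G s)) (\<lambda>s. F' (G s))"
 unfolding luc_def
proof (intro ballI allI impI)
 fix s and e :: real assume s: "s \<in> S" and e: "e > 0"
 obtain i where i: "G s \<in> Mi i" using assms s holo_in_D(3) UN_Mi by blast
 let ?T = "{s \<in> S. G s \<in> Mi i}" and ?V = "{y \<in> Om. g i y \<in> W}"
 have sT: "s \<in> ?T" using i s by auto
 have c: "continuous_on ?V (\<lambda>y. F' (g i y))"
  by (rule holo_continuous_on) (use assms(3) in \<open>simp add: holo_out_def\<close>)
 have oV: "open ?V" using assms(2) by (simp add: openM_def)
 have sub: "(\<lambda>s. f i (G s)) ` ?T \<subseteq> ?V" using f_in gf assms(6) by (simp add: image_subset_iff)
 have "luc ?T (\<lambda>n s. F n (g i (f i (G s)))) (\<lambda>s. F' (g i (f i (G s))))"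
  by (rule luc_compose[OF luc_const assms(1)[unfolded lucM_def, rule_format, of i] oV sub
     holo_continuous_on[OF holo_in_D(2)[OF assms(4)]] c])
 from lucD[OF this sT e] obtain d where d: "d > 0"
  "\<forall>\<^sub>F n. \<forall>x\<in>ball s d \<inter> ?T. dist (F n (g i (f i (G x)))) (F' (g i (f i (G x)))) < e" by blast
 obtain d2 where d2: "d2 > 0" "ball s d2 \<subseteq> ?T" using holo_in_D(1)[OF assms(4)] sT open_contains_ball by metis
 show "\<exists>d>0. \<forall>\<^sub>F n. \<forall>x\<in>ball s d \<inter> S. dist (F n (G x)) (F' (G x)) < e"
 proof (intro exI conjI)
  show "min d d2 > 0" using d d2 by simp
  show "\<forall>\<^sub>F n. \<forall>x\<in>ball s (min d d2) \<inter> S. dist (F n (G x)) (F' (G x)) < e"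
   using d(2)
  proof eventually_elim
   case (elim n)
   show ?case
   proof
    fix x assume x: "x \<in> ball s (min d d2) \<inter> S"
    hence "x \<in> ball s d \<inter> ?T" using d2(2) by auto
    moreover from this have "g i (f i (G x)) = G x" by (simp add: gf)
    ultimately show "dist (F n (G x)) (F' (G x)) < e" using elim by force
   qed
  qed
 qed
qed

lemma holo_out_holo:
 assumes "holo_out F X" "holo_in G S"
 shows "holo (\<lambda>s. F (G s)) S"
 by (rule holo_in_out[OF openM_X assms(2,1)]) (use assms(2) in \<open>auto simp: holo_in_def\<close>)

lemma holo_outI: "(\<And>i. holo (\<lambda>y. F (g i y)) Om) \<Longrightarrow> holo_out F W"
 unfolding holo_out_def by (blast intro: holo_subset)

lemma holo_in_local:
 assumes "open S" "\<And>s. s \<in> S \<Longrightarrow> \<exists>T. open T \<and> s \<in> T \<and> T \<subseteq> S \<and> holo_in G T"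
 shows "holo_in G S"
 unfolding holo_in_def
proof (intro conjI allI)
 show "G ` S \<subseteq> X"
 proof
  fix x assume "x \<in> G ` S"
  then obtain s where "s \<in> S" "x = G s" by blast
  thus "x \<in> X" using assms(2)[of s] holo_in_D(3) by blast
 qed
 fix i
 show "open {s \<in> S. G s \<in> Mi i}"
 proof (rule openI)
  fix s assume s: "s \<in> {s \<in> S. G s \<in> Mi i}"
  then obtain T where T: "open T" "s \<in> T" "T \<subseteq> S" "holo_in G T" using assms(2) by blast
  then obtain e where "e > 0" "ball s e \<subseteq> {s \<in> T. G s \<in> Mi i}"
   using holo_in_D(1)[OF T(4), of i] s open_contains_ball by (metis (no_types, lifting) mem_Collect_eq)
  thus "\<exists>e>0. ball s e \<subseteq> {s \<in> S. G s \<in> Mi i}" using T(3) by blast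
 qed
 show "holo (\<lambda>s. f i (G s)) {s \<in> S. G s \<in> Mi i}"
 proof (rule holo_local)
  fix s assume s: "s \<in> {s \<in> S. G s \<in> Mi i}"
  then obtain T where T: "open T" "s \<in> T" "T \<subseteq> S" "holo_in G T" using assms(2) by blast
  show "\<exists>T. s \<in> T \<and> holo (\<lambda>s. f i (G s)) T"
   by (rule exI[of _ "{s \<in> T. G s \<in> Mi i}"]) (use s T holo_in_D(2)[OF T(4)] in simp)
 qed
qed

text \<open>Convergence is arranged on a countable set of points of \<open>X\<close> that is dense
  in every parametrization, so the limits found in the various coordinates are values of one
  function.\<close>

lemma montelM:
 fixes T :: "nat \<Rightarrow> 'a \<Rightarrow> 'b::complex_euclidean"
 assumes W: "openM W" and lb: "\<And>i. locbdd {y \<in> Om. g i y \<in> W} (\<lambda>n y. T n (g i y))"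
 obtains r T' where "strict_mono (r :: nat \<Rightarrow> nat)" "lucM W (\<lambda>n. T (r n)) T'" "holo_out T' W"
proof -
 define V where "V = (\<lambda>i. {y \<in> Om. g i y \<in> W})"
 have oV: "open (V i)" for i using W by (simp add: openM_def V_def)
 have "\<forall>i. \<exists>Q. countable Q \<and> Q \<subseteq> V i \<and> V i \<subseteq> closure Q"
  using separable by metis
 then obtain Q where Q: "\<And>i. countable (Q i)" "\<And>i. Q i \<subseteq> V i" "\<And>i. V i \<subseteq> closure (Q i)" by metis
 obtain r where r: "strict_mono (r :: nat \<Rightarrow> nat)" "\<And>q. q \<in> (\<Union>i. g i ` Q i) \<Longrightarrow> convergent (\<lambda>n. T (r n) q)"
 proof (rule convergent_subsequence_countable[of "\<Union>i. g i ` Q i" T])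
  show "countable (\<Union>i. g i ` Q i)" using Q(1) by simp
  fix q assume "q \<in> (\<Union>i. g i ` Q i)"
  then obtain i y where y: "y \<in> V i" "q = g i y" using Q(2) by blast
  then obtain s B where "s > 0" "\<forall>\<^sub>F n. holo (\<lambda>y. T n (g i y)) (ball y s) \<and> (\<forall>x\<in>ball y s. norm (T n (g i x)) \<le> B)"
   using lb[of i] unfolding locbdd_def V_def by blast
  thus "\<exists>B. \<forall>\<^sub>F n. norm (T n q) \<le> B"
   unfolding y(2) by (intro exI[of _ B]) (auto elim!: eventually_mono)
 qed (use that in blast)
 define T' where "T' = (\<lambda>x. lim (\<lambda>n. T (r n) x))"
 have luc: "luc (V i) (\<lambda>n y. T (r n) (g i y)) (\<lambda>y. T' (g i y))" for i
 proof -
  have lb': "locbdd (V i) (\<lambda>n y. T (r n) (g i y))" unfolding V_def by (rule locbdd_subseq[OF lb r(1)])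
  obtain t where t: "luc (V i) (\<lambda>n y. T (r n) (g i y)) t"
   by (rule luc_vitali[OF oV Q(3) lb']) (use r(2) in auto)
  have "t y = T' (g i y)" if "y \<in> V i" for y
   using limI[OF luc_pointwise[OF t that]] by (simp add: T'_def)
  thus ?thesis by (intro luc_cong[OF t]) (auto intro: exI[of _ 1])
 qed
 have "holo_out T' W"
  unfolding holo_out_def
 proof
  fix i
  show "holo (\<lambda>y. T' (g i y)) {y \<in> Om. g i y \<in> W}"
   by (rule luc_holo[OF oV[unfolded V_def] luc[unfolded V_def] evholo_subseq[OF locbdd_evholo[OF lb] r(1)]])
 qed
 with r(1) luc show ?thesis by (intro that[of r T']) (auto simp: lucM_def V_def)
qed

end

section \<open>Limits of the coordinate maps\<close>

text \<open>The common outcome of two cases. If the base point keeps away from the boundary,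
  \<open>D\<close> and all \<open>Dk\<close> are \<open>Om\<close> and the \<open>phi\<close> are
  original coordinates; if not, \<open>D\<close> is the ball and \<open>Dk\<close> the part of it
  coming from the rescaled domain. Essential is that \<open>Phi\<close> has values in
  \<open>D\<close> itself, not merely in its closure.\<close>

locale limit_charts = union_of_copies Om X Mi f g
 for Om :: "'v::complex_euclidean set" and X :: "'a set" and Mi f g +
 fixes D :: "'v set" and U :: "nat \<Rightarrow> 'a set" and Dk :: "nat \<Rightarrow> 'v set"
  and phi :: "nat \<Rightarrow> 'a \<Rightarrow> 'v" and psi :: "nat \<Rightarrow> 'v \<Rightarrow> 'a" and Phi :: "'a \<Rightarrow> 'v"
 assumes open_D: "open D" and convex_D: "convex D" and bounded_D: "bounded D"
  and openM_U: "\<And>n. openM (U n)" and open_Dk: "\<And>n. open (Dk n)" and Dk_D: "\<And>n. Dk n \<subseteq> D"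
  and holo_phi: "\<And>n. holo_out (phi n) (U n)" and holo_psi: "\<And>n. holo_in (psi n) (Dk n)"
  and phi_in: "\<And>n x. x \<in> U n \<Longrightarrow> phi n x \<in> Dk n" and psi_in: "\<And>n y. y \<in> Dk n \<Longrightarrow> psi n y \<in> U n"
  and psi_phi: "\<And>n x. x \<in> U n \<Longrightarrow> psi n (phi n x) = x" and phi_psi: "\<And>n y. y \<in> Dk n \<Longrightarrow> phi n (psi n y) = y"
  and exh_U: "exhM U"
  and exh_Dk: "\<And>y. y \<in> D \<Longrightarrow> \<exists>r>0. ball y r \<subseteq> D \<and> (\<forall>\<^sub>F n. ball y r \<subseteq> Dk n)"
  and luc_phi: "lucM X phi Phi" and Phi_in: "\<And>x. x \<in> X \<Longrightarrow> Phi x \<in> D"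
begin

lemma U_X: "U n \<subseteq> X" using openM_U by (auto simp: openM_def)

lemma evholo_phi: "evholo Om (\<lambda>n y. phi n (g i y))"
 unfolding evholo_def
proof
 fix y assume "y \<in> Om"
 then obtain r where r: "r > 0" "ball y r \<subseteq> Om" "\<forall>\<^sub>F n. g i ` ball y r \<subseteq> U n"
  using exh_U unfolding exhM_def by blast
 have "\<forall>\<^sub>F n. holo (\<lambda>y. phi n (g i y)) (ball y r)"
  using r(3)
 proof eventually_elim
  case (elim n)
  show ?case
   by (rule holo_subset[OF holo_phi[unfolded holo_out_def, rule_format, of n i]]) (use elim r in auto)
 qed
 with r show "\<exists>r>0. \<forall>\<^sub>F n. holo (\<lambda>y. phi n (g i y)) (ball y r)" by blast
qed

lemma luc_phi_g: "luc Om (\<lambda>n y. phi n (g i y)) (\<lambda>y. Phi (g i y))"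
 using luc_phi by (simp add: lucM_def Om_X)

lemma holo_Phi_g: "holo (\<lambda>y. Phi (g i y)) Om"
 by (rule luc_holo[OF open_Om luc_phi_g evholo_phi])

lemma holo_Phi: "holo_out Phi X"
 by (rule holo_outI[OF holo_Phi_g])

lemma Phi_g_in: "y \<in> Om \<Longrightarrow> Phi (g i y) \<in> D"
 using Phi_in g_in Mi_X by blast

lemma holo_Phi_psi: "holo (\<lambda>y. Phi (psi n y)) (Dk n)"
 by (rule holo_out_holo[OF holo_Phi holo_psi])

lemma psi_X: "y \<in> Dk n \<Longrightarrow> psi n y \<in> X"
 using psi_in U_X by blast

lemma Phi_psi_in: "y \<in> Dk n \<Longrightarrow> Phi (psi n y) \<in> D"
 using Phi_in psi_X by blast

lemma locbdd_Phi_psi: "locbdd D (\<lambda>n y. Phi (psi n y))"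
 unfolding locbdd_def
proof
 fix y assume "y \<in> D"
 then obtain r where r: "r > 0" "\<forall>\<^sub>F n. ball y r \<subseteq> Dk n" using exh_Dk by blast
 obtain B where B: "\<And>x. x \<in> D \<Longrightarrow> norm x \<le> B" using bounded_D bounded_iff by blast
 have "\<forall>\<^sub>F n. holo (\<lambda>y. Phi (psi n y)) (ball y r) \<and> (\<forall>x\<in>ball y r. norm (Phi (psi n x)) \<le> B)"
  using r(2)
 proof eventually_elim
  case (elim n)
  hence "norm (Phi (psi n x)) \<le> B" if "x \<in> ball y r" for x
   using that by (intro B Phi_psi_in) blast
  thus ?case by (intro conjI holo_subset[OF holo_Phi_psi elim] ballI)
 qed
 with r show "\<exists>r>0. \<exists>B. \<forall>\<^sub>F n. holo (\<lambda>y. Phi (psi n y)) (ball y r) \<and> (\<forall>x\<in>ball y r. norm (Phi (psi n x)) \<le> B)"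
  by blast
qed

lemma phi_tendsto: "x \<in> X \<Longrightarrow> (\<lambda>n. phi n x) \<longlonglongrightarrow> Phi x"
proof (erule X_E)
 fix i y assume "y \<in> Om" "x = g i y"
 thus ?thesis using luc_pointwise[OF luc_phi_g, of y i] by simp
qed

lemma eventually_U: "x \<in> X \<Longrightarrow> \<forall>\<^sub>F n. x \<in> U n"
proof (erule X_E)
 fix i y assume "y \<in> Om" "x = g i y"
 moreover from this obtain r where "r > 0" "\<forall>\<^sub>F n. g i ` ball y r \<subseteq> U n"
  using exh_U unfolding exhM_def by blast
 ultimately show ?thesis by (auto elim!: eventually_mono)
qed

lemma Dk_compact:
 assumes "compact K" "K \<subseteq> D" shows "\<forall>\<^sub>F n. K \<subseteq> Dk n"
proof (rule eventually_compact_ball[OF assms(1), of "\<lambda>n A. A \<subseteq> Dk n"])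
 fix s assume "s \<in> K"
 thus "\<exists>r>0. \<forall>\<^sub>F n. ball s r \<subseteq> Dk n" using exh_Dk assms(2) by blast
qed auto

lemma limit_charts_subseq:
 assumes "strict_mono r"
 shows "limit_charts Om X Mi f g D (\<lambda>n. U (r n)) (\<lambda>n. Dk (r n)) (\<lambda>n. phi (r n)) (\<lambda>n. psi (r n)) Phi"
proof
 show "exhM (\<lambda>n. U (r n))"
  unfolding exhM_def
 proof (intro allI ballI)
  fix i y assume "y \<in> Om"
  then obtain s where "s > 0" "ball y s \<subseteq> Om" "\<forall>\<^sub>F n. g i ` ball y s \<subseteq> U n"
   using exh_U unfolding exhM_def by blast
  thus "\<exists>s>0. ball y s \<subseteq> Om \<and> (\<forall>\<^sub>F n. g i ` ball y s \<subseteq> U (r n))"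
   using eventually_strict_mono[OF assms] by blast
 qed
 show "\<exists>s>0. ball y s \<subseteq> D \<and> (\<forall>\<^sub>F n. ball y s \<subseteq> Dk (r n))" if "y \<in> D" for y
  using exh_Dk[OF that] eventually_strict_mono[OF assms] by blast
 show "lucM X (\<lambda>n. phi (r n)) Phi"
  using luc_subseq[OF luc_phi_g assms] by (simp add: lucM_def Om_X)
qed (fact open_D convex_D bounded_D openM_U open_Dk Dk_D holo_phi holo_psi Phi_in
   | rule phi_in psi_in psi_phi phi_psi; assumption)+

lemma linear_sum_Basis:
 assumes "linear (L :: 'x::euclidean_space \<Rightarrow> 'y::real_vector)"
 shows "L v = (\<Sum>b\<in>Basis. (v \<bullet> b) *\<^sub>R L b)"
 using linear_sum[OF assms, of "\<lambda>b. (v \<bullet> b) *\<^sub>R b" Basis] linear_scale[OF assms] by (simp add: euclidean_representation)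

lemma affine_discs:
 assumes r: "ball p r \<subseteq> Dk n" and w: "dist w p < r / 2" and v: "norm v \<le> r / 2"
 shows "holo (\<lambda>t::complex. w + cs t v) (ball 0 1)" "(\<lambda>t. w + cs t v) ` ball 0 1 \<subseteq> Dk n"
  "holo_in (\<lambda>t. psi n (w + cs t v)) (ball 0 1)"
proof -
 show u: "holo (\<lambda>t::complex. w + cs t v) (ball 0 1)" by (rule holo_line)
 have "w + cs t v \<in> ball p r" if "cmod t < 1" for t
 proof -
  have "cmod t * norm v \<le> 1 * norm v" using that by (intro mult_right_mono) auto
  thus ?thesis
   using w v norm_triangle_ineq[of "w - p" "cs t v"] by (simp add: dist_norm norm_cs norm_minus_commute algebra_simps)
 qed
 thus ub: "(\<lambda>t. w + cs t v) ` ball 0 1 \<subseteq> Dk n" using r by auto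
 show "holo_in (\<lambda>t. psi n (w + cs t v)) (ball 0 1)"
  by (rule holo_in_compose[OF holo_psi u open_ball open_Dk ub])
qed

text \<open>Points with equal image have coordinates \<open>phi n x\<close>, \<open>phi n y\<close>
  arbitrarily close to each other, while a ball of fixed radius stays in \<open>Dk n\<close>. An
  affine disc in that ball passes through both at nearby parameters, which will make their Kobayashi
  distance zero.\<close>

lemma close_discs:
 assumes x: "x \<in> X" and y: "y \<in> X" and eq: "Phi x = Phi y" and e: "e > 0"
 obtains G :: "complex \<Rightarrow> 'a" and a where "holo_in G (ball 0 1)" "G 0 = x" "G a = y" "cmod a < e" "cmod a < 1"
proof -
 obtain r where r: "r > 0" "\<forall>\<^sub>F n. ball (Phi x) r \<subseteq> Dk n" using exh_Dk Phi_in x by blast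
 define d where "d = min e 1 / 2"
 have d: "d > 0" "d < e" "d < 1" using e by (auto simp: d_def)
 \<comment> \<open>The two coordinates are then at most \<open>r / 2 * d\<close> apart, so the
   direction \<open>v\<close> obtained on dividing by \<open>d\<close> has norm at most
   \<open>r / 2\<close> and the disc stays in the ball.\<close>
 define s where "s = r * d / 4"
 have s: "s > 0" "s < r / 2" using r d by (auto simp: s_def)
 have "\<forall>\<^sub>F n. dist (phi n x) (Phi x) < s"
  "\<forall>\<^sub>F n. dist (phi n y) (Phi x) < s"
  using phi_tendsto[OF x] phi_tendsto[OF y] s eq by (auto simp: tendsto_iff)
 from eventually_conj[OF eventually_conj[OF this] eventually_conj[OF r(2) eventually_conj[OF eventually_U[OF x] eventually_U[OF y]]]]
 obtain n where n: "dist (phi n x) (Phi x) < s" "dist (phi n y) (Phi x) < s" "ball (Phi x) r \<subseteq> Dk n"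
  "x \<in> U n" "y \<in> U n"
  unfolding eventually_sequentially by blast
 define v where "v = (1 / d) *\<^sub>R (phi n y - phi n x)"
 have "norm (phi n y - phi n x) \<le> r / 2 * d"
  using n(1,2) dist_triangle2[of "phi n y" "phi n x" "Phi x"] by (simp add: dist_norm s_def)
 moreover have "norm v = norm (phi n y - phi n x) / d" unfolding v_def norm_scaleR using d by simp
 ultimately have nv: "norm v \<le> r / 2" using d(1) by (simp add: divide_le_eq)
 have "dist (phi n x) (Phi x) < r / 2" using n(1) s by simp
 hence "holo_in (\<lambda>t. psi n (phi n x + cs t v)) (ball 0 1)" by (rule affine_discs(3)[OF n(3) _ nv])
 thus ?thesis
  by (rule that[of _ "of_real d"]) (use n d in \<open>auto simp: v_def psi_phi cs_of_real\<close>)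
qed

lemma cder_phi:
 assumes y: "y \<in> Om" and x: "g i y \<in> U n"
 shows "cder (\<lambda>w. f i (psi n w)) (phi n (g i y)) (cder (\<lambda>y. phi n (g i y)) y \<xi>) = \<xi>"
  "cder (\<lambda>w. Phi (psi n w)) (phi n (g i y)) (cder (\<lambda>y. phi n (g i y)) y \<xi>) = cder (\<lambda>y. Phi (g i y)) y \<xi>"
proof -
 let ?S = "{y \<in> Om. g i y \<in> U n}" and ?T = "{w \<in> Dk n. psi n w \<in> Mi i}"
 have S: "holo (\<lambda>y. phi n (g i y)) ?S" "open ?S" "y \<in> ?S"
  using holo_phi[of n] openM_U[of n] y x by (simp_all add: holo_out_def openM_def)
 have T: "holo (\<lambda>w. f i (psi n w)) ?T" by (rule holo_in_D(2)[OF holo_psi])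
 have "phi n (g i y) \<in> ?T" using phi_in[OF x] psi_phi[OF x] g_in[OF y] by simp
 hence "cder (\<lambda>w. f i (psi n w)) (phi n (g i y)) (cder (\<lambda>y. phi n (g i y)) y \<xi>) = cder (\<lambda>y. f i (psi n (phi n (g i y)))) y \<xi>"
  by (rule cder_compose[OF S(1) T S(3), symmetric])
 also have "cder (\<lambda>y. f i (psi n (phi n (g i y)))) y = cder (\<lambda>y. y) y"
  by (rule cder_cong[OF S(2,3) _ holo_ident, symmetric]) (simp add: psi_phi fg)
 also have "cder (\<lambda>y. y) y = (\<lambda>v. v)" by (rule cder_eqI) simp
 finally show "cder (\<lambda>w. f i (psi n w)) (phi n (g i y)) (cder (\<lambda>y. phi n (g i y)) y \<xi>) = \<xi>" .
 have "cder (\<lambda>w. Phi (psi n w)) (phi n (g i y)) (cder (\<lambda>y. phi n (g i y)) y \<xi>) = cder (\<lambda>y. Phi (psi n (phi n (g i y)))) y \<xi>"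
  by (rule cder_compose[OF S(1) holo_Phi_psi S(3) phi_in[OF x], symmetric])
 also have "cder (\<lambda>y. Phi (psi n (phi n (g i y)))) y = cder (\<lambda>y. Phi (g i y)) y"
  by (rule cder_cong[OF S(2,3) _ holo_subset[OF holo_Phi_g], symmetric]) (auto simp: psi_phi)
 finally show "cder (\<lambda>w. Phi (psi n w)) (phi n (g i y)) (cder (\<lambda>y. phi n (g i y)) y \<xi>) = cder (\<lambda>y. Phi (g i y)) y \<xi>" .
qed

text \<open>The infinitesimal version of \<open>close_discs\<close>: the derivatives of
  \<open>phi n\<close> send \<open>\<xi>\<close> to vectors tending to zero, so discs whose velocity
  is any multiple \<open>A\<close> of them fit into the fixed ball.\<close>

lemma null_discs:
 assumes y: "y \<in> Om" and null: "cder (\<lambda>y. Phi (g i y)) y \<xi> = 0" and A: "A > 0"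
 obtains G :: "complex \<Rightarrow> 'a" where "holo_in G (ball 0 1)" "G 0 = g i y"
  "cder (\<lambda>t. f i (G t)) 0 1 = A *\<^sub>R \<xi>"
proof -
 let ?x = "g i y"
 have x: "?x \<in> X" using g_in[OF y] Mi_X by blast
 obtain r where r: "r > 0" "\<forall>\<^sub>F n. ball (Phi ?x) r \<subseteq> Dk n" using exh_Dk Phi_in x by blast
 have "(\<lambda>n. cder (\<lambda>y. phi n (g i y)) y \<xi>) \<longlonglongrightarrow> 0"
  using luc_cder_moving[OF open_Om luc_phi_g evholo_phi tendsto_const y, of i \<xi>] null by simp
 moreover have "r / (2 * A) > 0" using r A by simp
 ultimately have "\<forall>\<^sub>F n. norm (cder (\<lambda>y. phi n (g i y)) y \<xi>) < r / (2 * A)"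
  unfolding tendsto_iff by (simp add: dist_norm)
 moreover have "\<forall>\<^sub>F n. dist (phi n ?x) (Phi ?x) < r / 2"
  using phi_tendsto[OF x] r(1) half_gt_zero unfolding tendsto_iff by blast
 ultimately have "\<forall>\<^sub>F n. dist (phi n ?x) (Phi ?x) < r / 2 \<and>
   norm (cder (\<lambda>y. phi n (g i y)) y \<xi>) < r / (2 * A) \<and> ball (Phi ?x) r \<subseteq> Dk n \<and> ?x \<in> U n"
  using r(2) eventually_U[OF x] by eventually_elim auto
 then obtain n where n: "dist (phi n ?x) (Phi ?x) < r / 2"
   "norm (cder (\<lambda>y. phi n (g i y)) y \<xi>) < r / (2 * A)" "ball (Phi ?x) r \<subseteq> Dk n" "?x \<in> U n"
  unfolding eventually_sequentially by blast
 define v where "v = A *\<^sub>R cder (\<lambda>y. phi n (g i y)) y \<xi>"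
 have nv: "norm v \<le> r / 2" using n(2) A by (simp add: v_def field_simps)
 let ?T = "{w \<in> Dk n. psi n w \<in> Mi i}" and ?u = "\<lambda>t::complex. phi n ?x + cs t v"
 note u = affine_discs[OF n(3,1) nv]
 have T: "holo (\<lambda>w. f i (psi n w)) ?T" by (rule holo_in_D(2)[OF holo_psi])
 have pT: "phi n ?x \<in> ?T" using phi_in[OF n(4)] psi_phi[OF n(4)] g_in[OF y] by simp
 have "cder (\<lambda>t. f i (psi n (?u t))) 0 1 = cder (\<lambda>w. f i (psi n w)) (?u 0) (cder ?u 0 1)"
  by (rule cder_compose[OF u(1) T]) (use pT in simp_all)
 also have "cder ?u 0 1 = v" using cder_eqI[OF cder_line[of "phi n ?x" v 0]] by simp
 also have "cder (\<lambda>w. f i (psi n w)) (?u 0) v = A *\<^sub>R \<xi>"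
  using linear_scale[OF linear_cder[OF T pT]] cder_phi(1)[OF y n(4)] by (simp add: v_def)
 finally show ?thesis by (intro that[OF u(3)]) (use n(4) in \<open>simp_all add: psi_phi\<close>)
qed

text \<open>The counterpart of \<open>null_discs\<close>: a disc followed by \<open>Phi\<close> is a
  bounded map, so Cauchy's estimate limits its velocity, uniformly in the disc, the point and the
  copy.\<close>

lemma disc_velocity_bound:
 obtains B where "\<And>(G :: complex \<Rightarrow> 'a) y i. holo_in G (ball 0 1) \<Longrightarrow> y \<in> Om \<Longrightarrow> G 0 = g i y \<Longrightarrow>
  norm (cder (\<lambda>y. Phi (g i y)) y (cder (\<lambda>t. f i (G t)) 0 1)) \<le> B"
proof -
 obtain B where B: "\<And>x. x \<in> D \<Longrightarrow> norm x \<le> B" using bounded_D bounded_iff by blast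
 show ?thesis
 proof (rule that[of "4 * B"])
  fix G :: "complex \<Rightarrow> 'a" and y i assume G: "holo_in G (ball 0 1)" "y \<in> Om" "G 0 = g i y"
  let ?T = "{t \<in> ball 0 1. G t \<in> Mi i}"
  have T: "holo (\<lambda>t. f i (G t)) ?T" "open ?T" "0 \<in> ?T" using holo_in_D[OF G(1)] G g_in by auto
  have y: "f i (G 0) = y" using G fg by simp
  have "cder (\<lambda>y. Phi (g i y)) y (cder (\<lambda>t. f i (G t)) 0 1) = cder (\<lambda>t. Phi (g i (f i (G t)))) 0 1"
   using cder_compose[OF T(1) holo_Phi_g[of i] T(3), of 1] y G(2) by simp
  also have "cder (\<lambda>t. Phi (g i (f i (G t)))) 0 = cder (\<lambda>t. Phi (G t)) 0"
  proof (rule cder_cong[OF T(2,3)])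
   show "holo (\<lambda>t. Phi (g i (f i (G t)))) ?T"
    by (rule holo_compose[OF T(1) holo_Phi_g]) (use f_in in blast)
  qed (simp add: gf)
  also have "norm (cder (\<lambda>t. Phi (G t)) 0 1) \<le> 4 * B / 1 * norm (1::complex)"
  proof (rule holo_deriv_bound)
   show "holo (\<lambda>t. Phi (G t)) (ball 0 1)" by (rule holo_out_holo[OF holo_Phi G(1)])
   show "norm (Phi (G t)) \<le> B" if "t \<in> ball 0 1" for t
    by (rule B[OF Phi_in[OF holo_in_D(3)[OF G(1) that]]])
  qed simp
  finally show "norm (cder (\<lambda>y. Phi (g i y)) y (cder (\<lambda>t. f i (G t)) 0 1)) \<le> 4 * B" by simp
 qed
qed

end

text \<open>\<open>h\<close> is the limit of \<open>Phi\<close> read in the coordinates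
  \<open>psi n\<close>. It turns out to be the identity when \<open>Phi\<close> is injective, and a
  proper retraction carries the information when it is not.\<close>

locale retract_limit = limit_charts +
 fixes h :: "'a \<Rightarrow> 'a"
 assumes luc_h: "luc D (\<lambda>n y. Phi (psi n y)) h"
begin

lemma holo_h: "holo h D"
 by (rule luc_holo[OF open_D luc_h locbdd_evholo[OF locbdd_Phi_psi]])

text \<open>\<open>Phi \<circ> psi n\<close> is evaluated at the moving point
  \<open>phi n x\<close>, where it equals \<open>Phi x\<close>.\<close>

lemma h_Phi:
 assumes x: "x \<in> X" shows "h (Phi x) = Phi x"
proof -
 have "\<forall>\<^sub>F n. phi n x \<in> D"
  using eventually_U[OF x] by eventually_elim (use phi_in Dk_D in blast)
 hence "(\<lambda>n. Phi (psi n (phi n x))) \<longlonglongrightarrow> h (Phi x)"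
  by (rule luc_moving[OF luc_h holo_continuous_on[OF holo_h] phi_tendsto[OF x] Phi_in[OF x]])
 moreover have "\<forall>\<^sub>F n. Phi (psi n (phi n x)) = Phi x"
  using eventually_U[OF x] by eventually_elim (simp add: psi_phi)
 ultimately have "(\<lambda>n. Phi x) \<longlonglongrightarrow> h (Phi x)" by (rule Lim_transform_eventually)
 thus ?thesis by (simp add: LIMSEQ_const_iff)
qed

lemma Phi_psi_tendsto: "y \<in> D \<Longrightarrow> (\<lambda>n. Phi (psi n y)) \<longlonglongrightarrow> h y"
 by (rule luc_pointwise[OF luc_h])

lemma eventually_Dk: "y \<in> D \<Longrightarrow> \<forall>\<^sub>F n. y \<in> Dk n"
 using Dk_compact[of "{y}"] by simp

lemma h_in: assumes "y \<in> D" shows "h y \<in> D"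
proof -
 obtain y0 where "y0 \<in> Om" using Om_nonempty by blast
 hence x0: "g 0 y0 \<in> X" using g_in Mi_X by blast
 have cl: "h ` D \<subseteq> closure D"
 proof
  fix z assume "z \<in> h ` D"
  then obtain y where y: "y \<in> D" "z = h y" by blast
  have "\<forall>\<^sub>F n. Phi (psi n y) \<in> closure D"
   using eventually_Dk[OF y(1)] by eventually_elim (use Phi_psi_in closure_subset in blast)
  thus "z \<in> closure D"
   using Lim_in_closed_set[OF closed_closure _ _ Phi_psi_tendsto[OF y(1)]] y(2) by simp
 qed
 \<comment> \<open>The limit has values in the closure of \<open>D\<close> and fixes the interior
   point \<open>Phi (g 0 y0)\<close>, so the maximum principle excludes the boundary.\<close>
 show ?thesis
  by (rule holo_max_principle[OF open_D convex_D holo_h cl open_D convex_D Phi_in[OF x0] _ assms])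
    (simp add: h_Phi x0 Phi_in)
qed

lemma h_h: assumes "y \<in> D" shows "h (h y) = h y"
proof -
 have "\<forall>\<^sub>F n. Phi (psi n y) \<in> D"
  using eventually_Dk[OF assms] by eventually_elim (rule Phi_psi_in)
 hence "(\<lambda>n. h (Phi (psi n y))) \<longlonglongrightarrow> h (h y)"
  by (rule continuous_on_tendsto_compose[OF holo_continuous_on[OF holo_h] Phi_psi_tendsto[OF assms] h_in[OF assms]])
 moreover have "\<forall>\<^sub>F n. h (Phi (psi n y)) = Phi (psi n y)"
  using eventually_Dk[OF assms] by eventually_elim (rule h_Phi[OF psi_X])
 ultimately have "(\<lambda>n. Phi (psi n y)) \<longlonglongrightarrow> h (h y)" by (rule Lim_transform_eventually)
 thus ?thesis using Phi_psi_tendsto[OF assms] LIMSEQ_unique by blast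
qed

lemma cder_h_Phi:
 assumes y: "y \<in> Om"
 shows "cder h (Phi (g i y)) (cder (\<lambda>y. Phi (g i y)) y v) = cder (\<lambda>y. Phi (g i y)) y v"
proof -
 have "cder h (Phi (g i y)) (cder (\<lambda>y. Phi (g i y)) y v) = cder (\<lambda>y. h (Phi (g i y))) y v"
  by (rule cder_compose[OF holo_Phi_g holo_h y Phi_g_in[OF y], symmetric])
 also have "cder (\<lambda>y. h (Phi (g i y))) y = cder (\<lambda>y. Phi (g i y)) y"
  by (rule cder_cong[OF open_Om y _ holo_Phi_g, symmetric]) (rule h_Phi[symmetric, OF subsetD[OF Mi_X g_in]])
 finally show ?thesis .
qed

text \<open>The images of \<open>\<xi>\<close> under the derivatives of \<open>phi n\<close> tend to
  zero but do not vanish for large \<open>n\<close>; normalized, they have a limit direction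
  \<open>u\<close>. The derivative of \<open>Phi \<circ> psi n\<close> kills them, because
  \<open>Phi\<close> kills \<open>\<xi>\<close>, and this passes to the limit.\<close>

lemma cder_h_degenerate:
 assumes y: "y \<in> Om" and \<xi>: "\<xi> \<noteq> 0" "cder (\<lambda>y. Phi (g i y)) y \<xi> = 0"
 shows "\<exists>u. u \<noteq> 0 \<and> cder h (Phi (g i y)) u = 0"
proof -
 let ?x = "g i y" and ?v = "\<lambda>n. cder (\<lambda>y. phi n (g i y)) y \<xi>" and ?L = "\<lambda>n. cder (\<lambda>w. Phi (psi n w)) (phi n (g i y))"
 have xX: "?x \<in> X" using g_in[OF y] Mi_X by blast
 have pD: "Phi ?x \<in> D" by (rule Phi_g_in[OF y])
 obtain N where N: "\<And>n. n \<ge> N \<Longrightarrow> ?x \<in> U n" using eventually_U[OF xX] unfolding eventually_sequentially by blast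
 have v0: "?v n \<noteq> 0" if "n \<ge> N" for n
 proof
  let ?T = "{w \<in> Dk n. psi n w \<in> Mi i}"
  have "phi n ?x \<in> ?T" using phi_in[OF N[OF that]] psi_phi[OF N[OF that]] g_in[OF y] by simp
  hence "linear (cder (\<lambda>w. f i (psi n w)) (phi n ?x))" by (rule linear_cder[OF holo_in_D(2)[OF holo_psi]])
  moreover assume "?v n = 0"
  ultimately show False using cder_phi(1)[OF y N[OF that], of \<xi>] linear_0 \<xi>(1) by metis
 qed
 have "\<forall>n. sgn (?v (n + N)) \<in> sphere 0 1" using v0 by (simp add: norm_sgn)
 from seq_compactE[OF compact_imp_seq_compact[OF compact_sphere] this]
 obtain u t where u: "u \<in> sphere 0 1" "strict_mono t" "((\<lambda>n. sgn (?v (n + N))) \<circ> t) \<longlonglongrightarrow> u" by metis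
 define k where "k n = t n + N" for n
 have k: "strict_mono k" "\<And>n. k n \<ge> N" using u(2) by (simp_all add: k_def strict_mono_def)
 have lin: "linear (?L (k n))" for n by (rule linear_cder[OF holo_Phi_psi phi_in[OF N[OF k(2)]]])
 \<comment> \<open>Both the vector and the linear map vary with \<open>n\<close>, so the limit is
   taken in basis coordinates.\<close>
 have "(\<lambda>n. \<Sum>b\<in>Basis. (sgn (?v (k n)) \<bullet> b) *\<^sub>R ?L (k n) b) \<longlonglongrightarrow> (\<Sum>b\<in>Basis. (u \<bullet> b) *\<^sub>R cder h (Phi ?x) b)"
 proof (intro tendsto_sum tendsto_scaleR tendsto_inner tendsto_const)
  show "(\<lambda>n. sgn (?v (k n))) \<longlonglongrightarrow> u" using u(3) by (simp add: o_def k_def)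
  fix b
  have "(\<lambda>n. ?L n b) \<longlonglongrightarrow> cder h (Phi ?x) b"
   by (rule luc_cder_moving[OF open_D luc_h locbdd_evholo[OF locbdd_Phi_psi] phi_tendsto[OF xX] pD])
  from LIMSEQ_subseq_LIMSEQ[OF this k(1)] show "(\<lambda>n. ?L (k n) b) \<longlonglongrightarrow> cder h (Phi ?x) b" by (simp add: o_def)
 qed
 moreover have "(\<Sum>b\<in>Basis. (sgn (?v (k n)) \<bullet> b) *\<^sub>R ?L (k n) b) = 0" for n
 proof -
  have "(\<Sum>b\<in>Basis. (sgn (?v (k n)) \<bullet> b) *\<^sub>R ?L (k n) b) = ?L (k n) (sgn (?v (k n)))"
   by (rule linear_sum_Basis[OF lin, symmetric])
  also have "\<dots> = inverse (norm (?v (k n))) *\<^sub>R ?L (k n) (?v (k n))"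
   unfolding sgn_div_norm by (rule linear_scale[OF lin])
  finally show ?thesis using cder_phi(2)[OF y N[OF k(2)]] \<xi>(2) by simp
 qed
 ultimately have "(\<Sum>b\<in>Basis. (u \<bullet> b) *\<^sub>R cder h (Phi ?x) b) = 0" by (simp add: LIMSEQ_const_iff)
 hence "cder h (Phi ?x) u = 0" using linear_sum_Basis[OF linear_cder[OF holo_h pD], of u] by simp
 with u(1) show ?thesis by (intro exI[of _ u]) auto
qed

text \<open>An injective \<open>Phi\<close> is open on each copy, so \<open>h\<close>, which fixes
  its image, is the identity on an open set and hence on \<open>D\<close>. Then
  \<open>Phi \<circ> psi n\<close> tends to the identity, and Brouwer's theorem makes
  \<open>Phi\<close> surjective; a kernel of its derivative would be passed on to
  \<open>h\<close>.\<close>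

lemma inj_imp_biholo:
 assumes inj: "inj_on Phi X"
 shows "Phi ` X = D" "holo_in (inv_into X Phi) D"
proof -
 have gX: "g i ` Om \<subseteq> X" for i using g_in Mi_X by blast
 have inj_g: "inj_on (\<lambda>y. Phi (g i y)) Om" for i
 proof (rule inj_onI)
  fix y y' assume *: "y \<in> Om" "y' \<in> Om" "Phi (g i y) = Phi (g i y')"
  hence "g i y = g i y'" using inj_onD[OF inj] gX by blast
  thus "y = y'" using fg * by metis
 qed
 have oV: "open ((\<lambda>y. Phi (g i y)) ` Om)" for i
  by (rule invariance_of_domain[OF holo_continuous_on[OF holo_Phi_g] open_Om inj_g])
 obtain y0 where y0: "y0 \<in> Om" using Om_nonempty by blast
 obtain r where r: "r > 0" "ball (Phi (g 0 y0)) r \<subseteq> (\<lambda>y. Phi (g 0 y)) ` Om"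
  using oV[of 0] y0 open_contains_ball by blast
 have hid: "h y = y" if "y \<in> D" for y
 proof (rule holo_identity[OF open_D convex_D holo_h holo_ident Phi_g_in[OF y0] r(1) _ that])
  fix x assume "x \<in> ball (Phi (g 0 y0)) r"
  then obtain y where "y \<in> Om" "x = Phi (g 0 y)" using r(2) by blast
  thus "h x = x" using h_Phi gX by blast
 qed
 have luc_id: "luc D (\<lambda>n y. Phi (psi n y)) (\<lambda>y. y)"
  by (rule luc_cong[OF luc_h]) (auto intro: exI[of _ 1] simp: hid)
 have surj: "w \<in> Phi ` X" if w: "w \<in> D" for w
 proof -
  obtain e where e: "e > 0" "cball w e \<subseteq> D" using open_D w open_contains_cball by blast
  have "uniform_limit (cball w e) (\<lambda>n y. Phi (psi n y)) (\<lambda>y. y) sequentially"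
   by (rule luc_uniform[OF luc_id _ e(2)]) simp
  hence "\<forall>\<^sub>F n. \<forall>x\<in>cball w e. dist (Phi (psi n x)) x < e"
   unfolding uniform_limit_iff using e(1) by blast
  moreover have "\<forall>\<^sub>F n. cball w e \<subseteq> Dk n" by (rule Dk_compact[OF _ e(2)]) simp
  ultimately have "\<forall>\<^sub>F n. (\<forall>x\<in>cball w e. dist (Phi (psi n x)) x < e) \<and> cball w e \<subseteq> Dk n"
   by eventually_elim blast
  then obtain n where n: "\<And>x. x \<in> cball w e \<Longrightarrow> dist (Phi (psi n x)) x < e" "cball w e \<subseteq> Dk n"
   unfolding eventually_sequentially by blast
  obtain x where x: "x \<in> cball w e" "x + (Phi (psi n x) - x) = w"
  proof (rule perturbation_surj[of w e "\<lambda>x. Phi (psi n x) - x"])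
   show "continuous_on (cball w e) (\<lambda>x. Phi (psi n x) - x)"
    by (intro continuous_intros holo_continuous_on holo_subset[OF holo_Phi_psi n(2)])
   show "norm (Phi (psi n x) - x) \<le> e" if "x \<in> cball w e" for x
    using n(1)[OF that] by (simp add: dist_norm)
  qed (use e in auto)
  have "psi n x \<in> X" using psi_X n(2) x(1) by blast
  moreover have "Phi (psi n x) = w" using x(2) by simp
  ultimately show ?thesis by blast
 qed
 show im: "Phi ` X = D" using surj Phi_in by blast
 define \<theta> where "\<theta> = inv_into X Phi"
 have \<theta>: "\<theta> (Phi x) = x" if "x \<in> X" for x using inj that by (simp add: \<theta>_def)
 have eq: "{w \<in> D. \<theta> w \<in> Mi i} = (\<lambda>y. Phi (g i y)) ` Om" for i
 proof (intro equalityI subsetI)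
  fix w assume "w \<in> {w \<in> D. \<theta> w \<in> Mi i}"
  hence w: "w \<in> Phi ` X" "\<theta> w \<in> Mi i" using im by auto
  hence "w = Phi (g i (f i (\<theta> w)))" by (simp add: gf \<theta>_def f_inv_into_f)
  thus "w \<in> (\<lambda>y. Phi (g i y)) ` Om" using f_in[OF w(2)] by blast
 next
  fix w assume "w \<in> (\<lambda>y. Phi (g i y)) ` Om"
  then obtain y where y: "y \<in> Om" "w = Phi (g i y)" by blast
  hence "\<theta> w = g i y" using \<theta>[of "g i y"] gX[of i] by blast
  thus "w \<in> {w \<in> D. \<theta> w \<in> Mi i}" using y Phi_g_in g_in by simp
 qed
 have "inj (cder (\<lambda>y. Phi (g i y)) y)" if y: "y \<in> Om" for i y
 proof -
  have "cder (\<lambda>w. w) (Phi (g i y)) = cder h (Phi (g i y))"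
   by (rule cder_cong[OF open_D Phi_g_in[OF y] _ holo_ident]) (simp add: hid)
  moreover have "cder (\<lambda>w. w) (Phi (g i y)) = (\<lambda>v. v)" by (rule cder_eqI) simp
  ultimately have "cder (\<lambda>y. Phi (g i y)) y \<xi> \<noteq> 0" if "\<xi> \<noteq> 0" for \<xi> using cder_h_degenerate[OF y that] by metis
  thus ?thesis using linear_injective_0[OF linear_cder[OF holo_Phi_g y]] by blast
 qed
 moreover have "f i (\<theta> (Phi (g i y))) = y" if "y \<in> Om" for i y
  using \<theta>[of "g i y"] gX[of i] fg[OF that] that by auto
 ultimately have inv: "holo (\<lambda>w. f i (\<theta> w)) ((\<lambda>y. Phi (g i y)) ` Om)" for i
  by (rule holo_inverse_map(2)[OF open_Om holo_Phi_g inj_g])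
 have "\<theta> ` D \<subseteq> X" unfolding \<theta>_def im[symmetric] by (auto simp: inv_into_into)
 hence "holo_in \<theta> D" using oV inv by (simp add: holo_in_def eq)
 thus "holo_in (inv_into X Phi) D" by (simp add: \<theta>_def)
qed

end

section \<open>One-dimensional holomorphic retracts of convex domains\<close>

text \<open>The real coordinates of the derivative are the real parts of the derivatives of
  \<open>cfun b (F x)\<close>. Testing with functionals gives access to the removable singularity
  theorem for vector valued maps.\<close>

lemma holo_cfunI:
 fixes F :: "'a::complex_euclidean \<Rightarrow> 'b::complex_euclidean"
 assumes "\<And>w. holo (\<lambda>x. cfun w (F x)) S"
 shows "holo F S"
 unfolding holo_iff_clinear
proof
 fix z assume z: "z \<in> S"
 define D where "D = (\<lambda>v. \<Sum>b\<in>Basis. Re (cder (\<lambda>x. cfun b (F x)) z v) *\<^sub>R b)"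
 have Db: "D v \<bullet> b = Re (cder (\<lambda>x. cfun b (F x)) z v)" if "b \<in> Basis" for b v
  using that by (simp add: D_def inner_sum_left inner_Basis if_distrib sum.delta' cong: if_cong)
 have d: "(F has_derivative D) (at z)"
  unfolding has_derivative_componentwise_within[of F]
 proof
  fix b :: 'b assume b: "b \<in> Basis"
  have "((\<lambda>x. Re (cfun b (F x))) has_derivative (\<lambda>v. Re (cder (\<lambda>x. cfun b (F x)) z v))) (at z)"
   by (rule bounded_linear.has_derivative[OF bounded_linear_Re holoD(1)[OF assms z]])
  thus "((\<lambda>x. F x \<bullet> b) has_derivative (\<lambda>v. D v \<bullet> b)) (at z)"
   by (simp add: Db[OF b])
 qed
 have c: "cfun b (D v) = cder (\<lambda>x. cfun b (F x)) z v" for b v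
 proof -
  have "((\<lambda>x. cfun b (F x)) has_derivative (\<lambda>v. cfun b (D v))) (at z)"
   by (rule bounded_linear.has_derivative[OF clinearD(1)[OF clinear_cfun] d])
  from cder_eqI[OF this] show ?thesis by simp
 qed
 have "D (cs a v) = cs a (D v)" for a v
 proof (rule cfun_eqI)
  fix w
  show "cfun w (D (cs a v)) = cfun w (cs a (D v))"
   unfolding c clinearD(2)[OF holoD(2)[OF assms z]] clinearD(2)[OF clinear_cfun] by simp
 qed
 thus "\<exists>D. (F has_derivative D) (at z) \<and> clinear D"
  using d has_derivative_bounded_linear[OF d] by (auto simp: clinear_def)
qed

lemma compact_margin:
 fixes K :: "'a::euclidean_space set"
 assumes "compact K" "K \<subseteq> S" "open S"
 obtains s C where "s > 0" "compact C" "C \<subseteq> S" "\<And>x. x \<in> K \<Longrightarrow> cball x s \<subseteq> C"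
proof -
 obtain s where s: "s > 0" "(\<Union>x\<in>K. cball x s) \<subseteq> S"
  using compact_subset_open_imp_cball_epsilon_subset[OF assms(1,3,2)] by blast
 have eq: "(\<Union>x\<in>K. cball x s) = {x + y |x y. x \<in> K \<and> y \<in> cball 0 s}"
 proof
  show "(\<Union>x\<in>K. cball x s) \<subseteq> {x + y |x y. x \<in> K \<and> y \<in> cball 0 s}"
  proof
   fix z assume "z \<in> (\<Union>x\<in>K. cball x s)"
   then obtain x where "x \<in> K" "dist x z \<le> s" by auto
   hence "z = x + (z - x) \<and> x \<in> K \<and> z - x \<in> cball 0 s" by (simp add: dist_norm norm_minus_commute)
   thus "z \<in> {x + y |x y. x \<in> K \<and> y \<in> cball 0 s}" by blast
  qed
 qed (auto simp: dist_norm)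
 have "compact (\<Union>x\<in>K. cball x s)"
  unfolding eq by (rule compact_sums[OF assms(1) compact_cball])
 with s show ?thesis by (intro that[of s "\<Union>x\<in>K. cball x s"]) auto
qed

text \<open>Uniform closeness on a compact margin becomes closeness in the Lipschitz sense by Cauchy
  estimates. In this form a perturbation of an injective map can be shown to stay injective.\<close>

lemma luc_lipschitz:
 fixes f :: "nat \<Rightarrow> 'a::complex_euclidean \<Rightarrow> 'b::complex_euclidean"
 assumes "open S" "luc S f g" "holo g S" "compact K" "convex K" "K \<subseteq> S" "e > 0"
  and hol: "\<And>C. compact C \<Longrightarrow> C \<subseteq> S \<Longrightarrow> \<forall>\<^sub>F n. holo (f n) C"
 shows "\<forall>\<^sub>F n. \<forall>x\<in>K. \<forall>y\<in>K. norm ((f n x - g x) - (f n y - g y)) \<le> e * norm (x - y)"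
proof -
 obtain s C where sC: "s > 0" "compact C" "C \<subseteq> S" "\<And>x. x \<in> K \<Longrightarrow> cball x s \<subseteq> C"
  by (rule compact_margin[OF assms(4,6,1)]) blast
 have "\<forall>\<^sub>F n. \<forall>x\<in>C. dist (f n x) (g x) < e * s / 4"
  using luc_uniform[OF assms(2) sC(2,3)] assms(7) sC(1) unfolding uniform_limit_iff
  by (elim allE[of _ "e * s / 4"]) simp
 thus ?thesis using hol[OF sC(2,3)]
 proof eventually_elim
  case (elim n)
  show ?case
  proof (intro ballI)
   fix x y assume xy: "x \<in> K" "y \<in> K"
   have "norm ((f n x - g x) - (f n y - g y)) \<le> 4 * (e * s / 4) / s * norm (x - y)"
   proof (rule holo_lipschitz[OF assms(5) _ sC(1) _ _ xy])
    show "ball x s \<subseteq> C" if "x \<in> K" for x using sC(4)[OF that] ball_subset_cball[of x s] by blast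
    show "holo (\<lambda>x. f n x - g x) C" by (intro holo_diff elim(2) holo_subset[OF assms(3) sC(3)])
    show "norm (f n x - g x) \<le> e * s / 4" if "x \<in> C" for x
     using elim(1) that by (simp add: dist_norm less_imp_le)
   qed
   thus "norm ((f n x - g x) - (f n y - g y)) \<le> e * norm (x - y)" using sC(1) by simp
  qed
 qed
qed

text \<open>The derivative at \<open>x\<close> is bounded below by \<open>c\<close>; on a ball of
  radius \<open>d\<close> its variation and the Taylor remainder together cost at most half of
  this.\<close>

lemma local_injective:
 fixes f :: "'a::complex_euclidean \<Rightarrow> 'a"
 assumes "open S" "holo f S" "x \<in> S" "inj (cder f x)"
 obtains r where "r > 0" "ball x r \<subseteq> S" "inj_on f (ball x r)" "\<And>z. z \<in> ball x r \<Longrightarrow> inj (cder f z)"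
proof -
 obtain r C where rC: "r > 0" "ball x r \<subseteq> S" "C \<ge> 0"
  "\<And>y z v. y \<in> ball x r \<Longrightarrow> z \<in> ball x r \<Longrightarrow> norm (cder f y v - cder f z v) \<le> C * norm (y - z) * norm v"
  by (rule cder_lipschitz_local[OF assms(1-3)]) blast
 obtain r' C' where rC': "r' > 0" "ball x r' \<subseteq> S" "C' \<ge> 0"
  "\<And>y z. y \<in> ball x r' \<Longrightarrow> z \<in> ball x r' \<Longrightarrow> norm (f z - f y - cder f y (z - y)) \<le> C' * norm (z - y) ^ 2"
  by (rule holo_taylor_local[OF assms(1-3)]) blast
 obtain c where c: "c > 0" "\<And>v. c * norm v \<le> norm (cder f x v)"
  using linear_inj_bounded_below_pos[OF linear_cder[OF assms(2,3)] assms(4)] by blast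
 define K where "K = C + 2 * C' + 1"
 have K: "K > 0" "C \<le> K" "C + 2 * C' \<le> K" using rC rC' by (auto simp: K_def)
 define d where "d = min (min r r') (c / (2 * K))"
 have d: "d > 0" "d \<le> r" "d \<le> r'" "K * d \<le> c / 2"
 proof -
  have "K * d \<le> K * (c / (2 * K))" using K by (intro mult_left_mono) (auto simp: d_def)
  thus "K * d \<le> c / 2" using K by simp
 qed (use rC rC' c K in \<open>auto simp: d_def\<close>)
 have Cd: "C * d \<le> c / 2" using d(1,4) mult_right_mono[OF K(2), of d] by linarith
 have Cd': "(C + 2 * C') * d \<le> c / 2" using d(1,4) mult_right_mono[OF K(3), of d] by linarith
 have near: "norm (cder f z v - cder f x v) \<le> C * d * norm v" if "z \<in> ball x d" for z v
 proof -
  have "norm (cder f z v - cder f x v) \<le> C * norm (z - x) * norm v" using rC(4) that d rC(1) by auto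
  also have "\<dots> \<le> C * d * norm v"
   using that rC(3) by (intro mult_right_mono mult_left_mono) (auto simp: dist_norm norm_minus_commute)
  finally show ?thesis .
 qed
 show ?thesis
 proof (rule that[OF d(1)])
  show "ball x d \<subseteq> S" using rC(2) d by auto
  show "inj (cder f z)" if z: "z \<in> ball x d" for z
  proof -
   have zS: "z \<in> S" using z rC(2) d by auto
   have "v = 0" if v: "cder f z v = 0" for v
   proof -
    have "c * norm v \<le> C * d * norm v" using near[OF z, of v] c(2)[of v] v by simp
    also have "\<dots> \<le> (c / 2) * norm v"
     by (intro mult_right_mono Cd) simp
    finally show ?thesis using c(1) by simp
   qed
   thus ?thesis using linear_injective_0[OF linear_cder[OF assms(2) zS]] by blast
  qed
  show "inj_on f (ball x d)"
  proof (rule inj_onI)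
   fix y z assume yz: "y \<in> ball x d" "z \<in> ball x d" "f y = f z"
   have "norm (z - y) \<le> 2 * d"
    using yz norm_triangle_ineq4[of "z - x" "y - x"] by (simp add: dist_norm norm_minus_commute)
   have "norm (f z - f y - cder f y (z - y)) \<le> C' * norm (z - y) ^ 2" by (rule rC'(4)) (use yz d in auto)
   also have "\<dots> \<le> C' * (2 * d) * norm (z - y)"
   proof -
    have "C' * norm (z - y) \<le> C' * (2 * d)" using \<open>norm (z - y) \<le> 2 * d\<close> rC'(3) by (rule mult_left_mono)
    hence "C' * norm (z - y) * norm (z - y) \<le> C' * (2 * d) * norm (z - y)" by (rule mult_right_mono) simp
    thus ?thesis by (simp add: power2_eq_square mult.assoc)
   qed
   finally have 1: "norm (cder f y (z - y)) \<le> 2 * C' * d * norm (z - y)" using yz by (simp add: mult_ac)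
   have "c * norm (z - y) \<le> norm (cder f x (z - y))" by (rule c(2))
   also have "\<dots> \<le> norm (cder f y (z - y)) + norm (cder f y (z - y) - cder f x (z - y))"
    using norm_triangle_sub[of "cder f x (z - y)" "cder f y (z - y)"] by (simp add: norm_minus_commute)
   also have "\<dots> \<le> 2 * C' * d * norm (z - y) + C * d * norm (z - y)" using 1 near[OF yz(1)] by (intro add_mono)
   also have "\<dots> = ((C + 2 * C') * d) * norm (z - y)" by (simp add: algebra_simps)
   also have "\<dots> \<le> (c / 2) * norm (z - y)"
    by (intro mult_right_mono Cd') simp
   finally show "y = z" using c(1) by simp
  qed
 qed
qed

lemma disc_automorphism:
 assumes "a \<in> ball 0 1"
 obtains k k' where "k a = 0" "k holomorphic_on ball 0 1" "k' holomorphic_on ball 0 1"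
  "\<And>x. x \<in> ball 0 1 \<Longrightarrow> k x \<in> ball 0 1 \<and> k' (k x) = (x::complex)"
  "\<And>x. x \<in> ball 0 1 \<Longrightarrow> k' x \<in> ball 0 1 \<and> k (k' x) = x"
proof -
 have a: "cmod a < 1" using assms by simp
 show ?thesis
  by (rule that[of "Moebius_function 0 a" "Moebius_function 0 (- a)"])
    (use a in \<open>auto simp: Moebius_function_eq_zero Moebius_function_norm_lt_1
     intro: Moebius_function_compose Moebius_function_holomorphic\<close>)
qed

text \<open>The derivative has rank one at the fixed point \<open>p\<close>; the shape of the fixed
  point set away from \<open>p\<close> has to be deduced from convexity.\<close>

locale holo_retraction =
 fixes D :: "'v::complex_euclidean set" and h :: "'v \<Rightarrow> 'v" and p v :: 'v
 assumes open_D: "open D" and convex_D: "convex D" and bounded_D: "bounded D"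
  and holo_h: "holo h D" and h_in: "\<And>z. z \<in> D \<Longrightarrow> h z \<in> D" and h_h: "\<And>z. z \<in> D \<Longrightarrow> h (h z) = h z"
  and p_in: "p \<in> D" and h_p: "h p = p" and v_nonzero: "v \<noteq> 0" and cder_h_v: "cder h p v = v"
  and cder_h_range: "\<And>w. \<exists>c. cder h p w = cs c v"
begin

definition "Z = {z \<in> D. h z = z}"

definition "disc f \<longleftrightarrow> holo f (ball (0::complex) 1) \<and> f ` ball 0 1 \<subseteq> Z \<and> f 0 = p"

text \<open>The balls around \<open>p\<close> for the one-disc Kobayashi function (Lempert function)
  of the retract. The maps \<open>H t\<close> preserve each of them, because they send discs in
  \<open>Z\<close> through \<open>p\<close> to such discs.\<close>

definition "W r = {f ze |f ze. disc f \<and> cmod ze < r}"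

text \<open>A homothety of \<open>D\<close> towards \<open>p\<close> followed by \<open>h\<close>:
  as \<open>t\<close> decreases from one to zero it contracts \<open>Z\<close> to \<open>p\<close>
  inside \<open>Z\<close>.\<close>

definition "H t z = h (p + t *\<^sub>R (z - p))"

lemma h_Z: "z \<in> D \<Longrightarrow> h z \<in> Z" by (simp add: Z_def h_in h_h)

lemma Z_D: "Z \<subseteq> D" by (auto simp: Z_def)

lemma p_Z: "p \<in> Z" by (simp add: Z_def p_in h_p)

lemma seg_in: "z \<in> D \<Longrightarrow> 0 \<le> t \<Longrightarrow> t \<le> 1 \<Longrightarrow> p + t *\<^sub>R (z - p) \<in> D"
 using convexD_alt[OF convex_D p_in, of z t] by (simp add: algebra_simps)

lemma holo_seg: "holo (\<lambda>z. p + t *\<^sub>R (z - p)) S"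
proof -
 have "holo (\<lambda>z. p + cs (of_real t) (z - p)) S" by (intro holo_add holo_cs holo_diff) auto
 thus ?thesis by (simp add: cs_of_real)
qed

lemma holo_H: "0 \<le> t \<Longrightarrow> t \<le> 1 \<Longrightarrow> holo (H t) D"
 unfolding H_def by (rule holo_compose[OF holo_seg holo_h]) (use seg_in in blast)

lemma H_Z: "z \<in> D \<Longrightarrow> 0 \<le> t \<Longrightarrow> t \<le> 1 \<Longrightarrow> H t z \<in> Z"
 unfolding H_def by (intro h_Z seg_in)

lemma H_p: "H t p = p" by (simp add: H_def h_p)

lemma discD: "disc f \<Longrightarrow> holo f (ball 0 1)" "disc f \<Longrightarrow> cmod ze < 1 \<Longrightarrow> f ze \<in> Z"
  "disc f \<Longrightarrow> cmod ze < 1 \<Longrightarrow> f ze \<in> D" "disc f \<Longrightarrow> f 0 = p"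
 using Z_D by (auto simp: disc_def image_subset_iff subset_iff)

text \<open>Discs in the convex set \<open>D\<close> are easy to write down; \<open>h\<close> pushes
  them into the retract.\<close>

lemma disc_h:
 assumes "holo q (ball 0 1)" "\<And>t. cmod t < 1 \<Longrightarrow> q t \<in> D" "q 0 = p"
 shows "disc (\<lambda>t. h (q t))"
 unfolding disc_def using assms h_Z by (auto simp: h_p intro!: holo_compose[OF _ holo_h])

lemma disc_H: "disc f \<Longrightarrow> 0 \<le> t \<Longrightarrow> t \<le> 1 \<Longrightarrow> disc (\<lambda>ze. H t (f ze))"
 unfolding H_def
 by (rule disc_h[OF holo_compose[OF discD(1) holo_seg[of _ UNIV]]]) (auto simp: discD seg_in)

lemma W_I: "disc f \<Longrightarrow> cmod ze < r \<Longrightarrow> f ze \<in> W r" by (auto simp: W_def)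

lemma W_E: assumes "a \<in> W r" obtains f ze where "disc f" "cmod ze < r" "a = f ze"
 using assms by (auto simp: W_def)

lemma disc_const: "disc (\<lambda>_. p)" by (auto simp: disc_def p_Z)

lemma W_mono: "r \<le> s \<Longrightarrow> W r \<subseteq> W s"
 unfolding W_def by force

lemma H_W: "a \<in> W r \<Longrightarrow> 0 \<le> t \<Longrightarrow> t \<le> 1 \<Longrightarrow> H t a \<in> W r"
 by (erule W_E) (simp add: W_I[OF disc_H])

lemma W_Z: "r \<le> 1 \<Longrightarrow> W r \<subseteq> Z"
 by (auto simp: W_def discD(2))

section \<open>Shrunken copies of the domain and a Schwarz lemma\<close>

definition "shrink l = (\<lambda>z. p + l *\<^sub>R (z - p)) ` closure D"

text \<open>The factor is the one of \<open>half_plane_schwarz\<close>; what matters is that it is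
  below one for \<open>r < 1\<close>.\<close>

definition "K r = shrink ((3 + r\<^sup>2) / 4)"

lemma shrink_props:
 assumes "0 < l" "l < 1"
 shows "compact (shrink l)" "convex (shrink l)" "shrink l \<subseteq> D"
proof -
 have cc: "compact (closure D)" using bounded_D by (simp add: compact_eq_bounded_closed bounded_closure)
 show "compact (shrink l)" unfolding shrink_def by (intro compact_continuous_image cc continuous_intros)
 have "shrink l = (+) (p - l *\<^sub>R p) ` ((*\<^sub>R) l ` closure D)"
  by (auto simp: shrink_def image_image algebra_simps)
 thus "convex (shrink l)"
  by (simp add: convex_translation convex_scaling convex_closure[OF convex_D] del: image_add_atLeastAtMost)
 show "shrink l \<subseteq> D"
 proof
  fix y assume "y \<in> shrink l"
  then obtain z where z: "z \<in> closure D" "y = z - (1 - l) *\<^sub>R (z - p)" by (auto simp: shrink_def algebra_simps)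
  have "z - (1 - l) *\<^sub>R (z - p) \<in> interior D"
   by (rule mem_interior_closure_convex_shrink[OF convex_D _ z(1)]) (use assms in \<open>simp_all add: interior_open open_D p_in\<close>)
  thus "y \<in> D" using interior_subset z(2) by auto
 qed
qed

lemma K_props: assumes "0 < r" "r < 1" shows "compact (K r)" "convex (K r)" "K r \<subseteq> D"
proof -
 have "(3 + r\<^sup>2) / 4 > 0" "(3 + r\<^sup>2) / 4 < 1" using assms by (simp_all add: add_pos_nonneg power_less_one_iff)
 thus "compact (K r)" "convex (K r)" "K r \<subseteq> D" unfolding K_def by (rule shrink_props)+
qed

text \<open>Schwarz's lemma for \<open>u / (u + 2 * m)\<close>, which takes the half plane to the
  unit disc. Together with \<open>m \<le> cmod (u + 2 * m)\<close> it yields the factor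
  \<open>(3 + r\<^sup>2) / 4\<close>, which is not sharp but below one.\<close>

lemma half_plane_schwarz:
 fixes u :: "complex \<Rightarrow> complex"
 assumes "u holomorphic_on ball 0 1" "u 0 = 0" "m > 0" "\<And>t. cmod t < 1 \<Longrightarrow> Re (u t) > - m" "cmod ze < r" "r < 1"
 shows "Re (u ze) \<ge> - m * ((3 + r\<^sup>2) / 4)"
proof -
 define s where "s = (\<lambda>t. u t / (u t + 2 * of_real m))"
 have nz: "u t + 2 * of_real m \<noteq> 0" if "cmod t < 1" for t
  using assms(4)[OF that] assms(3) by (auto simp: complex_eq_iff)
 have id: "cmod (u t + 2 * of_real m) ^ 2 = cmod (u t) ^ 2 + 4 * m * (Re (u t) + m)" for t
  unfolding cmod_power2 by (simp add: power2_eq_square algebra_simps)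
 have sb: "cmod (s t) < 1" if "cmod t < 1" for t
 proof -
  have "m * (Re (u t) + m) > 0" using assms(3) assms(4)[OF that] by (intro mult_pos_pos) auto
  hence "cmod (u t) ^ 2 < cmod (u t + 2 * of_real m) ^ 2" unfolding id by simp
  hence "cmod (u t) < cmod (u t + 2 * of_real m)" by (rule power_less_imp_less_base) simp
  thus ?thesis using nz[OF that] by (simp add: s_def norm_divide)
 qed
 have z1: "cmod ze < 1" using assms by simp
 have "cmod (s ze) \<le> cmod ze"
 proof (rule Schwarz_Lemma(1)[of s])
  show "s holomorphic_on ball 0 1" unfolding s_def
   by (intro holomorphic_intros assms(1)) (use nz in auto)
 qed (use sb z1 assms(2) in \<open>auto simp: s_def\<close>)
 hence le: "cmod (u ze) \<le> r * cmod (u ze + 2 * of_real m)"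
  using nz[OF z1] assms(5) by (simp add: s_def norm_divide divide_le_eq) (meson less_imp_le mult_right_mono norm_ge_zero order_trans)
 have "cmod (u ze) ^ 2 \<le> r\<^sup>2 * cmod (u ze + 2 * of_real m) ^ 2"
  using power_mono[OF le norm_ge_zero, of 2] by (simp add: power_mult_distrib)
 hence 1: "(1 - r\<^sup>2) * cmod (u ze + 2 * of_real m) ^ 2 \<le> 4 * m * (Re (u ze) + m)"
  using id[of ze] by (simp add: algebra_simps)
 have "m \<le> Re (u ze + 2 * of_real m)" using assms(4)[OF z1] by simp
 hence "m \<le> cmod (u ze + 2 * of_real m)" using complex_Re_le_cmod order_trans by blast
 hence "m\<^sup>2 \<le> cmod (u ze + 2 * of_real m) ^ 2" using assms(3) by (intro power_mono) auto
 moreover have "0 \<le> r" using norm_ge_zero[of ze] assms(5) by linarith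
 hence "0 \<le> 1 - r\<^sup>2" using assms(6) by (simp add: power_le_one)
 ultimately have "m * ((1 - r\<^sup>2) * m) \<le> m * (4 * (Re (u ze) + m))"
  using 1 mult_left_mono[of "m\<^sup>2" "cmod (u ze + 2 * of_real m) ^ 2" "1 - r\<^sup>2"] by (simp add: power2_eq_square algebra_simps)
 hence "(1 - r\<^sup>2) * m \<le> 4 * (Re (u ze) + m)" using assms(3) by (simp only: mult_le_cancel_left_pos)
 thus ?thesis by (simp add: algebra_simps)
qed

text \<open>Separate the point from \<open>K r\<close>. When the homothety is undone, the hyperplane
  becomes one that bounds all of \<open>D\<close>, and the half plane version of Schwarz's lemma
  contradicts the separation.\<close>

lemma disc_K:
 assumes f: "disc f" and ze: "cmod ze < r" and r: "r < 1"
 shows "f ze \<in> K r"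
proof (rule ccontr)
 assume nK: "f ze \<notin> K r"
 have r0: "0 < r" using ze norm_ge_zero[of ze] by linarith
 define l where "l = (3 + r\<^sup>2) / 4"
 have l: "l > 0" by (simp add: l_def add_pos_nonneg)
 obtain a b where ab: "a \<bullet> f ze < b" "\<And>x. x \<in> K r \<Longrightarrow> a \<bullet> x > b"
  using separating_hyperplane_closed_point[OF K_props(2)[OF r0 r] compact_imp_closed[OF K_props(1)[OF r0 r]] nK] by blast
 have x: "a \<bullet> (x - p) > - ((a \<bullet> p - b) / l)" if "x \<in> D" for x
 proof -
  have "p + l *\<^sub>R (x - p) \<in> K r" using that closure_subset by (force simp: K_def shrink_def l_def)
  hence "a \<bullet> p + l * (a \<bullet> (x - p)) > b" using ab(2) by (force simp: inner_add_right)
  hence "l * (a \<bullet> (x - p)) > - (a \<bullet> p - b)" by simp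
  thus ?thesis using l by (simp add: minus_divide_left pos_divide_less_eq mult.commute)
 qed
 have m: "(a \<bullet> p - b) / l > 0" using x[OF p_in] by simp
 have "Re (cfun a (f ze - p)) \<ge> - ((a \<bullet> p - b) / l) * ((3 + r\<^sup>2) / 4)"
 proof (rule half_plane_schwarz[OF _ _ m _ ze r])
  have "holo (\<lambda>t. cfun a (f t - p)) (ball 0 1)" by (intro holo_cfun holo_diff discD(1)[OF f] holo_const)
  thus "(\<lambda>t. cfun a (f t - p)) holomorphic_on ball 0 1" by (simp add: holo_iff_holomorphic_on)
  show "cfun a (f 0 - p) = 0" using discD(4)[OF f] by (simp add: cfun_def complex_eq_iff)
  show "- ((a \<bullet> p - b) / l) < Re (cfun a (f t - p))" if "cmod t < 1" for t
   using x[OF discD(3)[OF f that]] by (simp add: inner_commute)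
 qed
 hence "a \<bullet> (f ze - p) \<ge> - (a \<bullet> p - b)" using l by (simp add: l_def[symmetric] inner_commute)
 thus False using ab(1) by (simp add: inner_diff_right)
qed

lemma W_K: "r < 1 \<Longrightarrow> W r \<subseteq> K r"
 by (auto simp: W_def disc_K)

text \<open>A disc through \<open>a\<close> is bent so as to pass through a nearby \<open>z\<close>:
  reparametrizing by \<open>l < 1\<close> leaves a margin \<open>s\<close> to the boundary of
  \<open>D\<close>, which is spent on adding a multiple of \<open>z - a\<close> that vanishes at the
  origin.\<close>

lemma W_open:
 assumes a: "a \<in> W r" and r: "0 < r" "r < 1"
 obtains e where "e > 0" "ball a e \<subseteq> D" "\<And>z. z \<in> ball a e \<Longrightarrow> h z \<in> W r"
proof -
 \<comment> \<open>The correction term divides by \<open>ze\<close>; for \<open>a = p\<close> the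
   constant disc offers a nonzero parameter.\<close>
 obtain f ze where f: "disc f" "cmod ze < r" "a = f ze" "ze \<noteq> 0"
 proof -
  obtain f ze where f: "disc f" "cmod ze < r" "a = f ze" using a by (rule W_E)
  show ?thesis
  proof (cases "ze = 0")
   case True
   hence "a = p" using f discD(4) by simp
   thus ?thesis by (intro that[OF disc_const, of "of_real (r/2)"]) (use r in auto)
  qed (rule that[OF f])
 qed
 \<comment> \<open>Between \<open>cmod ze / r\<close> and one, so that the parameter
   \<open>ze / l\<close> at which the new disc reaches \<open>h z\<close> still has modulus below
   \<open>r\<close>.\<close>
 define l where "l = (cmod ze / r + 1) / 2"
 have zr: "cmod ze / r < 1" using f r by simp
 have l: "0 < l" "l < 1" using zr r by (auto simp: l_def add_nonneg_pos)
 have l3: "cmod ze / r < l" using less_half_sum[OF zr] by (simp only: l_def one_add_one)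
 obtain s C where sC: "s > 0" "C \<subseteq> D" "\<And>x. x \<in> K l \<Longrightarrow> cball x s \<subseteq> C"
  by (rule compact_margin[OF K_props(1,3)[OF l(1,2)] open_D]) blast
 define e where "e = s * cmod ze"
 have lr: "cmod ze < l * r" using l3 r by (simp add: pos_divide_less_eq)
 also have "\<dots> \<le> l * 1" using l r by (intro mult_left_mono) auto
 finally have z1: "cmod ze < l" by simp
 have aK: "a \<in> K l" unfolding f(3) by (rule disc_K[OF f(1) z1 l(2)])
 have "cmod ze < 1" using z1 l by simp
 hence es: "e \<le> s" "e > 0" using sC(1) f(4) by (auto simp: e_def)
 show ?thesis
 proof (rule that[OF es(2)])
  show "ball a e \<subseteq> D" using sC(2) sC(3)[OF aK] es by (force simp: subset_iff)
  fix z assume z: "z \<in> ball a e"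
  define F where "F = (\<lambda>t. h (f (of_real l * t) + cs (of_real l * t / ze) (z - a)))"
  have inD: "f (of_real l * t) + cs (of_real l * t / ze) (z - a) \<in> D" if t: "cmod t < 1" for t
  proof -
   have lt: "cmod (of_real l * t) < l" using t l by (simp add: norm_mult)
   have "norm (cs (of_real l * t / ze) (z - a)) = cmod (of_real l * t) / cmod ze * norm (z - a)"
    by (simp add: norm_cs norm_divide norm_mult)
   also have "\<dots> \<le> 1 / cmod ze * e"
    using lt l z by (intro mult_mono divide_right_mono) (auto simp: dist_norm norm_minus_commute)
   also have "\<dots> = s" using f(4) by (simp add: e_def)
   finally have "f (of_real l * t) + cs (of_real l * t / ze) (z - a) \<in> cball (f (of_real l * t)) s"
    by (simp add: dist_norm)
   thus ?thesis using sC(2) sC(3)[OF disc_K[OF f(1) lt l(2)]] by blast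
  qed
  have "disc F"
   unfolding F_def
  proof (rule disc_h[OF _ inD])
   have "holo (\<lambda>t. f (of_real l * t)) (ball 0 1)"
   proof (rule holo_compose[OF _ discD(1)[OF f(1)]])
    show "holo (\<lambda>t. complex_of_real l * t) (ball 0 1)" by (intro holo_mult) auto
    show "(\<lambda>t. complex_of_real l * t) ` ball 0 1 \<subseteq> ball 0 1"
    proof
     fix x assume "x \<in> (\<lambda>t. complex_of_real l * t) ` ball 0 1"
     then obtain t where "cmod t < 1" "x = of_real l * t" by auto
     thus "x \<in> ball 0 1" using l mult_strict_mono[of l 1 "cmod t" 1] by (simp add: norm_mult)
    qed
   qed
   thus "holo (\<lambda>t. f (of_real l * t) + cs (of_real l * t / ze) (z - a)) (ball 0 1)"
    by (intro holo_add holo_cs holo_divide holo_mult) (use f(4) in auto)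
   show "f (of_real l * 0) + cs (of_real l * 0 / ze) (z - a) = p" using discD(4)[OF f(1)] by simp
  qed
  moreover have "cmod (ze / of_real l) < r"
   using l lr by (simp add: norm_divide pos_divide_less_eq mult.commute)
  ultimately have "F (ze / of_real l) \<in> W r" by (rule W_I)
  moreover have "F (ze / of_real l) = h z" using l f(4) f(3) by (simp add: F_def)
  ultimately show "h z \<in> W r" by simp
 qed
qed

text \<open>The complex line through \<open>p\<close> and \<open>z\<close> meets \<open>D\<close> in
  a convex set whose parameter domain is not the whole plane, as \<open>D\<close> is bounded. Its
  Riemann map, normalized by an automorphism, gives a disc through both points, and \<open>h\<close>
  moves it into \<open>Z\<close> while fixing \<open>p\<close> and \<open>z\<close>.\<close>

lemma W_exhaust:
 assumes z: "z \<in> Z" obtains r where "0 < r" "r < 1" "z \<in> W r"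
proof (cases "z = p")
 case True
 thus ?thesis using that[of "1/2"] W_I[OF disc_const, of 0 "1/2"] by simp
next
 case False
 define T where "T = {t::complex. p + cs t (z - p) \<in> D}"
 have oT: "open T" "convex T" unfolding T_def by (intro open_slice convex_slice open_D convex_D)+
 have mem: "0 \<in> T" "1 \<in> T" using z Z_D p_in by (auto simp: T_def)
 obtain B where B: "\<And>x. x \<in> D \<Longrightarrow> norm x \<le> B" using bounded_D bounded_iff by blast
 have "T \<noteq> UNIV"
 proof
  assume "T = UNIV"
  define t where "t = complex_of_real ((B + norm p + 1) / norm (z - p))"
  have "t \<in> T" using \<open>T = UNIV\<close> by simp
  hence "norm (p + cs t (z - p)) \<le> B" using B by (simp add: T_def)
  moreover have "norm (cs t (z - p)) \<le> norm (p + cs t (z - p)) + norm p"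
   using norm_triangle_ineq4[of "p + cs t (z - p)" p] by simp
  moreover have "norm (cs t (z - p)) = \<bar>B + norm p + 1\<bar>"
   using False unfolding t_def norm_cs norm_of_real by simp
  ultimately show False by linarith
 qed
 then obtain m m' where m: "m holomorphic_on T" "m' holomorphic_on ball 0 1"
  "\<And>x. x \<in> T \<Longrightarrow> m x \<in> ball 0 1 \<and> m' (m x) = x" "\<And>x. x \<in> ball 0 1 \<Longrightarrow> m' x \<in> T \<and> m (m' x) = x"
  using Riemann_mapping_theorem[of T] oT mem convex_imp_simply_connected[OF oT(2)] by (metis empty_iff)
 obtain k k' where k: "k (m 0) = 0" "k holomorphic_on ball 0 1" "k' holomorphic_on ball 0 1"
  "\<And>x. x \<in> ball 0 1 \<Longrightarrow> k x \<in> ball 0 1 \<and> k' (k x) = x" "\<And>x. x \<in> ball 0 1 \<Longrightarrow> k' x \<in> ball 0 1 \<and> k (k' x) = x"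
  using disc_automorphism m(3)[OF mem(1)] by blast
 define F where "F = (\<lambda>t. h (p + cs (m' (k' t)) (z - p)))"
 have "disc F"
  unfolding F_def
 proof (rule disc_h)
  have "k' ` ball 0 1 \<subseteq> ball 0 1" using k(5) by blast
  hence "(\<lambda>t. m' (k' t)) holomorphic_on ball 0 1"
   using holomorphic_on_compose_gen[OF k(3) m(2)] by (simp add: o_def)
  thus "holo (\<lambda>t. p + cs (m' (k' t)) (z - p)) (ball 0 1)"
   by (intro holo_add holo_cs) (simp_all add: holo_iff_holomorphic_on)
  show "p + cs (m' (k' t)) (z - p) \<in> D" if "cmod t < 1" for t using m(4) k(5) that by (auto simp: T_def)
  have "k' 0 = m 0" using k(1) k(4)[of "m 0"] m(3)[OF mem(1)] by simp
  thus "p + cs (m' (k' 0)) (z - p) = p" using m(3)[OF mem(1)] by simp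
 qed
 moreover have "F (k (m 1)) = z"
  using k(4)[of "m 1"] m(3)[OF mem(2)] z by (simp add: F_def Z_def)
 moreover have "k (m 1) \<in> ball 0 1" using k(4)[of "m 1"] m(3)[OF mem(2)] by simp
 moreover have "0 < (1 + cmod (k (m 1))) / 2" by (simp add: add_pos_nonneg)
 ultimately show ?thesis using W_I[of F "k (m 1)" "(1 + cmod (k (m 1))) / 2"]
  by (intro that[of "(1 + cmod (k (m 1))) / 2"]) auto
qed

lemma closure_W:
 assumes r: "0 < r" "r < 1"
 shows "compact (closure (W r))" "closure (W r) \<subseteq> K r" "closure (W r) \<subseteq> Z"
proof -
 show s: "closure (W r) \<subseteq> K r"
  by (intro closure_minimal W_K r compact_imp_closed K_props)
 show "compact (closure (W r))"
  by (rule compact_closure[THEN iffD2])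
    (use bounded_subset[OF compact_imp_bounded[OF K_props(1)[OF r]] W_K[OF r(2)]] in simp)
 show "closure (W r) \<subseteq> Z"
 proof
  fix z assume z: "z \<in> closure (W r)"
  then obtain x where x: "\<And>n. x n \<in> W r" "x \<longlonglongrightarrow> z" using closure_sequential by blast
  have zD: "z \<in> D" using z s K_props(3)[OF r] by blast
  have xZ: "x n \<in> Z" for n using x(1) W_Z r by (meson less_imp_le subset_iff)
  have "(\<lambda>n. h (x n)) \<longlonglongrightarrow> h z"
   by (rule continuous_on_tendsto_compose[OF holo_continuous_on[OF holo_h] x(2) zD])
     (rule always_eventually, rule allI, rule subsetD[OF Z_D xZ])
  moreover have "(\<lambda>n. h (x n)) = x" using xZ by (auto simp: Z_def)
  ultimately have "x \<longlonglongrightarrow> h z" by simp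
  with x(2) have "h z = z" by (rule LIMSEQ_unique[rotated])
  thus "z \<in> Z" using zD by (simp add: Z_def)
 qed
qed

text \<open>For \<open>t\<close> close to \<open>1\<close> the map \<open>H t - h\<close> is a contraction on the convex compact set \<open>K r\<close>, and
 \<open>h\<close> is the identity on \<open>closure (W r)\<close>. So the iterates of \<open>H t\<close> stay injective there, while
 they push it into a small neighbourhood of \<open>p\<close>, where \<open>Z\<close> is a graph over its tangent line.\<close>

lemma injective_H:
 assumes r: "0 < r" "r < 1"
 obtains t where "0 < t" "t < 1" "inj_on (H t) (closure (W r))"
proof -
 define s where "s = (\<lambda>n. real n / real (Suc n))"
 have s: "0 \<le> s n" "s n \<le> 1" "s n < 1" for n by (auto simp: s_def)
 have s1: "s \<longlonglongrightarrow> 1" unfolding s_def by (rule LIMSEQ_n_over_Suc_n)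
 obtain B where B: "\<And>x. x \<in> D \<Longrightarrow> norm (x - p) \<le> B"
  using bounded_D unfolding bounded_def dist_norm by (metis norm_minus_commute bounded_D bounded_any_center dist_norm)
 have "luc D (\<lambda>n z. p + s n *\<^sub>R (z - p)) (\<lambda>z. z)"
  unfolding luc_def
 proof (intro ballI allI impI)
  fix z and e :: real assume e: "e > 0"
  have "(\<lambda>n. \<bar>s n - 1\<bar> * B) \<longlonglongrightarrow> \<bar>1 - 1\<bar> * B" by (intro tendsto_intros s1)
  hence "\<forall>\<^sub>F n. \<bar>s n - 1\<bar> * B < e" using e by (intro order_tendstoD) auto
  hence "\<forall>\<^sub>F n. \<forall>x\<in>ball z 1 \<inter> D. dist (p + s n *\<^sub>R (x - p)) x < e"
  proof eventually_elim
   case (elim n)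
   show ?case
   proof
    fix x assume "x \<in> ball z 1 \<inter> D"
    hence "\<bar>s n - 1\<bar> * norm (x - p) \<le> \<bar>s n - 1\<bar> * B" using B by (intro mult_left_mono) auto
    moreover have "p + s n *\<^sub>R (x - p) - x = (s n - 1) *\<^sub>R (x - p)" by (simp add: algebra_simps)
    ultimately show "dist (p + s n *\<^sub>R (x - p)) x < e" using elim by (simp add: dist_norm)
   qed
  qed
  thus "\<exists>d>0. \<forall>\<^sub>F n. \<forall>x\<in>ball z d \<inter> D. dist (p + s n *\<^sub>R (x - p)) x < e"
   by (intro exI[of _ 1]) simp
 qed
 hence "luc D (\<lambda>n z. h (p + s n *\<^sub>R (z - p))) (\<lambda>z. h z)"
  by (rule luc_compose[OF _ luc_const open_D]) (auto intro: holo_continuous_on holo_h)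
 hence l: "luc D (\<lambda>n. H (s n)) h" by (simp add: H_def[abs_def])
 have "\<forall>\<^sub>F n. \<forall>x\<in>K r. \<forall>y\<in>K r. norm ((H (s n) x - h x) - (H (s n) y - h y)) \<le> 1/2 * norm (x - y)"
  by (rule luc_lipschitz[OF open_D l holo_h K_props[OF r]])
    (auto intro!: always_eventually holo_subset[OF holo_H] s)
 moreover have "\<forall>\<^sub>F n. (0::nat) < n" by (rule eventually_gt_at_top)
 ultimately have "\<forall>\<^sub>F n. (\<forall>x\<in>K r. \<forall>y\<in>K r. norm ((H (s n) x - h x) - (H (s n) y - h y)) \<le> 1/2 * norm (x - y)) \<and> 0 < n"
  by eventually_elim simp
 then obtain n where n: "\<And>x y. x \<in> K r \<Longrightarrow> y \<in> K r \<Longrightarrow> norm ((H (s n) x - h x) - (H (s n) y - h y)) \<le> 1/2 * norm (x - y)" "0 < n"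
  unfolding eventually_sequentially by blast
 have "inj_on (H (s n)) (closure (W r))"
 proof (rule inj_onI)
  fix x y assume xy: "x \<in> closure (W r)" "y \<in> closure (W r)" "H (s n) x = H (s n) y"
  hence "h x = x" "h y = y" using closure_W(3)[OF r] by (auto simp: Z_def)
  moreover have "x \<in> K r" "y \<in> K r" using xy closure_W(2)[OF r] by auto
  ultimately have "norm (x - y) \<le> 1/2 * norm (x - y)" using n(1)[of x y] xy(3) by (simp add: norm_minus_commute)
  thus "x = y" by simp
 qed
 moreover have "0 < s n" using n(2) by (simp add: s_def)
 ultimately show ?thesis using that s(3) by blast
qed

text \<open>\<open>A\<close> projects onto the line of \<open>v\<close>, which contains the range of
  \<open>cder h p\<close>; so the derivative of \<open>z - h z + A (h z)\<close> at \<open>p\<close>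
  is the identity. On \<open>Z\<close> this map reduces to \<open>A\<close>, that is to the
  coordinate \<open>cfun v\<close>.\<close>

lemma local_chart:
 obtains \<eta> where "\<eta> > 0" "inj_on (cfun v) (Z \<inter> ball p \<eta>)"
proof -
 let ?d = "cfun v v" and ?L = "cder h p"
 define A where "A x = cs (cfun v x / ?d) v" for x
 have "Re ?d \<noteq> 0" using v_nonzero by simp
 hence d: "?d \<noteq> 0" by force
 have A: "clinear A"
  unfolding clinear_def A_def
  by (intro conjI allI bounded_linear_compose[OF cs.bounded_linear_left]
    bounded_linear_compose[OF bounded_linear_divide] clinearD(1)[OF clinear_cfun])
    (simp add: clinearD(2)[OF clinear_cfun] cs_cs cs_complex_def)
 define G where "G z = z - h z + A (h z)" for z
 have G: "holo G D" unfolding G_def[abs_def]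
  by (intro holo_add holo_diff holo_ident holo_h holo_compose[OF holo_h clinear_holo[OF A, of UNIV]]) simp
 have "(G has_derivative (\<lambda>w. w - ?L w + A (?L w))) (at p)"
  unfolding G_def[abs_def] by (intro has_derivative_add has_derivative_diff has_derivative_ident
    bounded_linear.has_derivative[OF clinearD(1)[OF A]] holoD(1)[OF holo_h p_in])
 moreover have "w - ?L w + A (?L w) = w" for w
 proof -
  obtain c where "?L w = cs c v" using cder_h_range by blast
  thus ?thesis using d by (simp add: A_def clinearD(2)[OF clinear_cfun] cs_complex_def)
 qed
 ultimately have "(G has_derivative (\<lambda>w. w)) (at p)" by simp
 hence "inj (cder G p)" using cder_eqI[of G "\<lambda>w. w" p] by simp
 from local_injective[OF open_D G p_in this] obtain \<eta> where \<eta>: "\<eta> > 0" "inj_on G (ball p \<eta>)" by metis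
 have "inj_on (cfun v) (Z \<inter> ball p \<eta>)"
 proof (rule inj_onI)
  fix x y assume xy: "x \<in> Z \<inter> ball p \<eta>" "y \<in> Z \<inter> ball p \<eta>" "cfun v x = cfun v y"
  hence "G x = G y" by (simp add: G_def A_def Z_def)
  thus "x = y" using inj_onD[OF \<eta>(2)] xy by blast
 qed
 with \<eta>(1) show ?thesis by (rule that)
qed

lemma holo_H_iter:
 assumes "0 \<le> t" "t \<le> 1" shows "holo (H t ^^ m) D \<and> (H t ^^ m) ` D \<subseteq> D"
proof (induction m)
 case (Suc m)
 have "holo (\<lambda>z. H t ((H t ^^ m) z)) D" by (rule holo_compose[OF _ holo_H[OF assms]]) (use Suc in auto)
 thus ?case using Suc H_Z Z_D assms by (auto simp: subset_iff)
qed auto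

text \<open>The Earle-Hamilton argument: the homothety leaves a margin \<open>m\<close> to the
  boundary of \<open>D\<close>, and this room is spent on bending a disc so that it reaches its
  target at a parameter smaller by the factor \<open>k\<close>.\<close>

lemma H_contracts:
 assumes t: "0 < t" "t < 1" and r: "0 < r" "r < 1" and \<eta>: "\<eta> > 0"
 obtains n where "\<And>z. z \<in> closure (W r) \<Longrightarrow> (H t ^^ n) z \<in> ball p \<eta>"
proof -
 obtain B where B: "B > 0" "\<And>x. x \<in> D \<Longrightarrow> norm x \<le> B" using bounded_D bounded_pos by metis
 define L where "L = 4 * B / (1 - r)"
 have L: "L > 0" using B r by (simp add: L_def)
 have lip: "norm (f x - f y) \<le> L * norm (x - y)" if f: "disc f" and xy: "cmod x < r" "cmod y < r" for f x y
  unfolding L_def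
 proof (rule holo_lipschitz[OF convex_ball[of 0 r] _ _ discD(1)[OF f]])
  show "ball x (1 - r) \<subseteq> ball 0 1" if "x \<in> ball 0 r" for x :: complex
  proof
   fix y assume "y \<in> ball x (1 - r)"
   thus "y \<in> ball 0 1" using that norm_triangle_sub[of y x] by (simp add: dist_norm norm_minus_commute)
  qed
 qed (use r xy B(2) discD(3)[OF f] in auto)
 obtain m C where m: "m > 0" "C \<subseteq> D" "\<And>x. x \<in> shrink t \<Longrightarrow> cball x m \<subseteq> C"
  by (rule compact_margin[OF shrink_props(1,3)[OF t] open_D]) blast
 have tK: "p + t *\<^sub>R (z - p) \<in> shrink t" if "z \<in> D" for z using that closure_subset by (force simp: shrink_def)
 \<comment> \<open>The solution of \<open>L * (1 - k) = m * k\<close>: the distance from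
   \<open>f ze\<close> to \<open>f b\<close>, where \<open>b = k * ze\<close>, is then at most
   \<open>m * cmod b\<close>.\<close>
 define k where "k = L / (L + m)"
 have k: "0 < k" "k < 1" "L * (1 - k) = m * k" using L m(1) by (simp_all add: k_def field_simps)
 have step: "H t a \<in> W (k * s)" if a: "a \<in> W s" and s: "0 < s" "s \<le> r" for a s
 proof -
  obtain f ze where f: "disc f" "cmod ze < s" "a = f ze" using a by (rule W_E)
  show ?thesis
  proof (cases "ze = 0")
   case True
   thus ?thesis using W_I[OF disc_const, of 0 "k * s"] f s k by (simp add: discD H_p)
  next
   case False
   define b where "b = of_real k * ze"
   \<comment> \<open>The linear correction \<open>cs \<tau> w\<close> vanishes at zero and gives the
     new disc, at \<open>b\<close>, the value \<open>H t (f ze)\<close>.\<close>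
   define w where "w = cs (1 / b) (t *\<^sub>R (f ze - f b))"
   have b: "b \<noteq> 0" "cmod b < k * s" "cmod b < r"
    using False k s f(2) mult_strict_mono[of k 1 "cmod ze" r] by (auto simp: b_def norm_mult)
   have "ze - b = of_real (1 - k) * ze" by (simp add: b_def algebra_simps)
   hence "norm (f ze - f b) \<le> L * ((1 - k) * cmod ze)"
    using lip[OF f(1), of ze b] f(2) s b(3) k by (simp add: norm_mult del: of_real_diff)
   also have "\<dots> = m * cmod b" using k(1,3) by (simp add: b_def norm_mult mult.assoc[symmetric])
   finally have "t * norm (f ze - f b) \<le> 1 * (m * cmod b)" using t by (intro mult_mono) auto
   hence w: "norm w \<le> m" using b(1) t(1) by (simp add: w_def norm_cs norm_divide divide_le_eq)
   have "disc (\<lambda>\<tau>. h (p + t *\<^sub>R (f \<tau> - p) + cs \<tau> w))"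
   proof (rule disc_h)
    show "holo (\<lambda>\<tau>. p + t *\<^sub>R (f \<tau> - p) + cs \<tau> w) (ball 0 1)"
     by (intro holo_add[OF holo_compose[OF discD(1)[OF f(1)] holo_seg[of _ UNIV]]] holo_cs) auto
    fix \<tau> assume \<tau>: "cmod \<tau> < 1"
    have "cmod \<tau> * norm w \<le> 1 * m" using \<tau> w by (intro mult_mono) auto
    thus "p + t *\<^sub>R (f \<tau> - p) + cs \<tau> w \<in> D"
     using m(2) m(3)[OF tK[OF discD(3)[OF f(1) \<tau>]]] by (force simp: dist_norm norm_cs)
   qed (simp add: discD(4)[OF f(1)])
   from W_I[OF this b(2)] show ?thesis
    using b(1) by (simp add: H_def f(3) w_def cs_cs algebra_simps)
  qed
 qed
 have iter: "(H t ^^ n) z \<in> W (k ^ n * r)" if "z \<in> W r" for n z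
 proof (induction n)
  case (Suc n)
  have "k ^ n * r \<le> r" using k r by (simp add: mult_left_le_one_le power_le_one)
  thus ?case using step[OF Suc] k r by (simp add: mult.assoc)
 qed (use that in simp)
 have "\<eta> / (2 * L) > 0" using \<eta> L by simp
 then obtain n where n: "k ^ n < \<eta> / (2 * L)" using real_arch_pow_inv k(2) by blast
 have "(H t ^^ n) ` W r \<subseteq> cball p (\<eta> / 2)"
 proof
  fix y assume "y \<in> (H t ^^ n) ` W r"
  hence "y \<in> W (k ^ n * r)" using iter by blast
  then obtain f ze where f: "disc f" "cmod ze < k ^ n * r" "y = f ze" by (rule W_E)
  have kr: "k ^ n * r \<le> r" "k ^ n * r \<le> k ^ n"
   using k r by (simp_all add: mult_left_le_one_le power_le_one mult_left_le)
  have "norm (y - p) \<le> L * cmod ze" using lip[OF f(1), of ze 0] f kr r by (simp add: discD(4))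
  also have "\<dots> \<le> L * (\<eta> / (2 * L))" using f(2) kr n L by (intro mult_left_mono) auto
  finally show "y \<in> cball p (\<eta> / 2)" using L by (simp add: dist_norm norm_minus_commute)
 qed
 moreover have "continuous_on (closure (W r)) (H t ^^ n)"
  by (rule continuous_on_subset[OF holo_continuous_on[OF conjunct1[OF holo_H_iter]]])
    (use t closure_W(3)[OF r] Z_D in auto)
 ultimately have "(H t ^^ n) ` closure (W r) \<subseteq> cball p (\<eta> / 2)" by (intro image_closure_subset) auto
 hence "(H t ^^ n) z \<in> ball p \<eta>" if "z \<in> closure (W r)" for z using that \<eta> by (auto simp: image_subset_iff)
 thus ?thesis by (rule that)
qed

text \<open>Iterates of \<open>H t\<close> are injective on the closed ball and finally land where
  \<open>cfun v\<close> is injective, so the local coordinate at \<open>p\<close> pulls back to all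
  of \<open>closure (W r)\<close>.\<close>

lemma planar_chart:
 assumes r: "0 < r" "r < 1"
 obtains \<sigma> where "holo \<sigma> D" "inj_on (\<sigma> :: 'v \<Rightarrow> complex) (closure (W r))"
proof -
 obtain t where t: "0 < t" "t < 1" "inj_on (H t) (closure (W r))" by (rule injective_H[OF r])
 obtain \<eta> where \<eta>: "\<eta> > 0" "inj_on (cfun v) (Z \<inter> ball p \<eta>)" by (rule local_chart)
 obtain n where n: "\<And>z. z \<in> closure (W r) \<Longrightarrow> (H t ^^ n) z \<in> ball p \<eta>"
  by (rule H_contracts[OF t(1,2) r \<eta>(1)]) blast
 have H: "holo (H t) D" by (rule holo_H) (use t in auto)
 have HE: "H t ` closure (W r) \<subseteq> closure (W r)"
 proof -
  have "continuous_on (closure (W r)) (H t)"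
   by (rule continuous_on_subset[OF holo_continuous_on[OF H]]) (use closure_W(3)[OF r] Z_D in blast)
  moreover have "H t ` W r \<subseteq> W r" using H_W t by auto
  ultimately show ?thesis by (meson closed_closure closure_subset image_closure_subset order_trans)
 qed
 have it: "(H t ^^ m) ` closure (W r) \<subseteq> closure (W r) \<and> inj_on (H t ^^ m) (closure (W r))" for m
 proof (induction m)
  case (Suc m)
  have "inj_on (H t \<circ> (H t ^^ m)) (closure (W r))"
   using Suc t(3) by (intro comp_inj_on) (auto intro: inj_on_subset)
  thus ?case using Suc HE by (auto simp: image_comp[symmetric] o_def)
 qed auto
 show ?thesis
 proof
  show "holo (\<lambda>z. cfun v ((H t ^^ n) z)) D" using holo_H_iter[of t] t by (intro holo_cfun) simp
  have "inj_on (cfun v \<circ> (H t ^^ n)) (closure (W r))"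
  proof (rule comp_inj_on)
   show "inj_on (H t ^^ n) (closure (W r))" using it by blast
   show "inj_on (cfun v) ((H t ^^ n) ` closure (W r))"
    by (rule inj_on_subset[OF \<eta>(2)]) (use it n closure_W(3)[OF r] in blast)
  qed
  thus "inj_on (\<lambda>z. cfun v ((H t ^^ n) z)) (closure (W r))" by (simp add: o_def)
 qed
qed

end

section \<open>Riemann maps of the balls in the retract\<close>

context holo_retraction
begin

text \<open>For \<open>a = p\<close> the disc at hand may be constant; the one in direction
  \<open>v\<close> is not, since \<open>cder h p\<close> fixes \<open>v\<close>.\<close>

lemma nonconstant_disc:
 assumes a: "a \<in> W r" and r: "0 < r" "r < 1"
 obtains f ze ze' where "disc f" "cmod ze < r" "f ze = a" "cmod ze' < r" "f ze' \<noteq> a"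
proof (cases "a = p")
 case False
 obtain f ze where "disc f" "cmod ze < r" "a = f ze" using a by (rule W_E)
 thus ?thesis using False r by (intro that[of f ze 0]) (auto simp: discD)
next
 case True
 obtain e where e: "e > 0" "ball p e \<subseteq> D" using open_D p_in open_contains_ball by blast
 define c where "c = complex_of_real (e / norm v)"
 have c: "c \<noteq> 0" using e v_nonzero by (simp add: c_def)
 define f where "f = (\<lambda>t. h (p + cs t (cs c v)))"
 have inD: "p + cs t (cs c v) \<in> D" if "cmod t < 1" for t
 proof -
  have "norm (cs t (cs c v)) = cmod t * e" using e v_nonzero by (simp add: norm_cs c_def norm_divide)
  also have "\<dots> < e" using that e by simp
  finally show ?thesis using e(2) by (auto simp: dist_norm)
 qed
 have d: "disc f" unfolding f_def by (rule disc_h[OF holo_line]) (simp_all add: inD)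
 note hol = discD(1)[OF d]
 have "\<exists>ze'. cmod ze' < r \<and> f ze' \<noteq> p"
 proof (rule ccontr)
  assume "\<not> ?thesis"
  hence const: "\<And>t. t \<in> ball 0 r \<Longrightarrow> f t = p" by auto
  have "cder f 0 = cder (\<lambda>_. p) 0"
   by (rule cder_cong[of "ball 0 r"]) (use r const holo_subset[OF hol subset_ball[OF less_imp_le[OF r(2)]]] in auto)
  also have "\<dots> = (\<lambda>_. 0)" by (rule cder_eqI) simp
  finally have "cder f 0 1 = 0" by simp
  moreover have "cder f 0 1 = cs c v"
  proof -
   have "cder f 0 1 = cder h (p + cs 0 (cs c v)) (cder (\<lambda>t. p + cs t (cs c v)) 0 1)"
    unfolding f_def by (rule cder_compose[OF holo_line[of p "cs c v" UNIV] holo_h]) (use p_in in auto)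
   also have "cder (\<lambda>t. p + cs t (cs c v)) 0 = (\<lambda>s. cs s (cs c v))"
    by (rule cder_eqI[OF cder_line])
   finally show ?thesis
    using clinearD(2)[OF holoD(2)[OF holo_h p_in]] by (simp add: cder_h_v)
  qed
  moreover have "norm (cs c v) \<noteq> 0" using c v_nonzero by (simp add: norm_cs)
  ultimately show False by simp
 qed
 thus ?thesis using that[OF d, of 0] True r by (auto simp: discD(4)[OF d])
qed

text \<open>The homotopy is \<open>H (1 - t)\<close>, inherited from the convexity of
  \<open>D\<close>.\<close>

lemma contractible_W:
 assumes r: "0 < r" "r < 1"
 shows "contractible (W r)"
 unfolding contractible_def
proof (rule exI[of _ p], subst homotopic_with, goal_cases)
 case 2
 let ?k = "\<lambda>(t, x). H (1 - t) x"
 have cont: "continuous_on ({0..1} \<times> W r) ?k"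
 proof -
  have m: "(\<lambda>z. p + (1 - fst z) *\<^sub>R (snd z - p)) ` ({0..1} \<times> W r) \<subseteq> D"
   using seg_in W_Z[of r] Z_D r by (fastforce simp: image_subset_iff)
  have "continuous_on ({0..1} \<times> W r) (\<lambda>z. h (p + (1 - fst z) *\<^sub>R (snd z - p)))"
   by (rule continuous_on_compose2[OF holo_continuous_on[OF holo_h] _ m]) (intro continuous_intros)
  thus ?thesis by (simp add: H_def case_prod_unfold)
 qed
 show "\<exists>k. continuous_map (prod_topology (top_of_set {0..1::real}) (top_of_set (W r))) (top_of_set (W r)) k \<and>
   (\<forall>x\<in>topspace (top_of_set (W r)). k (0, x) = id x) \<and> (\<forall>x\<in>topspace (top_of_set (W r)). k (1, x) = p) \<and> (\<forall>t\<in>{0..1}. True)"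
 proof (rule exI[of _ ?k], intro conjI ballI)
  have "prod_topology (top_of_set {0..1}) (top_of_set (W r)) = top_of_set ({0..1::real} \<times> W r)"
   by (rule prod_topology_subtopology_eu)
  thus "continuous_map (prod_topology (top_of_set {0..1::real}) (top_of_set (W r))) (top_of_set (W r)) ?k"
   using cont H_W by auto
  show "?k (0, x) = id x" if "x \<in> topspace (top_of_set (W r))" for x
   using that W_Z[of r] r by (auto simp: H_def Z_def)
  show "?k (1, x) = p" for x by (simp add: H_def h_p)
 qed simp
qed simp

text \<open>\<open>\<sigma>\<close> maps \<open>W r\<close> onto a bounded, open, contractible
  planar set, which the Riemann mapping theorem turns into the disc. The inverse \<open>F\<close> is
  at first only continuous; its holomorphy is tested on discs \<open>f\<close> in \<open>Z\<close>,
  along which \<open>F\<close> is locally \<open>f\<close> after an inverse of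
  \<open>\<mu> = \<rho> \<circ> f\<close>.\<close>

lemma W_disc:
 assumes r: "0 < r" "r < 1"
 shows "\<exists>F \<rho>. holo F (ball (0::complex) 1) \<and> F ` ball 0 1 \<subseteq> W r \<and> F 0 = p \<and>
  open {z \<in> D. h z \<in> W r} \<and> holo (\<lambda>z. \<rho> (h z) :: complex) {z \<in> D. h z \<in> W r} \<and>
  (\<forall>z\<in>W r. \<rho> z \<in> ball 0 1 \<and> F (\<rho> z) = z) \<and> (\<forall>ze\<in>ball 0 1. \<rho> (F ze) = ze) \<and> \<rho> p = 0"
proof -
 obtain \<sigma> :: "'v \<Rightarrow> complex" where \<sigma>: "holo \<sigma> D" "inj_on \<sigma> (closure (W r))" by (rule planar_chart[OF r])
 define S where "S = \<sigma> ` W r"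
 have WZ: "W r \<subseteq> Z" using W_Z r by simp
 have pW: "p \<in> W r" using W_I[OF disc_const, of 0 r] r by simp
 have injW: "inj_on \<sigma> (W r)" by (rule inj_on_subset[OF \<sigma>(2) closure_subset])
 have sf: "holo (\<lambda>t. \<sigma> (f t)) (ball 0 r)" if "disc f" for f
 proof (rule holo_compose[OF holo_subset[OF discD(1)[OF that]] \<sigma>(1)])
  show "ball (0::complex) r \<subseteq> ball 0 1" using r by (intro subset_ball) simp
  show "f ` ball 0 r \<subseteq> D" using discD(3)[OF that] r by (simp add: image_subset_iff)
 qed
 \<comment> \<open>Through each point there is a nonconstant disc, and it stays nonconstant under
   the injective \<open>\<sigma>\<close>, so the open mapping theorem applies.\<close>
 have openS: "open S"
 proof (rule openI)
  fix s assume "s \<in> S"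
  then obtain a where a: "a \<in> W r" "s = \<sigma> a" by (auto simp: S_def)
  obtain f ze ze' where f: "disc f" "cmod ze < r" "f ze = a" "cmod ze' < r" "f ze' \<noteq> a"
   by (rule nonconstant_disc[OF a(1) r])
  have "open ((\<lambda>t. \<sigma> (f t)) ` ball 0 r)"
  proof (rule open_mapping_thm[of _ "ball 0 r"])
   show "(\<lambda>t. \<sigma> (f t)) holomorphic_on ball 0 r" using sf[OF f(1)] by (simp add: holo_iff_holomorphic_on)
   show "\<not> (\<lambda>t. \<sigma> (f t)) constant_on ball 0 r"
   proof
    assume "(\<lambda>t. \<sigma> (f t)) constant_on ball 0 r"
    hence "\<sigma> (f ze) = \<sigma> (f ze')" using f by (auto simp: constant_on_def)
    thus False using inj_onD[OF injW, of "f ze" "f ze'"] W_I[OF f(1)] f by auto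
   qed
  qed auto
  moreover have "(\<lambda>t. \<sigma> (f t)) ` ball 0 r \<subseteq> S" using W_I[OF f(1)] by (auto simp: S_def)
  moreover have "s \<in> (\<lambda>t. \<sigma> (f t)) ` ball 0 r" using f a by auto
  ultimately show "\<exists>e>0. ball s e \<subseteq> S" using open_contains_ball by (meson order_trans)
 qed
 have cs: "continuous_on (closure (W r)) \<sigma>"
  by (rule continuous_on_subset[OF holo_continuous_on[OF \<sigma>(1)]]) (use closure_W(3)[OF r] Z_D in blast)
 \<comment> \<open>The inverse of \<open>\<sigma>\<close> is continuous because the closed ball is
   compact; this is why injectivity was arranged on the closure.\<close>
 obtain \<tau> where \<tau>: "homeomorphism (closure (W r)) (\<sigma> ` closure (W r)) \<sigma> \<tau>"
  using homeomorphism_compact[OF closure_W(1)[OF r] cs refl \<sigma>(2)] by blast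
 have \<tau>\<sigma>: "\<tau> (\<sigma> a) = a" if "a \<in> W r" for a
  using \<tau> that closure_subset by (auto simp: homeomorphism_def)
 have hom: "homeomorphism (W r) S \<sigma> \<tau>"
  unfolding S_def by (rule homeomorphism_of_subsets[OF \<tau> closure_subset subset_refl refl])
 have "contractible S"
  using contractible_W[OF r] homeomorphic_contractible_eq hom unfolding homeomorphic_def by blast
 hence sc: "simply_connected S" by (rule contractible_imp_simply_connected)
 have "bounded S"
  by (rule bounded_subset[OF compact_imp_bounded[OF compact_continuous_image[OF cs closure_W(1)[OF r]]]])
    (simp add: S_def image_mono closure_subset)
 hence "S \<noteq> UNIV" using not_bounded_UNIV by blast
 moreover have "S \<noteq> {}" using pW by (auto simp: S_def)
 ultimately obtain m m' where m: "m holomorphic_on S" "m' holomorphic_on ball 0 1"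
  "\<forall>x\<in>S. m x \<in> ball 0 1 \<and> m' (m x) = x" "\<forall>x\<in>ball 0 1. m' x \<in> S \<and> m (m' x) = x"
  using Riemann_mapping_theorem[of S] openS sc by blast
 have pS: "\<sigma> p \<in> S" using pW by (simp add: S_def)
 obtain k k' where k: "k (m (\<sigma> p)) = 0" "k holomorphic_on ball 0 1" "k' holomorphic_on ball 0 1"
  "\<And>x. x \<in> ball 0 1 \<Longrightarrow> k x \<in> ball 0 1 \<and> k' (k x) = x" "\<And>x. x \<in> ball 0 1 \<Longrightarrow> k' x \<in> ball 0 1 \<and> k (k' x) = x"
  using disc_automorphism m(3) pS by blast
 define \<rho> where "\<rho> = (\<lambda>z. k (m (\<sigma> z)))"
 define F where "F = (\<lambda>t. \<tau> (m' (k' t)))"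
 have \<rho>F: "\<rho> z \<in> ball 0 1 \<and> F (\<rho> z) = z" if z: "z \<in> W r" for z
 proof -
  have "\<sigma> z \<in> S" using z by (simp add: S_def)
  thus ?thesis using m(3) k(4) \<tau>\<sigma>[OF z] by (simp add: \<rho>_def F_def)
 qed
 have FW: "F t \<in> W r \<and> \<rho> (F t) = t" if t: "t \<in> ball 0 1" for t
 proof -
  have "k' t \<in> ball 0 1" "k (k' t) = t" using k(5)[OF t] by auto
  hence "m' (k' t) \<in> S" "m (m' (k' t)) = k' t" using m(4) by auto
  then obtain a where "a \<in> W r" "m' (k' t) = \<sigma> a" by (auto simp: S_def)
  thus ?thesis using \<open>m (m' (k' t)) = k' t\<close> \<open>k (k' t) = t\<close> \<tau>\<sigma> by (simp add: F_def \<rho>_def)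
 qed
 have hol_km: "(\<lambda>s. k (m s)) holomorphic_on S"
 proof -
  have "m ` S \<subseteq> ball 0 1" using m(3) by blast
  thus ?thesis using holomorphic_on_compose_gen[OF m(1) k(2)] by (simp add: o_def)
 qed
 have contF: "continuous_on (ball 0 1) F"
 proof -
  have "k' ` ball 0 1 \<subseteq> ball 0 1" using k(5) by blast
  hence c1: "continuous_on (ball 0 1) (\<lambda>t. m' (k' t))"
   using holomorphic_on_imp_continuous_on[OF holomorphic_on_compose_gen[OF k(3) m(2)]] by (simp add: o_def)
  have "(\<lambda>t. m' (k' t)) ` ball 0 1 \<subseteq> S" using m(4) k(5) by blast
  moreover have "continuous_on S \<tau>" using hom by (simp add: homeomorphism_def)
  ultimately show ?thesis unfolding F_def using continuous_on_compose2[OF _ c1] by blast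
 qed
 have openV: "open {z \<in> D. h z \<in> W r}"
 proof (rule openI)
  fix z assume z: "z \<in> {z \<in> D. h z \<in> W r}"
  then obtain e where e: "e > 0" "ball (h z) e \<subseteq> D" "\<And>y. y \<in> ball (h z) e \<Longrightarrow> h y \<in> W r"
   using W_open[OF _ r, of "h z"] by auto
  have "continuous_on D h" by (rule holo_continuous_on[OF holo_h])
  from continuous_open_preimage[OF this open_D open_ball[of "h z" e]]
  have "open (D \<inter> h -` ball (h z) e)" .
  moreover have "z \<in> D \<inter> h -` ball (h z) e" using z e(1) by simp
  ultimately obtain d where "d > 0" "ball z d \<subseteq> D \<inter> h -` ball (h z) e" using open_contains_ball by metis
  moreover have "D \<inter> h -` ball (h z) e \<subseteq> {z \<in> D. h z \<in> W r}"
  proof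
   fix y assume y: "y \<in> D \<inter> h -` ball (h z) e"
   hence "h (h y) \<in> W r" using e(3) by blast
   thus "y \<in> {z \<in> D. h z \<in> W r}" using y h_h by simp
  qed
  ultimately show "\<exists>e>0. ball z e \<subseteq> {z \<in> D. h z \<in> W r}" by blast
 qed
 have holF: "holo F (ball 0 1)"
 proof (rule holo_cfunI)
  fix w
  have "\<exists>T. b \<in> T \<and> holo (\<lambda>t. cfun w (F t)) T" if b: "b \<in> ball 0 1" for b
  proof -
   have bW: "F b \<in> W r" "\<rho> (F b) = b" using FW[OF b] by auto
   obtain f ze ze' where f: "disc f" "cmod ze < r" "f ze = F b" "cmod ze' < r" "f ze' \<noteq> F b"
    by (rule nonconstant_disc[OF bW(1) r])
   define \<mu> where "\<mu> = (\<lambda>t. \<rho> (f t))"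
   have F\<mu>: "F (\<mu> t) = f t" if "cmod t < r" for t using \<rho>F[OF W_I[OF f(1) that]] by (simp add: \<mu>_def)
   have "(\<lambda>t. \<sigma> (f t)) ` ball 0 r \<subseteq> S" using W_I[OF f(1)] by (auto simp: S_def)
   hence h\<mu>: "\<mu> holomorphic_on ball 0 r"
    using holomorphic_on_compose_gen[OF sf[OF f(1), unfolded holo_iff_holomorphic_on[OF open_ball]] hol_km]
    by (simp add: \<mu>_def \<rho>_def o_def)
   have \<mu>b: "\<mu> ze = b" using f bW by (simp add: \<mu>_def)
   have "\<mu> ze' \<noteq> b"
   proof
    assume "\<mu> ze' = b"
    thus False using F\<mu>[OF f(4)] f(5) by simp
   qed
   have h\<mu>': "deriv \<mu> holomorphic_on ball 0 r" by (intro holomorphic_deriv h\<mu>) simp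
   have "\<exists>\<beta>\<in>ball 0 r. deriv \<mu> \<beta> \<noteq> 0"
   proof (rule ccontr)
    assume "\<not> ?thesis"
    hence "\<And>x. x \<in> ball 0 r \<Longrightarrow> (\<mu> has_field_derivative 0) (at x)"
     using holomorphic_derivI[OF h\<mu> open_ball] by metis
    then obtain c where "\<And>x. x \<in> ball 0 r \<Longrightarrow> \<mu> x = c"
     using has_field_derivative_zero_constant[OF convex_ball[of "0::complex" r]]
     by (metis at_within_open open_ball)
    thus False using \<open>\<mu> ze' \<noteq> b\<close> \<mu>b f by simp
   qed
   then obtain \<beta> where \<beta>: "\<beta> \<in> ball 0 r" "deriv \<mu> \<beta> \<noteq> 0" by blast
   \<comment> \<open>Zeros of the derivative of \<open>\<mu>\<close> are isolated, so near
     \<open>ze\<close> a local inverse of \<open>\<mu>\<close> can fail to exist only over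
     \<open>b\<close> itself.\<close>
   obtain d where d: "d > 0" "ball ze d \<subseteq> ball 0 r" "\<And>t. t \<in> ball ze d - {ze} \<Longrightarrow> deriv \<mu> t \<noteq> 0"
   proof (cases "deriv \<mu> ze = 0")
    case True
    show ?thesis
     by (rule isolated_zeros[OF h\<mu>' open_ball connected_ball _ True \<beta>]) (use f that in auto)
   next
    case False
    have "continuous_on (ball 0 r) (deriv \<mu>)" using h\<mu>' by (rule holomorphic_on_imp_continuous_on)
    from continuous_open_preimage[OF this open_ball, of "- {0}"]
    have "open (ball 0 r \<inter> deriv \<mu> -` (- {0}))" by auto
    moreover have "ze \<in> ball 0 r \<inter> deriv \<mu> -` (- {0})" using f False by simp
    ultimately obtain d where "d > 0" "ball ze d \<subseteq> ball 0 r \<inter> deriv \<mu> -` (- {0})"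
     using open_contains_ball by metis
    thus ?thesis by (intro that[of d]) auto
   qed
   let ?N = "\<mu> ` ball ze d"
   have hd: "\<mu> holomorphic_on ball ze d" using h\<mu> d(2) holomorphic_on_subset by blast
   have oN: "open ?N"
   proof (rule open_mapping_thm[OF hd open_ball connected_ball open_ball order.refl])
    show "\<not> \<mu> constant_on ball ze d"
    proof
     assume "\<mu> constant_on ball ze d"
     then obtain c where c: "\<And>t. t \<in> ball ze d \<Longrightarrow> \<mu> t = c" by (auto simp: constant_on_def)
     define t where "t = ze + of_real (d / 2)"
     have t: "t \<in> ball ze d - {ze}" using d(1) by (auto simp: t_def dist_norm)
     have "(\<mu> has_field_derivative 0) (at t)"
      by (rule has_field_derivative_transform_within_open[OF DERIV_const[of c] open_ball]) (use t c in auto)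
     thus False using d(3)[OF t] DERIV_imp_deriv by blast
    qed
   qed
   have loc: "\<exists>T. open T \<and> y \<in> T \<and> holo (\<lambda>t. cfun w (F t)) T" if y: "y \<in> ?N - {b}" for y
   proof -
    obtain \<xi> where \<xi>: "\<xi> \<in> ball ze d" "y = \<mu> \<xi>" using y by blast
    have "\<xi> \<noteq> ze" using y \<xi> \<mu>b by auto
    hence "deriv \<mu> \<xi> \<noteq> 0" using d(3) \<xi> by blast
    then obtain e where e: "e > 0" "ball \<xi> e \<subseteq> ball ze d" "inj_on \<mu> (ball \<xi> e)"
     by (rule has_complex_derivative_locally_injective[OF hd \<xi>(1) open_ball])
    have he: "\<mu> holomorphic_on ball \<xi> e" using hd e(2) holomorphic_on_subset by blast
    obtain j where j: "j holomorphic_on \<mu> ` ball \<xi> e" "\<And>z. z \<in> ball \<xi> e \<Longrightarrow> j (\<mu> z) = z"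
     using holomorphic_has_inverse[OF he open_ball e(3)] by metis
    have oe: "open (\<mu> ` ball \<xi> e)" by (rule open_mapping_thm3[OF he open_ball e(3)])
    have "holo (\<lambda>t. cfun w (f (j t))) (\<mu> ` ball \<xi> e)"
    proof (rule holo_compose[OF _ holo_cfun[OF discD(1)[OF f(1)]]])
     show "holo j (\<mu> ` ball \<xi> e)" using j(1) by (simp add: holo_iff_holomorphic_on oe)
     show "j ` \<mu> ` ball \<xi> e \<subseteq> ball 0 1" using j(2) e(2) d(2) r by fastforce
    qed
    moreover have "cfun w (f (j t)) = cfun w (F t)" if t: "t \<in> \<mu> ` ball \<xi> e" for t
    proof -
     obtain z where z: "z \<in> ball \<xi> e" "t = \<mu> z" using t by blast
     hence "z \<in> ball 0 r" using e(2) d(2) by blast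
     thus ?thesis using j(2)[OF z(1)] F\<mu>[of z] z by simp
    qed
    ultimately have "holo (\<lambda>t. cfun w (F t)) (\<mu> ` ball \<xi> e)"
     by (rule holo_cong[OF _ oe])
    moreover have "y \<in> \<mu> ` ball \<xi> e" using \<xi> e(1) by simp
    ultimately show ?thesis using oe by blast
   qed
   have "holo (\<lambda>t. cfun w (F t)) (?N - {b})"
    by (rule holo_local) (use loc in blast)
   moreover have "open (?N - {b})" using oN by auto
   ultimately have h1: "(\<lambda>t. cfun w (F t)) holomorphic_on (?N - {b})" by (simp add: holo_iff_holomorphic_on)
   have "?N \<subseteq> ball 0 1"
   proof
    fix y assume "y \<in> ?N"
    then obtain z where "z \<in> ball 0 r" "y = \<mu> z" using d(2) by blast
    thus "y \<in> ball 0 1" using \<rho>F[OF W_I[OF f(1)], of z] by (simp add: \<mu>_def)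
   qed
   hence "continuous_on ?N (\<lambda>t. cfun w (F t))"
    by (intro continuous_on_compose2[OF linear_continuous_on[OF clinearD(1)[OF clinear_cfun], of UNIV]
       continuous_on_subset[OF contF]]) auto
   \<comment> \<open>The exceptional point \<open>b\<close> is removable because \<open>F\<close> is
     continuous there.\<close>
   hence "(\<lambda>t. cfun w (F t)) holomorphic_on ?N"
    using no_isolated_singularity[OF _ h1 oN] by blast
   hence "holo (\<lambda>t. cfun w (F t)) ?N" using oN by (simp add: holo_iff_holomorphic_on)
   moreover have "b \<in> ?N" using \<mu>b d(1) by force
   ultimately show ?thesis by blast
  qed
  thus "holo (\<lambda>t. cfun w (F t)) (ball 0 1)" by (rule holo_local)
 qed
 show ?thesis
 proof (rule exI[of _ F], rule exI[of _ \<rho>], intro conjI ballI)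
  show "holo F (ball 0 1)" by (rule holF)
  show "F ` ball 0 1 \<subseteq> W r" using FW by blast
  show "F 0 = p" "\<rho> p = 0" using \<rho>F[OF pW] k(1) by (auto simp: \<rho>_def)
  show "open {z \<in> D. h z \<in> W r}" by (rule openV)
  have "holo (\<lambda>z. \<sigma> (h z)) {z \<in> D. h z \<in> W r}"
   by (rule holo_compose[OF holo_subset[OF holo_h] \<sigma>(1)]) (use h_in in auto)
  thus "holo (\<lambda>z. \<rho> (h z)) {z \<in> D. h z \<in> W r}"
   unfolding \<rho>_def by (rule holo_comp_holomorphic[OF _ hol_km openS]) (auto simp: S_def)
  show "\<rho> z \<in> ball 0 1" "F (\<rho> z) = z" if "z \<in> W r" for z using \<rho>F[OF that] by auto
  show "\<rho> (F ze) = ze" if "ze \<in> ball 0 1" for ze using FW[OF that] by blast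
 qed
qed

text \<open>The Riemann maps of the balls \<open>W (r n)\<close> and their inverses form normal
  families. The normalizations \<open>F n 0 = p\<close> and \<open>\<rho> n p = 0\<close> keep both
  limits off the boundary, and the relations between \<open>F n\<close> and \<open>\<rho> n\<close>
  pass to the limit at moving points.\<close>

theorem retract_is_disc:
 obtains F R where "holo F (ball (0::complex) 1)" "F ` ball 0 1 \<subseteq> D" "holo (R :: 'v \<Rightarrow> complex) D"
  "R ` D \<subseteq> ball 0 1" "\<And>ze. ze \<in> ball 0 1 \<Longrightarrow> R (F ze) = ze" "\<And>z. z \<in> D \<Longrightarrow> F (R z) = h z"
proof -
 define r where "r = (\<lambda>n. 1 - 1 / (real n + 2))"
 have r: "0 < r n" "r n < 1" for n by (auto simp: r_def field_simps)
 have r1: "\<forall>\<^sub>F n. s < r n" if "s < 1" for s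
 proof -
  obtain N where N: "1 / (1 - s) < real N" using reals_Archimedean2 by blast
  have "s < r n" if "n \<ge> N" for n
  proof -
   have "1 / (1 - s) < real n + 2" using N that by linarith
   hence "1 / (real n + 2) < 1 - s" using \<open>s < 1\<close> by (simp add: field_simps)
   thus ?thesis by (simp add: r_def)
  qed
  thus ?thesis unfolding eventually_sequentially by blast
 qed
 define P where "P = (\<lambda>n F \<rho>. holo F (ball (0::complex) 1) \<and> F ` ball 0 1 \<subseteq> W (r n) \<and> F 0 = p \<and>
  open {z \<in> D. h z \<in> W (r n)} \<and> holo (\<lambda>z. \<rho> (h z) :: complex) {z \<in> D. h z \<in> W (r n)} \<and>
  (\<forall>z\<in>W (r n). \<rho> z \<in> ball 0 1 \<and> F (\<rho> z) = z) \<and> (\<forall>ze\<in>ball 0 1. \<rho> (F ze) = ze) \<and> \<rho> p = 0)"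
 have "\<forall>n. \<exists>F \<rho>. P n F \<rho>" unfolding P_def using W_disc[OF r] by (rule allI)
 then obtain F \<rho> where "\<And>n. P n (F n) (\<rho> n)" by metis
 hence F: "holo (F n) (ball 0 1)" "F n ` ball 0 1 \<subseteq> W (r n)" "F n 0 = p"
  "holo (\<lambda>z. \<rho> n (h z)) {z \<in> D. h z \<in> W (r n)}"
  "\<And>z. z \<in> W (r n) \<Longrightarrow> \<rho> n z \<in> ball 0 1" "\<And>z. z \<in> W (r n) \<Longrightarrow> F n (\<rho> n z) = z"
  "\<And>ze. ze \<in> ball 0 1 \<Longrightarrow> \<rho> n (F n ze) = ze" "\<rho> n p = 0" for n
  by (simp_all add: P_def)
 obtain B where B: "\<And>x. x \<in> D \<Longrightarrow> norm x \<le> B" using bounded_D bounded_iff by blast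
 have WZ: "W (r n) \<subseteq> Z" for n using W_Z[of "r n"] r(2)[of n] by simp
 have FZ: "F n ze \<in> Z" if "ze \<in> ball 0 1" for n ze using F(2)[of n] WZ[of n] that by blast
 have FD: "F n ze \<in> D" if "ze \<in> ball 0 1" for n ze using FZ[OF that] Z_D by blast
 have lbF: "locbdd (ball 0 1) F"
  unfolding locbdd_def
 proof
  fix z :: complex assume "z \<in> ball 0 1"
  then obtain e where e: "e > 0" "ball z e \<subseteq> ball 0 1" using open_ball open_contains_ball by metis
  have "norm (F n x) \<le> B" if "x \<in> ball z e" for n x using B[OF FD] e(2) that by blast
  thus "\<exists>r>0. \<exists>B. \<forall>\<^sub>F n. holo (F n) (ball z r) \<and> (\<forall>x\<in>ball z r. norm (F n x) \<le> B)"
   using e holo_subset[OF F(1) e(2)] by (intro exI[of _ e] conjI exI[of _ B] always_eventually allI) auto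
 qed
 have ex: "\<exists>d>0. ball z d \<subseteq> D \<and> (\<forall>\<^sub>F n. ball z d \<subseteq> {z \<in> D. h z \<in> W (r n)})" if z: "z \<in> D" for z
 proof -
  obtain s where s: "0 < s" "s < 1" "h z \<in> W s" using W_exhaust[OF h_Z[OF z]] by blast
  have "open {z \<in> D. h z \<in> W s}" using W_disc[OF s(1,2)] by (elim exE conjE)
  moreover have "z \<in> {z \<in> D. h z \<in> W s}" using s z by simp
  ultimately obtain d where d: "d > 0" "ball z d \<subseteq> {z \<in> D. h z \<in> W s}" using open_contains_ball by metis
  have "\<forall>\<^sub>F n. ball z d \<subseteq> {z \<in> D. h z \<in> W (r n)}"
   using r1[OF s(2)] by eventually_elim (use d W_mono[of s] in \<open>auto dest!: less_imp_le\<close>)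
  thus ?thesis using d by blast
 qed
 \<comment> \<open>\<open>\<rho> n\<close> is meaningful on the retract only; after composition with
   \<open>h\<close> it lives on open subsets of \<open>D\<close>, where Montel's theorem
   applies.\<close>
 define Q where "Q = (\<lambda>n z. \<rho> n (h z))"
 have lbR: "locbdd D Q"
  unfolding locbdd_def
 proof
  fix z assume "z \<in> D"
  then obtain d where d: "d > 0" "\<forall>\<^sub>F n. ball z d \<subseteq> {z \<in> D. h z \<in> W (r n)}" using ex by blast
  have "\<forall>\<^sub>F n. holo (Q n) (ball z d) \<and> (\<forall>x\<in>ball z d. norm (Q n x) \<le> 1)"
   using d(2)
  proof eventually_elim
   case (elim n)
   have "norm (Q n x) \<le> 1" if "x \<in> ball z d" for x
    using F(5)[of "h x" n] elim that by (auto simp: Q_def)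
   thus ?case using holo_subset[OF F(4) elim] by (simp add: Q_def[abs_def])
  qed
  thus "\<exists>r>0. \<exists>B. \<forall>\<^sub>F n. holo (Q n) (ball z r) \<and> (\<forall>x\<in>ball z r. norm (Q n x) \<le> B)"
   using d(1) by blast
 qed
 obtain i F1 where i: "strict_mono (i :: nat \<Rightarrow> nat)" "luc (ball 0 1) (\<lambda>n. F (i n)) F1"
  by (rule montel[OF open_ball lbF])
 obtain j R where j: "strict_mono (j :: nat \<Rightarrow> nat)" "luc D (\<lambda>n. Q (i (j n))) R"
  by (rule montel[OF open_D locbdd_subseq[OF lbR i(1)]])
 define l where "l = (\<lambda>n. i (j n))"
 have l: "strict_mono l" using strict_mono_o[OF i(1) j(1)] by (simp add: l_def o_def)
 have lF: "luc (ball 0 1) (\<lambda>n. F (l n)) F1" using luc_subseq[OF i(2) j(1)] by (simp add: l_def)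
 have lR: "luc D (\<lambda>n. Q (l n)) R" using j(2) by (simp add: l_def)
 have hF: "holo F1 (ball 0 1)"
  by (rule luc_holo[OF open_ball lF evholo_subseq[OF locbdd_evholo[OF lbF] l]])
 have hR: "holo R D"
  by (rule luc_holo[OF open_D lR evholo_subseq[OF locbdd_evholo[OF lbR] l]])
 have F10: "F1 0 = p"
  using luc_pointwise[OF lF, of 0] F(3) by (simp add: LIMSEQ_const_iff)
 have F1D: "F1 ze \<in> D" if "ze \<in> ball 0 1" for ze
 proof (rule holo_max_principle[OF open_ball convex_ball hF _ open_D convex_D, of 0])
  show "F1 ` ball 0 1 \<subseteq> closure D"
  proof
   fix z assume "z \<in> F1 ` ball 0 1"
   then obtain t where t: "t \<in> ball 0 1" "z = F1 t" by blast
   show "z \<in> closure D" unfolding t(2)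
    by (rule Lim_in_closed_set[OF closed_closure _ sequentially_bot luc_pointwise[OF lF t(1)]])
      (rule always_eventually, rule allI, rule subsetD[OF closure_subset FD[OF t(1)]])
  qed
 qed (use that F10 p_in in auto)
 have ev: "\<forall>\<^sub>F n. h z \<in> W (r (l n))" if "z \<in> D" for z
 proof -
  obtain d where "d > 0" "\<forall>\<^sub>F n. ball z d \<subseteq> {z \<in> D. h z \<in> W (r n)}" using ex[OF \<open>z \<in> D\<close>] by blast
  hence "\<forall>\<^sub>F n. ball z d \<subseteq> {z \<in> D. h z \<in> W (r (l n))}"
   using eventually_strict_mono[OF l] by blast
  thus ?thesis
  proof eventually_elim
   case (elim n)
   have "z \<in> ball z d" using \<open>d > 0\<close> by simp
   with elim show ?case by blast
  qed
 qed
 have R0: "R p = 0"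
  using luc_pointwise[OF lR p_in] F(8) by (simp add: LIMSEQ_const_iff Q_def h_p)
 have RD: "R z \<in> ball 0 1" if "z \<in> D" for z
 proof (rule holo_max_principle[OF open_D convex_D hR _ open_ball convex_ball p_in])
  show "R ` D \<subseteq> closure (ball 0 1)"
  proof
   fix y assume "y \<in> R ` D"
   then obtain z where z: "z \<in> D" "y = R z" by blast
   have "\<forall>\<^sub>F n. Q (l n) z \<in> closure (ball 0 1)"
    using ev[OF z(1)] by eventually_elim (use F(5) closure_subset in \<open>force simp: Q_def\<close>)
   thus "y \<in> closure (ball 0 1)" unfolding z(2)
    by (rule Lim_in_closed_set[OF closed_closure _ sequentially_bot luc_pointwise[OF lR z(1)]])
  qed
 qed (use that R0 in auto)
 show ?thesis
 proof (rule that[OF hF _ hR])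
  show "F1 ` ball 0 1 \<subseteq> D" "R ` D \<subseteq> ball 0 1" using F1D RD by auto
  show "R (F1 ze) = ze" if ze: "ze \<in> ball 0 1" for ze
  proof -
   have "(\<lambda>n. Q (l n) (F (l n) ze)) \<longlonglongrightarrow> R (F1 ze)"
    by (rule luc_moving[OF lR holo_continuous_on[OF hR] luc_pointwise[OF lF ze] F1D[OF ze]])
      (simp add: FD[OF ze])
   moreover have "Q (l n) (F (l n) ze) = ze" for n
    using FZ[OF ze] F(7)[OF ze] by (simp add: Q_def Z_def)
   ultimately show ?thesis by (simp add: LIMSEQ_const_iff)
  qed
  show "F1 (R z) = h z" if z: "z \<in> D" for z
  proof -
   have "\<forall>\<^sub>F n. Q (l n) z \<in> ball 0 1"
    using ev[OF z] by eventually_elim (unfold Q_def, rule F(5))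
   hence "(\<lambda>n. F (l n) (Q (l n) z)) \<longlonglongrightarrow> F1 (R z)"
    by (rule luc_moving[OF lF holo_continuous_on[OF hF] luc_pointwise[OF lR z] RD[OF z]])
   moreover have "\<forall>\<^sub>F n. F (l n) (Q (l n) z) = h z"
    using ev[OF z] by eventually_elim (simp add: Q_def F(6))
   ultimately have "(\<lambda>n. h z) \<longlonglongrightarrow> F1 (R z)" by (rule Lim_transform_eventually)
   thus ?thesis by (simp add: LIMSEQ_const_iff)
  qed
 qed
qed

end

section \<open>Univalent functions and additive Cousin data on discs\<close>

text \<open>Partial sums of the Taylor series at the centre; they are the entire corrections in the
  additive Cousin problem.\<close>

lemma polynomial_approx:
 assumes "f holomorphic_on ball 0 R" "r < R" "e > 0"
 obtains p where "p holomorphic_on UNIV" "\<And>z. cmod z \<le> r \<Longrightarrow> cmod (f z - p z) < e"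
proof -
 define a where "a = (\<lambda>n. (deriv ^^ n) f 0 / fact n)"
 have sums: "(\<lambda>n. a n * z ^ n) sums f z" if "cmod z < R" for z
  using holomorphic_power_series[OF assms(1), of z] that by (simp add: a_def)
 have "ereal R \<le> conv_radius a"
 proof (rule conv_radius_geI_ex)
  fix s :: real assume s: "0 < s" "ereal s < ereal R"
  hence "summable (\<lambda>n. a n * (of_real s) ^ n)" using sums[of "of_real s"] sums_summable by simp
  thus "\<exists>z. norm z = s \<and> summable (\<lambda>n. a n * z ^ n)" using s by (intro exI[of _ "of_real s"]) simp
 qed
 hence "ereal r < conv_radius a" using assms(2) by (metis ereal_less_eq(3) less_ereal.simps(1) order_less_le_trans)
 from powser_uniform_limit[OF this, of 0]
 have ul: "uniform_limit (cball 0 r) (\<lambda>n x. \<Sum>i<n. a i * x ^ i) (\<lambda>x. \<Sum>i. a i * x ^ i) sequentially" by simp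
 have "\<forall>\<^sub>F n. \<forall>x\<in>cball 0 r. dist (\<Sum>i<n. a i * x ^ i) (\<Sum>i. a i * x ^ i) < e"
  using ul assms(3) unfolding uniform_limit_iff by blast
 then obtain n where n: "\<forall>x\<in>cball 0 r. dist (\<Sum>i<n. a i * x ^ i) (\<Sum>i. a i * x ^ i) < e"
  unfolding eventually_sequentially by blast
 show ?thesis
 proof
  show "(\<lambda>x. \<Sum>i<n. a i * x ^ i) holomorphic_on UNIV" by (intro holomorphic_intros)
  fix z :: complex assume z: "cmod z \<le> r"
  hence "(\<Sum>i. a i * z ^ i) = f z" using sums[of z] assms(2) sums_unique by force
  thus "cmod (f z - (\<Sum>i<n. a i * z ^ i)) < e" using n z by (force simp: dist_norm norm_minus_commute)
 qed
qed

text \<open>The Mittag-Leffler device: the series of the \<open>l k\<close> converges after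
  subtraction of entire functions \<open>p k\<close>, and the finite sum of the \<open>p k\<close>
  in \<open>\<alpha>\<close> restores the prescribed differences.\<close>

lemma cousin_discs:
 fixes r :: "nat \<Rightarrow> real"
 assumes r: "\<And>n. r n < r (Suc n)" and l: "\<And>n. l n holomorphic_on ball 0 (r n)"
 obtains \<alpha> where "\<And>n. \<alpha> n holomorphic_on ball 0 (r n)" "\<And>n z. z \<in> ball 0 (r n) \<Longrightarrow> \<alpha> n z - \<alpha> (Suc n) z = l n z"
proof -
 have mono: "r m \<le> r n" if "m \<le> n" for m n
  using that by (rule lift_Suc_mono_le[of r, rotated]) (use r less_imp_le in blast)
 have "\<forall>n. \<exists>p. p holomorphic_on UNIV \<and> (\<forall>z. cmod z \<le> r n \<longrightarrow> cmod (l (Suc n) z - p z) < (1/2) ^ n)"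
 proof
  fix n
  obtain p where "p holomorphic_on UNIV" "\<And>z. cmod z \<le> r n \<Longrightarrow> cmod (l (Suc n) z - p z) < (1/2) ^ n"
   by (rule polynomial_approx[OF l[of "Suc n"] r[of n], of "(1/2) ^ n"]) auto
  thus "\<exists>p. p holomorphic_on UNIV \<and> (\<forall>z. cmod z \<le> r n \<longrightarrow> cmod (l (Suc n) z - p z) < (1/2) ^ n)" by blast
 qed
 from choice[OF this] obtain q where q: "\<And>n. q n holomorphic_on UNIV"
  "\<And>n z. cmod z \<le> r n \<Longrightarrow> cmod (l (Suc n) z - q n z) < (1/2) ^ n" by blast
 \<comment> \<open>\<open>l (Suc m)\<close> is approximated on the smaller disc of radius
   \<open>r m\<close>; no smaller disc precedes index zero, so nothing is subtracted there.\<close>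
 define p where "p = (\<lambda>n. case n of 0 \<Rightarrow> (\<lambda>_. 0) | Suc m \<Rightarrow> q m)"
 have hp: "p n holomorphic_on S" for n S
  by (rule holomorphic_on_subset[of _ UNIV]) (auto simp: p_def q split: nat.splits)
 define F where "F = (\<lambda>n z. l n z - p n z)"
 have F: "cmod (F (k + n) z) \<le> (1/2) ^ (k - 1)" if z: "z \<in> ball 0 (r n)" and k: "k \<ge> 1" for k n z
 proof -
  obtain m where m: "k + n = Suc m" "n \<le> m" "k - 1 \<le> m" using k by (cases "k + n") auto
  have "cmod z \<le> r m" using z mono[OF m(2)] by simp
  hence "cmod (F (k + n) z) < (1/2) ^ m" using q(2) by (simp add: F_def p_def m(1))
  also have "\<dots> \<le> (1/2) ^ (k - 1)" using m(3) by (intro power_decreasing) auto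
  finally show ?thesis by simp
 qed
 have sM: "summable (\<lambda>k. (1/2::real) ^ (k - 1))"
  using summable_Suc_iff[of "\<lambda>k. (1/2::real) ^ (k - 1)"] by (simp add: summable_geometric)
 have ul: "uniform_limit (ball 0 (r n)) (\<lambda>N z. \<Sum>k<N. F (k + n) z) (\<lambda>z. \<Sum>k. F (k + n) z) sequentially" for n
 proof (rule Weierstrass_m_test_ev[OF _ sM])
  show "\<forall>\<^sub>F k. \<forall>z\<in>ball 0 (r n). cmod (F (k + n) z) \<le> (1/2) ^ (k - 1)"
   using eventually_ge_at_top[of 1] by eventually_elim (use F in blast)
 qed
 have smb: "summable (\<lambda>k. F (k + n) z)" if z: "z \<in> ball 0 (r n)" for n z
 proof (rule summable_comparison_test_ev[OF _ sM])
  show "\<forall>\<^sub>F k. cmod (F (k + n) z) \<le> (1/2) ^ (k - 1)"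
   using eventually_ge_at_top[of 1] by eventually_elim (rule F[OF z])
 qed
 define \<alpha> where "\<alpha> = (\<lambda>n z. (\<Sum>k. F (k + n) z) - (\<Sum>k<n. p k z))"
 show ?thesis
 proof
  fix n
  have "(\<lambda>z. \<Sum>k. F (k + n) z) holomorphic_on ball 0 (r n)"
  proof (rule holomorphic_uniform_sequence[OF open_ball])
   show "(\<lambda>z. \<Sum>k<N. F (k + n) z) holomorphic_on ball 0 (r n)" for N
    unfolding F_def
   proof (intro holomorphic_intros hp holomorphic_on_subset[OF l])
    show "ball 0 (r n) \<subseteq> ball 0 (r (k + n))" for k :: nat using mono[of n "k + n"] by (intro subset_ball) simp
   qed
   fix x :: complex assume "x \<in> ball 0 (r n)"
   then obtain d where "d > 0" "cball x d \<subseteq> ball 0 (r n)" using open_contains_cball open_ball by metis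
   thus "\<exists>d>0. cball x d \<subseteq> ball 0 (r n) \<and>
     uniform_limit (cball x d) (\<lambda>N z. \<Sum>k<N. F (k + n) z) (\<lambda>z. \<Sum>k. F (k + n) z) sequentially"
    using uniform_limit_on_subset[OF ul] by blast
  qed
  thus "\<alpha> n holomorphic_on ball 0 (r n)"
   unfolding \<alpha>_def by (intro holomorphic_intros hp)
  fix z :: complex assume z: "z \<in> ball 0 (r n)"
  have "(\<Sum>k. F (Suc k + n) z) = (\<Sum>k. F (k + n) z) - F n z"
   using suminf_split_head[OF smb[OF z]] by simp
  thus "\<alpha> n z - \<alpha> (Suc n) z = l n z" by (simp add: \<alpha>_def F_def)
 qed
qed

text \<open>Schottky's bound for functions of modulus at most one at the centre, at two thirds of
  the radius, then squared and increased by one as in \<open>univalent_growth\<close>.\<close>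

definition growth_const :: real where
 "growth_const = 1 + (exp (pi * exp (pi * (2 + 2 * 1 + 12 * (2/3) / (1 - 2/3))))) ^ 2"

lemma growth_const_pos: "growth_const > 0"
 by (simp add: growth_const_def add_pos_nonneg)

text \<open>As \<open>t\<close> is omitted, \<open>1 - \<kappa> / t\<close> has a holomorphic square
  root. Its branch \<open>F\<close> with value \<open>-1\<close> at the centre omits zero, and it
  omits one because the only zero of \<open>\<kappa>\<close> is the centre, where \<open>F\<close>
  is \<open>-1\<close>. Schottky's theorem bounds such a function.\<close>

lemma univalent_growth:
 assumes hol: "\<kappa> holomorphic_on ball c \<rho>" and inj: "inj_on \<kappa> (ball c \<rho>)" and c: "\<kappa> c = 0"
  and t: "t \<notin> \<kappa> ` ball c \<rho>" and \<rho>: "\<rho> > 0" and v: "cmod (v - c) \<le> \<rho> / 2"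
 shows "cmod (\<kappa> v) \<le> growth_const * cmod t"
proof -
 have t0: "t \<noteq> 0" using t c \<rho> by (metis centre_in_ball image_eqI)
 have nz: "1 - \<kappa> z / t \<noteq> 0" if "z \<in> ball c \<rho>" for z
  using t that t0 by (auto simp: field_simps)
 have h1: "(\<lambda>z. 1 - \<kappa> z / t) holomorphic_on ball c \<rho>" by (intro holomorphic_intros hol) (use t0 in auto)
 obtain l where l: "l holomorphic_on ball c \<rho>" "\<And>z. z \<in> ball c \<rho> \<Longrightarrow> 1 - \<kappa> z / t = exp (l z)"
  using simply_connected_imp_holomorphic_log[OF h1 convex_imp_simply_connected[OF convex_ball]
    open_imp_locally_path_connected[OF open_ball] nz] by metis
 define F where "F = (\<lambda>z. - exp ((l z - l c) / 2))"
 have F2: "F z ^ 2 = 1 - \<kappa> z / t" if "z \<in> ball c \<rho>" for z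
 proof -
  have "F z ^ 2 = exp (2 * ((l z - l c) / 2))" unfolding F_def power2_minus by (rule exp_double[symmetric])
  also have "exp (2 * ((l z - l c) / 2)) = exp (l z - l c)" by (simp only: times_divide_eq_right nonzero_mult_div_cancel_left[OF zero_neq_numeral[symmetric]])
  also have "\<dots> = exp (l z) / exp (l c)" by (rule exp_diff)
  also have "exp (l c) = 1" using l(2)[of c] c \<rho> by simp
  finally show ?thesis using l(2)[OF that] by simp
 qed
 \<comment> \<open>Schottky's theorem is applied on the closed unit disc, hence the radius
   \<open>3/4 * \<rho>\<close>; the half radius of the claim is two thirds of it.\<close>
 define G where "G = (\<lambda>z. F (c + of_real (3/4 * \<rho>) * z))"
 have inb: "c + of_real (3/4 * \<rho>) * z \<in> ball c \<rho>" if "z \<in> cball 0 1" for z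
 proof -
  have "cmod (of_real (3/4 * \<rho>) * z) \<le> 3/4 * \<rho> * 1"
   unfolding norm_mult norm_of_real using that \<rho> by (intro mult_mono) auto
  also have "\<dots> < \<rho>" using \<rho> by simp
  finally show ?thesis by (simp add: dist_norm)
 qed
 have nG: "cmod (G z) \<le> exp (pi * exp (pi * (2 + 2 * 1 + 12 * (2/3) / (1 - 2/3))))" if "cmod z \<le> 2/3" for z
 proof (rule Schottky[of G 1 "2/3" z])
  have hF: "F holomorphic_on ball c \<rho>" unfolding F_def by (intro holomorphic_intros l) auto
  have hA: "(\<lambda>z. c + of_real (3/4 * \<rho>) * z) holomorphic_on cball 0 1" by (intro holomorphic_intros)
  have "(\<lambda>z. c + of_real (3/4 * \<rho>) * z) ` cball 0 1 \<subseteq> ball c \<rho>" by (rule image_subsetI) (rule inb)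
  from holomorphic_on_compose_gen[OF hA hF this]
  have "(F \<circ> (\<lambda>z. c + of_real (3/4 * \<rho>) * z)) holomorphic_on cball 0 1" .
  thus "G holomorphic_on cball 0 1" by (simp add: G_def o_def)
  show "cmod (G 0) \<le> 1" by (simp add: G_def F_def)
  fix z :: complex assume z: "z \<in> cball 0 1"
  let ?z = "c + of_real (3/4 * \<rho>) * z"
  show "\<not> (G z = 0 \<or> G z = 1)"
  proof
   assume "G z = 0 \<or> G z = 1"
   hence "G z = 1" by (simp add: G_def F_def)
   hence "\<kappa> ?z = 0" using F2[OF inb[OF z]] t0 by (simp add: G_def)
   hence "?z = c" using inj_onD[OF inj, of ?z c] inb[OF z] c \<rho> by simp
   hence "G z = F c" by (simp only: G_def)
   hence "G z = - 1" by (simp add: F_def)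
   with \<open>G z = 1\<close> show False by simp
  qed
 qed (use that in auto)
 define z where "z = (v - c) / of_real (3/4 * \<rho>)"
 have "complex_of_real (3/4 * \<rho>) \<noteq> 0" using \<rho> by simp
 hence "complex_of_real (3/4 * \<rho>) * z = v - c"
  unfolding z_def times_divide_eq_right by (rule nonzero_mult_div_cancel_left)
 hence vz: "v = c + of_real (3/4 * \<rho>) * z" by (simp only: add_diff_cancel_left' diff_add_cancel add.commute[of c])
 have "cmod z = cmod (v - c) / (3/4 * \<rho>)" unfolding z_def norm_divide norm_of_real using \<rho> by simp
 also have "\<dots> \<le> 2/3" using v \<rho> by (simp add: field_simps)
 finally have zb: "cmod z \<le> 2/3" .
 have vb: "v \<in> ball c \<rho>" using v \<rho> by (simp add: dist_norm norm_minus_commute)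
 have "\<kappa> v = t * (1 - F v ^ 2)" using F2[OF vb] t0 by simp
 hence e: "cmod (\<kappa> v) = cmod t * cmod (1 - F v ^ 2)" by (simp add: norm_mult)
 have "cmod (1 - F v ^ 2) \<le> 1 + cmod (F v) ^ 2"
  using norm_triangle_ineq4[of 1 "F v ^ 2"] by (simp add: norm_power)
 also have "\<dots> \<le> growth_const"
  unfolding growth_const_def using nG[OF zb] vz by (intro add_left_mono power_mono) (auto simp: G_def)
 finally have "cmod t * cmod (1 - F v ^ 2) \<le> cmod t * growth_const" by (rule mult_left_mono) simp
 thus ?thesis unfolding e by (simp add: mult.commute)
qed

lemma deriv_bound:
 assumes "f holomorphic_on ball c r" "s < r" "s > 0" "\<And>z. cmod (z - c) \<le> s \<Longrightarrow> cmod (f z) \<le> B"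
 shows "cmod (deriv f c) \<le> B / s"
proof -
 have "norm ((deriv ^^ 1) f c) \<le> fact 1 * B / s ^ 1"
  by (rule Cauchy_inequality)
    (use assms in \<open>auto intro!: holomorphic_on_imp_continuous_on holomorphic_on_subset[OF assms(1)] simp: norm_minus_commute\<close>)
 thus ?thesis by simp
qed

text \<open>Cauchy's estimate for the growth bound. Read contrapositively, a large derivative forces
  a large disc to be covered, as in Koebe's theorem.\<close>

lemma univalent_covers:
 assumes "\<kappa> holomorphic_on ball c \<rho>" "inj_on \<kappa> (ball c \<rho>)" "\<kappa> c = 0" "t \<notin> \<kappa> ` ball c \<rho>" "\<rho> > 0"
 shows "cmod (deriv \<kappa> c) * \<rho> \<le> 2 * growth_const * cmod t"
proof -
 have "cmod (deriv \<kappa> c) \<le> (growth_const * cmod t) / (\<rho> / 2)"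
  by (rule deriv_bound[OF assms(1)]) (use univalent_growth[OF assms] assms(5) in auto)
 thus ?thesis using assms(5) by (simp add: field_simps)
qed

text \<open>Some \<open>t\<close> of modulus below
  \<open>2 * cmod (deriv \<kappa> c) * \<rho>\<close> is omitted: otherwise the inverse would map a
  disc of that radius into one of radius \<open>\<rho>\<close>, and Cauchy's estimate would
  contradict the chain rule at the centre. The growth bound is then used for this
  \<open>t\<close>.\<close>

lemma univalent_bound:
 assumes hol: "\<kappa> holomorphic_on ball c \<rho>" and inj: "inj_on \<kappa> (ball c \<rho>)" and c: "\<kappa> c = 0"
  and \<rho>: "\<rho> > 0" and v: "cmod (v - c) \<le> \<rho> / 2"
 shows "cmod (\<kappa> v) \<le> 2 * growth_const * cmod (deriv \<kappa> c) * \<rho>"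
proof -
 let ?A = "cmod (deriv \<kappa> c)"
 have A: "?A > 0" using holomorphic_injective_imp_regular[OF hol open_ball inj, of c] \<rho> by simp
 define s where "s = 2 * ?A * \<rho>"
 have s: "s > 0" using A \<rho> by (simp add: s_def)
 have "\<exists>t. t \<in> ball 0 s \<and> t \<notin> \<kappa> ` ball c \<rho>"
 proof (rule ccontr)
  assume "\<not> ?thesis"
  hence cov: "ball 0 s \<subseteq> \<kappa> ` ball c \<rho>" by blast
  obtain g where g: "g holomorphic_on \<kappa> ` ball c \<rho>" "\<And>z. z \<in> ball c \<rho> \<Longrightarrow> deriv \<kappa> z * deriv g (\<kappa> z) = 1"
   "\<And>z. z \<in> ball c \<rho> \<Longrightarrow> g (\<kappa> z) = z"
   using holomorphic_has_inverse[OF hol open_ball inj] by metis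
  have hg: "g holomorphic_on ball 0 s" using g(1) cov holomorphic_on_subset by blast
  have dg: "deriv (\<lambda>z. g z - c) 0 = deriv g 0"
  proof -
   have "(g has_field_derivative deriv g 0) (at 0)" using holomorphic_derivI[OF hg open_ball] s by simp
   hence "((\<lambda>z. g z - c) has_field_derivative deriv g 0) (at 0)" by (auto intro!: derivative_eq_intros)
   thus ?thesis by (rule DERIV_imp_deriv)
  qed
  have "cmod (deriv (\<lambda>z. g z - c) 0) \<le> \<rho> / (3/4 * s)"
  proof (rule deriv_bound[of _ 0 s])
   show "(\<lambda>z. g z - c) holomorphic_on ball 0 s" by (intro holomorphic_intros hg)
   fix z :: complex assume "cmod (z - 0) \<le> 3/4 * s"
   hence "z \<in> ball 0 s" using s by simp
   then obtain y where "y \<in> ball c \<rho>" "z = \<kappa> y" using cov by blast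
   thus "cmod (g z - c) \<le> \<rho>" using g(3)[of y] by (simp add: dist_norm norm_minus_commute)
  qed (use s in auto)
  hence "?A * cmod (deriv g 0) \<le> ?A * (\<rho> / (3/4 * s))" unfolding dg by (intro mult_left_mono) auto
  also have "\<dots> = 2/3" using A \<rho> by (simp add: s_def field_simps)
  finally have "cmod (deriv \<kappa> c * deriv g 0) \<le> 2/3" by (simp add: norm_mult)
  moreover have "deriv \<kappa> c * deriv g 0 = 1" using g(2)[of c] c \<rho> by simp
  ultimately show False by simp
 qed
 then obtain t where t: "cmod t < s" "t \<notin> \<kappa> ` ball c \<rho>" by auto
 have "cmod (\<kappa> v) \<le> growth_const * cmod t" by (rule univalent_growth[OF hol inj c t(2) \<rho> v])
 also have "\<dots> \<le> growth_const * s" using t(1) growth_const_pos by (intro mult_left_mono) auto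
 finally show ?thesis by (simp add: s_def mult_ac)
qed

text \<open>The distortion bound on discs of radius \<open>2 * cmod z\<close> gives linear growth,
  and Liouville's theorem leaves polynomials of degree at most one.\<close>

lemma entire_injective_affine:
 assumes hol: "f holomorphic_on UNIV" and inj: "inj (f :: complex \<Rightarrow> complex)"
 shows "f z = (f 1 - f 0) * z + f 0"
proof -
 define \<kappa> where "\<kappa> = (\<lambda>z. f z - f 0)"
 have h: "\<kappa> holomorphic_on UNIV" unfolding \<kappa>_def by (intro holomorphic_intros hol)
 have k: "\<kappa> z = (\<Sum>k\<le>1. (deriv ^^ k) \<kappa> 0 / fact k * z ^ k)" for z
 proof (rule Liouville_polynomial[OF h])
  fix z :: complex assume z: "1 \<le> cmod z"
  have "cmod (\<kappa> z) \<le> 2 * growth_const * cmod (deriv \<kappa> 0) * (2 * cmod z)"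
  proof (rule univalent_bound[of _ 0])
   show "\<kappa> holomorphic_on ball 0 (2 * cmod z)" using h holomorphic_on_subset by blast
   show "inj_on \<kappa> (ball 0 (2 * cmod z))" using inj by (auto simp: inj_on_def \<kappa>_def)
   show "\<kappa> 0 = 0" "0 < 2 * cmod z" "cmod (z - 0) \<le> 2 * cmod z / 2" using z by (auto simp: \<kappa>_def)
  qed
  thus "cmod (\<kappa> z) \<le> (4 * growth_const * cmod (deriv \<kappa> 0)) * cmod z ^ 1" by simp
 qed
 have "\<kappa> z = \<kappa> 0 + deriv \<kappa> 0 * z" for z using k[of z] by (simp add: \<kappa>_def)
 from this[of z] this[of 1] show ?thesis by (simp add: \<kappa>_def algebra_simps)
qed

section \<open>Neighbourhoods of compact sets\<close>

text \<open>Otherwise distinct points with equal image occur ever closer to \<open>K\<close>. Their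
  limits in \<open>K\<close> have equal image, hence coincide, against local injectivity
  there.\<close>

lemma injective_near_compact:
 fixes f :: "'a::complex_euclidean \<Rightarrow> 'a"
 assumes S: "open S" "holo f S" and K: "compact K" "K \<subseteq> S" "inj_on f K" and d: "\<And>x. x \<in> K \<Longrightarrow> inj (cder f x)"
 obtains N where "open N" "K \<subseteq> N" "N \<subseteq> S" "inj_on f N" "\<And>z. z \<in> N \<Longrightarrow> inj (cder f z)"
proof -
 have "\<forall>x\<in>K. \<exists>r>0. ball x r \<subseteq> S \<and> inj_on f (ball x r) \<and> (\<forall>z\<in>ball x r. inj (cder f z))"
 proof
  fix x assume x: "x \<in> K"
  obtain r where "r > 0" "ball x r \<subseteq> S" "inj_on f (ball x r)" "\<And>z. z \<in> ball x r \<Longrightarrow> inj (cder f z)"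
   by (rule local_injective[OF S subsetD[OF K(2) x] d[OF x]]) blast
  thus "\<exists>r>0. ball x r \<subseteq> S \<and> inj_on f (ball x r) \<and> (\<forall>z\<in>ball x r. inj (cder f z))" by blast
 qed
 from bchoice[OF this] obtain r where
  "\<forall>x\<in>K. r x > 0 \<and> ball x (r x) \<subseteq> S \<and> inj_on f (ball x (r x)) \<and> (\<forall>z\<in>ball x (r x). inj (cder f z))" ..
 hence r: "\<And>x. x \<in> K \<Longrightarrow> r x > 0" "\<And>x. x \<in> K \<Longrightarrow> ball x (r x) \<subseteq> S"
  "\<And>x. x \<in> K \<Longrightarrow> inj_on f (ball x (r x))" "\<And>x z. x \<in> K \<Longrightarrow> z \<in> ball x (r x) \<Longrightarrow> inj (cder f z)" by simp_all
 define V where "V = (\<Union>x\<in>K. ball x (r x))"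
 have "open V" unfolding V_def by (intro open_UN ballI open_ball)
 moreover have "K \<subseteq> V"
 proof
  fix x assume "x \<in> K"
  thus "x \<in> V" using r(1)[of x] unfolding V_def by (intro UN_I[of x]) simp_all
 qed
 moreover have "V \<subseteq> S" unfolding V_def by (rule UN_least) (rule r(2))
 ultimately have V: "open V" "K \<subseteq> V" "V \<subseteq> S" .
 define N where "N = (\<lambda>n. V \<inter> (\<Union>x\<in>K. ball x (1 / real (Suc n))))"
 have "\<exists>n. inj_on f (N n)"
 proof (rule ccontr)
  assume "\<not> ?thesis"
  hence "\<forall>n. \<exists>y z. y \<in> N n \<and> z \<in> N n \<and> y \<noteq> z \<and> f y = f z" unfolding inj_on_def by metis
  then obtain y z where yz: "\<And>n. y n \<in> N n" "\<And>n. z n \<in> N n" "\<And>n. y n \<noteq> z n" "\<And>n. f (y n) = f (z n)" by metis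
  have "\<forall>n. \<exists>k. k \<in> K \<and> dist k (y n) < 1 / real (Suc n)" "\<forall>n. \<exists>k. k \<in> K \<and> dist k (z n) < 1 / real (Suc n)"
   using yz(1,2) by (auto simp: N_def)
  then obtain a b where ab: "\<And>n. a n \<in> K" "\<And>n. dist (a n) (y n) < 1 / real (Suc n)"
   "\<And>n. b n \<in> K" "\<And>n. dist (b n) (z n) < 1 / real (Suc n)" by metis
  obtain k i where i: "k \<in> K" "strict_mono (i :: nat \<Rightarrow> nat)" "(a \<circ> i) \<longlonglongrightarrow> k"
   using K(1) ab(1) unfolding compact_def by metis
  obtain l j where j: "l \<in> K" "strict_mono (j :: nat \<Rightarrow> nat)" "((b \<circ> i) \<circ> j) \<longlonglongrightarrow> l"
   using K(1) ab(3) unfolding compact_def by (metis comp_apply)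
  define m where "m = i \<circ> j"
  have m: "strict_mono m" unfolding m_def by (rule strict_mono_o[OF i(2) j(2)])
  have am: "(\<lambda>n. a (m n)) \<longlonglongrightarrow> k" using LIMSEQ_subseq_LIMSEQ[OF i(3) j(2)] by (simp add: m_def o_def)
  have bm: "(\<lambda>n. b (m n)) \<longlonglongrightarrow> l" using j(3) by (simp add: m_def o_def)
  have "(\<lambda>n. 1 / real (Suc n)) \<longlonglongrightarrow> 0" by (rule LIMSEQ_Suc[OF lim_1_over_n])
  from LIMSEQ_subseq_LIMSEQ[OF this m] have inv: "(\<lambda>n. 1 / real (Suc (m n))) \<longlonglongrightarrow> 0" by (simp add: o_def)
  have near: "(\<lambda>n. v (m n)) \<longlonglongrightarrow> q" if "(\<lambda>n. u (m n)) \<longlonglongrightarrow> q" "\<And>n. dist (u n) (v n) < 1 / real (Suc n)" for u v and q :: 'a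
  proof -
   have "(\<lambda>n. v (m n) - u (m n)) \<longlonglongrightarrow> 0"
    by (rule Lim_null_comparison[OF _ inv])
      (use that(2) in \<open>auto simp: dist_norm norm_minus_commute less_imp_le intro!: always_eventually\<close>)
   from tendsto_add[OF this that(1)] show ?thesis by simp
  qed
  have ym: "(\<lambda>n. y (m n)) \<longlonglongrightarrow> k" by (rule near[OF am ab(2)])
  have zm: "(\<lambda>n. z (m n)) \<longlonglongrightarrow> l" by (rule near[OF bm ab(4)])
  have c: "continuous_on S f" by (rule holo_continuous_on[OF S(2)])
  have NS: "N n \<subseteq> S" for n using V by (auto simp: N_def)
  have "(\<lambda>n. f (y (m n))) \<longlonglongrightarrow> f k"
   by (rule continuous_on_tendsto_compose[OF c ym subsetD[OF K(2) i(1)]])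
     (rule always_eventually, rule allI, rule subsetD[OF NS yz(1)])
  moreover have "(\<lambda>n. f (z (m n))) \<longlonglongrightarrow> f l"
   by (rule continuous_on_tendsto_compose[OF c zm subsetD[OF K(2) j(1)]])
     (rule always_eventually, rule allI, rule subsetD[OF NS yz(2)])
  ultimately have "f k = f l" using yz(4) LIMSEQ_unique by simp
  hence kl: "k = l" using inj_onD[OF K(3)] i j by blast
  have ob: "open (ball k (r k))" "k \<in> ball k (r k)" using r(1)[OF i(1)] by auto
  have "\<forall>\<^sub>F n. y (m n) \<in> ball k (r k)" by (rule topological_tendstoD[OF ym ob])
  moreover have "\<forall>\<^sub>F n. z (m n) \<in> ball k (r k)"
   by (rule topological_tendstoD[OF zm ob(1)]) (use ob(2) kl in simp)
  ultimately have "\<forall>\<^sub>F n. False"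
  proof eventually_elim
   case (elim n)
   thus ?case using inj_onD[OF r(3)[OF i(1)] yz(4)] yz(3) by blast
  qed
  thus False by simp
 qed
 then obtain n where n: "inj_on f (N n)" by blast
 show ?thesis
 proof (rule that[OF _ _ _ n])
  show "open (N n)" unfolding N_def using V by auto
  show "K \<subseteq> N n" using V by (auto simp: N_def intro: exI[of _ n])
  show "N n \<subseteq> S" using V by (auto simp: N_def)
  show "inj (cder f z)" if "z \<in> N n" for z using that r(4) by (auto simp: N_def V_def)
 qed
qed

text \<open>Along a kernel vector \<open>f\<close> would change only quadratically, against the
  linear lower bound.\<close>

lemma expanding_inj_cder:
 assumes "open S" "holo f S" "x \<in> S" "c > 0" "\<And>x y. x \<in> S \<Longrightarrow> y \<in> S \<Longrightarrow> c * norm (x - y) \<le> norm (f x - f y)"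
 shows "inj (cder f x)"
proof -
 have lin: "linear (cder f x)" by (rule linear_cder[OF assms(2,3)])
 obtain r C where rC: "r > 0" "ball x r \<subseteq> S" "C \<ge> 0"
  "\<And>y z. y \<in> ball x r \<Longrightarrow> z \<in> ball x r \<Longrightarrow> norm (f z - f y - cder f y (z - y)) \<le> C * norm (z - y) ^ 2"
  by (rule holo_taylor_local[OF assms(1-3)]) blast
 have "v = 0" if v: "cder f x v = 0" for v
 proof (rule ccontr)
  assume v0: "v \<noteq> 0"
  define m where "m = min (r / 2) (c / (2 * (C + 1)))"
  have m: "m > 0" "m < r" using rC assms(4) by (auto simp: m_def)
  define t where "t = m / norm v"
  have t: "t > 0" using v0 m by (simp add: t_def)
  have nt: "norm (t *\<^sub>R v) = m" using m v0 by (simp add: t_def)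
  hence b: "x + t *\<^sub>R v \<in> ball x r" "x \<in> ball x r" using m by (auto simp: dist_norm)
  have "norm (f (x + t *\<^sub>R v) - f x) \<le> C * norm (t *\<^sub>R v) ^ 2"
   using rC(4)[OF b(2,1)] v linear_scale[OF lin, of t v] by simp
  moreover have "c * norm (t *\<^sub>R v) \<le> norm (f (x + t *\<^sub>R v) - f x)"
   using assms(5)[OF subsetD[OF rC(2) b(1)] subsetD[OF rC(2) b(2)]] by simp
  ultimately have "c * norm (t *\<^sub>R v) \<le> (C * norm (t *\<^sub>R v)) * norm (t *\<^sub>R v)" by (simp add: power2_eq_square)
  hence "c \<le> C * norm (t *\<^sub>R v)" using t v0 by simp
  also have "\<dots> \<le> (C + 1) * (c / (2 * (C + 1)))"
   unfolding nt using rC(3) m by (intro mult_mono) (auto simp: m_def)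
  also have "\<dots> < c" using rC(3) assms(4) by (simp add: field_simps add_pos_nonneg)
  finally show False by simp
 qed
 thus ?thesis using linear_injective_0[OF lin] by blast
qed

section \<open>The limit fibration\<close>

definition pt :: "complex \<Rightarrow> complex \<Rightarrow> complex ^ 2" where
 "pt a b = (\<chi> i. if i = 1 then a else b)"

lemma pt_nth [simp]: "pt a b $ 1 = a" "pt a b $ 2 = b"
 by (simp_all add: pt_def)

lemma pt_eta [simp]: "pt (y $ 1) (y $ 2) = y"
 by (simp add: vec_eq_iff forall_2)

lemma pt_eq_iff:
 fixes x y :: "complex ^ 2"
 shows "x = y \<longleftrightarrow> x $ 1 = y $ 1 \<and> x $ 2 = y $ 2"
 by (simp add: vec_eq_iff forall_2)

lemma dist_pt_left: "dist (pt a b) (pt a' b) = dist a a'" and dist_pt_right: "dist (pt a b) (pt a b') = dist b b'"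
 by (simp_all add: dist_vec_def L2_set_def sum_2)

lemma dist_nth: "dist (x $ i) (y $ i) \<le> dist x (y :: complex ^ 'n)"
 by (rule dist_vec_nth_le)

lemma holo_pt: "holo a S \<Longrightarrow> holo b S \<Longrightarrow> holo (\<lambda>x. pt (a x) (b x)) S"
proof (rule holo_vec_lambda)
 fix i :: 2 assume "holo a S" "holo b S"
 thus "holo (\<lambda>x. pt (a x) (b x) $ i) S" by (cases "i = 1") (simp_all add: pt_def)
qed

definition bidisc :: "real \<Rightarrow> real \<Rightarrow> (complex ^ 2) set" where
 "bidisc a b = {y. cmod (y $ 1) < a \<and> cmod (y $ 2) < b}"

definition cbidisc :: "real \<Rightarrow> real \<Rightarrow> (complex ^ 2) set" where
 "cbidisc a b = {y. cmod (y $ 1) \<le> a \<and> cmod (y $ 2) \<le> b}"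

lemma open_bidisc: "open (bidisc a b)"
 unfolding bidisc_def by (intro open_Collect_conj open_Collect_less continuous_intros)

lemma compact_cbidisc: "compact (cbidisc a b)"
 unfolding compact_eq_bounded_closed
proof
 show "closed (cbidisc a b)"
  unfolding cbidisc_def by (intro closed_Collect_conj closed_Collect_le continuous_intros)
 show "bounded (cbidisc a b)"
  unfolding bounded_iff
 proof (intro exI ballI)
  fix y assume "y \<in> cbidisc a b"
  thus "norm y \<le> a + b" using L2_set_le_sum[of UNIV "\<lambda>i. cmod (y $ i)"]
   by (simp add: cbidisc_def sum_2 norm_vec_def)
 qed
qed

lemma convex_cbidisc: "convex (cbidisc a b)"
proof -
 have lin: "linear (\<lambda>y::complex ^ 2. y $ i)" for i
  by (rule bounded_linear.linear[OF bounded_linear_vec_nth])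
 have eq: "cbidisc a b = (\<lambda>y. y $ 1) -` cball 0 a \<inter> (\<lambda>y. y $ 2) -` cball 0 b"
  by (auto simp: cbidisc_def)
 show ?thesis unfolding eq by (intro convex_Int convex_linear_vimage lin convex_cball)
qed

lemma bidisc_subset_cbidisc: "bidisc a b \<subseteq> cbidisc a b"
 by (auto simp: bidisc_def cbidisc_def)

text \<open>\<open>F\<close> parametrizes the retract by the unit disc, and its left inverse
  \<open>R\<close> is defined on all of \<open>D\<close>, so \<open>R \<circ> Phi\<close> projects
  the whole union to the disc.\<close>

locale fibration = retract_limit Om X Mi f g D U Dk phi psi Phi h
 for Om :: "(complex ^ 2) set" and X :: "'a set" and Mi f g D U Dk phi psi Phi h +
 fixes F :: "complex \<Rightarrow> complex ^ 2" and R :: "complex ^ 2 \<Rightarrow> complex"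
 assumes holo_F: "holo F (ball 0 1)" and F_D: "F ` ball 0 1 \<subseteq> D" and holo_R: "holo R D"
  and R_ball: "R ` D \<subseteq> ball 0 1" and R_F: "\<And>ze. ze \<in> ball 0 1 \<Longrightarrow> R (F ze) = ze"
  and F_R: "\<And>z. z \<in> D \<Longrightarrow> F (R z) = h z"
begin

definition "pr x = R (Phi x)"

text \<open>The determinant of the tangent vector of the disc at \<open>F (R z)\<close> and the
  displacement of \<open>z\<close> from that point: a transverse coordinate that vanishes on the
  retract. With \<open>R\<close> it flattens a neighbourhood of the retract.\<close>

definition "\<tau> z = cder F (R z) 1 $ 1 * (z - F (R z)) $ 2 - cder F (R z) 1 $ 2 * (z - F (R z)) $ 1"

definition "Lam z = pt (R z) (\<tau> z)"

lemma pr_ball: "x \<in> X \<Longrightarrow> pr x \<in> ball 0 1"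
 using Phi_in R_ball by (simp add: pr_def image_subset_iff)

lemma holo_pr: "holo_out pr X"
 unfolding pr_def by (rule holo_out_compose[OF holo_Phi holo_R]) (use Phi_in in blast)

lemma F_pr: "x \<in> X \<Longrightarrow> F (pr x) = Phi x"
 using F_R[OF Phi_in] h_Phi by (simp add: pr_def)

lemma holo_FR: "holo (\<lambda>z. F (R z)) D"
 by (rule holo_compose[OF holo_R holo_F R_ball])

lemma holo_dFR: "holo (\<lambda>z. cder F (R z) 1 $ i) D"
 by (rule holo_vec_nth[OF holo_compose[OF holo_R holo_cder[OF open_ball holo_F] R_ball]])

lemma holo_\<tau>: "holo \<tau> D"
 unfolding \<tau>_def by (intro holo_diff holo_mult holo_dFR holo_vec_nth holo_FR holo_ident)

lemma holo_Lam: "holo Lam D"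
 unfolding Lam_def by (intro holo_pt holo_R holo_\<tau>)

lemma F_in: "ze \<in> ball 0 1 \<Longrightarrow> F ze \<in> D" using F_D by blast

lemma Lam_F: "ze \<in> ball 0 1 \<Longrightarrow> Lam (F ze) = pt ze 0"
 by (simp add: Lam_def \<tau>_def R_F)

lemma cder_R_F: assumes ze: "ze \<in> ball 0 1" shows "cder R (F ze) (cder F ze 1) = 1"
proof -
 have "cder R (F ze) (cder F ze 1) = cder (\<lambda>t. R (F t)) ze 1"
  by (rule cder_compose[OF holo_F holo_R ze F_in[OF ze], symmetric])
 also have "cder (\<lambda>t. R (F t)) ze = cder (\<lambda>t. t) ze"
  by (rule cder_cong[OF open_ball ze _ holo_ident, symmetric]) (simp add: R_F)
 also have "\<dots> = (\<lambda>v. v)" by (rule cder_eqI) simp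
 finally show ?thesis by simp
qed

lemma has_derivative_mult_zero:
 fixes a b :: "'z::real_normed_vector \<Rightarrow> complex"
 assumes "(a has_derivative a') (at z)" "(b has_derivative b') (at z)" "b z = 0"
 shows "((\<lambda>z. a z * b z) has_derivative (\<lambda>v. a z * b' v)) (at z)"
 using has_derivative_mult[OF assms(1,2)] assms(3) by simp

text \<open>A kernel vector \<open>v\<close> is killed by the derivative of \<open>R\<close>, so
  \<open>\<tau>\<close> sees \<open>v\<close> itself as displacement; \<open>v\<close> is then
  parallel to the tangent vector of \<open>F\<close>, on which the derivative of \<open>R\<close> is
  injective.\<close>

lemma inj_cder_Lam:
 assumes ze: "ze \<in> ball 0 1" shows "inj (cder Lam (F ze))"
proof -
 let ?z = "F ze" and ?a = "cder F ze 1"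
 have zD: "?z \<in> D" by (rule F_in[OF ze])
 have "v = 0" if v: "cder Lam ?z v = 0" for v
 proof -
  have dL: "((\<lambda>z. Lam z $ i) has_derivative (\<lambda>w. cder Lam ?z w $ i)) (at ?z)" for i
   by (rule bounded_linear.has_derivative[OF bounded_linear_vec_nth holoD(1)[OF holo_Lam zD]])
  have "cder R ?z w = cder Lam ?z w $ 1" "cder \<tau> ?z w = cder Lam ?z w $ 2" for w
   using cder_eqI[OF dL[of 1]] cder_eqI[OF dL[of 2]] by (simp_all add: Lam_def)
  with v have Rv: "cder R ?z v = 0" and \<tau>v: "cder \<tau> ?z v = 0" by auto
  let ?c = "\<lambda>z. z - F (R z)"
  have dc: "((\<lambda>z. ?c z $ i) has_derivative (\<lambda>v. (v - cder F ze (cder R ?z v)) $ i)) (at ?z)" for i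
  proof -
   have "((\<lambda>z. F (R z)) has_derivative (\<lambda>v. cder F (R ?z) (cder R ?z v))) (at ?z)"
    by (rule has_derivative_compose[OF holoD(1)[OF holo_R zD] holoD(1)[OF holo_F]])
      (use ze in \<open>simp add: R_F\<close>)
   hence "(?c has_derivative (\<lambda>v. v - cder F ze (cder R ?z v))) (at ?z)"
    using has_derivative_diff[OF has_derivative_ident] ze by (simp add: R_F)
   thus ?thesis by (rule bounded_linear.has_derivative[OF bounded_linear_vec_nth])
  qed
  have c0: "?c ?z $ i = 0" for i using ze by (simp add: R_F)
  have "(\<tau> has_derivative (\<lambda>v. cder F (R ?z) 1 $ 1 * (v - cder F ze (cder R ?z v)) $ 2
    - cder F (R ?z) 1 $ 2 * (v - cder F ze (cder R ?z v)) $ 1)) (at ?z)"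
   unfolding \<tau>_def
   by (rule has_derivative_diff[OF has_derivative_mult_zero[OF holoD(1)[OF holo_dFR zD] dc c0]
      has_derivative_mult_zero[OF holoD(1)[OF holo_dFR zD] dc c0]])
  from cder_eqI[OF this] \<tau>v Rv
  have "?a $ 1 * v $ 2 - ?a $ 2 * v $ 1 = 0"
   using ze linear_0[OF linear_cder[OF holo_F ze]] by (simp add: R_F)
  hence det: "?a $ 1 * v $ 2 = ?a $ 2 * v $ 1" by simp
  have a: "cder R ?z ?a = 1" by (rule cder_R_F[OF ze])
  hence "?a \<noteq> 0" using linear_0[OF linear_cder[OF holo_R zD]] by auto
  have "\<exists>c. v = cs c ?a"
  proof (cases "?a $ 1 = 0")
   case True
   hence "?a $ 2 \<noteq> 0" using \<open>?a \<noteq> 0\<close> by (auto simp: pt_eq_iff)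
   thus ?thesis using det True
    by (intro exI[of _ "v $ 2 / ?a $ 2"]) (auto simp: pt_eq_iff cs_vec_def cs_complex_def)
  next
   case False
   thus ?thesis using det
    by (intro exI[of _ "v $ 1 / ?a $ 1"]) (simp add: pt_eq_iff cs_vec_def cs_complex_def field_simps)
  qed
  then obtain c where c: "v = cs c ?a" ..
  thus "v = 0" using Rv a clinearD(2)[OF holoD(2)[OF holo_R zD], of c ?a] by (simp add: cs_complex_def)
 qed
 thus ?thesis using linear_injective_0[OF linear_cder[OF holo_Lam zD]] by blast
qed

text \<open>The limit is \<open>R \<circ> h\<close>, which equals \<open>R\<close>: in the
  coordinates \<open>psi n\<close> the projection of the union tends to the one of
  \<open>D\<close>.\<close>

lemma luc_pr_psi: "luc D (\<lambda>n z. pr (psi n z)) R"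
proof -
 have "luc D (\<lambda>n z. R (Phi (psi n z))) (\<lambda>z. R (h z))"
  by (rule luc_compose[OF luc_h luc_const open_D _ holo_continuous_on[OF holo_h] holo_continuous_on[OF holo_R]])
    (use h_in in blast)
 thus ?thesis
 proof (rule luc_cong)
  show "R (h z) = R z" if "z \<in> D" for z using F_R[OF that] R_F[of "R z"] R_ball that by (metis image_subset_iff)
 qed (auto simp: pr_def intro: exI[of _ 1])
qed

text \<open>In the coordinates \<open>Lam\<close> the projection tends to the first coordinate, so
  \<open>Fn n\<close> is a small perturbation of the identity near the flat disc and can be inverted
  there; this straightens \<open>pr\<close> exactly for each \<open>n\<close>. The size
  \<open>ep\<close> is independent of \<open>n\<close>, whereas by the last clause
  \<open>\<tau> \<circ> phi n\<close> tends to zero on the union, so the fibre pieces covered grow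
  to whole fibres.\<close>

lemma bidiscs:
 assumes r: "0 < r" "r < 1"
 obtains ep P where "ep > 0"
  "\<forall>\<^sub>F n. holo_in (P n) (bidisc r ep) \<and>
   (\<forall>y\<in>bidisc r ep. P n y \<in> U n \<and> pr (P n y) = y $ 1 \<and> \<tau> (phi n (P n y)) = y $ 2)"
  "\<And>i y \<delta>. y \<in> Om \<Longrightarrow> pr (g i y) \<in> ball 0 r \<Longrightarrow> \<delta> > 0 \<Longrightarrow> \<exists>d>0. ball y d \<subseteq> Om \<and>
   (\<forall>\<^sub>F n. \<forall>z\<in>ball y d. pr (g i z) \<in> ball 0 r \<and> g i z \<in> U n \<and>
    cmod (\<tau> (phi n (g i z))) < \<delta> \<and> P n (pt (pr (g i z)) (\<tau> (phi n (g i z)))) = g i z)"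
proof -
 \<comment> \<open>Room beyond \<open>r\<close>: the inverse of a perturbed identity is obtained on
   a slightly smaller bidisc.\<close>
 define r0 where "r0 = (1 + r) / 2"
 have r0: "r < r0" "r0 < 1" using r by (auto simp: r0_def)
 define K where "K = F ` cball 0 r0"
 have cb: "cball 0 r0 \<subseteq> ball (0::complex) 1" using r0 by auto
 have K: "compact K" "K \<subseteq> D"
 proof -
  show "compact K" unfolding K_def
   by (intro compact_continuous_image continuous_on_subset[OF holo_continuous_on[OF holo_F] cb] compact_cball)
  show "K \<subseteq> D" unfolding K_def using image_mono[OF cb, of F] F_D by (rule order_trans)
 qed
 have injK: "inj_on Lam K"
 proof (rule inj_onI)
  fix x y assume "x \<in> K" "y \<in> K" and e: "Lam x = Lam y"
  then obtain a b where "a \<in> cball 0 r0" "x = F a" "b \<in> cball 0 r0" "y = F b" by (auto simp: K_def)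
  moreover from this have "Lam x = pt a 0" "Lam y = pt b 0" using Lam_F cb by blast+
  ultimately show "x = y" using e pt_nth(1) by metis
 qed
 have dK: "inj (cder Lam x)" if "x \<in> K" for x using that inj_cder_Lam cb by (auto simp: K_def)
 obtain N where N: "open N" "K \<subseteq> N" "N \<subseteq> D" "inj_on Lam N" "\<And>z. z \<in> N \<Longrightarrow> inj (cder Lam z)"
 proof (rule injective_near_compact[OF open_D holo_Lam K injK dK])
  fix N assume "open N" "K \<subseteq> N" "N \<subseteq> D" "inj_on Lam N" "\<And>z. z \<in> N \<Longrightarrow> inj (cder Lam z)"
  thus ?thesis by (rule that)
 qed
 define E where "E = inv_into N Lam"
 have E_Lam: "E (Lam z) = z" if "z \<in> N" for z using N(4) that by (simp add: E_def)
 have Lam_E: "Lam (E y) = y" "E y \<in> N" if "y \<in> Lam ` N" for y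
  using that by (auto simp: E_def f_inv_into_f inv_into_into)
 have oO: "open (Lam ` N)" and hE: "holo E (Lam ` N)"
  by (rule holo_inverse_map[OF N(1) holo_subset[OF holo_Lam N(3)] N(4,5) E_Lam]; assumption)+
 have sub: "(\<lambda>ze. pt ze 0) ` cball 0 r0 \<subseteq> Lam ` N"
 proof
  fix y assume "y \<in> (\<lambda>ze. pt ze 0) ` cball 0 r0"
  then obtain ze where "ze \<in> cball 0 r0" "y = pt ze 0" by blast
  hence "y = Lam (F ze)" "F ze \<in> N" using Lam_F[of ze] cb N(2) by (auto simp: K_def)
  thus "y \<in> Lam ` N" by blast
 qed
 have "compact ((\<lambda>ze. pt ze 0) ` cball 0 r0)"
  by (intro compact_continuous_image holo_continuous_on holo_pt) auto
 then obtain s C' where s: "s > 0" "C' \<subseteq> Lam ` N" "\<And>x. x \<in> (\<lambda>ze. pt ze 0) ` cball 0 r0 \<Longrightarrow> cball x s \<subseteq> C'"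
  by (rule compact_margin[OF _ sub oO]) blast
 define ep where "ep = s / 2"
 define C where "C = cbidisc r0 (2 * ep)"
 have ep: "ep > 0" using s by (simp add: ep_def)
 have CO: "C \<subseteq> Lam ` N"
 proof
  fix y assume y: "y \<in> C"
  have "dist (pt (y $ 1) 0) y = cmod (y $ 2)"
   using dist_pt_right[of "y $ 1" 0 "y $ 2"] by simp
  hence "y \<in> cball (pt (y $ 1) 0) s" using y by (simp add: C_def cbidisc_def ep_def)
  moreover have "pt (y $ 1) 0 \<in> (\<lambda>ze. pt ze 0) ` cball 0 r0" using y by (simp add: C_def cbidisc_def)
  ultimately show "y \<in> Lam ` N" using s(2,3) by blast
 qed
 have cC: "compact C" "convex C" unfolding C_def by (rule compact_cbidisc convex_cbidisc)+
 \<comment> \<open>A displacement of size \<open>\<rho>\<close> cannot lead from the bidisc of radii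
   \<open>r\<close>, \<open>ep\<close> out of the one of radii \<open>r0\<close>,
   \<open>2 * ep\<close>.\<close>
 define \<rho> where "\<rho> = min (r0 - r) ep"
 have \<rho>: "\<rho> > 0" using r0 ep by (simp add: \<rho>_def)
 define Fn where "Fn = (\<lambda>n y. pt (pr (psi n (E y))) (y $ 2))"
 have ED: "E ` Lam ` N \<subseteq> D" using Lam_E N(3) by blast
 have lF: "luc (Lam ` N) Fn (\<lambda>y. y)"
 proof -
  have "luc (Lam ` N) (\<lambda>n y. pr (psi n (E y))) (\<lambda>y. R (E y))"
   by (rule luc_compose[OF luc_const luc_pr_psi open_D ED holo_continuous_on[OF hE] holo_continuous_on[OF holo_R]])
  hence "luc (Lam ` N) Fn (\<lambda>y. pt (R (E y)) (y $ 2))"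
   by (simp add: luc_def Fn_def dist_pt_left)
  thus ?thesis
  proof (rule luc_cong)
   fix y assume "y \<in> Lam ` N"
   hence "Lam (E y) $ 1 = y $ 1" using Lam_E by simp
   thus "pt (R (E y)) (y $ 2) = y" by (simp add: Lam_def pt_eq_iff)
  qed (auto intro: exI[of _ 1])
 qed
 have evD: "\<forall>\<^sub>F n. E ` C' \<subseteq> Dk n" if "compact C'" "C' \<subseteq> Lam ` N" for C'
 proof (rule Dk_compact)
  show "compact (E ` C')"
   by (intro compact_continuous_image that continuous_on_subset[OF holo_continuous_on[OF hE] that(2)])
  show "E ` C' \<subseteq> D" using ED that(2) by blast
 qed
 have hFn: "holo (Fn n) C'" if "E ` C' \<subseteq> Dk n" "C' \<subseteq> Lam ` N" for n C'
  unfolding Fn_def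
  by (intro holo_pt holo_vec_nth holo_ident
    holo_compose[OF holo_subset[OF hE that(2)] holo_out_holo[OF holo_pr holo_psi] that(1)])
 \<comment> \<open>With Lipschitz constant \<open>1/2\<close> for the perturbation,
   \<open>Fn n\<close> expands distances by at least \<open>1/2\<close>, which gives injectivity of
   the map and of its derivative.\<close>
 have lip: "\<forall>\<^sub>F n. \<forall>x\<in>C. \<forall>y\<in>C. norm ((Fn n x - x) - (Fn n y - y)) \<le> 1/2 * norm (x - y)"
 proof (rule luc_lipschitz[OF oO lF holo_ident cC CO])
  show "\<forall>\<^sub>F n. holo (Fn n) C'" if "compact C'" "C' \<subseteq> Lam ` N" for C'
   using evD[OF that] by eventually_elim (rule hFn[OF _ that(2)])
 qed simp
 have close: "\<forall>\<^sub>F n. \<forall>x\<in>C. dist (Fn n x) x < \<rho>"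
  using luc_uniform[OF lF cC(1) CO] \<rho> unfolding uniform_limit_iff by blast
 define G where "G = (\<lambda>n. inv_into C (Fn n))"
 define P where "P = (\<lambda>n y. psi n (E (G n y)))"
 define V where "V = bidisc r0 (2 * ep)"
 have VC: "V \<subseteq> C" unfolding V_def C_def by (rule bidisc_subset_cbidisc)
 have expand: "1/2 * norm (x - y) \<le> norm (Fn n x - Fn n y)"
  if "norm ((Fn n x - x) - (Fn n y - y)) \<le> 1/2 * norm (x - y)" for n x y
  using that norm_triangle_sub[of "x - y" "Fn n x - Fn n y"]
  by (simp add: algebra_simps norm_minus_commute)
 have injFn: "inj_on (Fn n) C"
  if l: "\<forall>x\<in>C. \<forall>y\<in>C. norm ((Fn n x - x) - (Fn n y - y)) \<le> 1/2 * norm (x - y)" for n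
 proof (rule inj_onI)
  fix x y assume xy: "x \<in> C" "y \<in> C" "Fn n x = Fn n y"
  have "1/2 * norm (x - y) \<le> norm (Fn n x - Fn n y)" by (rule expand) (use l xy in blast)
  thus "x = y" using xy(3) by simp
 qed
 have ev1: "\<forall>\<^sub>F n. holo_in (P n) (bidisc r ep) \<and>
   (\<forall>y\<in>bidisc r ep. P n y \<in> U n \<and> pr (P n y) = y $ 1 \<and> \<tau> (phi n (P n y)) = y $ 2)"
  using lip close evD[OF cC(1) CO]
 proof eventually_elim
  case (elim n)
  have inj: "inj_on (Fn n) C" by (rule injFn[OF elim(1)])
  have hV: "holo (Fn n) V" by (rule holo_subset[OF hFn[OF elim(3) CO] VC])
  have G: "G n (Fn n x) = x" if "x \<in> C" for x using inj that by (simp add: G_def)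
  have GV: "holo (G n) (Fn n ` V)"
  proof (rule holo_inverse_map(2)[OF _ hV])
   show "open V" by (simp add: V_def open_bidisc)
   show "inj_on (Fn n) V" by (rule inj_on_subset[OF inj VC])
   show "inj (cder (Fn n) x)" if x: "x \<in> V" for x
   proof (rule expanding_inj_cder[OF _ hV x, of "1/2"])
    show "open V" by (simp add: V_def open_bidisc)
    show "1/2 * norm (x - y) \<le> norm (Fn n x - Fn n y)" if "x \<in> V" "y \<in> V" for x y
     by (rule expand) (use elim(1) VC that in blast)
   qed simp
   show "G n (Fn n x) = x" if "x \<in> V" for x using G VC that by blast
  qed
  \<comment> \<open>Brouwer's theorem on a ball of radius \<open>\<rho>\<close> around the
    target.\<close>
  have cover: "\<exists>x\<in>V. Fn n x = y" if y: "y \<in> bidisc r ep" for y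
  proof -
   have bV: "cball y \<rho> \<subseteq> V"
   proof
    fix x assume x: "x \<in> cball y \<rho>"
    have 1: "cmod (x $ i) \<le> cmod (y $ i) + \<rho>" for i
     using x dist_nth[of y i x] norm_triangle_sub[of "x $ i" "y $ i"] by (simp add: dist_norm norm_minus_commute)
    show "x \<in> V" using y 1[of 1] 1[of 2] by (auto simp: V_def bidisc_def \<rho>_def)
   qed
   obtain x where "x \<in> cball y \<rho>" "x + (Fn n x - x) = y"
   proof (rule perturbation_surj[of y \<rho> "\<lambda>x. Fn n x - x"])
    show "continuous_on (cball y \<rho>) (\<lambda>x. Fn n x - x)"
     by (intro continuous_intros holo_continuous_on holo_subset[OF hV bV])
    show "norm (Fn n x - x) \<le> \<rho>" if "x \<in> cball y \<rho>" for x
     using elim(2) bV VC that by (force simp: dist_norm less_imp_le)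
   qed (use \<rho> in auto)
   thus ?thesis using bV by (auto intro: bexI[of _ x])
  qed
  have GQ: "G n y \<in> V" "Fn n (G n y) = y" if y: "y \<in> bidisc r ep" for y
  proof -
   obtain x where x: "x \<in> V" "Fn n x = y" using cover[OF y] by blast
   hence "G n y = x" using G VC by blast
   thus "G n y \<in> V" "Fn n (G n y) = y" using x by auto
  qed
  have QV: "bidisc r ep \<subseteq> Fn n ` V" using cover by blast
  have EGD: "E (G n y) \<in> Dk n" if "y \<in> bidisc r ep" for y using GQ(1)[OF that] VC elim(3) by blast
  have "holo (\<lambda>y. E (G n y)) (bidisc r ep)"
   by (rule holo_compose[OF holo_subset[OF GV QV] hE]) (use GQ VC CO in blast)
  hence "holo_in (P n) (bidisc r ep)"
   unfolding P_def by (rule holo_in_compose[OF holo_psi _ open_bidisc open_Dk]) (use EGD in blast)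
  moreover have "P n y \<in> U n \<and> pr (P n y) = y $ 1 \<and> \<tau> (phi n (P n y)) = y $ 2" if y: "y \<in> bidisc r ep" for y
  proof (intro conjI)
   show "P n y \<in> U n" unfolding P_def by (rule psi_in[OF EGD[OF y]])
   have 1: "Fn n (G n y) $ 1 = y $ 1" "Fn n (G n y) $ 2 = y $ 2" using GQ(2)[OF y] by auto
   thus "pr (P n y) = y $ 1" by (simp add: P_def Fn_def)
   have "\<tau> (phi n (P n y)) = Lam (E (G n y)) $ 2" using phi_psi[OF EGD[OF y]] by (simp add: P_def Lam_def)
   also have "\<dots> = G n y $ 2" using Lam_E(1) GQ(1)[OF y] VC CO by (metis subsetD)
   finally show "\<tau> (phi n (P n y)) = y $ 2" using 1 by (simp add: Fn_def)
  qed
  ultimately show ?case by blast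
 qed
 \<comment> \<open>\<open>Lam (phi n x)\<close> tends to \<open>pt (pr x) 0\<close>, so each point
   eventually falls into the region where \<open>Fn n\<close> was inverted.\<close>
 have ev2: "\<exists>d>0. ball y d \<subseteq> Om \<and>
   (\<forall>\<^sub>F n. \<forall>z\<in>ball y d. pr (g i z) \<in> ball 0 r \<and> g i z \<in> U n \<and>
    cmod (\<tau> (phi n (g i z))) < \<delta> \<and> P n (pt (pr (g i z)) (\<tau> (phi n (g i z)))) = g i z)"
  if y: "y \<in> Om" "pr (g i y) \<in> ball 0 r" and \<delta>: "\<delta> > 0" for i y \<delta>
 proof -
  have gX: "g i z \<in> X" if "z \<in> Om" for z using g_in Mi_X that by blast
  define S where "S = {z \<in> Om. g i z \<in> {x \<in> {x \<in> X. Phi x \<in> N}. pr x \<in> ball 0 r}}"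
  have oS: "open S"
   unfolding S_def
   by (rule openM_vimage_in[OF holo_in_g openM_vimage_out[OF openM_vimage_out[OF openM_X holo_Phi N(1)]
      holo_out_subset[OF holo_pr] open_ball] open_Om]) blast
  have SOm: "S \<subseteq> Om" by (auto simp: S_def)
  have PhiN: "Phi (g i y) \<in> N"
  proof -
   have "pr (g i y) \<in> cball 0 r0" using y(2) r0 by simp
   hence "F (pr (g i y)) \<in> K" unfolding K_def by (rule imageI)
   thus ?thesis using F_pr[OF gX[OF y(1)]] N(2) by auto
  qed
  have yS: "y \<in> S" using y gX PhiN by (simp add: S_def)
  have l1: "luc S (\<lambda>n z. phi n (g i z)) (\<lambda>z. Phi (g i z))" by (rule luc_subset[OF luc_phi_g SOm])
  have c1: "continuous_on S (\<lambda>z. Phi (g i z))"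
   by (rule continuous_on_subset[OF holo_continuous_on[OF holo_Phi_g] SOm])
  have l2: "luc S (\<lambda>n z. Lam (phi n (g i z))) (\<lambda>z. Lam (Phi (g i z)))"
   by (rule luc_compose[OF l1 luc_const open_D _ c1 holo_continuous_on[OF holo_Lam]])
     (use Phi_g_in SOm in blast)
  have LamPhi: "Lam (Phi (g i z)) = pt (pr (g i z)) 0" if "z \<in> S" for z
  proof -
   have "z \<in> Om" using that SOm by blast
   thus ?thesis using F_pr[OF gX, of z] Lam_F[OF pr_ball[OF gX], of z] by simp
  qed
  define e where "e = min \<delta> \<rho>"
  have e: "e > 0" "e \<le> \<delta>" "e \<le> \<rho>" using \<delta> \<rho> by (auto simp: e_def)
  obtain d1 where d1: "d1 > 0" "\<forall>\<^sub>F n. \<forall>z\<in>ball y d1 \<inter> S. dist (Lam (phi n (g i z))) (Lam (Phi (g i z))) < e"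
   using lucD[OF l2 yS e(1)] by blast
  obtain q where q: "q > 0" "ball (Phi (g i y)) q \<subseteq> N" using N(1) PhiN open_contains_ball by blast
  obtain d2 where d2: "d2 > 0" "\<forall>\<^sub>F n. \<forall>z\<in>ball y d2 \<inter> S. dist (phi n (g i z)) (Phi (g i z)) < q / 2"
   using lucD[OF l1 yS, of "q/2"] q(1) by auto
  obtain d3 where d3: "d3 > 0" "\<And>z. z \<in> S \<Longrightarrow> dist z y < d3 \<Longrightarrow> dist (Phi (g i z)) (Phi (g i y)) < q / 2"
   using c1 yS q(1) unfolding continuous_on_iff by (metis half_gt_zero)
  obtain d4 where d4: "d4 > 0" "\<forall>\<^sub>F n. g i ` ball y d4 \<subseteq> U n"
   using exh_U y(1) unfolding exhM_def by blast
  obtain d5 where d5: "d5 > 0" "ball y d5 \<subseteq> S" using oS yS open_contains_ball by blast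
  define d where "d = min (min d1 d2) (min (min d3 d4) d5)"
  have d: "d > 0" "ball y d \<subseteq> S" using d1 d2 d3 d4 d5 by (auto simp: d_def)
  have "\<forall>\<^sub>F n. \<forall>z\<in>ball y d. pr (g i z) \<in> ball 0 r \<and> g i z \<in> U n \<and>
    cmod (\<tau> (phi n (g i z))) < \<delta> \<and> P n (pt (pr (g i z)) (\<tau> (phi n (g i z)))) = g i z"
   using d1(2) d2(2) d4(2) lip
  proof eventually_elim
   case (elim n)
   show ?case
   proof
    fix z assume z: "z \<in> ball y d"
    have zS: "z \<in> S" using z d by blast
    have zU: "g i z \<in> U n" using elim(3) z by (auto simp: d_def)
    let ?w = "phi n (g i z)"
    have prz: "pr (g i z) \<in> ball 0 r" using zS by (simp add: S_def)
    have "dist ?w (Phi (g i z)) < q / 2" using elim(2) z zS by (auto simp: d_def)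
    moreover have "dist (Phi (g i z)) (Phi (g i y)) < q / 2" using d3(2)[OF zS] z by (auto simp: d_def dist_commute)
    ultimately have "?w \<in> ball (Phi (g i y)) q"
     using dist_triangle[of "Phi (g i y)" ?w "Phi (g i z)"] by (simp add: dist_commute)
    hence wN: "?w \<in> N" using q by blast
    have "z \<in> ball y d1 \<inter> S" using z zS by (simp add: d_def)
    hence Ld: "dist (Lam ?w) (pt (pr (g i z)) 0) < e" using elim(1) LamPhi[OF zS] by metis
    have L1: "dist (Lam ?w $ 1) (pr (g i z)) < e" "dist (Lam ?w $ 2) 0 < e"
     using le_less_trans[OF dist_nth[of "Lam ?w" 1 "pt (pr (g i z)) 0"] Ld]
      le_less_trans[OF dist_nth[of "Lam ?w" 2 "pt (pr (g i z)) 0"] Ld] by simp_all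
    have "cmod (Lam ?w $ 1) \<le> r0"
     using L1(1) prz e(3) norm_triangle_sub[of "Lam ?w $ 1" "pr (g i z)"] by (simp add: \<rho>_def dist_norm)
    moreover have "cmod (Lam ?w $ 2) \<le> 2 * ep" using L1(2) e(3) ep by (simp add: \<rho>_def)
    ultimately have LC: "Lam ?w \<in> C" by (simp add: C_def cbidisc_def)
    have "Fn n (Lam ?w) = pt (pr (g i z)) (\<tau> ?w)"
     using E_Lam[OF wN] psi_phi[OF zU] by (simp add: Fn_def) (simp add: Lam_def)
    hence "G n (pt (pr (g i z)) (\<tau> ?w)) = Lam ?w"
     using injFn[OF elim(4)] LC unfolding G_def by (metis inv_into_f_f)
    hence "P n (pt (pr (g i z)) (\<tau> ?w)) = g i z"
     using E_Lam[OF wN] psi_phi[OF zU] by (simp add: P_def)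
    moreover have "cmod (\<tau> ?w) < \<delta>" using L1(2) e(2) by (simp add: Lam_def)
    ultimately show "pr (g i z) \<in> ball 0 r \<and> g i z \<in> U n \<and> cmod (\<tau> ?w) < \<delta> \<and>
      P n (pt (pr (g i z)) (\<tau> ?w)) = g i z" using prz zU by blast
   qed
  qed
  thus ?thesis using d SOm by (intro exI[of _ d]) blast
 qed
 show ?thesis by (rule that[OF ep ev1 ev2])
qed

end

section \<open>Unions of increasing bidiscs over a fixed disc\<close>

lemma slice_deriv:
 assumes "holo \<Phi> S" "pt ze v \<in> S"
 shows "((\<lambda>v. \<Phi> (pt ze v) :: complex) has_field_derivative cder \<Phi> (pt ze v) (pt 0 1)) (at v)"
proof -
 have e: "pt ze v = pt ze 0 + cs v (pt 0 1)" for v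
  by (simp add: pt_eq_iff cs_vec_def cs_complex_def)
 have "((\<lambda>v. \<Phi> (pt ze 0 + cs v (pt 0 1))) has_derivative (\<lambda>s. cder \<Phi> (pt ze v) (cs s (pt 0 1)))) (at v)"
  by (rule has_derivative_compose[OF cder_line, of \<Phi> "cder \<Phi> (pt ze v)"])
    (use holoD(1)[OF assms] in \<open>simp only: e[symmetric]\<close>)
 moreover have "(\<lambda>s. cder \<Phi> (pt ze v) (cs s (pt 0 1))) = (*) (cder \<Phi> (pt ze v) (pt 0 1))"
  using clinearD(2)[OF holoD(2)[OF assms]] by (simp add: fun_eq_iff cs_complex_def mult.commute)
 ultimately show ?thesis unfolding has_field_derivative_def e[symmetric] by simp
qed

lemma holo_pt_line: "holo (\<lambda>v. pt ze v) S" "holo (\<lambda>v. pt v ze) S"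
 by (intro holo_pt holo_const holo_ident)+

lemma (in union_of_copies) holo_in_cong:
 assumes "holo_in G S" "\<And>s. s \<in> S \<Longrightarrow> G s = G' s"
 shows "holo_in G' S"
proof -
 have eq: "{s \<in> S. G' s \<in> Mi i} = {s \<in> S. G s \<in> Mi i}" for i using assms(2) by auto
 have "holo (\<lambda>s. f i (G' s)) {s \<in> S. G s \<in> Mi i}" for i
  by (rule holo_cong[OF holo_in_D(2,1)[OF assms(1)]]) (simp add: assms(2))
 moreover have "G' ` S \<subseteq> X" using assms by (force simp: holo_in_def)
 ultimately show ?thesis using holo_in_D(1)[OF assms(1)] by (simp add: holo_in_def eq)
qed

text \<open>What remains of the geometry: bidiscs \<open>P n\<close> of one fixed size, compatible
  with \<open>pr\<close>, whose fibre coordinate \<open>w n\<close> tends to zero at every point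
  over the disc. Hence the \<open>P n\<close> capture more and more of each fibre.\<close>

locale bidisc_exhaustion = union_of_copies Om X Mi f g
 for Om :: "'v::complex_euclidean set" and X :: "'a set" and Mi f g +
 fixes pr :: "'a \<Rightarrow> complex" and r ep :: real and U :: "nat \<Rightarrow> 'a set"
  and P :: "nat \<Rightarrow> complex ^ 2 \<Rightarrow> 'a" and w :: "nat \<Rightarrow> 'a \<Rightarrow> complex"
 assumes r_pos: "r > 0" and ep_pos: "ep > 0" and holo_pr: "holo_out pr X"
  and openM_U: "\<And>n. openM (U n)" and holo_w: "\<And>n. holo_out (w n) (U n)"
  and holo_P: "\<And>n. holo_in (P n) (bidisc r ep)" and P_U: "\<And>n y. y \<in> bidisc r ep \<Longrightarrow> P n y \<in> U n"
  and pr_P: "\<And>n y. y \<in> bidisc r ep \<Longrightarrow> pr (P n y) = y $ 1" and w_P: "\<And>n y. y \<in> bidisc r ep \<Longrightarrow> w n (P n y) = y $ 2"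
  and exh: "\<And>i y \<delta>. y \<in> Om \<Longrightarrow> pr (g i y) \<in> ball 0 r \<Longrightarrow> \<delta> > 0 \<Longrightarrow> \<exists>d>0. ball y d \<subseteq> Om \<and>
   (\<forall>\<^sub>F n. \<forall>z\<in>ball y d. pr (g i z) \<in> ball 0 r \<and> g i z \<in> U n \<and>
    cmod (w n (g i z)) < \<delta> \<and> P n (pt (pr (g i z)) (w n (g i z))) = g i z)"
begin

definition "Xr = {x \<in> X. pr x \<in> ball 0 r}"

definition "good n \<delta> x \<longleftrightarrow> x \<in> U n \<and> cmod (w n x) < \<delta> \<and> P n (pt (pr x) (w n x)) = x"

lemma openM_Xr: "openM Xr"
 unfolding Xr_def by (rule openM_vimage_out[OF openM_X holo_pr open_ball])

lemma Xr_X: "Xr \<subseteq> X" by (auto simp: Xr_def)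

lemma P_Xr: "y \<in> bidisc r ep \<Longrightarrow> P n y \<in> Xr"
 using holo_in_D(3)[OF holo_P] pr_P by (auto simp: Xr_def bidisc_def)

lemma good_mono: "good n \<delta> x \<Longrightarrow> \<delta> \<le> \<delta>' \<Longrightarrow> good n \<delta>' x"
 by (auto simp: good_def)

lemma exh_in:
 assumes G: "holo_in G S" "open S" "G ` S \<subseteq> Xr" and s: "s \<in> S" and \<delta>: "\<delta> > 0"
 shows "\<exists>d>0. ball s d \<subseteq> S \<and> (\<forall>\<^sub>F n. \<forall>t\<in>ball s d. good n \<delta> (G t))"
proof -
 obtain i where i: "G s \<in> Mi i" using G s holo_in_D(3) UN_Mi by blast
 let ?T = "{s \<in> S. G s \<in> Mi i}"
 have sT: "s \<in> ?T" using i s by auto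
 have "pr (g i (f i (G s))) \<in> ball 0 r" using gf[OF i] G(3) s by (auto simp: Xr_def)
 from exh[OF f_in[OF i] this \<delta>] obtain d where d: "d > 0"
  "\<forall>\<^sub>F n. \<forall>z\<in>ball (f i (G s)) d. pr (g i z) \<in> ball 0 r \<and> g i z \<in> U n \<and>
    cmod (w n (g i z)) < \<delta> \<and> P n (pt (pr (g i z)) (w n (g i z))) = g i z" by (elim exE conjE) (rule that; assumption)
 have "open (?T \<inter> (\<lambda>s. f i (G s)) -` ball (f i (G s)) d)"
  by (rule continuous_open_preimage[OF holo_continuous_on[OF holo_in_D(2)[OF G(1)]] holo_in_D(1)[OF G(1)] open_ball])
 moreover have "s \<in> ?T \<inter> (\<lambda>s. f i (G s)) -` ball (f i (G s)) d" using sT d(1) by auto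
 ultimately obtain e where e: "e > 0" "ball s e \<subseteq> ?T \<inter> (\<lambda>s. f i (G s)) -` ball (f i (G s)) d"
  using open_contains_ball by metis
 have "\<forall>\<^sub>F n. \<forall>t\<in>ball s e. good n \<delta> (G t)"
  using d(2)
 proof eventually_elim
  case (elim n)
  show ?case
  proof
   fix t assume "t \<in> ball s e"
   hence t: "G t \<in> Mi i" "f i (G t) \<in> ball (f i (G s)) d" using e(2) by auto
   thus "good n \<delta> (G t)" using bspec[OF elim t(2)] by (simp add: gf good_def)
  qed
 qed
 with e show ?thesis by blast
qed

lemma exh_compact:
 assumes G: "holo_in G S" "open S" "G ` S \<subseteq> Xr" and K: "compact K" "K \<subseteq> S" and \<delta>: "\<delta> > 0"
 shows "\<forall>\<^sub>F n. \<forall>t\<in>K. good n \<delta> (G t)"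
proof (rule eventually_compact_ball[OF K(1), of "\<lambda>n A. \<forall>t\<in>A. good n \<delta> (G t)"])
 fix s assume "s \<in> K"
 thus "\<exists>r>0. \<forall>\<^sub>F n. \<forall>t\<in>ball s r. good n \<delta> (G t)"
  using exh_in[OF G subsetD[OF K(2)] \<delta>] by blast
qed auto

lemma exh_point:
 assumes "x \<in> Xr" "\<delta> > 0" shows "\<forall>\<^sub>F n. good n \<delta> x"
proof -
 obtain i where i: "x \<in> Mi i" using assms(1) Xr_X UN_Mi by blast
 have "pr (g i (f i x)) \<in> ball 0 r" using assms(1) gf[OF i] by (simp add: Xr_def)
 from exh[OF f_in[OF i] this assms(2)] obtain d where d: "d > 0"
  "\<forall>\<^sub>F n. \<forall>z\<in>ball (f i x) d. pr (g i z) \<in> ball 0 r \<and> g i z \<in> U n \<and>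
    cmod (w n (g i z)) < \<delta> \<and> P n (pt (pr (g i z)) (w n (g i z))) = g i z"
  by (elim exE conjE) (rule that; assumption)
 from d(2) show ?thesis
 proof eventually_elim
  case (elim n)
  from bspec[OF elim, of "f i x"] d(1) show ?case by (simp add: gf[OF i] good_def)
 qed
qed

text \<open>A holomorphic section of the projection; it will be the zero of the normalized fibre
  coordinates.\<close>

definition "s ze = P 0 (pt ze 0)"
definition "c n ze = w n (s ze)"
definition "d n ze = cder (\<lambda>y. w n (P 0 y)) (pt ze 0) (pt 0 1)"
text \<open>The coordinates \<open>w n\<close> collapse to zero, so they are normalized affinely on
  each fibre: zero on the section \<open>s\<close>, and derivative one there with respect to the
  fibre coordinate of \<open>P 0\<close>.\<close>

definition "T n x = (w n x - c n (pr x)) / d n (pr x)"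

definition tube :: "complex \<Rightarrow> real \<Rightarrow> (complex ^ 2) set" where "tube ze e = {y :: complex ^ 2. y $ 1 \<in> cball ze e \<and> cmod (y $ 2) \<le> ep / 2}"

lemma tube_compact: "compact (tube ze e)"
proof -
 have "tube ze e = (\<lambda>y. pt (ze + y $ 1) (y $ 2)) ` cbidisc e (ep / 2)"
 proof
  show "tube ze e \<subseteq> (\<lambda>y. pt (ze + y $ 1) (y $ 2)) ` cbidisc e (ep / 2)"
  proof
   fix y assume "y \<in> tube ze e"
   hence "y = pt (ze + pt (y $ 1 - ze) (y $ 2) $ 1) (pt (y $ 1 - ze) (y $ 2) $ 2)"
    "pt (y $ 1 - ze) (y $ 2) \<in> cbidisc e (ep / 2)"
    by (auto simp: tube_def cbidisc_def dist_norm norm_minus_commute pt_eq_iff)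
   thus "y \<in> (\<lambda>y. pt (ze + y $ 1) (y $ 2)) ` cbidisc e (ep / 2)" by (rule image_eqI)
  qed
 qed (auto simp: tube_def cbidisc_def dist_norm)
 thus ?thesis
  by (auto intro!: compact_continuous_image compact_cbidisc holo_continuous_on holo_pt holo_add holo_vec_nth)
qed

lemma tube_bidisc: "cball ze e \<subseteq> ball 0 r \<Longrightarrow> tube ze e \<subseteq> bidisc r ep"
 using ep_pos by (auto simp: tube_def bidisc_def subset_iff)

definition "good_at j ze e \<longleftrightarrow> (\<forall>y\<in>tube ze e. good j (ep / 8) (P 0 y))"

lemma P_image: "P n ` bidisc r ep \<subseteq> Xr" using P_Xr by blast

lemma eventually_good_at: "cball ze e \<subseteq> ball 0 r \<Longrightarrow> \<forall>\<^sub>F j. good_at j ze e"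
 unfolding good_at_def
 by (rule exh_compact[OF holo_P open_bidisc P_image tube_compact tube_bidisc]) (use ep_pos in auto)

lemma eventually_good_P: "cball ze e \<subseteq> ball 0 r \<Longrightarrow> \<forall>\<^sub>F n. \<forall>y\<in>tube ze e. good n ep (P j y)"
 by (rule exh_compact[OF holo_P open_bidisc P_image tube_compact tube_bidisc ep_pos])

definition "V n j = {y \<in> bidisc r ep. P j y \<in> U n}"

lemma open_V: "open (V n j)"
 unfolding V_def by (rule openM_vimage_in[OF holo_P openM_U open_bidisc])

lemma holo_wP: "holo (\<lambda>y. w n (P j y)) (V n j)"
 by (rule holo_in_out[OF openM_U holo_in_subset[OF holo_P open_V] holo_w]) (auto simp: V_def)

lemma tube_V: "cball ze e \<subseteq> ball 0 r \<Longrightarrow> \<forall>y\<in>tube ze e. good n \<delta> (P j y) \<Longrightarrow> tube ze e \<subseteq> V n j"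
 using tube_bidisc[of ze e] unfolding V_def good_def by blast

context
 fixes ze0 e j n
 assumes sub: "cball ze0 e \<subseteq> ball 0 r" and gn: "\<forall>y\<in>tube ze0 e. good n ep (P j y)"
begin

lemma in_tube: "ze \<in> cball ze0 e \<Longrightarrow> cmod v \<le> ep / 2 \<Longrightarrow> pt ze v \<in> tube ze0 e"
 by (simp add: tube_def)

lemma in_bidisc: "ze \<in> cball ze0 e \<Longrightarrow> cmod v \<le> ep / 2 \<Longrightarrow> pt ze v \<in> bidisc r ep"
 using in_tube tube_bidisc[OF sub] by blast

lemma fibre_deriv:
 assumes ze: "ze \<in> cball ze0 e" and v: "cmod v \<le> ep / 2"
 shows "((\<lambda>v. w n (P j (pt ze v))) has_field_derivative cder (\<lambda>y. w n (P j y)) (pt ze v) (pt 0 1)) (at v)"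
 by (rule slice_deriv[OF holo_wP]) (use tube_V[OF sub gn] in_tube[OF ze v] in blast)

lemma fibre_holo: "ze \<in> cball ze0 e \<Longrightarrow> (\<lambda>v. w n (P j (pt ze v))) holomorphic_on ball 0 (ep / 2)"
 unfolding holomorphic_on_open[OF open_ball]
 by (intro ballI exI, rule fibre_deriv) simp_all

text \<open>Over a common base point \<open>P n\<close> recovers a point from its value of
  \<open>w n\<close>, and \<open>w j\<close> then recovers the parameter.\<close>

lemma fibre_inj: assumes ze: "ze \<in> cball ze0 e" shows "inj_on (\<lambda>v. w n (P j (pt ze v))) (ball 0 (ep / 2))"
proof (rule inj_onI)
 fix u v assume uv: "u \<in> ball 0 (ep / 2)" "v \<in> ball 0 (ep / 2)" "w n (P j (pt ze u)) = w n (P j (pt ze v))"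
 have b: "pt ze u \<in> tube ze0 e" "pt ze v \<in> tube ze0 e" using in_tube[OF ze] uv by simp_all
 have bb: "pt ze u \<in> bidisc r ep" "pt ze v \<in> bidisc r ep" using b tube_bidisc[OF sub] by auto
 have "P n (pt (pr (P j (pt ze y))) (w n (P j (pt ze y)))) = P j (pt ze y)" if "pt ze y \<in> tube ze0 e" for y
  using bspec[OF gn that] by (simp add: good_def)
 from this[OF b(1)] this[OF b(2)] have "P j (pt ze u) = P j (pt ze v)"
  by (simp only: pr_P[OF bb(1)] pr_P[OF bb(2)] uv(3) pt_nth)
 hence "w j (P j (pt ze u)) = w j (P j (pt ze v))" by (rule arg_cong)
 thus "u = v" by (simp only: w_P[OF bb(1)] w_P[OF bb(2)] pt_nth)
qed

end

lemma base:
 assumes sub: "cball ze0 e \<subseteq> ball 0 r" and gj: "good_at j ze0 e" and ze: "ze \<in> cball ze0 e"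
 shows "cmod (c j ze) < ep / 8" "P j (pt ze (c j ze)) = s ze"
proof -
 have b: "pt ze 0 \<in> tube ze0 e" using ze ep_pos by (simp add: tube_def)
 have "good j (ep / 8) (P 0 (pt ze 0))" using gj b by (simp add: good_at_def)
 moreover have "pr (P 0 (pt ze 0)) = ze" using pr_P tube_bidisc[OF sub] b by force
 ultimately show "cmod (c j ze) < ep / 8" "P j (pt ze (c j ze)) = s ze" by (simp_all add: good_def c_def s_def)
qed

lemma good_at_good: "good_at j ze0 e \<Longrightarrow> \<forall>y\<in>tube ze0 e. good j ep (P 0 y)"
 using good_mono[of j "ep / 8" _ ep] ep_pos by (simp add: good_at_def)

lemma d_nonzero:
 assumes sub: "cball ze0 e \<subseteq> ball 0 r" and gj: "good_at j ze0 e" and ze: "ze \<in> cball ze0 e"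
 shows "((\<lambda>v. w j (P 0 (pt ze v))) has_field_derivative d j ze) (at 0)" "d j ze \<noteq> 0"
proof -
 show D: "((\<lambda>v. w j (P 0 (pt ze v))) has_field_derivative d j ze) (at 0)"
  unfolding d_def by (rule fibre_deriv[OF sub good_at_good[OF gj] ze]) (use ep_pos in simp)
 show "d j ze \<noteq> 0"
  using holomorphic_injective_imp_regular[OF fibre_holo[OF sub good_at_good[OF gj] ze] open_ball
    fibre_inj[OF sub good_at_good[OF gj] ze], of 0] DERIV_imp_deriv[OF D] ep_pos by simp
qed

text \<open>The derivative at the section is \<open>1 / d j\<close> for every \<open>n\<close>:
  passing from \<open>P 0\<close> to \<open>P j\<close> is the coordinate change
  \<open>w j \<circ> P 0\<close>, with derivative \<open>d j\<close>, and \<open>T n\<close> has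
  derivative one with respect to \<open>P 0\<close>. This independence of \<open>n\<close> yields
  normality and a limit with known derivative.\<close>

lemma T_fibre:
 assumes sub: "cball ze0 e \<subseteq> ball 0 r" and gj: "good_at j ze0 e" and ze: "ze \<in> cball ze0 e"
  and gn: "\<forall>y\<in>tube ze0 e. good n ep (P j y)" and gn0: "good_at n ze0 e"
 shows "(\<lambda>v. T n (P j (pt ze v))) holomorphic_on ball 0 (ep / 2)" (is "?t holomorphic_on _")
  "inj_on (\<lambda>v. T n (P j (pt ze v))) (ball 0 (ep / 2))" "T n (P j (pt ze (c j ze))) = 0"
  "((\<lambda>v. T n (P j (pt ze v))) has_field_derivative 1 / d j ze) (at (c j ze))"
proof -
 let ?\<kappa> = "\<lambda>v. w n (P j (pt ze v))"
 have bd: "pt ze v \<in> bidisc r ep" if "cmod v \<le> ep / 2" for v using in_bidisc[OF sub gn ze that] .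
 have dn: "d n ze \<noteq> 0" by (rule d_nonzero(2)[OF sub gn0 ze])
 have cj: "cmod (c j ze) < ep / 8" "P j (pt ze (c j ze)) = s ze" by (rule base[OF sub gj ze])+
 hence cb: "c j ze \<in> ball 0 (ep / 2)" using ep_pos by simp
 have T: "?t v = (?\<kappa> v - c n ze) / d n ze" if "v \<in> ball 0 (ep / 2)" for v
  using pr_P[OF bd] that by (simp add: T_def)
 have "(\<lambda>v. (?\<kappa> v - c n ze) / d n ze) holomorphic_on ball 0 (ep / 2)"
  by (intro holomorphic_intros fibre_holo[OF sub gn ze] dn)
 thus hol: "?t holomorphic_on ball 0 (ep / 2)"
  by (rule holomorphic_transform) (simp add: T)
 show inj: "inj_on ?t (ball 0 (ep / 2))"
 proof (rule inj_onI)
  fix u v assume uv: "u \<in> ball 0 (ep / 2)" "v \<in> ball 0 (ep / 2)" "?t u = ?t v"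
  hence "?\<kappa> u = ?\<kappa> v" using dn by (simp add: T)
  thus "u = v" using inj_onD[OF fibre_inj[OF sub gn ze]] uv by blast
 qed
 show "?t (c j ze) = 0" using T[OF cb] cj by (simp add: c_def)
 define D where "D = cder (\<lambda>y. w n (P j y)) (pt ze (c j ze)) (pt 0 1)"
 have D: "(?\<kappa> has_field_derivative D) (at (c j ze))"
  unfolding D_def by (rule fibre_deriv[OF sub gn ze]) (use cb in simp)
 let ?h = "\<lambda>v. w j (P 0 (pt ze v))"
 have pz: "pr (P 0 (pt ze v)) = ze" if "v \<in> ball 0 (ep / 2)" for v using pr_P[OF bd] that by simp
 have hP: "cmod (?h v) < ep / 8 \<and> P j (pt ze (?h v)) = P 0 (pt ze v)" if "v \<in> ball 0 (ep / 2)" for v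
 proof -
  have "pt ze v \<in> tube ze0 e" using that ze by (simp add: tube_def)
  hence "good j (ep / 8) (P 0 (pt ze v))" using gj by (simp add: good_at_def)
  thus ?thesis using pz[OF that] by (simp add: good_def)
 qed
 have h0: "?h 0 = c j ze" by (simp add: c_def s_def)
 have hd: "(?h has_field_derivative d j ze) (at 0)" by (rule d_nonzero(1)[OF sub gj ze])
 \<comment> \<open>Two computations of one derivative, by the chain rule through \<open>P j\<close>
   and directly through \<open>P 0\<close>; they give \<open>D * d j ze = d n ze\<close>.\<close>
 have "((\<lambda>v. ?\<kappa> (?h v)) has_field_derivative D * d j ze) (at 0)"
  by (rule DERIV_chain2[OF _ hd]) (simp add: h0 D)
 moreover have "((\<lambda>v. ?\<kappa> (?h v)) has_field_derivative d n ze) (at 0)"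
  by (rule has_field_derivative_transform_within_open[OF d_nonzero(1)[OF sub gn0 ze] open_ball[of 0 "ep / 2"]])
    (use hP ep_pos in auto)
 ultimately have Dd: "D * d j ze = d n ze" by (rule DERIV_unique)
 have "((\<lambda>v. (?\<kappa> v - c n ze) / d n ze) has_field_derivative D / d n ze) (at (c j ze))"
  using DERIV_cdivide[OF DERIV_diff[OF D DERIV_const[of "c n ze"]], of "d n ze"] by simp
 moreover have "D / d n ze = 1 / d j ze" using Dd[symmetric] dn by simp
 ultimately have "((\<lambda>v. (?\<kappa> v - c n ze) / d n ze) has_field_derivative 1 / d j ze) (at (c j ze))" by simp
 thus "(?t has_field_derivative 1 / d j ze) (at (c j ze))"
  by (rule has_field_derivative_transform_within_open[OF _ open_ball cb]) (simp add: T)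
qed

lemma cj_ball: "cmod (c j ze) < ep / 8 \<Longrightarrow> ball (c j ze) (3/8 * ep) \<subseteq> ball 0 (ep / 2)"
proof
 fix v assume "cmod (c j ze) < ep / 8" "v \<in> ball (c j ze) (3/8 * ep)"
 thus "v \<in> ball 0 (ep / 2)"
  using norm_triangle_sub[of v "c j ze"] by (simp add: dist_norm norm_minus_commute)
qed

lemma holo_c: assumes "good_at n ze0 e" "cball ze0 e \<subseteq> ball 0 r" shows "holo (c n) (ball ze0 e)" "holo (d n) (ball ze0 e)"
proof -
 have sub: "(\<lambda>ze. pt ze 0) ` ball ze0 e \<subseteq> V n 0"
  using tube_V[OF assms(2) good_at_good[OF assms(1)]] ep_pos by (force simp: tube_def)
 show "holo (c n) (ball ze0 e)"
  unfolding c_def s_def by (rule holo_compose[OF holo_pt_line(2) holo_wP sub])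
 show "holo (d n) (ball ze0 e)"
  unfolding d_def by (rule holo_compose[OF holo_pt_line(2) holo_cder[OF open_V holo_wP] sub])
qed

text \<open>Seen through a fixed \<open>P j\<close>, \<open>T n\<close> is univalent on fibres with
  zero at \<open>c j\<close> and derivative \<open>1 / d j\<close>, so
  \<open>univalent_bound\<close> holds uniformly in \<open>n\<close>; the minimum of
  \<open>cmod (d j)\<close> over a closed disc of base points makes it locally uniform.\<close>

lemma locbdd_T: "locbdd {y \<in> Om. g i y \<in> Xr} (\<lambda>n y. T n (g i y))"
 unfolding locbdd_def
proof
 fix y assume y: "y \<in> {y \<in> Om. g i y \<in> Xr}"
 let ?ze = "pr (g i y)"
 let ?S = "{y \<in> Om. g i y \<in> Xr}"
 have oS: "open ?S" using openM_Xr by (simp add: openM_def)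
 have "?ze \<in> ball 0 r" using y by (simp add: Xr_def)
 then obtain e where e: "e > 0" "cball ?ze e \<subseteq> ball 0 r" using open_contains_cball open_ball by metis
 have G: "holo_in (g i) ?S" "g i ` ?S \<subseteq> Xr" using holo_in_subset[OF holo_in_g oS] by auto
 \<comment> \<open>With fibre coordinate below \<open>ep / 16\<close> and \<open>c j\<close> below
   \<open>ep / 8\<close>, the point is within \<open>3/16 * ep\<close> of the centre, which is half
   of the radius \<open>3/8 * ep\<close> used for univalence.\<close>
 obtain d1 where d1: "d1 > 0" "ball y d1 \<subseteq> ?S" "\<forall>\<^sub>F j. \<forall>t\<in>ball y d1. good j (ep / 16) (g i t)"
  using exh_in[OF G(1) oS G(2) y, of "ep / 16"] ep_pos by auto
 have "\<forall>\<^sub>F j. good_at j ?ze e \<and> (\<forall>t\<in>ball y d1. good j (ep / 16) (g i t))"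
  using eventually_good_at[OF e(2)] d1(3) by eventually_elim simp
 then obtain j where j: "good_at j ?ze e" "\<And>t. t \<in> ball y d1 \<Longrightarrow> good j (ep / 16) (g i t)"
  unfolding eventually_sequentially by blast
 obtain d2 where d2: "d2 > 0" "ball y d2 \<subseteq> ?S" "\<forall>\<^sub>F n. \<forall>t\<in>ball y d2. good n ep (g i t)"
  using exh_in[OF G(1) oS G(2) y ep_pos] by auto
 have hpr: "holo (\<lambda>y. pr (g i y)) ?S"
  by (rule holo_subset[OF holo_out_holo[OF holo_pr holo_in_g]]) auto
 have "open (?S \<inter> (\<lambda>y. pr (g i y)) -` ball ?ze (e / 2))"
  by (rule continuous_open_preimage[OF holo_continuous_on[OF hpr] oS open_ball])
 moreover have "y \<in> ?S \<inter> (\<lambda>y. pr (g i y)) -` ball ?ze (e / 2)" using y e(1) by simp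
 ultimately obtain d3 where d3: "d3 > 0" "ball y d3 \<subseteq> ?S \<inter> (\<lambda>y. pr (g i y)) -` ball ?ze (e / 2)"
  by (rule openE)
 define q where "q = min d1 (min d2 d3)"
 have q: "q > 0" "ball y q \<subseteq> ball y d1" "ball y q \<subseteq> ball y d2" "ball y q \<subseteq> ball y d3"
  using d1 d2 d3 by (auto simp: q_def)
 have sb: "cball ?ze (e / 2) \<subseteq> ball ?ze e" using e(1) by auto
 have "continuous_on (cball ?ze (e / 2)) (\<lambda>ze. cmod (d j ze))"
  by (intro continuous_on_norm continuous_on_subset[OF holo_continuous_on[OF holo_c(2)[OF j(1) e(2)]] sb])
 then obtain zem where zem: "zem \<in> cball ?ze (e / 2)" "\<And>ze. ze \<in> cball ?ze (e / 2) \<Longrightarrow> cmod (d j zem) \<le> cmod (d j ze)"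
 proof -
  assume c: "continuous_on (cball ?ze (e / 2)) (\<lambda>ze. cmod (d j ze))"
   and g: "\<And>zem. zem \<in> cball ?ze (e / 2) \<Longrightarrow> (\<And>ze. ze \<in> cball ?ze (e / 2) \<Longrightarrow> cmod (d j zem) \<le> cmod (d j ze)) \<Longrightarrow> thesis"
  have "cball ?ze (e / 2) \<noteq> {}" using e(1) by simp
  from continuous_attains_inf[OF compact_cball this c] show thesis by (elim bexE, intro g) (assumption, erule bspec)
 qed
 define m where "m = cmod (d j zem)"
 have m: "m > 0"
  using d_nonzero(2)[OF e(2) j(1), of zem] zem(1) e(1) by (auto simp: m_def)
 define B where "B = 2 * growth_const * (1 / m) * (3/8 * ep)"
 have "\<forall>\<^sub>F n. holo (\<lambda>y. T n (g i y)) (ball y q) \<and> (\<forall>x\<in>ball y q. norm (T n (g i x)) \<le> B)"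
  using d2(3) eventually_good_at[OF e(2)] eventually_good_P[OF e(2), of j]
 proof eventually_elim
  case (elim n)
  have prb: "pr (g i x) \<in> cball ?ze e" "pr (g i x) \<in> ball ?ze e" "pr (g i x) \<in> cball ?ze (e / 2)" if x: "x \<in> ball y q" for x
  proof -
   have "pr (g i x) \<in> ball ?ze (e / 2)" using x q(4) d3(2) by blast
   hence "dist ?ze (pr (g i x)) < e / 2" by (simp only: mem_ball)
   thus "pr (g i x) \<in> cball ?ze e" "pr (g i x) \<in> ball ?ze e" "pr (g i x) \<in> cball ?ze (e / 2)"
    using e(1) unfolding mem_ball mem_cball by linarith+
  qed
  have qS: "ball y q \<subseteq> ?S" using q(2) d1(2) by blast
  have hp: "holo (\<lambda>y. pr (g i y)) (ball y q)" by (rule holo_subset[OF hpr qS])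
  have im: "(\<lambda>y. pr (g i y)) ` ball y q \<subseteq> ball ?ze e" using prb by blast
  have "holo (\<lambda>y. T n (g i y)) (ball y q)"
   unfolding T_def
  proof (intro holo_divide holo_diff)
   show "holo (\<lambda>y. w n (g i y)) (ball y q)"
    by (rule holo_in_out[OF openM_U holo_in_subset[OF holo_in_g open_ball] holo_w])
      (use qS elim(1) q(3) in \<open>auto simp: good_def\<close>)
   show "holo (\<lambda>y. c n (pr (g i y))) (ball y q)" by (rule holo_compose[OF hp holo_c(1)[OF elim(2) e(2)] im])
   show "holo (\<lambda>y. d n (pr (g i y))) (ball y q)" by (rule holo_compose[OF hp holo_c(2)[OF elim(2) e(2)] im])
   show "d n (pr (g i x)) \<noteq> 0" if "x \<in> ball y q" for x
    by (rule d_nonzero(2)[OF e(2) elim(2) prb(1)[OF that]])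
  qed
  moreover have "norm (T n (g i x)) \<le> B" if x: "x \<in> ball y q" for x
  proof -
   let ?z = "pr (g i x)" and ?v = "w j (g i x)"
   let ?t = "\<lambda>v. T n (P j (pt ?z v))"
   note F = T_fibre[OF e(2) j(1) prb(1)[OF x] elim(3,2)]
   have cb: "cmod (c j ?z) < ep / 8" by (rule base[OF e(2) j(1) prb(1)[OF x]])
   have gd: "good j (ep / 16) (g i x)" using j(2) x q(2) by blast
   have "cmod (?t ?v) \<le> 2 * growth_const * cmod (deriv ?t (c j ?z)) * (3/8 * ep)"
   proof (rule univalent_bound[OF holomorphic_on_subset[OF F(1) cj_ball[OF cb]] inj_on_subset[OF F(2) cj_ball[OF cb]] F(3)])
    show "0 < 3/8 * ep" using ep_pos by simp
    have "cmod (?v - c j ?z) \<le> cmod ?v + cmod (c j ?z)" by (rule norm_triangle_ineq4)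
    thus "cmod (?v - c j ?z) \<le> 3/8 * ep / 2" using cb gd by (simp add: good_def)
   qed
   also have "deriv ?t (c j ?z) = 1 / d j ?z" by (rule DERIV_imp_deriv[OF F(4)])
   also have "2 * growth_const * cmod (1 / d j ?z) * (3/8 * ep) \<le> B"
    unfolding B_def
   proof (intro mult_right_mono mult_left_mono)
    show "cmod (1 / d j ?z) \<le> 1 / m"
     using zem(2)[OF prb(3)[OF x]] m by (simp add: norm_divide m_def frac_le)
   qed (use growth_const_pos ep_pos in auto)
   finally have "cmod (?t ?v) \<le> B" .
   moreover have "P j (pt ?z ?v) = g i x" using gd by (simp add: good_def)
   ultimately show ?thesis by simp
  qed
  ultimately show ?case by blast
 qed
 thus "\<exists>q>0. \<exists>B. \<forall>\<^sub>F n. holo (\<lambda>y. T n (g i y)) (ball y q) \<and> (\<forall>x\<in>ball y q. norm (T n (g i x)) \<le> B)"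
  using q(1) by blast
qed

text \<open>On a fixed tube \<open>w j \<circ> P 0\<close> tends uniformly to zero, so by Cauchy its
  derivative does too. Hence the derivatives \<open>1 / d j\<close> of the limiting coordinate blow
  up on fibre discs of fixed size.\<close>

lemma d_tendsto: assumes "ze \<in> ball 0 r" shows "(\<lambda>j. d j ze) \<longlonglongrightarrow> 0"
 unfolding tendsto_iff
proof (intro allI impI)
 fix \<delta> :: real assume \<delta>: "\<delta> > 0"
 obtain e where e: "e > 0" "cball ze e \<subseteq> ball 0 r" using assms open_contains_cball open_ball by metis
 have ze: "ze \<in> cball ze e" using e by simp
 define \<eta> where "\<eta> = \<delta> * (ep / 4) / 2"
 have \<eta>: "\<eta> > 0" using \<delta> ep_pos by (simp add: \<eta>_def)
 have "\<forall>\<^sub>F j. \<forall>y\<in>tube ze e. good j \<eta> (P 0 y)"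
  by (rule exh_compact[OF holo_P open_bidisc P_image tube_compact tube_bidisc[OF e(2)] \<eta>])
 thus "\<forall>\<^sub>F j. dist (d j ze) 0 < \<delta>"
  using eventually_good_at[OF e(2)]
 proof eventually_elim
  case (elim j)
  have "cmod (deriv (\<lambda>v. w j (P 0 (pt ze v))) 0) \<le> \<eta> / (ep / 4)"
  proof (rule deriv_bound[OF fibre_holo[OF e(2) good_at_good[OF elim(2)] ze]])
   fix v assume "cmod (v - 0) \<le> ep / 4"
   hence "pt ze v \<in> tube ze e" using ze ep_pos by (simp add: tube_def)
   thus "cmod (w j (P 0 (pt ze v))) \<le> \<eta>" using elim(1) by (simp add: good_def less_imp_le)
  qed (use ep_pos in auto)
  also have "deriv (\<lambda>v. w j (P 0 (pt ze v))) 0 = d j ze"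
   by (rule DERIV_imp_deriv[OF d_nonzero(1)[OF e(2) elim(2) ze]])
  also have "\<eta> / (ep / 4) = \<delta> / 2" using ep_pos by (simp add: \<eta>_def)
  finally show "dist (d j ze) 0 < \<delta>" using \<delta> by simp
 qed
qed

text \<open>On each fibre the limit \<open>T'\<close> is injective by Hurwitz's theorem, its
  derivative at the section excluding constants. It is onto the plane because
  \<open>univalent_covers\<close>, with derivative \<open>1 / d j\<close> on a disc of radius
  \<open>3/8 * ep\<close>, forbids an omitted value once \<open>d j\<close> is small.\<close>

theorem trivialization:
 obtains T' I where "holo_out T' Xr" "holo_in I {y :: complex ^ 2. y $ 1 \<in> ball 0 r}"
  "\<And>x. x \<in> Xr \<Longrightarrow> I (pt (pr x) (T' x)) = x"
  "\<And>y :: complex ^ 2. y $ 1 \<in> ball 0 r \<Longrightarrow> I y \<in> Xr \<and> pr (I y) = y $ 1 \<and> T' (I y) = y $ 2"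
proof -
 obtain k T' where k: "strict_mono (k :: nat \<Rightarrow> nat)" "lucM Xr (\<lambda>n. T (k n)) T'" "holo_out T' Xr"
  by (rule montelM[OF openM_Xr locbdd_T])
 have fib: "\<forall>\<^sub>F j. cmod (c j ze) < ep / 8 \<and> d j ze \<noteq> 0 \<and>
   (\<lambda>v. T' (P j (pt ze v))) holomorphic_on ball 0 (ep / 2) \<and> inj_on (\<lambda>v. T' (P j (pt ze v))) (ball 0 (ep / 2)) \<and>
   T' (P j (pt ze (c j ze))) = 0 \<and> deriv (\<lambda>v. T' (P j (pt ze v))) (c j ze) = 1 / d j ze"
  if zer: "ze \<in> ball 0 r" for ze
 proof -
  obtain e where e: "e > 0" "cball ze e \<subseteq> ball 0 r" using zer open_contains_cball open_ball by metis
  have ze: "ze \<in> cball ze e" using e by simp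
  show ?thesis
   using eventually_good_at[OF e(2)]
  proof eventually_elim
   case (elim j)
   let ?B = "ball (0::complex) (ep / 2)"
   let ?t = "\<lambda>n v. T (k n) (P j (pt ze v))" and ?t' = "\<lambda>v. T' (P j (pt ze v))"
   have cj: "cmod (c j ze) < ep / 8" by (rule base[OF e(2) elim ze])
   hence cb: "c j ze \<in> ?B" using ep_pos by simp
   have "\<forall>\<^sub>F n. good_at n ze e \<and> (\<forall>y\<in>tube ze e. good n ep (P j y))"
    using eventually_good_at[OF e(2)] eventually_good_P[OF e(2)] by (rule eventually_conj)
   from eventually_strict_mono[OF k(1) this] obtain N where
    N: "\<And>n. n \<ge> N \<Longrightarrow> good_at (k n) ze e \<and> (\<forall>y\<in>tube ze e. good (k n) ep (P j y))"
    unfolding eventually_sequentially by blast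
   have F: "?t n holomorphic_on ?B" "inj_on (?t n) ?B" "?t n (c j ze) = 0"
    "(?t n has_field_derivative 1 / d j ze) (at (c j ze))" if "n \<ge> N" for n
    using T_fibre[OF e(2) elim ze, of "k n"] N[OF that] by blast+
   have im: "(\<lambda>v. pt ze v) ` ?B \<subseteq> bidisc r ep" using zer ep_pos by (auto simp: bidisc_def)
   have hi: "holo_in (\<lambda>v. P j (pt ze v)) ?B"
    by (rule holo_in_compose[OF holo_P holo_pt_line(1) open_ball open_bidisc im])
   have iX: "(\<lambda>v. P j (pt ze v)) ` ?B \<subseteq> Xr" using P_Xr im by blast
   have lu: "luc ?B ?t ?t'" by (rule lucM_in[OF k(2) openM_Xr k(3) hi open_ball iX])
   have hol: "holo ?t' ?B" by (rule holo_in_out[OF openM_Xr hi k(3) iX])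
   have ev: "evholo ?B ?t"
    unfolding evholo_def
   proof
    fix v assume "v \<in> ?B"
    then obtain q where q: "q > 0" "ball v q \<subseteq> ?B" using open_contains_ball open_ball by metis
    have "holo (?t n) (ball v q)" if "n \<ge> N" for n
     using F(1)[OF that] holo_iff_holomorphic_on[OF open_ball] holo_subset[OF _ q(2)] by blast
    thus "\<exists>q>0. \<forall>\<^sub>F n. holo (?t n) (ball v q)"
     using q(1) unfolding eventually_sequentially by blast
   qed
   have dl: "(\<lambda>n. cder (?t n) (c j ze) 1) \<longlonglongrightarrow> cder ?t' (c j ze) 1"
    by (rule luc_cder_moving[OF open_ball lu ev tendsto_const cb])
   have "cder (?t n) (c j ze) 1 = 1 / d j ze" if "n \<ge> N" for n
    using cder_complex(2)[OF F(1)[OF that, folded holo_iff_holomorphic_on[OF open_ball]] cb] DERIV_imp_deriv[OF F(4)[OF that]]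
    by simp
   hence "\<forall>\<^sub>F n. cder (?t n) (c j ze) 1 = 1 / d j ze"
    unfolding eventually_sequentially by blast
   from Lim_transform_eventually[OF dl this] have "cder ?t' (c j ze) 1 = 1 / d j ze"
    by (simp add: LIMSEQ_const_iff)
   hence dt: "deriv ?t' (c j ze) = 1 / d j ze" using cder_complex(2)[OF hol cb] by simp
   have dj: "d j ze \<noteq> 0" by (rule d_nonzero(2)[OF e(2) elim ze])
   have holm: "?t' holomorphic_on ?B" using hol by (simp add: holo_iff_holomorphic_on)
   have "inj_on ?t' ?B"
   proof (rule Hurwitz_injective[OF open_ball connected_ball, of "\<lambda>n. ?t (n + N)"])
    show "?t (n + N) holomorphic_on ?B" "inj_on (?t (n + N)) ?B" for n using F[of "n + N"] by auto
    show "uniform_limit K (\<lambda>n. ?t (n + N)) ?t' sequentially" if "compact K" "K \<subseteq> ?B" for K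
     by (rule luc_uniform[OF luc_subseq[OF lu, of "\<lambda>n. n + N"] that]) (simp add: strict_mono_def)
    show "\<not> ?t' constant_on ?B"
    proof
     assume "?t' constant_on ?B"
     then obtain a where a: "\<And>v. v \<in> ?B \<Longrightarrow> ?t' v = a" by (auto simp: constant_on_def)
     have "(?t' has_field_derivative 0) (at (c j ze))"
      by (rule has_field_derivative_transform_within_open[OF DERIV_const[of a] open_ball cb]) (simp add: a)
     thus False using dt dj DERIV_imp_deriv by fastforce
    qed
   qed (rule holm)
   moreover have "?t' (c j ze) = 0"
   proof -
    have "\<forall>\<^sub>F n. ?t n (c j ze) = 0" using F(3) unfolding eventually_sequentially by blast
    from Lim_transform_eventually[OF luc_pointwise[OF lu cb] this] show ?thesis by (simp add: LIMSEQ_const_iff)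
   qed
   ultimately show ?case using cj dj holm dt by blast
  qed
 qed
 have inj: "x = x'" if x: "x \<in> Xr" "x' \<in> Xr" "pr x = pr x'" "T' x = T' x'" for x x'
 proof -
  have e2: "ep / 2 > 0" using ep_pos by simp
  have ze: "pr x \<in> ball 0 r" using x by (simp add: Xr_def)
  have "\<forall>\<^sub>F j. inj_on (\<lambda>v. T' (P j (pt (pr x) v))) (ball 0 (ep / 2)) \<and> good j (ep / 2) x \<and> good j (ep / 2) x'"
   using fib[OF ze] exh_point[OF x(1) e2] exh_point[OF x(2) e2] by eventually_elim blast
  then obtain j where j: "inj_on (\<lambda>v. T' (P j (pt (pr x) v))) (ball 0 (ep / 2))" "good j (ep / 2) x" "good j (ep / 2) x'"
   unfolding eventually_sequentially by blast
  have "w j x = w j x'"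
   by (rule inj_onD[OF j(1)]) (use j x in \<open>auto simp: good_def\<close>)
  moreover have "P j (pt (pr x) (w j x)) = x" "P j (pt (pr x') (w j x')) = x'" using j(2,3) by (simp_all only: good_def)
  ultimately show ?thesis using x(3) by metis
 qed
 have surj: "\<exists>x\<in>Xr. pr x = ze \<and> T' x = t" if ze: "ze \<in> ball 0 r" for ze t
 proof (rule ccontr)
  assume no: "\<not> ?thesis"
  \<comment> \<open>An omitted \<open>t\<close> would force \<open>cmod (d j ze) \<ge> q\<close> for
    large \<open>j\<close>; one is added so that \<open>t = 0\<close> causes no division by
    zero.\<close>
  define q where "q = 3/8 * ep / (2 * growth_const * (cmod t + 1))"
  have q: "q > 0" using ep_pos growth_const_pos by (simp add: q_def add_nonneg_pos)
  hence "\<forall>\<^sub>F j. dist (d j ze) 0 < q" using d_tendsto[OF ze] by (simp add: tendsto_iff)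
  hence "\<forall>\<^sub>F j. False"
   using fib[OF ze]
  proof eventually_elim
   case (elim j)
   let ?t = "\<lambda>v. T' (P j (pt ze v))"
   have sb: "ball (c j ze) (3/8 * ep) \<subseteq> ball 0 (ep / 2)" using elim(2) cj_ball by blast
   have "cmod (deriv ?t (c j ze)) * (3/8 * ep) \<le> 2 * growth_const * cmod t"
   proof (rule univalent_covers)
    show "?t holomorphic_on ball (c j ze) (3/8 * ep)" using elim(2) sb holomorphic_on_subset by blast
    show "inj_on ?t (ball (c j ze) (3/8 * ep))" using elim(2) sb inj_on_subset by blast
    show "t \<notin> ?t ` ball (c j ze) (3/8 * ep)"
    proof
     assume "t \<in> ?t ` ball (c j ze) (3/8 * ep)"
     then obtain v where v: "v \<in> ball 0 (ep / 2)" "t = ?t v" using sb by blast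
     hence b: "pt ze v \<in> bidisc r ep" using ze ep_pos by (simp add: bidisc_def)
     thus False using no P_Xr[OF b] pr_P[OF b] v(2) by (metis pt_nth(1))
    qed
   qed (use elim(2) ep_pos in auto)
   hence "3/8 * ep \<le> 2 * growth_const * cmod t * cmod (d j ze)"
    using elim(2) by (simp add: norm_divide field_simps)
   also have "\<dots> \<le> 2 * growth_const * (cmod t + 1) * cmod (d j ze)"
    using growth_const_pos by (intro mult_right_mono mult_left_mono) auto
   also have "\<dots> < 2 * growth_const * (cmod t + 1) * q"
    using elim(1) growth_const_pos by (intro mult_strict_left_mono) (auto simp: add_nonneg_pos)
   also have "\<dots> = 3/8 * ep"
   proof -
    have "2 * growth_const * (cmod t + 1) > 0" using growth_const_pos by (simp add: add_nonneg_pos)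
    thus ?thesis unfolding q_def by (metis nonzero_mult_div_cancel_left order_less_irrefl times_divide_eq_right)
   qed
   finally show False by simp
  qed
  thus False by simp
 qed
 define \<Theta> where "\<Theta> x = pt (pr x) (T' x)" for x
 define I where "I = inv_into Xr \<Theta>"
 have inj\<Theta>: "inj_on \<Theta> Xr" using inj by (auto simp: inj_on_def \<Theta>_def pt_eq_iff)
 have I\<Theta>: "I (\<Theta> x) = x" if "x \<in> Xr" for x using inj\<Theta> that by (simp add: I_def)
 have I: "I y \<in> Xr \<and> pr (I y) = y $ 1 \<and> T' (I y) = y $ 2" if y1: "y $ 1 \<in> ball 0 r" for y :: "complex ^ 2"
 proof -
  obtain x where x: "x \<in> Xr" "pr x = y $ 1" "T' x = y $ 2" using surj[OF y1, of "y $ 2"] by blast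
  hence "\<Theta> x = y" by (simp add: \<Theta>_def)
  hence "I y = x" using I\<Theta>[OF x(1)] by simp
  thus ?thesis using x by simp
 qed
 \<comment> \<open>Locally \<open>I\<close> is \<open>P j\<close> after the inverse of
   \<open>\<Theta> \<circ> P j\<close>, a map between open sets of coordinate space.\<close>
 have "holo_in I {y :: complex ^ 2. y $ 1 \<in> ball 0 r}"
 proof (rule holo_in_local)
  have "open ((\<lambda>y::complex^2. y $ 1) -` ball 0 r)"
   by (rule open_vimage[OF open_ball]) (intro continuous_intros)
  thus "open {y :: complex^2. y $ 1 \<in> ball 0 r}" by (simp add: vimage_def)
  fix y :: "complex^2" assume y: "y \<in> {y. y $ 1 \<in> ball 0 r}"
  hence Iy: "I y \<in> Xr" "pr (I y) = y $ 1" "T' (I y) = y $ 2" using I by auto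
  from exh_point[OF Iy(1) ep_pos] obtain j where j: "good j ep (I y)" unfolding eventually_sequentially by blast
  let ?B = "bidisc r ep"
  let ?G = "\<lambda>y. \<Theta> (P j y)"
  have G1: "?G y = pt (y $ 1) (T' (P j y))" if "y \<in> ?B" for y using pr_P[OF that] by (simp add: \<Theta>_def)
  have hT: "holo (\<lambda>y. T' (P j y)) ?B" by (rule holo_in_out[OF openM_Xr holo_P k(3) P_image])
  have hG: "holo ?G ?B"
   by (rule holo_cong[OF holo_pt[OF holo_vec_nth[OF holo_ident] hT] open_bidisc]) (simp add: G1)
  have injP: "u = v" if "u \<in> ?B" "v \<in> ?B" "P j u = P j v" for u v
   using pr_P[OF that(1), of j] pr_P[OF that(2), of j] w_P[OF that(1), of j] w_P[OF that(2), of j] that(3)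
   by (simp add: pt_eq_iff)
  have injG: "inj_on ?G ?B"
   using injP inj_onD[OF inj\<Theta>] P_Xr by (intro inj_onI) blast
  have invG: "inv_into ?B ?G (?G u) = u" if "u \<in> ?B" for u by (rule inv_into_f_f[OF injG that])
  \<comment> \<open>The first component of \<open>?G\<close> is the coordinate itself, so a kernel
    vector is vertical; in the vertical direction \<open>T'\<close> is univalent and its derivative
    nonzero.\<close>
  have dG: "inj (cder ?G u)" if u: "u \<in> ?B" for u
  proof -
   have "b = 0" if b: "cder ?G u b = 0" for b
   proof -
    have d: "((\<lambda>y. ?G y $ i) has_derivative (\<lambda>v. cder ?G u v $ i)) (at u)" for i
     by (rule bounded_linear.has_derivative[OF bounded_linear_vec_nth holoD(1)[OF hG u]])
    have "((\<lambda>y. y $ 1) has_derivative (\<lambda>v. cder ?G u v $ 1)) (at u)"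
     by (rule has_derivative_transform_within_open[OF d[of 1] open_bidisc u]) (simp add: G1)
    hence "cder (\<lambda>y. y $ 1) u = (\<lambda>v. cder ?G u v $ 1)" by (rule cder_eqI)
    moreover have "cder (\<lambda>y::complex^2. y $ 1) u = (\<lambda>v. v $ 1)"
     by (rule cder_eqI) (rule bounded_linear_imp_has_derivative[OF bounded_linear_vec_nth])
    ultimately have "b $ 1 = cder ?G u b $ 1" by metis
    hence b1: "b $ 1 = 0" using b by simp
    have "((\<lambda>y. T' (P j y)) has_derivative (\<lambda>v. cder ?G u v $ 2)) (at u)"
     by (rule has_derivative_transform_within_open[OF d[of 2] open_bidisc u]) (simp add: G1)
    from cder_eqI[OF this] have Tb: "cder (\<lambda>y. T' (P j y)) u b = 0" using b by simp
    have "b = cs (b $ 2) (pt 0 1)" using b1 by (simp add: pt_eq_iff cs_vec_def cs_complex_def)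
    hence Tb': "b $ 2 * cder (\<lambda>y. T' (P j y)) u (pt 0 1) = 0"
     using Tb clinearD(2)[OF holoD(2)[OF hT u], of "b $ 2" "pt 0 1"] by (simp add: cs_complex_def)
    let ?l = "\<lambda>v. T' (P j (pt (u $ 1) v))"
    have line: "pt (u $ 1) v \<in> ?B" if "v \<in> ball 0 ep" for v using u that by (simp add: bidisc_def)
    have ld: "(?l has_field_derivative cder (\<lambda>y. T' (P j y)) (pt (u $ 1) v) (pt 0 1)) (at v)" if "v \<in> ball 0 ep" for v
     by (rule slice_deriv[OF hT line[OF that]])
    have "deriv ?l (u $ 2) \<noteq> 0"
    proof (rule holomorphic_injective_imp_regular[of _ "ball 0 ep"])
     show "?l holomorphic_on ball 0 ep" unfolding holomorphic_on_open[OF open_ball] using ld by blast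
     show "inj_on ?l (ball 0 ep)"
     proof (rule inj_onI)
      fix a b assume ab: "a \<in> ball 0 ep" "b \<in> ball 0 ep" "?l a = ?l b"
      have "?G (pt (u $ 1) a) = ?G (pt (u $ 1) b)" using ab(3) line[OF ab(1)] line[OF ab(2)] by (simp add: G1)
      hence "pt (u $ 1) a = pt (u $ 1) b" using inj_onD[OF injG] line[OF ab(1)] line[OF ab(2)] by blast
      thus "a = b" by (metis pt_nth(2))
     qed
    qed (use u in \<open>auto simp: bidisc_def\<close>)
    moreover have "u $ 2 \<in> ball 0 ep" using u by (simp add: bidisc_def)
    ultimately have "cder (\<lambda>y. T' (P j y)) u (pt 0 1) \<noteq> 0" using DERIV_imp_deriv[OF ld[of "u $ 2"]] by simp
    hence "b $ 2 = 0" using Tb' by simp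
    thus "b = 0" using b1 by (simp add: pt_eq_iff)
   qed
   thus ?thesis using linear_injective_0[OF linear_cder[OF hG u]] by blast
  qed
  have oG: "open (?G ` ?B)" and hinv: "holo (inv_into ?B ?G) (?G ` ?B)"
   by (rule holo_inverse_map[OF open_bidisc hG injG dG invG]; assumption)+
  have "holo_in (\<lambda>z. P j (inv_into ?B ?G z)) (?G ` ?B)"
   by (rule holo_in_compose[OF holo_P hinv oG open_bidisc]) (use invG in auto)
  moreover have "P j (inv_into ?B ?G z) = I z" if z: "z \<in> ?G ` ?B" for z
  proof -
   obtain u where u: "u \<in> ?B" "z = ?G u" using z by blast
   thus ?thesis using invG[OF u(1)] I\<Theta>[OF P_Xr[OF u(1)]] by simp
  qed
  ultimately have hI: "holo_in I (?G ` ?B)" by (rule holo_in_cong)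
  have "pt (y $ 1) (w j (I y)) \<in> ?B" using y j by (simp add: bidisc_def good_def)
  moreover have "?G (pt (y $ 1) (w j (I y))) = y" using j Iy by (simp add: good_def \<Theta>_def)
  ultimately have "y \<in> ?G ` ?B" by (metis image_eqI)
  moreover have "?G ` ?B \<subseteq> {y. y $ 1 \<in> ball 0 r}" by (auto simp: G1 bidisc_def)
  ultimately show "\<exists>T. open T \<and> y \<in> T \<and> T \<subseteq> {y. y $ 1 \<in> ball 0 r} \<and> holo_in I T" using oG hI by blast
 qed
 thus ?thesis using that[OF k(3), of I] I\<Theta> I by (simp add: \<Theta>_def)
qed

end

section \<open>Gluing trivializations over an exhaustion of the disc\<close>

context union_of_copies
begin

lemma holo_out_local: "(\<And>x. x \<in> W \<Longrightarrow> \<exists>V. x \<in> V \<and> holo_out F V) \<Longrightarrow> holo_out F W"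
 unfolding holo_out_def
proof (intro allI, rule holo_local)
 fix i y assume "\<And>x. x \<in> W \<Longrightarrow> \<exists>V. x \<in> V \<and> (\<forall>i. holo (\<lambda>y. F (g i y)) {y \<in> Om. g i y \<in> V})" and y: "y \<in> {y \<in> Om. g i y \<in> W}"
 from this(1)[of "g i y"] y obtain V where "g i y \<in> V" "\<forall>i. holo (\<lambda>y. F (g i y)) {y \<in> Om. g i y \<in> V}" by blast
 with y show "\<exists>T. y \<in> T \<and> holo (\<lambda>y. F (g i y)) T"
  by (intro exI[of _ "{y \<in> Om. g i y \<in> V}"] conjI) simp_all
qed

lemma holo_out_cong:
 assumes "holo_out F W" "openM W" "\<And>x. x \<in> W \<Longrightarrow> F x = F' x"
 shows "holo_out F' W"
 unfolding holo_out_def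
proof
 fix i
 have "open {y \<in> Om. g i y \<in> W}" using assms(2) by (simp add: openM_def)
 thus "holo (\<lambda>y. F' (g i y)) {y \<in> Om. g i y \<in> W}"
  by (rule holo_cong[OF assms(1)[unfolded holo_out_def, rule_format]]) (simp add: assms(3))
qed

lemma holo_out_affine:
 fixes T :: "'a \<Rightarrow> complex"
 assumes T: "holo_out T W" and pr: "holo_out pr W" "pr ` W \<subseteq> S" and ab: "holo a S" "holo b S"
 shows "holo_out (\<lambda>x. a (pr x) * T x + b (pr x)) W"
 unfolding holo_out_def
proof
 fix i
 show "holo (\<lambda>y. a (pr (g i y)) * T (g i y) + b (pr (g i y))) {y \<in> Om. g i y \<in> W}"
  using holo_out_compose[OF pr(1) ab(1) pr(2)] holo_out_compose[OF pr(1) ab(2) pr(2)] T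
  unfolding holo_out_def by (intro holo_add holo_mult) blast+
qed

definition triv :: "('a \<Rightarrow> complex) \<Rightarrow> real \<Rightarrow> ('a \<Rightarrow> complex) \<Rightarrow> (complex ^ 2 \<Rightarrow> 'a) \<Rightarrow> bool" where
 "triv pr r T I \<longleftrightarrow> holo_out T {x \<in> X. pr x \<in> ball 0 r} \<and> holo_in I {y :: complex ^ 2. y $ 1 \<in> ball 0 r} \<and>
   (\<forall>x\<in>X. pr x \<in> ball 0 r \<longrightarrow> I (pt (pr x) (T x)) = x) \<and>
   (\<forall>y :: complex ^ 2. y $ 1 \<in> ball 0 r \<longrightarrow> I y \<in> X \<and> pr (I y) = y $ 1 \<and> T (I y) = y $ 2)"

lemma trivD:
 assumes "triv pr r T I"
 shows "holo_out T {x \<in> X. pr x \<in> ball 0 r}" "holo_in I {y :: complex ^ 2. y $ 1 \<in> ball 0 r}"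
  "\<And>x. x \<in> X \<Longrightarrow> pr x \<in> ball 0 r \<Longrightarrow> I (pt (pr x) (T x)) = x"
  "\<And>y :: complex ^ 2. y $ 1 \<in> ball 0 r \<Longrightarrow> I y \<in> X" "\<And>y :: complex ^ 2. y $ 1 \<in> ball 0 r \<Longrightarrow> pr (I y) = y $ 1"
  "\<And>y :: complex ^ 2. y $ 1 \<in> ball 0 r \<Longrightarrow> T (I y) = y $ 2"
 using assms unfolding triv_def by simp_all

lemma open_strip: "open {y :: complex ^ 2. y $ 1 \<in> ball 0 r}"
proof -
 have "open ((\<lambda>y::complex^2. y $ 1) -` ball 0 r)"
  by (rule open_vimage[OF open_ball]) (intro continuous_intros)
 thus ?thesis by (simp add: vimage_def)
qed

text \<open>Over each base point the change between two trivializations is an injective entire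
  function, hence affine. Its coefficients are read off at zero and one, so they depend
  holomorphically on the base point.\<close>

lemma triv_change:
 assumes pr: "holo_out pr X" and T: "triv pr r T I" and S: "triv pr r' S J" and r: "r \<le> r'"
 obtains a b where "a holomorphic_on ball 0 r" "b holomorphic_on ball 0 r" "\<And>ze. ze \<in> ball 0 r \<Longrightarrow> a ze \<noteq> 0"
  "\<And>x. x \<in> X \<Longrightarrow> pr x \<in> ball 0 r \<Longrightarrow> S x = a (pr x) * T x + b (pr x)"
proof -
 have br: "ball 0 r \<subseteq> ball (0::complex) r'" using r by auto
 have "openM {x \<in> X. pr x \<in> ball 0 r'}" by (rule openM_vimage_out[OF openM_X pr open_ball])
 hence h: "holo (\<lambda>y. S (I y)) {y :: complex ^ 2. y $ 1 \<in> ball 0 r}"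
  by (rule holo_in_out[OF _ trivD(2)[OF T] trivD(1)[OF S]]) (use trivD(4,5)[OF T] br in auto)
 have hb: "(\<lambda>ze. S (I (pt ze v))) holomorphic_on ball 0 r" for v
  unfolding holo_iff_holomorphic_on[OF open_ball, symmetric]
  by (rule holo_compose[OF holo_pt[OF holo_ident holo_const] h]) auto
 have hf: "(\<lambda>v. S (I (pt ze v))) holomorphic_on UNIV" if ze: "ze \<in> ball 0 r" for ze
  unfolding holo_iff_holomorphic_on[OF open_UNIV, symmetric]
  by (rule holo_compose[OF holo_pt[OF holo_const holo_ident] h]) (use ze in auto)
 have inj: "inj (\<lambda>v. S (I (pt ze v)))" if ze: "ze \<in> ball 0 r" for ze
 proof (rule injI)
  fix u v assume e: "S (I (pt ze u)) = S (I (pt ze v))"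
  have i: "I (pt ze u) \<in> X" "pr (I (pt ze u)) = ze" "T (I (pt ze u)) = u" for u
   using trivD(4-6)[OF T, of "pt ze u"] ze by simp_all
  have "J (pt ze (S (I (pt ze u)))) = I (pt ze u)" for u
   using trivD(3)[OF S i(1), of u] i(2)[of u] ze br by auto
  hence "I (pt ze u) = I (pt ze v)" using e by metis
  thus "u = v" using i(3) by metis
 qed
 define b where "b = (\<lambda>ze. S (I (pt ze 0)))"
 define a where "a = (\<lambda>ze. S (I (pt ze 1)) - S (I (pt ze 0)))"
 show ?thesis
 proof (rule that)
  show "a holomorphic_on ball 0 r" "b holomorphic_on ball 0 r"
   unfolding a_def b_def by (intro holomorphic_intros hb)+
  show "a ze \<noteq> 0" if "ze \<in> ball 0 r" for ze
   using injD[OF inj[OF that], of 1 0] by (auto simp: a_def)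
  fix x assume x: "x \<in> X" "pr x \<in> ball 0 r"
  have "S (I (pt (pr x) (T x))) = a (pr x) * T x + b (pr x)"
   unfolding a_def b_def by (rule entire_injective_affine[OF hf[OF x(2)] inj[OF x(2)]])
  thus "S x = a (pr x) * T x + b (pr x)" by (simp only: trivD(3)[OF T x])
 qed
qed

text \<open>The affine transition maps are made trivial by two additive Cousin problems: one for
  logarithms of the linear coefficients, and, in the coordinates rescaled by its solution, one for
  the translations.\<close>

theorem triv_glue:
 assumes pr: "holo_out pr X" and pr1: "\<And>x. x \<in> X \<Longrightarrow> pr x \<in> ball 0 1"
  and ex: "\<And>r. 0 < r \<Longrightarrow> r < 1 \<Longrightarrow> \<exists>T I. triv pr r T I"
 obtains T I where "triv pr 1 T I"
proof -
 define r where "r n = 1 - 1 / (real n + 2)" for n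
 have r: "0 < r n" "r n < 1" "r n < r (Suc n)" for n by (auto simp: r_def field_simps)
 have rmono: "r m \<le> r n" if "m \<le> n" for m n
  using that by (rule lift_Suc_mono_le[of r, rotated]) (use r less_imp_le in blast)
 have rex: "\<exists>n. t < r n" if "t < 1" for t
 proof -
  obtain n where "1 / (1 - t) < real n" using reals_Archimedean2 by blast
  hence "1 < real n * (1 - t)" using \<open>t < 1\<close> by (simp add: field_simps)
  moreover have "real n * (1 - t) \<le> (real n + 2) * (1 - t)" using \<open>t < 1\<close> by (intro mult_right_mono) auto
  ultimately have "t < r n" by (simp add: r_def field_simps)
  thus ?thesis by blast
 qed
 have "\<forall>n. \<exists>TI. triv pr (r n) (fst TI) (snd TI)" using ex r by auto
 then obtain TI where TI: "\<And>n. triv pr (r n) (fst (TI n)) (snd (TI n))" by metis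
 define T where "T n = fst (TI n)" for n
 define I where "I n = snd (TI n)" for n
 have tr: "triv pr (r n) (T n) (I n)" for n using TI by (simp add: T_def I_def)
 have "\<exists>a b. a holomorphic_on ball 0 (r n) \<and> b holomorphic_on ball 0 (r n) \<and> (\<forall>ze\<in>ball 0 (r n). a ze \<noteq> 0) \<and>
   (\<forall>x\<in>X. pr x \<in> ball 0 (r n) \<longrightarrow> T (Suc n) x = a (pr x) * T n x + b (pr x))" for n
 proof (rule triv_change[OF pr tr[of n] tr[of "Suc n"] less_imp_le[OF r(3)]])
  fix a b assume "a holomorphic_on ball 0 (r n)" "b holomorphic_on ball 0 (r n)" "\<And>ze. ze \<in> ball 0 (r n) \<Longrightarrow> a ze \<noteq> 0"
   "\<And>x. x \<in> X \<Longrightarrow> pr x \<in> ball 0 (r n) \<Longrightarrow> T (Suc n) x = a (pr x) * T n x + b (pr x)"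
  thus ?thesis by (intro exI[of _ a] exI[of _ b] conjI ballI impI allI) simp_all
 qed
 then obtain a b where a: "\<And>n. a n holomorphic_on ball 0 (r n)" "\<And>n ze. ze \<in> ball 0 (r n) \<Longrightarrow> a n ze \<noteq> 0"
  and b: "\<And>n. b n holomorphic_on ball 0 (r n)"
  and step: "\<And>n x. x \<in> X \<Longrightarrow> pr x \<in> ball 0 (r n) \<Longrightarrow> T (Suc n) x = a n (pr x) * T n x + b n (pr x)"
  by metis
 have "\<exists>l. l holomorphic_on ball 0 (r n) \<and> (\<forall>ze\<in>ball 0 (r n). a n ze = exp (l ze))" for n
  using simply_connected_imp_holomorphic_log[OF a(1) convex_imp_simply_connected[OF convex_ball]
    open_imp_locally_path_connected[OF open_ball] a(2)] by metis
 then obtain l where l: "\<And>n. l n holomorphic_on ball 0 (r n)" "\<And>n ze. ze \<in> ball 0 (r n) \<Longrightarrow> a n ze = exp (l n ze)"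
  by metis
 obtain \<alpha> where \<alpha>: "\<And>n. \<alpha> n holomorphic_on ball 0 (r n)" "\<And>n z. z \<in> ball 0 (r n) \<Longrightarrow> \<alpha> n z - \<alpha> (Suc n) z = l n z"
  by (rule cousin_discs[of r l, OF r(3) l(1)]) (rule that)
 have sub: "ball 0 (r n) \<subseteq> ball (0::complex) (r (Suc n))" for n using r(3)[of n] by auto
 \<comment> \<open>The translation \<open>b n\<close> as it appears after the trivialization
   \<open>T (Suc n)\<close> has been multiplied by \<open>exp (\<alpha> (Suc n) z)\<close>.\<close>
 have "(\<lambda>z. exp (\<alpha> (Suc n) z) * b n z) holomorphic_on ball 0 (r n)" for n
  by (intro holomorphic_intros b holomorphic_on_subset[OF \<alpha>(1) sub])
 then obtain B where B: "\<And>n. B n holomorphic_on ball 0 (r n)"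
  "\<And>n z. z \<in> ball 0 (r n) \<Longrightarrow> B n z - B (Suc n) z = exp (\<alpha> (Suc n) z) * b n z"
  by (rule cousin_discs[of r "\<lambda>n z. exp (\<alpha> (Suc n) z) * b n z", OF r(3)]) (rule that)
 define S where "S n x = exp (\<alpha> n (pr x)) * T n x + B n (pr x)" for n x
 define J where "J n (y :: complex ^ 2) = I n (pt (y $ 1) ((y $ 2 - B n (y $ 1)) / exp (\<alpha> n (y $ 1))))" for n y
 have S_Suc: "S (Suc n) x = S n x" if x: "x \<in> X" "pr x \<in> ball 0 (r n)" for n x
 proof -
  have "\<alpha> n (pr x) = \<alpha> (Suc n) (pr x) + l n (pr x)" using \<alpha>(2)[OF x(2)] by (simp add: algebra_simps)
  moreover have "B n (pr x) = B (Suc n) (pr x) + exp (\<alpha> (Suc n) (pr x)) * b n (pr x)"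
   using B(2)[OF x(2)] by (simp add: algebra_simps)
  ultimately show ?thesis using step[OF x] l(2)[OF x(2)] by (simp add: S_def exp_add algebra_simps)
 qed
 have S_eq: "S n x = S m x" if x: "x \<in> X" "pr x \<in> ball 0 (r m)" and mn: "m \<le> n" for m n x
  using mn
 proof (induction n rule: dec_induct)
  case (step n)
  have "pr x \<in> ball 0 (r n)" using x(2) rmono[OF step.hyps(1)] by auto
  from S_Suc[OF x(1) this] step.IH show ?case by simp
 qed simp
 have J: "J n y \<in> X" "pr (J n y) = y $ 1" "S n (J n y) = y $ 2" if y: "y $ 1 \<in> ball 0 (r n)" for n and y :: "complex ^ 2"
  using trivD(4-6)[OF tr[of n], of "pt (y $ 1) ((y $ 2 - B n (y $ 1)) / exp (\<alpha> n (y $ 1)))"] y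
  by (simp_all add: J_def S_def)
 have JS: "J n (pt (pr x) (S n x)) = x" if "x \<in> X" "pr x \<in> ball 0 (r n)" for n x
  using trivD(3)[OF tr[of n] that] by (simp add: J_def S_def)
 \<comment> \<open>The corrected trivializations agree on overlaps, so the first disc containing the
   base point may define the global one.\<close>
 define N where "N ze = (LEAST n. cmod ze < r n)" for ze
 have N: "ze \<in> ball 0 (r (N ze))" if "ze \<in> ball 0 1" for ze
  using LeastI_ex[OF rex[of "cmod ze"]] that by (simp add: N_def)
 have N_le: "N ze \<le> n" if "ze \<in> ball 0 (r n)" for ze n
  unfolding N_def by (rule Least_le) (use that in simp)
 have r1: "ball 0 (r n) \<subseteq> ball (0::complex) 1" for n using r(2)[of n] by auto
 define T' where "T' x = S (N (pr x)) x" for x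
 define I' where "I' (y :: complex ^ 2) = J (N (y $ 1)) y" for y
 have T'_eq: "T' x = S n x" if x: "x \<in> X" "pr x \<in> ball 0 (r n)" for n x
  unfolding T'_def by (rule S_eq[OF x(1) N[OF pr1[OF x(1)]] N_le[OF x(2)], symmetric])
 have I': "I' y \<in> X" "pr (I' y) = y $ 1" "T' (I' y) = y $ 2" if y: "y $ 1 \<in> ball 0 1" for y :: "complex ^ 2"
  using J[OF N[OF y]] by (simp_all add: I'_def T'_def)
 have I'_eq: "I' y = J n y" if y: "y $ 1 \<in> ball 0 (r n)" for n and y :: "complex ^ 2"
 proof -
  have y1: "y $ 1 \<in> ball 0 1" using y r1 by blast
  have "pr (I' y) \<in> ball 0 (r n)" using y I'(2)[OF y1] by simp
  from JS[OF I'(1)[OF y1] this] have "J n (pt (y $ 1) (y $ 2)) = I' y"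
   by (simp only: T'_eq[OF I'(1)[OF y1] \<open>pr (I' y) \<in> ball 0 (r n)\<close>, symmetric] I'(2,3)[OF y1])
  thus ?thesis by simp
 qed
 have oX: "openM {x \<in> X. pr x \<in> ball 0 (r n)}" for n by (rule openM_vimage_out[OF openM_X pr open_ball])
 have "holo_out T' {x \<in> X. pr x \<in> ball 0 1}"
 proof (rule holo_out_local)
  fix x assume "x \<in> {x \<in> X. pr x \<in> ball 0 1}"
  hence x: "x \<in> X" "pr x \<in> ball 0 1" by auto
  let ?n = "N (pr x)"
  let ?W = "{x \<in> X. pr x \<in> ball 0 (r ?n)}"
  have "holo_out (\<lambda>x. exp (\<alpha> ?n (pr x)) * T ?n x + B ?n (pr x)) ?W"
  proof (rule holo_out_affine[OF trivD(1)[OF tr] holo_out_subset[OF pr], where S = "ball 0 (r ?n)"])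
   show "holo (\<lambda>z. exp (\<alpha> ?n z)) (ball 0 (r ?n))" "holo (B ?n) (ball 0 (r ?n))"
    unfolding holo_iff_holomorphic_on[OF open_ball] by (intro holomorphic_intros \<alpha> B)+
  qed auto
  hence "holo_out T' ?W" by (rule holo_out_cong[OF _ oX]) (elim CollectE conjE, simp only: T'_eq, simp only: S_def)
  moreover have "x \<in> ?W" using x N by simp
  ultimately show "\<exists>V. x \<in> V \<and> holo_out T' V" by (intro exI[of _ ?W] conjI)
 qed
 moreover have "holo_in I' {y :: complex ^ 2. y $ 1 \<in> ball 0 1}"
 proof (rule holo_in_local[OF open_strip])
  fix y :: "complex ^ 2" assume "y \<in> {y :: complex ^ 2. y $ 1 \<in> ball 0 1}"
  hence y: "y $ 1 \<in> ball 0 1" by simp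
  let ?n = "N (y $ 1)"
  let ?S = "{y :: complex ^ 2. y $ 1 \<in> ball 0 (r ?n)}"
  have c: "holo (\<lambda>y. y $ 1) ?S" "holo (\<lambda>y. y $ 2) ?S" by (intro holo_vec_nth holo_ident)+
  have "(\<lambda>z. exp (- \<alpha> ?n z)) holomorphic_on ball 0 (r ?n)" by (intro holomorphic_intros \<alpha>)
  hence "holo (\<lambda>y. exp (- \<alpha> ?n (y $ 1))) ?S"
   by (intro holo_compose[OF c(1), of "\<lambda>z. exp (- \<alpha> ?n z)" "ball 0 (r ?n)"])
     (auto simp: holo_iff_holomorphic_on)
  moreover have "holo (\<lambda>y. B ?n (y $ 1)) ?S"
   by (rule holo_compose[OF c(1), of _ "ball 0 (r ?n)"]) (auto simp: holo_iff_holomorphic_on B)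
  ultimately have "holo (\<lambda>y. pt (y $ 1) ((y $ 2 - B ?n (y $ 1)) * exp (- \<alpha> ?n (y $ 1)))) ?S"
   by (intro holo_pt holo_mult holo_diff c)
  from holo_in_compose[OF trivD(2)[OF tr[of ?n]] this open_strip open_strip]
  have "holo_in (\<lambda>y. J ?n y) ?S" by (simp add: image_subset_iff J_def exp_minus divide_inverse)
  hence "holo_in I' ?S" by (rule holo_in_cong) (simp add: I'_eq)
  moreover have "y \<in> ?S" using N[OF y] by simp
  moreover have "?S \<subseteq> {y :: complex ^ 2. y $ 1 \<in> ball 0 1}" using r1[of ?n] by blast
  ultimately show "\<exists>T. open T \<and> y \<in> T \<and> T \<subseteq> {y :: complex ^ 2. y $ 1 \<in> ball 0 1} \<and> holo_in I' T"
   by (intro exI[of _ ?S] conjI open_strip)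
 qed
 moreover have "I' (pt (pr x) (T' x)) = x" if x: "x \<in> X" for x
  using JS[OF x N[OF pr1[OF x]]] by (simp add: I'_def T'_def)
 ultimately have "triv pr 1 T' I'" using I' by (simp add: triv_def)
 thus ?thesis by (rule that)
qed

end

text \<open>One of \<open>u\<close>, \<open>v\<close> is killed and the other fixed, so they are
  independent; Cramer's rule expresses \<open>w\<close> in this basis.\<close>

lemma rank_one_range:
 fixes L :: "complex ^ 2 \<Rightarrow> complex ^ 2"
 assumes L: "clinear L" and u: "u \<noteq> 0" "L u = 0" and v: "v \<noteq> 0" "L v = v"
 shows "\<exists>c. L w = cs c v"
proof -
 have cs2: "cs c x $ i = c * x $ i" for c i and x :: "complex ^ 2" by (simp add: cs_vec_def cs_complex_def)
 let ?d = "u $ 1 * v $ 2 - u $ 2 * v $ 1"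
 have d: "?d \<noteq> 0"
 proof
  assume d0: "?d = 0"
  have "\<exists>c. u = cs c v"
  proof (cases "v $ 1 = 0")
   case True
   hence "v $ 2 \<noteq> 0" "u $ 1 = 0" using v(1) d0 by (auto simp: pt_eq_iff)
   hence "u = cs (u $ 2 / v $ 2) v" using True by (simp add: pt_eq_iff cs2)
   thus ?thesis ..
  next
   case False
   hence "u = cs (u $ 1 / v $ 1) v" using d0 by (simp add: pt_eq_iff cs2 field_simps)
   thus ?thesis ..
  qed
  then obtain c where c: "u = cs c v" ..
  hence "cs c v = 0" using clinearD(2)[OF L, of c v] u(2) v(2) by simp
  with c u(1) show False by simp
 qed
 let ?a = "(w $ 1 * v $ 2 - w $ 2 * v $ 1) / ?d" and ?b = "(u $ 1 * w $ 2 - u $ 2 * w $ 1) / ?d"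
 have e: "(w $ 1 * v $ 2 - w $ 2 * v $ 1) * u $ i + (u $ 1 * w $ 2 - u $ 2 * w $ 1) * v $ i = ?d * w $ i" for i :: 2
  using exhaust_2[of i] by (auto simp: algebra_simps)
 have "?a * u $ i + ?b * v $ i = w $ i" for i :: 2
  using e[of i] d by (simp add: add_divide_distrib[symmetric])
 hence w: "w = cs ?a u + cs ?b v" by (simp add: vec_eq_iff cs2)
 have "L w = cs ?a (L u) + cs ?b (L v)"
  using linear_add[OF bounded_linear.linear[OF clinearD(1)[OF L]]] clinearD(2)[OF L] by (subst w) simp
 hence "L w = cs ?b v" by (simp add: u(2) v(2))
 thus ?thesis ..
qed

theorem (in fibration) fibration_trivial:
 obtains T I where "triv pr 1 T I"
proof (rule triv_glue[OF holo_pr pr_ball])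
 fix r :: real assume r: "0 < r" "r < 1"
 obtain ep P where e: "ep > 0"
  and ev: "\<forall>\<^sub>F n. holo_in (P n) (bidisc r ep) \<and>
   (\<forall>y\<in>bidisc r ep. P n y \<in> U n \<and> pr (P n y) = y $ 1 \<and> \<tau> (phi n (P n y)) = y $ 2)"
  and ex: "\<And>i y \<delta>. y \<in> Om \<Longrightarrow> pr (g i y) \<in> ball 0 r \<Longrightarrow> \<delta> > 0 \<Longrightarrow> \<exists>d>0. ball y d \<subseteq> Om \<and>
   (\<forall>\<^sub>F n. \<forall>z\<in>ball y d. pr (g i z) \<in> ball 0 r \<and> g i z \<in> U n \<and>
    cmod (\<tau> (phi n (g i z))) < \<delta> \<and> P n (pt (pr (g i z)) (\<tau> (phi n (g i z)))) = g i z)"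
  by (rule bidiscs[OF r]) (rule that)
 obtain m where m: "\<And>n. n \<ge> m \<Longrightarrow> holo_in (P n) (bidisc r ep) \<and>
   (\<forall>y\<in>bidisc r ep. P n y \<in> U n \<and> pr (P n y) = y $ 1 \<and> \<tau> (phi n (P n y)) = y $ 2)"
  using ev unfolding eventually_sequentially by (elim exE) (rule that, drule spec, erule mp)
 \<comment> \<open>The locale asks for its properties at every index, so the first \<open>m\<close>
   indices are skipped by a shift.\<close>
 interpret bidisc_exhaustion Om X Mi f g pr r ep "\<lambda>n. U (n + m)" "\<lambda>n. P (n + m)" "\<lambda>n x. \<tau> (phi (n + m) x)"
 proof unfold_locales
  show "holo_out (\<lambda>x. \<tau> (phi (n + m) x)) (U (n + m))" for n
   by (rule holo_out_compose[OF holo_phi holo_\<tau>]) (use phi_in Dk_D in blast)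
  fix i y and \<delta> :: real assume "y \<in> Om" "pr (g i y) \<in> ball 0 r" "\<delta> > 0"
  from ex[OF this] obtain d where "d > 0" "ball y d \<subseteq> Om" and
   d: "\<forall>\<^sub>F n. \<forall>z\<in>ball y d. pr (g i z) \<in> ball 0 r \<and> g i z \<in> U n \<and>
    cmod (\<tau> (phi n (g i z))) < \<delta> \<and> P n (pt (pr (g i z)) (\<tau> (phi n (g i z)))) = g i z"
   by (elim exE conjE) (rule that)
  thus "\<exists>d>0. ball y d \<subseteq> Om \<and> (\<forall>\<^sub>F n. \<forall>z\<in>ball y d. pr (g i z) \<in> ball 0 r \<and> g i z \<in> U (n + m) \<and>
    cmod (\<tau> (phi (n + m) (g i z))) < \<delta> \<and> P (n + m) (pt (pr (g i z)) (\<tau> (phi (n + m) (g i z)))) = g i z)"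
   by (intro exI[of _ d] conjI sequentially_offset)
 qed (use r e m holo_pr openM_U in simp_all)
 obtain T I where "holo_out T Xr" "holo_in I {y :: complex ^ 2. y $ 1 \<in> ball 0 r}"
  "\<And>x. x \<in> Xr \<Longrightarrow> I (pt (pr x) (T x)) = x"
  "\<And>y :: complex ^ 2. y $ 1 \<in> ball 0 r \<Longrightarrow> I y \<in> Xr \<and> pr (I y) = y $ 1 \<and> T (I y) = y $ 2"
  by (rule trivialization) (rule that)
 hence "triv pr r T I" unfolding triv_def by (auto simp: Xr_def)
 thus "\<exists>T I. triv pr r T I" by blast
qed (assumption, rule that)

section \<open>Consequences for injective limits and for limits of rank one\<close>

context limit_charts
begin

lemma retract_subseq:
 obtains r h where "retract_limit Om X Mi f g D (\<lambda>n. U (r n)) (\<lambda>n. Dk (r n)) (\<lambda>n. phi (r n)) (\<lambda>n. psi (r n)) Phi h"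
proof -
 obtain r h where r: "strict_mono (r :: nat \<Rightarrow> nat)" "luc D (\<lambda>n y. Phi (psi (r n) y)) h"
  by (rule montel[OF open_D locbdd_Phi_psi]) (rule that)
 interpret s: limit_charts Om X Mi f g D "\<lambda>n. U (r n)" "\<lambda>n. Dk (r n)" "\<lambda>n. phi (r n)" "\<lambda>n. psi (r n)" Phi
  by (rule limit_charts_subseq[OF r(1)])
 have "retract_limit Om X Mi f g D (\<lambda>n. U (r n)) (\<lambda>n. Dk (r n)) (\<lambda>n. phi (r n)) (\<lambda>n. psi (r n)) Phi h"
  by unfold_locales (rule r(2))
 thus ?thesis by (rule that)
qed

theorem injective_limit:
 assumes "inj_on Phi X" shows "Phi ` X = D" "holo_in (inv_into X Phi) D"
proof -
 obtain r h where "retract_limit Om X Mi f g D (\<lambda>n. U (r n)) (\<lambda>n. Dk (r n)) (\<lambda>n. phi (r n)) (\<lambda>n. psi (r n)) Phi h"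
  by (rule retract_subseq) (rule that)
 then interpret r: retract_limit Om X Mi f g D "\<lambda>n. U (r n)" "\<lambda>n. Dk (r n)" "\<lambda>n. phi (r n)" "\<lambda>n. psi (r n)" Phi h .
 show "Phi ` X = D" "holo_in (inv_into X Phi) D" by (rule r.inj_imp_biholo[OF assms])+
qed

end

text \<open>The derivative of \<open>h\<close> has rank exactly one: it inherits a kernel from
  \<open>\<xi>\<close> by \<open>cder_h_degenerate\<close>, and it fixes the nonzero image of
  \<open>\<eta>\<close>.\<close>

theorem rank_one_limit:
 fixes Om :: "(complex ^ 2) set"
 assumes lc: "limit_charts Om X Mi f g D U Dk phi psi Phi"
  and y: "y \<in> Om" and \<xi>: "\<xi> \<noteq> 0" "cder (\<lambda>y. Phi (g i y)) y \<xi> = 0" and \<eta>: "cder (\<lambda>y. Phi (g i y)) y \<eta> \<noteq> 0"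
 obtains pr T I where "union_of_copies.holo_out Om g pr X" "\<And>x. x \<in> X \<Longrightarrow> pr x \<in> ball 0 1"
  "union_of_copies.triv Om X Mi f g pr 1 T I"
proof -
 interpret limit_charts Om X Mi f g D U Dk phi psi Phi by (rule lc)
 obtain r h where "retract_limit Om X Mi f g D (\<lambda>n. U (r n)) (\<lambda>n. Dk (r n)) (\<lambda>n. phi (r n)) (\<lambda>n. psi (r n)) Phi h"
  by (rule retract_subseq) (rule that)
 then interpret r: retract_limit Om X Mi f g D "\<lambda>n. U (r n)" "\<lambda>n. Dk (r n)" "\<lambda>n. phi (r n)" "\<lambda>n. psi (r n)" Phi h .
 let ?p = "Phi (g i y)" and ?v = "cder (\<lambda>y. Phi (g i y)) y \<eta>"
 have p: "?p \<in> D" by (rule Phi_g_in[OF y])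
 have hv: "cder h ?p ?v = ?v" by (rule r.cder_h_Phi[OF y])
 obtain u where u: "u \<noteq> 0" "cder h ?p u = 0" using r.cder_h_degenerate[OF y \<xi>] by (elim exE conjE) (rule that)
 interpret h: holo_retraction D h ?p ?v
 proof
  show "\<exists>c. cder h ?p w = cs c ?v" for w
   by (rule rank_one_range[OF holoD(2)[OF r.holo_h p] u \<eta> hv])
  show "h ?p = ?p" by (rule r.h_Phi[OF subsetD[OF Mi_X g_in[OF y]]])
 qed (fact open_D convex_D bounded_D r.holo_h r.h_in r.h_h p \<eta> hv)+
 obtain F R where "holo F (ball (0::complex) 1)" "F ` ball 0 1 \<subseteq> D" "holo (R :: complex ^ 2 \<Rightarrow> complex) D"
  "R ` D \<subseteq> ball 0 1" "\<And>ze. ze \<in> ball 0 1 \<Longrightarrow> R (F ze) = ze" "\<And>z. z \<in> D \<Longrightarrow> F (R z) = h z"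
  by (rule h.retract_is_disc) (rule that)
 then interpret fi: fibration Om X Mi f g D "\<lambda>n. U (r n)" "\<lambda>n. Dk (r n)" "\<lambda>n. phi (r n)" "\<lambda>n. psi (r n)" Phi h F R
  by unfold_locales
 obtain T I where "triv fi.pr 1 T I" by (rule fi.fibration_trivial) (rule that)
 with fi.holo_pr fi.pr_ball show ?thesis by (rule that)
qed

section \<open>Limits of maps of the copies into a bounded convex domain\<close>

locale copies_subseq = union_of_copies Om X Mi f g
 for Om :: "'v::complex_euclidean set" and X :: "'a set" and Mi f g +
 fixes s :: "nat \<Rightarrow> nat" and x0 :: 'a
 assumes mono_s: "strict_mono s" and x0_Mi: "\<And>n. x0 \<in> Mi (s n)"
begin

lemma x0_X: "x0 \<in> X" using x0_Mi Mi_X by blast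

lemma eventually_Mi: "\<forall>\<^sub>F n. Mi i \<subseteq> Mi (s n)"
proof (rule eventually_sequentiallyI)
 show "Mi i \<subseteq> Mi (s n)" if "i \<le> n" for n
  by (rule Mi_mono[OF order_trans[OF that strict_mono_imp_increasing[OF mono_s]]])
qed

lemma eventually_g_Mi: "\<forall>\<^sub>F n. \<forall>y\<in>Om. g i y \<in> Mi (s n)"
 using eventually_Mi[of i] by eventually_elim (use g_in in blast)

lemma copies_subseq_subseq: "strict_mono t \<Longrightarrow> copies_subseq Om X Mi f g (\<lambda>n. s (t n)) x0"
 by unfold_locales (use strict_mono_o[OF mono_s] x0_Mi in \<open>auto simp: o_def\<close>)

lemma exhM_Mi: "exhM (\<lambda>n. Mi (s n))"
 unfolding exhM_def
proof (intro allI ballI)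
 fix i y assume "y \<in> Om"
 then obtain d where d: "d > 0" "ball y d \<subseteq> Om" using open_Om open_contains_ball by blast
 have "\<forall>\<^sub>F n. g i ` ball y d \<subseteq> Mi (s n)"
  using eventually_g_Mi[of i] by eventually_elim (use d in blast)
 with d show "\<exists>r>0. ball y r \<subseteq> Om \<and> (\<forall>\<^sub>F n. g i ` ball y r \<subseteq> Mi (s n))" by blast
qed

text \<open>The point \<open>x\<close> and the base point lie in one common copy of the convex set
  \<open>Om\<close>, where the maximum principle is available.\<close>

lemma max_principleM:
 fixes Phi :: "'a \<Rightarrow> 'b::complex_euclidean"
 assumes Phi: "holo_out Phi X" "\<And>x. x \<in> X \<Longrightarrow> Phi x \<in> closure E" and E: "open E" "convex E"
  and x0: "Phi x0 \<in> E" and x: "x \<in> X"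
 shows "Phi x \<in> E"
proof -
 obtain i where i: "x \<in> Mi i" using x UN_Mi by blast
 obtain n where n: "Mi i \<subseteq> Mi (s n)" using eventually_Mi[of i] unfolding eventually_sequentially by blast
 have fx: "f (s n) x \<in> Om" "g (s n) (f (s n) x) = x" using i n by (auto intro: f_in gf)
 have "Phi (g (s n) (f (s n) x)) \<in> E"
 proof (rule holo_max_principle[OF open_Om convex_Om _ _ E _ _ fx(1), where f = "\<lambda>y. Phi (g (s n) y)"])
  show "holo (\<lambda>y. Phi (g (s n) y)) Om" by (rule holo_out_holo[OF Phi(1) holo_in_g])
  show "(\<lambda>y. Phi (g (s n) y)) ` Om \<subseteq> closure E" using Phi(2) g_in Mi_X by blast
  show "f (s n) x0 \<in> Om" by (rule f_in[OF x0_Mi])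
  show "Phi (g (s n) (f (s n) x0)) \<in> E" using x0 gf[OF x0_Mi] by simp
 qed
 thus ?thesis by (simp add: fx(2))
qed

text \<open>Montel's theorem with the limit kept inside \<open>E\<close>: convergence of the values
  at \<open>x0\<close> to a point of \<open>E\<close> anchors the maximum principle.\<close>

lemma maps_limit:
 fixes Z :: "nat \<Rightarrow> 'a \<Rightarrow> 'b::complex_euclidean"
 assumes Z: "\<And>n. holo_out (Z n) (Mi (s n))" "\<And>n x. x \<in> Mi (s n) \<Longrightarrow> Z n x \<in> closure E"
  and E: "open E" "convex E" "bounded E" and e0: "(\<lambda>n. Z n x0) \<longlonglongrightarrow> e0" "e0 \<in> E"
 obtains t Phi where "strict_mono (t :: nat \<Rightarrow> nat)" "lucM X (\<lambda>n. Z (t n)) Phi" "holo_out Phi X"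
  "\<And>x. x \<in> X \<Longrightarrow> Phi x \<in> E" "Phi x0 = e0"
proof -
 obtain B where B: "\<And>x. x \<in> closure E \<Longrightarrow> norm x \<le> B" using bounded_closure[OF E(3)] bounded_iff by blast
 have lb: "locbdd {y \<in> Om. g i y \<in> X} (\<lambda>n y. Z n (g i y))" for i
  unfolding locbdd_def Om_X
 proof
  fix y assume "y \<in> Om"
  then obtain d where d: "d > 0" "ball y d \<subseteq> Om" using open_Om open_contains_ball by blast
  have "\<forall>\<^sub>F n. holo (\<lambda>y. Z n (g i y)) (ball y d) \<and> (\<forall>x\<in>ball y d. norm (Z n (g i x)) \<le> B)"
   using eventually_g_Mi[of i]
  proof eventually_elim
   case (elim n)
   have "ball y d \<subseteq> {y \<in> Om. g i y \<in> Mi (s n)}" using elim d(2) by blast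
   from holo_subset[OF Z(1)[unfolded holo_out_def, rule_format] this] this show ?case using B Z(2) by blast
  qed
  with d show "\<exists>r>0. \<exists>B. \<forall>\<^sub>F n. holo (\<lambda>y. Z n (g i y)) (ball y r) \<and> (\<forall>x\<in>ball y r. norm (Z n (g i x)) \<le> B)"
   by (intro exI[of _ d] exI[of _ B] conjI)
 qed
 obtain t Phi where t: "strict_mono (t :: nat \<Rightarrow> nat)" "lucM X (\<lambda>n. Z (t n)) Phi" "holo_out Phi X"
  by (rule montelM[OF openM_X lb]) (rule that)
 have lim: "(\<lambda>n. Z (t n) x) \<longlonglongrightarrow> Phi x" if x: "x \<in> X" for x
 proof (rule X_E[OF x])
  fix i y assume "y \<in> Om" "x = g i y"
  with luc_pointwise[OF t(2)[unfolded lucM_def, rule_format, of i], of y] x show ?thesis by simp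
 qed
 have cl: "Phi x \<in> closure E" if x: "x \<in> X" for x
 proof (rule X_E[OF x])
  fix i y assume "x \<in> Mi i"
  hence "\<forall>\<^sub>F n. Z (t n) x \<in> closure E"
   using eventually_strict_mono[OF t(1) eventually_Mi[of i]] by (auto elim!: eventually_mono intro: Z(2))
  thus ?thesis by (rule Lim_in_closed_set[OF closed_closure _ sequentially_bot lim[OF x]])
 qed
 have p0: "Phi x0 = e0"
  by (rule LIMSEQ_unique[OF lim[OF x0_X] LIMSEQ_subseq_LIMSEQ[OF e0(1) t(1), unfolded o_def]])
 have "Phi x \<in> E" if x: "x \<in> X" for x
  by (rule max_principleM[OF t(3) cl E(1,2) _ x]) (use p0 e0(2) in auto)
 with t p0 show ?thesis by (intro that)
qed

theorem interior_limit_charts: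
 assumes bd: "bounded Om" and p0: "(\<lambda>n. f (s n) x0) \<longlonglongrightarrow> p0" "p0 \<in> Om"
 obtains U Dk phi psi Phi where "limit_charts Om X Mi f g Om U Dk phi psi Phi"
proof -
 obtain t Phi where t: "strict_mono (t :: nat \<Rightarrow> nat)" "lucM X (\<lambda>n. f (s (t n))) Phi" "holo_out Phi X"
  "\<And>x. x \<in> X \<Longrightarrow> Phi x \<in> Om" "Phi x0 = p0"
  by (rule maps_limit[of "\<lambda>n. f (s n)", OF holo_out_f subsetD[OF closure_subset f_in] open_Om convex_Om bd p0]) (assumption, rule that)
 interpret t: copies_subseq Om X Mi f g "\<lambda>n. s (t n)" x0 by (rule copies_subseq_subseq[OF t(1)])
 have "limit_charts Om X Mi f g Om (\<lambda>n. Mi (s (t n))) (\<lambda>n. Om) (\<lambda>n. f (s (t n))) (\<lambda>n. g (s (t n))) Phi"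
 proof unfold_locales
  show "\<exists>r>0. ball y r \<subseteq> Om \<and> (\<forall>\<^sub>F n. ball y r \<subseteq> Om)" if "y \<in> Om" for y
   using that open_Om open_contains_ball by (metis (no_types, lifting) always_eventually)
 qed (fact open_Om convex_Om bd openM_Mi order_refl holo_out_f holo_in_g f_in g_in gf fg t.exhM_Mi t(2) t(4))+
 thus ?thesis by (rule that)
qed

end

section \<open>Second order behaviour of a strongly convex boundary\<close>

locale C2_function =
 fixes r :: "'e::euclidean_space \<Rightarrow> real" and U :: "'e set"
 assumes open_U: "open U" and C2: "Ck_on (Suc (Suc 0)) r U"
begin

definition "dr x = frechet_derivative r (at x)"

definition "d2 b b' x = frechet_derivative (\<lambda>y. dr y b) (at x) b'"

lemma diff_r: "x \<in> U \<Longrightarrow> r differentiable at x"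
 and diff_dr: "x \<in> U \<Longrightarrow> b \<in> Basis \<Longrightarrow> (\<lambda>y. dr y b) differentiable at x"
 and cont_d2: "b \<in> Basis \<Longrightarrow> b' \<in> Basis \<Longrightarrow> continuous_on U (d2 b b')"
 using C2 by (auto simp: dr_def d2_def[abs_def])

lemma has_derivative_r: "x \<in> U \<Longrightarrow> (r has_derivative dr x) (at x)"
 unfolding dr_def using diff_r frechet_derivative_works by blast

lemma linear_dr: "x \<in> U \<Longrightarrow> linear (dr x)"
 by (rule has_derivative_linear[OF has_derivative_r])

lemma linear_expand:
 fixes L :: "'e \<Rightarrow> real" assumes "linear L" shows "L v = (\<Sum>b\<in>Basis. (v \<bullet> b) * L b)"
 using linear_sum[OF assms, of "\<lambda>b. (v \<bullet> b) *\<^sub>R b" Basis] linear_cmul[OF assms]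
 by (simp add: euclidean_representation)

text \<open>\<open>Ck_on\<close> speaks of derivatives along basis vectors; a general direction
  \<open>v\<close> is reached by linear expansion.\<close>

lemma dr_derivative:
 assumes x: "x \<in> U"
 shows "((\<lambda>y. dr y v) has_derivative (\<lambda>w. \<Sum>b\<in>Basis. \<Sum>b'\<in>Basis. (v \<bullet> b) * ((w \<bullet> b') * d2 b b' x))) (at x)"
proof -
 have "((\<lambda>y. dr y b) has_derivative (\<lambda>w. \<Sum>b'\<in>Basis. (w \<bullet> b') * d2 b b' x)) (at x)" if b: "b \<in> Basis" for b
 proof -
  have d: "((\<lambda>y. dr y b) has_derivative frechet_derivative (\<lambda>y. dr y b) (at x)) (at x)"
   using diff_dr[OF x b] frechet_derivative_works by blast
  moreover have "frechet_derivative (\<lambda>y. dr y b) (at x) = (\<lambda>w. \<Sum>b'\<in>Basis. (w \<bullet> b') * d2 b b' x)"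
   unfolding d2_def by (rule ext) (rule linear_expand[OF has_derivative_linear[OF d]])
  ultimately show ?thesis by (simp only:)
 qed
 hence "((\<lambda>y. \<Sum>b\<in>Basis. (v \<bullet> b) * dr y b) has_derivative (\<lambda>w. \<Sum>b\<in>Basis. (v \<bullet> b) * (\<Sum>b'\<in>Basis. (w \<bullet> b') * d2 b b' x))) (at x)"
  by (intro has_derivative_sum has_derivative_mult_right)
 hence "((\<lambda>y. \<Sum>b\<in>Basis. (v \<bullet> b) * dr y b) has_derivative (\<lambda>w. \<Sum>b\<in>Basis. \<Sum>b'\<in>Basis. (v \<bullet> b) * ((w \<bullet> b') * d2 b b' x))) (at x)"
  by (simp only: sum_distrib_left)
 thus ?thesis
  by (rule has_derivative_transform_within_open[OF _ open_U x]) (simp add: linear_expand[OF linear_dr, of _ v, symmetric])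
qed

text \<open>The Hessian as an explicit bilinear form, so that continuity in the base point and
  scaling in the arguments can be read off.\<close>

definition "hs x v w = (\<Sum>b\<in>Basis. \<Sum>b'\<in>Basis. (v \<bullet> b) * ((w \<bullet> b') * d2 b b' x))"

lemma hessian_hs: "x \<in> U \<Longrightarrow> hessian_form r x v = hs x v v"
 unfolding hessian_form_def hs_def dr_def[symmetric]
 by (subst frechet_derivative_at[OF dr_derivative, symmetric]) auto

lemma hs_bilinear: "hs x (v + v') w = hs x v w + hs x v' w" "hs x v (w + w') = hs x v w + hs x v w'"
 "hs x (c *\<^sub>R v) w = c * hs x v w" "hs x v (c *\<^sub>R w) = c * hs x v w"
 by (simp_all add: hs_def inner_add_left algebra_simps sum.distrib sum_distrib_left)

lemma tendsto_hs:
 assumes "(\<xi> \<longlongrightarrow> x) F" "x \<in> U" "(v \<longlongrightarrow> v0) F" "(w \<longlongrightarrow> w0) F"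
 shows "((\<lambda>j. hs (\<xi> j) (v j) (w j)) \<longlongrightarrow> hs x v0 w0) F"
proof -
 have "((\<lambda>j. d2 b b' (\<xi> j)) \<longlongrightarrow> d2 b b' x) F" if "b \<in> Basis" "b' \<in> Basis" for b b'
  using cont_d2[OF that] assms(1,2) open_U
  by (metis continuous_on_eq_continuous_at continuous_within_tendsto_compose' isCont_tendsto_compose)
 thus ?thesis unfolding hs_def by (intro tendsto_sum tendsto_mult tendsto_inner assms tendsto_const)
qed

lemma tendsto_dr:
 assumes "(\<xi> \<longlongrightarrow> x) F" "x \<in> U" "(v \<longlongrightarrow> v0) F"
 shows "((\<lambda>j. dr (\<xi> j) (v j)) \<longlongrightarrow> dr x v0) F"
proof -
 have "((\<lambda>j. dr (\<xi> j) b) \<longlongrightarrow> dr x b) F" if "b \<in> Basis" for b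
  using diff_dr[OF assms(2) that] differentiable_imp_continuous_within isCont_tendsto_compose assms(1) by blast
 hence "((\<lambda>j. \<Sum>b\<in>Basis. (v j \<bullet> b) * dr (\<xi> j) b) \<longlongrightarrow> (\<Sum>b\<in>Basis. (v0 \<bullet> b) * dr x b)) F"
  by (intro tendsto_sum tendsto_mult tendsto_inner assms tendsto_const)
 moreover have "\<forall>\<^sub>F j in F. (\<Sum>b\<in>Basis. (v j \<bullet> b) * dr (\<xi> j) b) = dr (\<xi> j) (v j)"
  using topological_tendstoD[OF assms(1) open_U assms(2)]
  by eventually_elim (rule linear_expand[OF linear_dr, symmetric])
 ultimately show ?thesis
  unfolding linear_expand[OF linear_dr[OF assms(2)], of v0] by (rule Lim_transform_eventually)
qed

text \<open>The remainder has Lagrange form: the Hessian is taken at a point \<open>\<xi>\<close>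
  other than \<open>ze\<close>, and \<open>hessian_lower_bound\<close> admits two different points
  for this reason.\<close>

lemma taylor2:
 assumes seg: "closed_segment ze (ze + w) \<subseteq> U"
 obtains \<xi> where "\<xi> \<in> closed_segment ze (ze + w)" "r (ze + w) = r ze + dr ze w + hs \<xi> w w / 2"
proof -
 have inU: "ze + t *\<^sub>R w \<in> closed_segment ze (ze + w)" if "0 \<le> t" "t \<le> 1" for t
  using that unfolding in_segment by (intro exI[of _ t]) (simp add: algebra_simps)
 define df where "df m t = (if m = 0 then r (ze + t *\<^sub>R w) else if m = 1 then dr (ze + t *\<^sub>R w) w
   else hs (ze + t *\<^sub>R w) w w)" for m :: nat and t
 have line: "((\<lambda>t. ze + t *\<^sub>R w) has_derivative (\<lambda>h. h *\<^sub>R w)) (at t)" for t :: real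
  by (auto intro!: derivative_eq_intros)
 have D: "DERIV (df m) t :> df (Suc m) t" if m: "m < 2" and t: "0 \<le> t" "t \<le> 1" for m t
 proof -
  have x: "ze + t *\<^sub>R w \<in> U" using inU[OF t] seg by blast
  consider "m = 0" | "m = 1" using m by linarith
  thus ?thesis
  proof cases
   case 1
   have "((\<lambda>t. r (ze + t *\<^sub>R w)) has_derivative (\<lambda>h. dr (ze + t *\<^sub>R w) (h *\<^sub>R w))) (at t)"
    by (rule has_derivative_compose[OF line has_derivative_r[OF x]])
   moreover have "(\<lambda>h. dr (ze + t *\<^sub>R w) (h *\<^sub>R w)) = (*) (dr (ze + t *\<^sub>R w) w)"
    using linear_cmul[OF linear_dr[OF x]] by (simp add: fun_eq_iff mult.commute)
   ultimately show ?thesis using 1 by (simp add: df_def[abs_def] has_field_derivative_def)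
  next
   case 2
   have "((\<lambda>t. dr (ze + t *\<^sub>R w) w) has_derivative (\<lambda>h. hs (ze + t *\<^sub>R w) w (h *\<^sub>R w))) (at t)"
    unfolding hs_def by (rule has_derivative_compose[OF line dr_derivative[OF x]])
   moreover have "(\<lambda>h. hs (ze + t *\<^sub>R w) w (h *\<^sub>R w)) = (*) (hs (ze + t *\<^sub>R w) w w)"
    by (simp add: fun_eq_iff hs_bilinear mult.commute)
   ultimately show ?thesis using 2 by (simp add: df_def[abs_def] has_field_derivative_def)
  qed
 qed
 obtain t where t: "0 < t" "t \<le> 1" "r (ze + 1 *\<^sub>R w) = (\<Sum>m<2. df m 0 / fact m * 1 ^ m) + df 2 t / fact 2 * 1 ^ 2"
 proof -
  assume g: "\<And>t. 0 < t \<Longrightarrow> t \<le> 1 \<Longrightarrow> r (ze + 1 *\<^sub>R w) = (\<Sum>m<2. df m 0 / fact m * 1 ^ m) + df 2 t / fact 2 * 1 ^ 2 \<Longrightarrow> thesis"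
  have "\<exists>t>0. t \<le> 1 \<and> r (ze + 1 *\<^sub>R w) = (\<Sum>m<2. df m 0 / fact m * 1 ^ m) + df 2 t / fact 2 * 1 ^ 2"
   by (rule Maclaurin2[of 1 df "\<lambda>t. r (ze + t *\<^sub>R w)" 2]) (use D in \<open>auto simp: df_def[abs_def]\<close>)
  thus thesis by (elim exE conjE) (rule g)
 qed
 thus ?thesis
  using that[OF inU[of t]] by (simp add: df_def numeral_2_eq_2)
qed

text \<open>Positivity on the tangent space at one point extends to all vectors and nearby points at
  the price of a penalty for the non-tangential part, by compactness of the unit sphere. One
  constant plays all roles, so that a contradiction arises as it tends to zero.\<close>

lemma hessian_lower_bound:
 assumes a: "a \<in> U" and pos: "\<And>v. v \<noteq> 0 \<Longrightarrow> dr a v = 0 \<Longrightarrow> 0 < hs a v v"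
 obtains c where "c > 0" "ball a c \<subseteq> U"
  "\<And>ze \<xi> v. ze \<in> ball a c \<Longrightarrow> \<xi> \<in> ball a c \<Longrightarrow> c * (norm v)\<^sup>2 \<le> hs \<xi> v v + (dr ze v)\<^sup>2 / c"
proof -
 obtain c0 where c0: "c0 > 0" "ball a c0 \<subseteq> U" using a open_U open_contains_ball by blast
 have "\<exists>c>0. c \<le> c0 \<and> (\<forall>ze\<in>ball a c. \<forall>\<xi>\<in>ball a c. \<forall>v. norm v = 1 \<longrightarrow> c \<le> hs \<xi> v v + (dr ze v)\<^sup>2 / c)"
 proof (rule ccontr)
  assume neg: "\<not> ?thesis"
  define e where "e n = c0 / (real n + 1)" for n
  have e: "e n > 0" "e n \<le> c0" for n using c0 by (auto simp: e_def field_simps)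
  have e_lim: "e \<longlonglongrightarrow> 0" unfolding e_def by real_asymp
  have "\<exists>ze \<xi> v. ze \<in> ball a (e n) \<and> \<xi> \<in> ball a (e n) \<and> norm v = 1 \<and> hs \<xi> v v + (dr ze v)\<^sup>2 / e n < e n" for n
   using neg e[of n] by (meson not_le)
  then obtain ze \<xi> v where *: "\<And>n. ze n \<in> ball a (e n)" "\<And>n. \<xi> n \<in> ball a (e n)" "\<And>n. norm (v n) = 1"
   "\<And>n. hs (\<xi> n) (v n) (v n) + (dr (ze n) (v n))\<^sup>2 / e n < e n" by metis
  obtain v0 t where t: "strict_mono (t :: nat \<Rightarrow> nat)" "norm v0 = 1" "(\<lambda>n. v (t n)) \<longlonglongrightarrow> v0"
 proof -
   assume g: "\<And>t v0. strict_mono (t :: nat \<Rightarrow> nat) \<Longrightarrow> norm v0 = 1 \<Longrightarrow> (\<lambda>n. v (t n)) \<longlonglongrightarrow> v0 \<Longrightarrow> thesis"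
   have "\<forall>n. v n \<in> sphere 0 1" using *(3) by simp
   from seq_compactE[OF compact_imp_seq_compact[OF compact_sphere] this]
   obtain v0 t where "v0 \<in> sphere 0 1" "strict_mono (t :: nat \<Rightarrow> nat)" "(v \<circ> t) \<longlonglongrightarrow> v0" by metis
   thus thesis by (intro g[of t v0]) (simp_all add: o_def)
  qed
  have et: "(\<lambda>n. e (t n)) \<longlonglongrightarrow> 0" using LIMSEQ_subseq_LIMSEQ[OF e_lim t(1)] by (simp add: o_def)
  have lim: "(\<lambda>n. x (t n)) \<longlonglongrightarrow> a" if "\<And>n. x n \<in> ball a (e n)" for x
   by (rule metric_tendsto_imp_tendsto[OF et]) (use that e in \<open>auto simp: dist_commute less_imp_le abs_of_pos\<close>)
  have L1: "(\<lambda>n. dr (ze (t n)) (v (t n))) \<longlonglongrightarrow> dr a v0" by (rule tendsto_dr[OF lim[OF *(1)] a t(3)])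
  have L2: "(\<lambda>n. hs (\<xi> (t n)) (v (t n)) (v (t n))) \<longlonglongrightarrow> hs a v0 v0" by (rule tendsto_hs[OF lim[OF *(2)] a t(3,3)])
  \<comment> \<open>Multiplied by \<open>e\<close>, the negated inequality forces the limit vector
    \<open>v0\<close> to be tangential; only then is the Hessian positive on it.\<close>
  have "(\<lambda>n. e (t n) * (e (t n) - hs (\<xi> (t n)) (v (t n)) (v (t n)))) \<longlonglongrightarrow> 0 * (0 - hs a v0 v0)"
   by (intro tendsto_intros et L2)
  moreover have "(dr (ze (t n)) (v (t n)))\<^sup>2 \<le> e (t n) * (e (t n) - hs (\<xi> (t n)) (v (t n)) (v (t n)))" for n
   using *(4)[of "t n"] e(1)[of "t n"] by (simp add: field_simps)
  ultimately have "(dr a v0)\<^sup>2 \<le> 0 * (0 - hs a v0 v0)"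
   by (intro LIMSEQ_le[OF tendsto_power[OF L1]]) auto
  hence d0: "dr a v0 = 0" by simp
  have "hs (\<xi> n) (v n) (v n) \<le> e n" for n
  proof -
   have "0 \<le> (dr (ze n) (v n))\<^sup>2 / e n" using e(1)[of n] by simp
   thus ?thesis using *(4)[of n] by linarith
  qed
  hence "hs a v0 v0 \<le> 0" by (intro LIMSEQ_le[OF L2 et]) auto
  moreover have "v0 \<noteq> 0" using t(2) by auto
  ultimately show False using pos[OF _ d0] by fastforce
 qed
 then obtain c where c: "c > 0" "c \<le> c0" and
  bound: "\<And>ze \<xi> v. ze \<in> ball a c \<Longrightarrow> \<xi> \<in> ball a c \<Longrightarrow> norm v = 1 \<Longrightarrow> c \<le> hs \<xi> v v + (dr ze v)\<^sup>2 / c" by blast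
 show ?thesis
 proof (rule that[OF c(1)])
  show sub: "ball a c \<subseteq> U" using c c0 by auto
  fix ze \<xi> v :: 'e assume ze: "ze \<in> ball a c" and \<xi>: "\<xi> \<in> ball a c"
  have zU: "ze \<in> U" using ze sub by blast
  define u where "u = sgn v"
  have vu: "v = norm v *\<^sub>R u" by (cases "v = 0") (simp_all add: u_def sgn_div_norm)
  have "c * (norm v)\<^sup>2 \<le> (norm v)\<^sup>2 * (hs \<xi> u u + (dr ze u)\<^sup>2 / c)"
  proof (cases "v = 0")
   case False
   hence "c \<le> hs \<xi> u u + (dr ze u)\<^sup>2 / c" by (intro bound[OF ze \<xi>]) (simp add: u_def norm_sgn)
   thus ?thesis by (subst mult.commute) (intro mult_left_mono, simp_all)
  qed simp
  also have "\<dots> = hs \<xi> (norm v *\<^sub>R u) (norm v *\<^sub>R u) + (dr ze (norm v *\<^sub>R u))\<^sup>2 / c"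
   using linear_cmul[OF linear_dr[OF zU]] by (simp add: hs_bilinear algebra_simps power2_eq_square)
  finally show "c * (norm v)\<^sup>2 \<le> hs \<xi> v v + (dr ze v)\<^sup>2 / c" using vu by metis
 qed
qed

end

section \<open>Unitary frames in two complex dimensions\<close>

definition herm :: "complex ^ 2 \<Rightarrow> complex ^ 2 \<Rightarrow> complex" where
 "herm v n = v $ 1 * cnj (n $ 1) + v $ 2 * cnj (n $ 2)"

text \<open>For a unit vector \<open>n\<close> the pair \<open>n\<close>, \<open>perp n\<close> is a
  unitary basis; for a normal \<open>n\<close> the second vector spans the complex tangent direction
  of the boundary.\<close>

definition perp :: "complex ^ 2 \<Rightarrow> complex ^ 2" where
 "perp n = pt (- cnj (n $ 2)) (cnj (n $ 1))"

lemma cs_nth: "cs c v $ i = c * v $ i" for v :: "complex ^ 2"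
 by (simp add: cs_vec_def cs_complex_def)

lemma Re_herm: "Re (herm v n) = v \<bullet> n"
 by (simp add: herm_def inner_vec_def sum_2 inner_complex_def)

lemma herm_self: "herm n n = of_real ((norm n)\<^sup>2)"
 by (simp add: herm_def norm_vec_def L2_set_def sum_2 complex_norm_square[symmetric])

lemma herm_linear: "herm (cs c v) n = c * herm v n" "herm (v + w) n = herm v n + herm w n" "herm (v - w) n = herm v n - herm w n"
 by (simp_all add: herm_def cs_nth algebra_simps)

lemma herm_perp [simp]: "herm (perp n) n = 0" "herm n (perp n) = 0" "norm (perp n) = norm n"
 by (simp_all add: herm_def perp_def norm_vec_def L2_set_def sum_2)

lemma herm_le: "cmod (herm v n) \<le> norm v * norm n"
proof (cases "herm v n = 0")
 case False
 let ?t = "cnj (sgn (herm v n))"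
 have t: "cmod ?t = 1" using False by (simp add: norm_sgn)
 have "cmod (herm v n) = Re (?t * herm v n)"
  using False by (simp add: sgn_div_norm complex_norm_square[symmetric] field_simps power2_eq_square flip: of_real_mult)
 also have "\<dots> = cs ?t v \<bullet> n" by (simp only: herm_linear(1)[symmetric] Re_herm)
 also have "\<dots> \<le> norm (cs ?t v) * norm n" by (rule norm_cauchy_schwarz)
 finally show ?thesis using t by (simp add: norm_cs)
qed simp

lemma herm_decompose:
 assumes "norm n = 1" shows "v = cs (herm v n) n + cs (herm v (perp n)) (perp n)"
proof -
 have 1: "n $ 1 * cnj (n $ 1) + n $ 2 * cnj (n $ 2) = 1" using herm_self[of n] assms by (simp add: herm_def)
 have "herm v n * n $ 1 + herm v (perp n) * (- cnj (n $ 2)) = v $ 1 * (n $ 1 * cnj (n $ 1) + n $ 2 * cnj (n $ 2))"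
  "herm v n * n $ 2 + herm v (perp n) * cnj (n $ 1) = v $ 2 * (n $ 1 * cnj (n $ 1) + n $ 2 * cnj (n $ 2))"
  by (simp_all add: herm_def perp_def algebra_simps)
 thus ?thesis unfolding 1 by (simp add: pt_eq_iff cs_nth) (simp add: perp_def)
qed

lemma tendsto_cs:
 assumes "(c \<longlongrightarrow> c0) F" "(v \<longlongrightarrow> v0) F"
 shows "((\<lambda>i. cs (c i) (v i :: complex ^ 2)) \<longlongrightarrow> cs c0 v0) F"
proof (rule vec_tendstoI)
 show "((\<lambda>x. cs (c x) (v x) $ i) \<longlongrightarrow> cs c0 v0 $ i) F" for i
  unfolding cs_nth by (intro tendsto_mult tendsto_vec_nth assms)
qed

lemma tendsto_perp:
 assumes "(n \<longlongrightarrow> n0) F" shows "((\<lambda>i. perp (n i)) \<longlongrightarrow> perp n0) F"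
proof (rule vec_tendstoI)
 fix i :: 2
 show "((\<lambda>x. perp (n x) $ i) \<longlongrightarrow> perp n0 $ i) F"
 proof (cases "i = 1")
  case True
  have "((\<lambda>x. - cnj (n x $ 2)) \<longlongrightarrow> - cnj (n0 $ 2)) F" by (intro tendsto_intros assms)
  with True show ?thesis by (simp add: perp_def)
 next
  case False
  hence "i = 2" using exhaust_2[of i] by blast
  moreover have "((\<lambda>x. cnj (n x $ 1)) \<longlongrightarrow> cnj (n0 $ 1)) F" by (intro tendsto_intros assms)
  ultimately show ?thesis by (simp add: perp_def)
 qed
qed

locale strongly_convex_point = C2_function r U
 for r :: "complex ^ 2 \<Rightarrow> real" and U :: "(complex ^ 2) set" +
 fixes Om :: "(complex ^ 2) set" and a :: "complex ^ 2"
 assumes open_Om: "open Om" and convex_Om: "convex Om" and bounded_Om: "bounded Om"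
  and frontier_U: "frontier Om \<subseteq> U" and Om_U: "Om \<inter> U = {x \<in> U. r x < 0}"
  and a_frontier: "a \<in> frontier Om" and dr_nonzero: "\<And>x. x \<in> frontier Om \<Longrightarrow> \<exists>v. dr x v \<noteq> 0"
  and hs_pos: "\<And>v. v \<noteq> 0 \<Longrightarrow> dr a v = 0 \<Longrightarrow> 0 < hs a v v"
begin

lemma a_U: "a \<in> U" using a_frontier frontier_U by blast

lemma r_frontier: assumes "z \<in> frontier Om" shows "r z = 0"
proof -
 have zU: "z \<in> U" using assms frontier_U by blast
 have "z \<notin> Om" using assms open_Om by (simp add: frontier_def interior_open)
 hence "r z \<ge> 0" using Om_U zU by fastforce
 moreover have "\<not> r z > 0"
 proof
  assume "r z > 0"
  moreover have "isCont r z"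
   using has_derivative_continuous[OF has_derivative_r[OF zU]] .
  ultimately have "\<forall>\<^sub>F y in nhds z. r y > 0"
   by (metis isContD order_tendstoD(1) tendsto_at_iff_tendsto_nhds)
  moreover have "\<forall>\<^sub>F y in nhds z. y \<in> U" by (rule eventually_nhds_in_open[OF open_U zU])
  ultimately have "\<forall>\<^sub>F y in nhds z. y \<notin> Om"
  proof eventually_elim
   case (elim y)
   hence "y \<in> Om \<Longrightarrow> r y < 0" using Om_U by blast
   with elim(1) show ?case by auto
  qed
  then obtain S where "open S" "z \<in> S" "\<forall>y\<in>S. y \<notin> Om" unfolding eventually_nhds by blast
  moreover have "z \<in> closure Om" using assms by (simp add: frontier_def)
  ultimately show False using open_Int_closure_eq_empty[of S Om] by blast
 qed
 ultimately show ?thesis by simp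
qed

text \<open>A quadratic separation of all of \<open>Om\<close> from its tangent planes, uniform near
  \<open>a\<close>. Close to \<open>ze\<close> it comes from Taylor's formula and the penalized
  Hessian bound; a distant \<open>z\<close> is first moved towards \<open>ze\<close> along a
  segment, whose interior lies in \<open>Om\<close> by convexity.\<close>

lemma boundary_convexity:
 obtains c where "c > 0"
  "\<And>ze z. ze \<in> frontier Om \<Longrightarrow> ze \<in> ball a c \<Longrightarrow> z \<in> Om \<Longrightarrow> c * (norm (z - ze))\<^sup>2 \<le> - dr ze (z - ze)"
proof -
 obtain c0 where c0: "c0 > 0" "ball a c0 \<subseteq> U"
  "\<And>ze \<xi> v. ze \<in> ball a c0 \<Longrightarrow> \<xi> \<in> ball a c0 \<Longrightarrow> c0 * (norm v)\<^sup>2 \<le> hs \<xi> v v + (dr ze v)\<^sup>2 / c0"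
  by (rule hessian_lower_bound[OF a_U hs_pos]) (assumption, assumption, rule that)
 have "((\<lambda>p. dr (fst p) (snd p)) \<longlongrightarrow> dr a 0) (nhds a \<times>\<^sub>F nhds 0)"
  by (rule tendsto_dr[OF filterlim_fst a_U filterlim_snd])
 moreover have "dr a 0 = 0" by (rule linear_0[OF linear_dr[OF a_U]])
 ultimately have "\<forall>\<^sub>F p in nhds (a, 0). \<bar>dr (fst p) (snd p)\<bar> < c0"
  using c0(1) by (auto simp: tendsto_iff nhds_prod)
 then obtain e where e: "e > 0" "\<And>p. dist p (a, 0) < e \<Longrightarrow> \<bar>dr (fst p) (snd p)\<bar> < c0"
  unfolding eventually_nhds_metric by blast
 define \<eta> where "\<eta> = min (c0 / 2) (e / 2)"
 have \<eta>: "\<eta> > 0" using c0 e by (simp add: \<eta>_def)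
 have small: "\<bar>dr ze w\<bar> < c0" if "ze \<in> ball a \<eta>" "norm w < \<eta>" for ze w
 proof -
  have "dist (ze, w) (a, 0) \<le> dist ze a + dist w 0"
   unfolding dist_Pair_Pair by (rule sqrt_sum_squares_le_sum) auto
  also have "\<dots> < e" using that by (simp add: \<eta>_def dist_commute)
  finally show ?thesis using e(2)[of "(ze, w)"] by simp
 qed
 have near: "c0 / 3 * (norm w)\<^sup>2 \<le> - dr ze w"
  if ze: "ze \<in> frontier Om" "ze \<in> ball a \<eta>" and w: "ze + w \<in> Om" "norm w < \<eta>" for ze w
 proof -
  have b: "ze \<in> ball a c0" "ze + w \<in> ball a c0"
   using ze(2) w(2) c0(1) norm_triangle_ineq4[of "a - ze" w] by (auto simp: \<eta>_def dist_norm algebra_simps)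
  have seg: "closed_segment ze (ze + w) \<subseteq> ball a c0" by (rule closed_segment_subset[OF b convex_ball])
  obtain \<xi> where \<xi>: "\<xi> \<in> closed_segment ze (ze + w)" "r (ze + w) = r ze + dr ze w + hs \<xi> w w / 2"
   by (rule taylor2[OF order_trans[OF seg c0(2)]]) (rule that)
  have "r (ze + w) < 0" using w(1) b(2) c0(2) Om_U by blast
  hence h: "hs \<xi> w w < - 2 * dr ze w" using \<xi>(2) r_frontier[OF ze(1)] by simp
  have "c0 * (norm w)\<^sup>2 \<le> hs \<xi> w w + (dr ze w)\<^sup>2 / c0" by (rule c0(3)[OF b(1)]) (use \<xi>(1) seg in blast)
  with h have m: "c0 * (norm w)\<^sup>2 < - 2 * dr ze w + (dr ze w)\<^sup>2 / c0" by linarith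
  have s: "\<bar>dr ze w\<bar> < c0" by (rule small[OF ze(2) w(2)])
  \<comment> \<open>Where the first derivative is below \<open>c0\<close>, the quadratic penalty is
    dominated by a linear term and can be absorbed.\<close>
  have sq: "(dr ze w)\<^sup>2 / c0 \<le> \<bar>dr ze w\<bar>"
   using s c0(1) mult_right_mono[of "\<bar>dr ze w\<bar>" c0 "\<bar>dr ze w\<bar>"] by (simp add: field_simps power2_eq_square)
  have "0 \<le> c0 * (norm w)\<^sup>2" using c0(1) by simp
  with m sq have "c0 * (norm w)\<^sup>2 \<le> - 3 * dr ze w" by linarith
  thus ?thesis by simp
 qed
 obtain d where d: "d > 0" "\<And>x y. x \<in> closure Om \<Longrightarrow> y \<in> closure Om \<Longrightarrow> norm (x - y) \<le> d"
 proof -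
  obtain B where B: "B > 0" "\<And>x. x \<in> closure Om \<Longrightarrow> norm x \<le> B"
   using bounded_closure[OF bounded_Om] bounded_pos by metis
  have "norm (x - y) \<le> B + B" if "x \<in> closure Om" "y \<in> closure Om" for x y
   using norm_triangle_ineq4[of x y] B(2)[OF that(1)] B(2)[OF that(2)] by linarith
  with B(1) show ?thesis by (intro that[of "B + B"]) auto
 qed
 \<comment> \<open>The last entry covers distant points: shortening by
   \<open>t \<ge> \<eta> / (2 * d)\<close>, with \<open>d\<close> a bound for the diameter, costs
   one factor \<open>t\<close>.\<close>
 define c where "c = min \<eta> (min (c0 / 3) (c0 / 3 * \<eta> / (2 * d)))"
 show ?thesis
 proof (rule that[of c])
  show "c > 0" using \<eta> c0 d by (simp add: c_def)
  fix ze z assume ze: "ze \<in> frontier Om" "ze \<in> ball a c" and z: "z \<in> Om"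
  define w where "w = z - ze"
  have zeh: "ze \<in> ball a \<eta>" using ze(2) by (simp add: c_def)
  show "c * (norm (z - ze))\<^sup>2 \<le> - dr ze (z - ze)"
  proof (cases "norm w < \<eta>")
   case True
   have "c * (norm w)\<^sup>2 \<le> c0 / 3 * (norm w)\<^sup>2" by (intro mult_right_mono) (auto simp: c_def)
   with near[OF ze(1) zeh _ True] z show ?thesis by (simp add: w_def)
  next
   case False
   hence nw: "norm w \<ge> \<eta>" by simp
   define t where "t = \<eta> / (2 * norm w)"
   have t: "0 < t" "t < 1" "norm (t *\<^sub>R w) < \<eta>"
   proof -
    have "norm w > 0" using \<eta> nw by linarith
    thus "0 < t" "t < 1" "norm (t *\<^sub>R w) < \<eta>" using \<eta> nw by (simp_all add: t_def field_simps)
   qed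
   have "ze - t *\<^sub>R (ze - z) \<in> interior Om"
    by (rule mem_interior_closure_convex_shrink[OF convex_Om])
      (use z ze(1) t open_Om in \<open>auto simp: interior_open frontier_def\<close>)
   hence "ze + t *\<^sub>R w \<in> Om" using open_Om by (simp add: interior_open w_def algebra_simps)
   from near[OF ze(1) zeh this t(3)]
   have "c0 / 3 * (t\<^sup>2 * (norm w)\<^sup>2) \<le> t * (- dr ze w)"
    using linear_cmul[OF linear_dr[of ze]] ze(1) frontier_U by (auto simp: power_mult_distrib)
   hence "t * (c0 / 3 * t * (norm w)\<^sup>2) \<le> t * (- dr ze w)" by (simp add: power2_eq_square algebra_simps)
   hence 1: "c0 / 3 * t * (norm w)\<^sup>2 \<le> - dr ze w" using t(1) by (simp only: mult_le_cancel_left_pos)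
   have "norm w \<le> d" using d(2)[of z ze] z ze(1) closure_subset by (auto simp: w_def frontier_def)
   hence "\<eta> / (2 * d) \<le> t" using nw \<eta> d(1) unfolding t_def by (intro divide_left_mono mult_pos_pos) auto
   hence "c0 / 3 * (\<eta> / (2 * d)) \<le> c0 / 3 * t" using c0(1) by (intro mult_left_mono) auto
   moreover have "c \<le> c0 / 3 * (\<eta> / (2 * d))" by (simp add: c_def)
   ultimately have "c \<le> c0 / 3 * t" by (rule order_trans[rotated])
   hence "c * (norm w)\<^sup>2 \<le> c0 / 3 * t * (norm w)\<^sup>2" by (intro mult_right_mono) auto
   with 1 show ?thesis by (simp add: w_def)
  qed
 qed
qed

section \<open>Gradient, inner normal and nearest boundary points\<close>

definition "grad x = (\<Sum>b\<in>Basis. dr x b *\<^sub>R b)"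

lemma grad_inner: "x \<in> U \<Longrightarrow> grad x \<bullet> v = dr x v"
 using linear_expand[OF linear_dr, of x v] by (simp add: grad_def inner_sum_right inner_commute[of _ v] mult.commute)

lemma tendsto_grad: "(\<xi> \<longlongrightarrow> x) F \<Longrightarrow> x \<in> U \<Longrightarrow> ((\<lambda>j. grad (\<xi> j)) \<longlongrightarrow> grad x) F"
 unfolding grad_def by (intro tendsto_sum tendsto_scaleR tendsto_dr tendsto_const)

lemma grad_nonzero: "x \<in> frontier Om \<Longrightarrow> grad x \<noteq> 0"
 using dr_nonzero grad_inner frontier_U by (metis inner_zero_left subsetD)

text \<open>The inner unit normal, as the defining function is negative inside.\<close>

definition "normal x = - sgn (grad x)"

lemma norm_normal: "x \<in> frontier Om \<Longrightarrow> norm (normal x) = 1"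
 using grad_nonzero by (simp add: normal_def norm_sgn)

lemma dr_normal: assumes "x \<in> frontier Om" shows "dr x v = - norm (grad x) * (v \<bullet> normal x)"
proof -
 have "dr x v = grad x \<bullet> v" using grad_inner assms frontier_U by auto
 thus ?thesis using grad_nonzero[OF assms] by (simp add: normal_def sgn_div_norm inner_commute)
qed

lemma tendsto_normal: "(\<xi> \<longlongrightarrow> x) F \<Longrightarrow> x \<in> frontier Om \<Longrightarrow> ((\<lambda>j. normal (\<xi> j)) \<longlongrightarrow> normal x) F"
 unfolding normal_def by (intro tendsto_minus tendsto_sgn tendsto_grad grad_nonzero) (use frontier_U in auto)

lemma nearest_boundary_point:
 assumes x: "x \<in> Om"
 obtains ze where "ze \<in> frontier Om" "dist x ze \<le> dist x a" "ball x (dist x ze) \<subseteq> Om" "dist x ze > 0"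
proof -
 obtain ze where ze: "ze \<in> frontier Om" "\<And>y. y \<in> frontier Om \<Longrightarrow> dist x ze \<le> dist x y"
  using distance_attains_inf[of "frontier Om" x] a_frontier by auto
 have z: "ze \<notin> Om" using ze(1) open_Om by (simp add: frontier_def interior_open)
 hence pos: "dist x ze > 0" using x by auto
 have "ball x (dist x ze) \<subseteq> Om"
 proof (rule ccontr)
  assume "\<not> ?thesis"
  hence "ball x (dist x ze) \<inter> frontier Om \<noteq> {}"
  proof (intro connected_Int_frontier[OF connected_ball])
   have "x \<in> ball x (dist x ze) \<inter> Om" using x pos by simp
   thus "ball x (dist x ze) \<inter> Om \<noteq> {}" by blast
   show "ball x (dist x ze) - Om \<noteq> {}" using \<open>\<not> ball x (dist x ze) \<subseteq> Om\<close> by blast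
  qed
  thus False using ze(2) by force
 qed
 with ze pos a_frontier show ?thesis by (intro that) auto
qed

text \<open>\<open>Om\<close> lies on one side of the tangent plane at \<open>ze\<close>, and a ball
  around \<open>x\<close> inside \<open>Om\<close> touches it there; equality in the Cauchy-Schwarz
  inequality forces \<open>x - ze\<close> onto the normal.\<close>

lemma nearest_normal:
 assumes ze: "ze \<in> frontier Om" and b: "ball x (dist x ze) \<subseteq> Om" and pos: "dist x ze > 0"
  and mono: "\<And>z. z \<in> Om \<Longrightarrow> 0 \<le> - dr ze (z - ze)"
 shows "x = ze + dist x ze *\<^sub>R normal ze"
proof -
 let ?G = "grad ze" and ?d = "dist x ze"
 have zU: "ze \<in> U" using ze frontier_U by blast
 have G: "norm ?G > 0" using grad_nonzero[OF ze] by simp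
 have *: "t * norm ?G \<le> - (?G \<bullet> (x - ze))" if t: "0 \<le> t" "t < ?d" for t
 proof -
  have "x + t *\<^sub>R sgn ?G \<in> Om" using b t G by (auto simp: dist_norm norm_sgn subset_iff)
  from mono[OF this] have "?G \<bullet> (x + t *\<^sub>R sgn ?G - ze) \<le> 0" by (simp add: grad_inner[OF zU])
  hence "?G \<bullet> (x - ze) + t * (?G \<bullet> sgn ?G) \<le> 0" by (simp add: inner_diff_right inner_add_right)
  moreover have "?G \<bullet> sgn ?G = norm ?G"
   using G by (simp add: sgn_div_norm power2_norm_eq_inner[symmetric] power2_eq_square)
  ultimately show ?thesis by simp
 qed
 have "?d * norm ?G \<le> - (?G \<bullet> (x - ze))"
 proof (rule field_le_mult_one_interval)
  fix z :: real assume z: "0 < z" "z < 1"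
  have "z * ?d < ?d" using z(2) pos by simp
  thus "z * (?d * norm ?G) \<le> - (?G \<bullet> (x - ze))"
   using *[of "z * ?d"] z(1) pos by (simp add: mult.assoc)
 qed
 moreover have "(- ?G) \<bullet> (x - ze) \<le> norm (- ?G) * norm (x - ze)" by (rule norm_cauchy_schwarz)
 ultimately have "(- ?G) \<bullet> (x - ze) = norm (- ?G) * norm (x - ze)" by (simp add: dist_norm mult.commute)
 hence "norm ?G *\<^sub>R (x - ze) = ?d *\<^sub>R (- ?G)" using norm_cauchy_schwarz_eq[of "- ?G" "x - ze"] by (simp add: dist_norm)
 hence "inverse (norm ?G) *\<^sub>R (norm ?G *\<^sub>R (x - ze)) = inverse (norm ?G) *\<^sub>R (?d *\<^sub>R (- ?G))" by (rule arg_cong)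
 hence "x - ze = ?d *\<^sub>R normal ze" using G by (simp add: normal_def sgn_div_norm)
 thus ?thesis by (simp add: algebra_simps)
qed

end

section \<open>Rescaling at a strongly convex boundary point\<close>

text \<open>The Cayley transform of the Siegel domain
  \<open>k\<^sup>2 * (cmod (u $ 2))\<^sup>2 < Re (u $ 1)\<close> to the unit ball, taking
  \<open>pt 1 0\<close> to the centre; \<open>yac\<close> is its inverse.\<close>

definition cay :: "real \<Rightarrow> complex ^ 2 \<Rightarrow> complex ^ 2" where
 "cay k u = pt ((u $ 1 - 1) / (u $ 1 + 1)) (2 * of_real k * u $ 2 / (u $ 1 + 1))"

definition yac :: "real \<Rightarrow> complex ^ 2 \<Rightarrow> complex ^ 2" where
 "yac k w = pt ((1 + w $ 1) / (1 - w $ 1)) (w $ 2 / (of_real k * (1 - w $ 1)))"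

lemma norm_pow2_vec2: "(norm (u :: complex ^ 2))\<^sup>2 = (cmod (u $ 1))\<^sup>2 + (cmod (u $ 2))\<^sup>2"
 by (simp add: norm_vec_def L2_set_def sum_2)

lemma norm_cay:
 fixes u :: "complex ^ 2"
 assumes "u $ 1 + 1 \<noteq> 0"
 shows "1 - (norm (cay k u))\<^sup>2 = 4 * (Re (u $ 1) - k\<^sup>2 * (cmod (u $ 2))\<^sup>2) / (cmod (u $ 1 + 1))\<^sup>2"
proof -
 have 1: "(cmod (u $ 1 + 1))\<^sup>2 - (cmod (u $ 1 - 1))\<^sup>2 = 4 * Re (u $ 1)"
  unfolding cmod_power2 by (simp add: power2_eq_square algebra_simps)
 have "(norm (cay k u))\<^sup>2 = ((cmod (u $ 1 - 1))\<^sup>2 + 4 * (k\<^sup>2 * (cmod (u $ 2))\<^sup>2)) / (cmod (u $ 1 + 1))\<^sup>2"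
  by (simp add: norm_pow2_vec2 cay_def norm_divide norm_mult power_divide power_mult_distrib add_divide_distrib)
 hence "1 - (norm (cay k u))\<^sup>2 = ((cmod (u $ 1 + 1))\<^sup>2 - (cmod (u $ 1 - 1))\<^sup>2 - 4 * (k\<^sup>2 * (cmod (u $ 2))\<^sup>2)) / (cmod (u $ 1 + 1))\<^sup>2"
  using assms by (simp add: diff_divide_distrib add_divide_distrib)
 thus ?thesis by (simp only: 1 right_diff_distrib)
qed

lemma cay_cball:
 fixes u :: "complex ^ 2"
 assumes "k\<^sup>2 * (cmod (u $ 2))\<^sup>2 \<le> Re (u $ 1)"
 shows "u $ 1 + 1 \<noteq> 0" "cay k u \<in> cball 0 1"
proof -
 have "0 \<le> k\<^sup>2 * (cmod (u $ 2))\<^sup>2" by simp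
 hence "Re (u $ 1) + 1 > 0" using assms by linarith
 hence "Re (u $ 1 + 1) > 0" by simp
 thus nz: "u $ 1 + 1 \<noteq> 0" by force
 have "0 \<le> 4 * (Re (u $ 1) - k\<^sup>2 * (cmod (u $ 2))\<^sup>2) / (cmod (u $ 1 + 1))\<^sup>2" using assms by simp
 hence "(norm (cay k u))\<^sup>2 \<le> 1" using norm_cay[OF nz, of k] by linarith
 thus "cay k u \<in> cball 0 1" by (simp add: power_le_one_iff)
qed

lemma cay_ball_iff:
 fixes u :: "complex ^ 2"
 assumes "u $ 1 + 1 \<noteq> 0"
 shows "cay k u \<in> ball 0 1 \<longleftrightarrow> k\<^sup>2 * (cmod (u $ 2))\<^sup>2 < Re (u $ 1)"
proof -
 have "cay k u \<in> ball 0 1 \<longleftrightarrow> 0 < 1 - (norm (cay k u))\<^sup>2" by (simp add: power_less_one_iff)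
 also have "\<dots> \<longleftrightarrow> k\<^sup>2 * (cmod (u $ 2))\<^sup>2 < Re (u $ 1)"
  unfolding norm_cay[OF assms] using assms by (simp add: zero_less_divide_iff zero_less_power2)
 finally show ?thesis .
qed

lemma ball_nth: "w \<in> ball 0 1 \<Longrightarrow> 1 - w $ 1 \<noteq> 0" for w :: "complex ^ 2"
proof -
 assume "w \<in> ball 0 1"
 hence "cmod (w $ 1) < 1" using Finite_Cartesian_Product.norm_nth_le[of w 1] by simp
 thus ?thesis by force
qed

lemma yac_cay: "u $ 1 + 1 \<noteq> 0 \<Longrightarrow> k \<noteq> 0 \<Longrightarrow> yac k (cay k u) = u" for u :: "complex ^ 2"
proof -
 assume nz: "u $ 1 + 1 \<noteq> 0" and k: "k \<noteq> 0"
 have "1 + (u $ 1 - 1) / (u $ 1 + 1) = 2 * u $ 1 / (u $ 1 + 1)" "1 - (u $ 1 - 1) / (u $ 1 + 1) = 2 / (u $ 1 + 1)"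
  using nz by (simp_all add: divide_simps)
 thus ?thesis using nz k by (simp add: pt_eq_iff yac_def cay_def)
qed

lemma cay_yac:
 assumes w: "w \<in> ball 0 1" and k: "k \<noteq> 0"
 shows "cay k (yac k w) = w" "yac k w $ 1 + 1 \<noteq> 0"
proof -
 have nz: "1 - w $ 1 \<noteq> 0" by (rule ball_nth[OF w])
 have e: "yac k w $ 1 + 1 = 2 / (1 - w $ 1)" "yac k w $ 1 - 1 = 2 * w $ 1 / (1 - w $ 1)"
  using nz by (simp_all add: yac_def field_simps)
 show "yac k w $ 1 + 1 \<noteq> 0" unfolding e using nz by simp
 show "cay k (yac k w) = w" unfolding cay_def e using nz k by (simp add: pt_eq_iff yac_def)
qed

lemma holo_cay: "(\<And>u :: complex ^ 2. u \<in> S \<Longrightarrow> u $ 1 + 1 \<noteq> 0) \<Longrightarrow> holo (cay k) S"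
 unfolding cay_def[abs_def] by (intro holo_pt holo_divide holo_mult holo_add holo_diff holo_vec_nth holo_ident holo_const)

lemma holo_yac: assumes k: "k \<noteq> 0" shows "holo (yac k) (ball 0 1)"
 unfolding yac_def[abs_def]
 by (intro holo_pt holo_divide holo_mult holo_add holo_diff holo_vec_nth holo_ident holo_const)
   (use k ball_nth in auto)

text \<open>The non-Hermitian part of a quadratic boundary is the real part of a holomorphic
  polynomial in the second coordinate; a shear absorbs it into the first one.\<close>

definition "shear \<beta> (u :: complex ^ 2) = pt (u $ 1 + \<beta> * (u $ 2)\<^sup>2) (u $ 2)"

lemma shear_shear [simp]: "shear (- \<beta>) (shear \<beta> u) = u" "shear \<beta> (shear (- \<beta>) u) = u"
 by (simp_all add: shear_def pt_eq_iff)

lemma holo_shear: "holo (shear \<beta>) S"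
 unfolding shear_def[abs_def] power2_eq_square by (intro holo_pt holo_mult holo_add holo_vec_nth holo_ident holo_const)

section \<open>Anisotropic dilations at the boundary\<close>

context strongly_convex_point
begin

text \<open>Coordinates in the unitary frame at \<open>ze\<close>, scaled by \<open>\<delta>\<close>
  in the normal and by \<open>sqrt \<delta>\<close> in the complex tangential direction: first order
  terms in the former and second order terms in the latter then both have size
  \<open>\<delta>\<close>.\<close>

definition Bm :: "complex ^ 2 \<Rightarrow> real \<Rightarrow> complex ^ 2 \<Rightarrow> complex ^ 2" where
 "Bm ze \<delta> u = ze + cs (of_real \<delta> * u $ 1) (normal ze) + cs (of_real (sqrt \<delta>) * u $ 2) (perp (normal ze))"

definition "Bi ze \<delta> z = pt (herm (z - ze) (normal ze) / of_real \<delta>) (herm (z - ze) (perp (normal ze)) / of_real (sqrt \<delta>))"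

lemma holo_Bm: "holo (Bm ze \<delta>) S"
 unfolding Bm_def[abs_def] by (intro holo_add holo_cs holo_mult holo_vec_nth holo_ident holo_const)

lemma holo_Bi: "\<delta> > 0 \<Longrightarrow> holo (Bi ze \<delta>) S"
 unfolding Bi_def[abs_def] herm_def
 by (intro holo_pt holo_divide holo_add holo_mult holo_diff holo_vec_nth holo_ident holo_const) auto

lemma Bi_Bm: assumes "ze \<in> frontier Om" "\<delta> > 0" shows "Bi ze \<delta> (Bm ze \<delta> u) = u"
 using assms norm_normal[OF assms(1)] by (simp add: Bi_def Bm_def pt_eq_iff herm_linear herm_self)

lemma Bm_Bi: assumes "ze \<in> frontier Om" "\<delta> > 0" shows "Bm ze \<delta> (Bi ze \<delta> z) = z"
proof -
 have "Bm ze \<delta> (Bi ze \<delta> z) = ze + (cs (herm (z - ze) (normal ze)) (normal ze) + cs (herm (z - ze) (perp (normal ze))) (perp (normal ze)))"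
  using assms by (simp add: Bm_def Bi_def)
 thus ?thesis using herm_decompose[OF norm_normal[OF assms(1)], of "z - ze"] by simp
qed

text \<open>The right side is the normal component from \<open>boundary_convexity\<close>, and the
  tangential component is part of the left. In scaled coordinates the power of
  \<open>\<delta>\<close> cancels, which traps all rescaled copies in one Siegel domain.\<close>

lemma Bi_siegel:
 assumes ze: "ze \<in> frontier Om" and \<delta>: "\<delta> > 0" and c: "c \<ge> 0" and z: "c * (norm (z - ze))\<^sup>2 \<le> - dr ze (z - ze)"
 shows "c * (cmod (Bi ze \<delta> z $ 2))\<^sup>2 \<le> norm (grad ze) * Re (Bi ze \<delta> z $ 1)"
proof -
 let ?w = "z - ze" and ?n = "normal ze"
 have "cmod (herm ?w (perp ?n)) \<le> norm ?w" using herm_le[of ?w "perp ?n"] norm_normal[OF ze] by simp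
 hence "c * (cmod (herm ?w (perp ?n)))\<^sup>2 \<le> c * (norm ?w)\<^sup>2" using c by (intro mult_left_mono power_mono) auto
 also have "\<dots> \<le> norm (grad ze) * (?w \<bullet> ?n)" using z dr_normal[OF ze, of ?w] by simp
 finally have "c * (cmod (herm ?w (perp ?n)))\<^sup>2 / \<delta> \<le> norm (grad ze) * (?w \<bullet> ?n) / \<delta>"
  using \<delta> by (intro divide_right_mono) auto
 thus ?thesis using \<delta> by (simp add: Bi_def norm_divide power_divide Re_divide_of_real Re_herm)
qed

text \<open>Taylor expansion in scaled coordinates. The filter is arbitrary because the result is
  used along sequences and also along the product of \<open>sequentially\<close> with the
  neighbourhoods of a point, where it yields uniformity.\<close>

lemma tendsto_rescaled:
 fixes F :: "'i filter" and u :: "'i \<Rightarrow> complex ^ 2" and u0 :: "complex ^ 2"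
 assumes ev: "\<forall>\<^sub>F i in F. \<delta> i > 0 \<and> ze i \<in> frontier Om"
  and \<delta>: "(\<delta> \<longlongrightarrow> 0) F" and ze: "(ze \<longlongrightarrow> a) F" and u: "(u \<longlongrightarrow> u0) F"
 defines "e \<equiv> cs (u0 $ 2) (perp (normal a))"
 shows "((\<lambda>i. Bm (ze i) (\<delta> i) (u i)) \<longlongrightarrow> a) F"
  "((\<lambda>i. r (Bm (ze i) (\<delta> i) (u i)) / \<delta> i) \<longlongrightarrow> hs a e e / 2 - norm (grad a) * Re (u0 $ 1)) F"
proof -
 \<comment> \<open>The displacement divided by \<open>sqrt (\<delta> i)\<close>. Its normal part
   tends to zero, so only the tangential vector \<open>e\<close> survives in the Hessian.\<close>
 define w' where "w' i = cs (of_real (sqrt (\<delta> i)) * u i $ 1) (normal (ze i)) + cs (u i $ 2) (perp (normal (ze i)))" for i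
 define w where "w i = sqrt (\<delta> i) *\<^sub>R w' i" for i
 have s\<delta>: "((\<lambda>i. sqrt (\<delta> i)) \<longlongrightarrow> 0) F" using tendsto_real_sqrt[OF \<delta>] by simp
 have n: "((\<lambda>i. normal (ze i)) \<longlongrightarrow> normal a) F" by (rule tendsto_normal[OF ze a_frontier])
 have "(w' \<longlongrightarrow> cs (of_real 0 * u0 $ 1) (normal a) + cs (u0 $ 2) (perp (normal a))) F"
  unfolding w'_def by (intro tendsto_add tendsto_cs tendsto_mult tendsto_of_real s\<delta> tendsto_vec_nth u n tendsto_perp)
 hence w': "(w' \<longlongrightarrow> e) F" by (simp add: e_def)
 have w: "(w \<longlongrightarrow> 0) F" using tendsto_scaleR[OF s\<delta> w'] by (simp add: w_def[abs_def])
 have B: "\<forall>\<^sub>F i in F. ze i + w i = Bm (ze i) (\<delta> i) (u i)"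
  using ev
 proof eventually_elim
  case (elim i)
  have "of_real (sqrt (\<delta> i)) * of_real (sqrt (\<delta> i)) = (of_real (\<delta> i) :: complex)"
   using elim by (metis less_imp_le of_real_mult real_sqrt_mult_self abs_of_nonneg)
  thus ?case
   by (simp add: Bm_def w_def w'_def cs_of_real[symmetric] cs_add_right cs_cs mult.assoc[symmetric])
 qed
 have zw: "((\<lambda>i. ze i + w i) \<longlongrightarrow> a) F" using tendsto_add[OF ze w] by simp
 show Bma: "((\<lambda>i. Bm (ze i) (\<delta> i) (u i)) \<longlongrightarrow> a) F" by (rule Lim_transform_eventually[OF zw B])
 obtain c where c: "c > 0" "ball a c \<subseteq> U" using a_U open_U open_contains_ball by blast
 have inb: "\<forall>\<^sub>F i in F. ze i \<in> ball a c \<and> ze i + w i \<in> ball a c"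
  using ze zw c(1) by (intro eventually_conj) (auto simp: tendsto_iff dist_commute)
 define \<xi> where "\<xi> i = (SOME \<xi>. \<xi> \<in> closed_segment (ze i) (ze i + w i) \<and>
   r (ze i + w i) = r (ze i) + dr (ze i) (w i) + hs \<xi> (w i) (w i) / 2)" for i
 have \<xi>: "\<forall>\<^sub>F i in F. \<xi> i \<in> closed_segment (ze i) (ze i + w i) \<and>
   r (ze i + w i) = r (ze i) + dr (ze i) (w i) + hs (\<xi> i) (w i) (w i) / 2"
  using inb
 proof eventually_elim
  case (elim i)
  have "closed_segment (ze i) (ze i + w i) \<subseteq> U"
   using closed_segment_subset[OF _ _ convex_ball, of "ze i" a c "ze i + w i"] elim c(2) by blast
  then obtain \<xi>' where "\<xi>' \<in> closed_segment (ze i) (ze i + w i)"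
   "r (ze i + w i) = r (ze i) + dr (ze i) (w i) + hs \<xi>' (w i) (w i) / 2" by (rule taylor2) (rule that)
  hence "\<exists>\<xi>. \<xi> \<in> closed_segment (ze i) (ze i + w i) \<and>
   r (ze i + w i) = r (ze i) + dr (ze i) (w i) + hs \<xi> (w i) (w i) / 2" by (intro exI[of _ \<xi>'] conjI)
  from someI_ex[OF this] show ?case unfolding \<xi>_def .
 qed
 have \<xi>a: "(\<xi> \<longlongrightarrow> a) F"
 proof -
  have "((\<lambda>i. \<xi> i - ze i) \<longlongrightarrow> 0) F"
  proof (rule Lim_null_comparison[OF _ tendsto_norm_zero[OF w]])
   show "\<forall>\<^sub>F i in F. norm (\<xi> i - ze i) \<le> norm (w i)"
    using \<xi>
   proof eventually_elim
    case (elim i)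
    from segment_bound(1)[OF conjunct1[OF elim]] show ?case by simp
   qed
  qed
  from tendsto_add[OF this ze] show ?thesis by simp
 qed
 have "((\<lambda>i. hs (\<xi> i) (w' i) (w' i) / 2 - norm (grad (ze i)) * Re (u i $ 1)) \<longlongrightarrow> hs a e e / 2 - norm (grad a) * Re (u0 $ 1)) F"
  by (intro tendsto_diff tendsto_mult tendsto_divide tendsto_hs[OF \<xi>a a_U] w' tendsto_const tendsto_norm
    tendsto_grad[OF ze a_U] tendsto_Re tendsto_vec_nth u) simp
 moreover have "\<forall>\<^sub>F i in F. hs (\<xi> i) (w' i) (w' i) / 2 - norm (grad (ze i)) * Re (u i $ 1) = r (Bm (ze i) (\<delta> i) (u i)) / \<delta> i"
  using ev B \<xi>
 proof eventually_elim
  case (elim i)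
  have 0: "\<delta> i > 0" and z: "ze i \<in> frontier Om" using elim by auto
  have "hs (\<xi> i) (w i) (w i) = \<delta> i * hs (\<xi> i) (w' i) (w' i)"
   using 0 by (simp add: w_def hs_bilinear mult.assoc[symmetric])
  moreover have "w i \<bullet> normal (ze i) = \<delta> i * Re (u i $ 1)"
  proof -
   have "herm (w' i) (normal (ze i)) = of_real (sqrt (\<delta> i)) * u i $ 1"
    using norm_normal[OF z] by (simp add: w'_def herm_linear herm_self)
   hence "w' i \<bullet> normal (ze i) = sqrt (\<delta> i) * Re (u i $ 1)" by (simp add: Re_herm[symmetric])
   thus ?thesis using 0 by (simp add: w_def mult.assoc[symmetric])
  qed
  hence "dr (ze i) (w i) = \<delta> i * (- norm (grad (ze i)) * Re (u i $ 1))" using dr_normal[OF z, of "w i"] by simp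
  ultimately have "r (Bm (ze i) (\<delta> i) (u i)) = \<delta> i * (hs (\<xi> i) (w' i) (w' i) / 2 - norm (grad (ze i)) * Re (u i $ 1))"
   using elim r_frontier[OF z] by (simp add: algebra_simps)
  thus ?case using 0 by simp
 qed
 ultimately show "((\<lambda>i. r (Bm (ze i) (\<delta> i) (u i)) / \<delta> i) \<longlongrightarrow> hs a e e / 2 - norm (grad a) * Re (u0 $ 1)) F"
  by (rule Lim_transform_eventually)
qed

text \<open>The limit equation of \<open>tendsto_rescaled\<close> solved for
  \<open>Re (u $ 1)\<close>: the rescaled boundaries tend to the graph of this form.\<close>

definition "Q t = hs a (cs t (perp (normal a))) (cs t (perp (normal a))) / (2 * norm (grad a))"

text \<open>A real quadratic form in \<open>t\<close> is a multiple of
  \<open>(cmod t)\<^sup>2\<close> plus the real part of a multiple of the complex square. The first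
  multiple is the mean of the values at \<open>1\<close> and \<open>\<i>\<close>, both positive
  because both directions are tangential.\<close>

lemma Q_form:
 obtains \<alpha> \<beta> where "\<alpha> > 0" "\<And>t. Q t = \<alpha> * (cmod t)\<^sup>2 + Re (\<beta> * t\<^sup>2)"
proof -
 let ?n = "normal a"
 define e1 where "e1 = perp ?n"
 define e2 where "e2 = cs \<i> (perp ?n)"
 define g where "g = 4 * norm (grad a)"
 have g: "g > 0" using grad_nonzero[OF a_frontier] by (simp add: g_def)
 have t: "cs t (perp ?n) = Re t *\<^sub>R e1 + Im t *\<^sub>R e2" for t
 proof -
  have "t = of_real (Re t) + of_real (Im t) * \<i>" by (simp add: complex_eq_iff)
  hence "cs t (perp ?n) = cs (of_real (Re t) + of_real (Im t) * \<i>) (perp ?n)" by (rule arg_cong)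
  thus ?thesis by (simp add: e1_def e2_def cs_add_left cs_of_real cs_cs[symmetric])
 qed
 have d: "dr a e1 = 0" "dr a e2 = 0"
  unfolding dr_normal[OF a_frontier] e1_def e2_def Re_herm[symmetric] herm_linear by simp_all
 have "e1 \<noteq> 0" "e2 \<noteq> 0" using norm_normal[OF a_frontier] norm_cs[of \<i> "perp ?n"] herm_perp(3)[of ?n] unfolding e1_def e2_def
  by (metis norm_zero zero_neq_one, metis mult_1 norm_ii norm_zero zero_neq_one)
 hence pos: "hs a e1 e1 > 0" "hs a e2 e2 > 0" using hs_pos d by auto
 define A where "A = hs a e1 e1 / g"
 define C where "C = hs a e2 e2 / g"
 define M where "M = (hs a e1 e2 + hs a e2 e1) / g"
 define \<beta> where "\<beta> = Complex (A - C) (- M)"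
 show ?thesis
 proof (rule that)
  show "A + C > 0" unfolding A_def C_def by (intro add_pos_pos divide_pos_pos pos g)
  fix t
  have "Q t = 2 * ((Re t)\<^sup>2 * A + (Im t)\<^sup>2 * C + Re t * Im t * M)"
   using g unfolding Q_def t by (simp add: A_def C_def M_def g_def hs_bilinear power2_eq_square field_simps)
  also have "\<dots> = (A + C) * (cmod t)\<^sup>2 + Re (\<beta> * t\<^sup>2)"
   unfolding \<beta>_def cmod_power2 by (simp add: power2_eq_square algebra_simps)
  finally show "Q t = (A + C) * (cmod t)\<^sup>2 + Re (\<beta> * t\<^sup>2)" .
 qed
qed

end

lemma luc_eventually_in:
 assumes l: "luc S f g" "open S" "z \<in> S" and g: "continuous_on S g" and T: "open T" "g z \<in> T"
 shows "\<exists>d>0. ball z d \<subseteq> S \<and> (\<forall>\<^sub>F n. \<forall>x\<in>ball z d. f n x \<in> T)"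
proof -
 obtain e where e: "e > 0" "ball (g z) e \<subseteq> T" using T open_contains_ball by blast
 obtain d1 where d1: "d1 > 0" "\<forall>\<^sub>F n. \<forall>x\<in>ball z d1 \<inter> S. dist (f n x) (g x) < e / 2"
  using lucD[OF l(1,3), of "e / 2"] e(1) by auto
 obtain d2 where d2: "d2 > 0" "\<And>x. x \<in> S \<Longrightarrow> dist x z < d2 \<Longrightarrow> dist (g x) (g z) < e / 2"
  using g l(3) e(1) unfolding continuous_on_iff by (metis half_gt_zero)
 obtain d3 where d3: "d3 > 0" "ball z d3 \<subseteq> S" using l(2,3) open_contains_ball by blast
 define d where "d = min d1 (min d2 d3)"
 have d: "d > 0" "ball z d \<subseteq> S" using d1 d2 d3 by (auto simp: d_def)
 have "\<forall>\<^sub>F n. \<forall>x\<in>ball z d. f n x \<in> T"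
  using d1(2)
 proof eventually_elim
  case (elim n)
  show ?case
  proof
   fix x assume x: "x \<in> ball z d"
   hence xS: "x \<in> S" using d by blast
   have "dist (f n x) (g x) < e / 2" using elim x xS by (auto simp: d_def)
   moreover have "dist (g x) (g z) < e / 2" using d2(2)[OF xS] x by (auto simp: d_def dist_commute)
   ultimately have "f n x \<in> ball (g z) e" using dist_triangle[of "f n x" "g z" "g x"] by (simp add: dist_commute)
   thus "f n x \<in> T" using e(2) by blast
  qed
 qed
 with d show ?thesis by blast
qed

context strongly_convex_point
begin

text \<open>Two Cayley transforms play different roles. With the crude constant \<open>k\<close> the
  rescaled copies become bounded, which provides the limit \<open>uu\<close> of their coordinates.
  With the exact limiting boundary \<open>Q\<close>, the map \<open>\<Theta>\<close> takes the limit
  domain \<open>DS\<close> to the ball and gives the final charts.\<close>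

lemma rescaled_limit_charts:
 assumes cp: "copies_subseq Om X Mi f g s x0"
  and ze: "\<And>n. ze n \<in> frontier Om" "ze \<longlonglongrightarrow> a" and \<delta>: "\<And>n. \<delta> n > 0" "\<delta> \<longlonglongrightarrow> 0"
  and base: "\<And>n. f (s n) x0 = Bm (ze n) (\<delta> n) (pt 1 0)"
  and k: "k > 0" and siegel: "\<And>n x. x \<in> Mi (s n) \<Longrightarrow>
   k\<^sup>2 * (cmod (Bi (ze n) (\<delta> n) (f (s n) x) $ 2))\<^sup>2 \<le> Re (Bi (ze n) (\<delta> n) (f (s n) x) $ 1)"
  and Psi: "union_of_copies.lucM Om g X (\<lambda>n x. cay k (Bi (ze n) (\<delta> n) (f (s n) x))) Psi"
   "union_of_copies.holo_out Om g Psi X" "\<And>x. x \<in> X \<Longrightarrow> Psi x \<in> ball 0 1"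
 obtains U' Dk phi psi Phi where "limit_charts Om X Mi f g (ball 0 1) U' Dk phi psi Phi"
proof -
 interpret c: copies_subseq Om X Mi f g s x0 by (rule cp)
 define u where "u n x = Bi (ze n) (\<delta> n) (f (s n) x)" for n x
 define uu where "uu x = yac k (Psi x)" for x
 have hu: "c.holo_out (u n) (Mi (s n))" for n
  unfolding u_def by (rule c.holo_out_compose[OF c.holo_out_f holo_Bi[OF \<delta>(1), where S = UNIV]]) simp
 have huu: "c.holo_out uu X"
  unfolding uu_def by (rule c.holo_out_compose[OF Psi(2) holo_yac]) (use k Psi(3) in auto)
 have huug: "holo (\<lambda>y. uu (g i y)) Om" for i by (rule c.holo_out_holo[OF huu c.holo_in_g])
 \<comment> \<open>Convergence was obtained for \<open>cay k \<circ> u n\<close>;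
   \<open>yac k\<close> carries it back, as \<open>Psi\<close> stays in the open ball.\<close>
 have luc_u: "luc Om (\<lambda>n y. u n (g i y)) (\<lambda>y. uu (g i y))" for i
 proof -
  have gX: "g i y \<in> X" if "y \<in> Om" for y using c.g_in[OF that] c.Mi_X by blast
  have 1: "luc Om (\<lambda>n y. cay k (u n (g i y))) (\<lambda>y. Psi (g i y))"
   using Psi(1) by (simp add: c.lucM_def c.Om_X u_def)
  have "luc Om (\<lambda>n y. yac k (cay k (u n (g i y)))) (\<lambda>y. uu (g i y))"
   unfolding uu_def
  proof (rule luc_compose[OF 1 luc_const open_ball[of 0 1]])
   show "(\<lambda>y. Psi (g i y)) ` Om \<subseteq> ball 0 1" using Psi(3) gX by blast
   show "continuous_on Om (\<lambda>y. Psi (g i y))" by (rule holo_continuous_on[OF c.holo_out_holo[OF Psi(2) c.holo_in_g]])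
   show "continuous_on (ball 0 1) (yac k)" by (rule holo_continuous_on[OF holo_yac]) (use k in simp)
  qed
  thus ?thesis
  proof (rule luc_cong)
   fix z assume "z \<in> Om"
   have "\<forall>\<^sub>F n. \<forall>x\<in>ball z 1 \<inter> Om. yac k (cay k (u n (g i x))) = u n (g i x)"
    using c.eventually_g_Mi[of i]
   proof eventually_elim
    case (elim n)
    have "yac k (cay k (u n x)) = u n x" if "x \<in> Mi (s n)" for x
     unfolding u_def by (rule yac_cay[OF cay_cball(1)[OF siegel[OF that]]]) (use k in simp)
    with elim show ?case by blast
   qed
   thus "\<exists>d>0. \<forall>\<^sub>F n. \<forall>x\<in>ball z d \<inter> Om. yac k (cay k (u n (g i x))) = u n (g i x)"
    by (intro exI[of _ 1]) simp
  qed simp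
 qed
 have Bmu: "Bm (ze n) (\<delta> n) (u n x) = f (s n) x" for n x unfolding u_def by (rule Bm_Bi[OF ze(1) \<delta>(1)])
 let ?n = "perp (normal a)" and ?G = "norm (grad a)"
 have G: "?G > 0" using grad_nonzero[OF a_frontier] by simp
 have rho: "hs a (cs t ?n) (cs t ?n) / 2 - ?G * p = ?G * (Q t - p)" for t p
  using G by (simp add: Q_def field_simps)
 \<comment> \<open>The defining function is negative on \<open>Om\<close>, so its rescaled limit is
   at most zero; strictness follows later from the maximum principle.\<close>
 have limQ: "Q (uu x $ 2) \<le> Re (uu x $ 1)" if x: "x \<in> X" for x
 proof (rule c.X_E[OF x])
  fix i y assume y: "x \<in> Mi i" "y \<in> Om" "x = g i y"
  have ux: "(\<lambda>n. u n x) \<longlonglongrightarrow> uu x" using luc_pointwise[OF luc_u y(2), of i] y(3) by simp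
  have ev: "\<forall>\<^sub>F n. \<delta> n > 0 \<and> ze n \<in> frontier Om" using \<delta> ze by simp
  note R = tendsto_rescaled[OF ev \<delta>(2) ze(2) ux, unfolded rho]
  have "\<forall>\<^sub>F n. r (Bm (ze n) (\<delta> n) (u n x)) / \<delta> n \<le> 0"
   using topological_tendstoD[OF R(1) open_U a_U] c.eventually_Mi[of i]
  proof eventually_elim
   case (elim n)
   have "Bm (ze n) (\<delta> n) (u n x) \<in> Om" unfolding Bmu by (rule c.f_in) (use elim y(1) in blast)
   hence "r (Bm (ze n) (\<delta> n) (u n x)) < 0" using elim(1) Om_U by blast
   thus ?case using \<delta>(1)[of n] by (simp add: divide_neg_pos less_imp_le)
  qed
  hence "?G * (Q (uu x $ 2) - Re (uu x $ 1)) \<le> 0"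
   by (intro tendsto_upperbound[OF R(2)]) auto
  thus ?thesis using G by (simp add: mult_le_0_iff)
 qed
 obtain \<alpha> \<beta> where \<alpha>: "\<alpha> > 0" and Q: "\<And>t. Q t = \<alpha> * (cmod t)\<^sup>2 + Re (\<beta> * t\<^sup>2)" by (rule Q_form) (rule that)
 define m where "m = sqrt \<alpha>"
 have m: "m \<noteq> 0" "m\<^sup>2 = \<alpha>" using \<alpha> by (simp_all add: m_def)
 define \<Theta> where "\<Theta> v = cay m (shear (- \<beta>) v)" for v
 define \<Theta>' where "\<Theta>' w = shear \<beta> (yac m w)" for w
 define H where "H = {v. shear (- \<beta>) v $ 1 + 1 \<noteq> (0::complex)}"
 define DS where "DS = {v :: complex ^ 2. Q (v $ 2) < Re (v $ 1)}"
 have sh: "m\<^sup>2 * (cmod (shear (- \<beta>) v $ 2))\<^sup>2 \<le> Re (shear (- \<beta>) v $ 1) \<longleftrightarrow> Q (v $ 2) \<le> Re (v $ 1)"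
  "m\<^sup>2 * (cmod (shear (- \<beta>) v $ 2))\<^sup>2 < Re (shear (- \<beta>) v $ 1) \<longleftrightarrow> Q (v $ 2) < Re (v $ 1)" for v
  unfolding m Q by (auto simp: shear_def)
 have QH: "v \<in> H" "\<Theta> v \<in> cball 0 1" if "Q (v $ 2) \<le> Re (v $ 1)" for v
  using cay_cball[OF sh(1)[THEN iffD2, OF that]] by (simp_all add: H_def \<Theta>_def)
 have \<Theta>_ball: "\<Theta> v \<in> ball 0 1 \<longleftrightarrow> v \<in> DS" if "v \<in> H" for v
  unfolding \<Theta>_def DS_def mem_Collect_eq sh(2)[symmetric] by (rule cay_ball_iff) (use that in \<open>simp add: H_def\<close>)
 have DSH: "DS \<subseteq> H" using QH(1) by (auto simp: DS_def)
 have \<Theta>'\<Theta>: "\<Theta>' (\<Theta> v) = v" if "v \<in> H" for v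
  unfolding \<Theta>_def \<Theta>'_def by (subst yac_cay) (use that m in \<open>simp_all add: H_def\<close>)
 have \<Theta>\<Theta>': "\<Theta> (\<Theta>' w) = w" "\<Theta>' w \<in> H" if "w \<in> ball 0 1" for w
  using cay_yac[OF that m(1)] by (simp_all add: \<Theta>_def \<Theta>'_def H_def)
 have \<Theta>'_DS: "\<Theta>' w \<in> DS" if "w \<in> ball 0 1" for w using \<Theta>_ball[OF \<Theta>\<Theta>'(2)[OF that]] \<Theta>\<Theta>'(1)[OF that] that by simp
 have h\<Theta>: "holo \<Theta> H"
  unfolding \<Theta>_def[abs_def]
  by (rule holo_compose[OF holo_shear holo_cay[of "{v. v $ 1 + 1 \<noteq> 0}"]]) (auto simp: H_def)
 have h\<Theta>': "holo \<Theta>' (ball 0 1)"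
  unfolding \<Theta>'_def[abs_def] by (rule holo_compose[OF holo_yac[OF m(1)] holo_shear[where S = UNIV]]) simp
 have oDS: "open DS"
  unfolding DS_def Q by (intro open_Collect_less continuous_intros)
 have uuH: "uu x \<in> H" "\<Theta> (uu x) \<in> cball 0 1" if "x \<in> X" for x using QH[OF limQ[OF that]] .
 have h\<Theta>uu: "c.holo_out (\<lambda>x. \<Theta> (uu x)) X" by (rule c.holo_out_compose[OF huu h\<Theta>]) (use uuH in blast)
 have "u n x0 = pt 1 0" for n unfolding u_def base by (rule Bi_Bm[OF ze(1) \<delta>(1)])
 moreover have "(\<lambda>n. u n x0) \<longlonglongrightarrow> uu x0"
 proof (rule c.X_E[OF c.x0_X])
  fix i y assume "y \<in> Om" "x0 = g i y"
  thus ?thesis using luc_pointwise[OF luc_u, of y i] by simp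
 qed
 ultimately have "(\<lambda>n::nat. pt 1 0) \<longlonglongrightarrow> uu x0" by (simp only:)
 hence "uu x0 = pt 1 0" by (rule LIMSEQ_unique[OF _ tendsto_const])
 hence \<Theta>0: "\<Theta> (uu x0) = 0" by (simp add: \<Theta>_def shear_def cay_def pt_eq_iff)
 \<comment> \<open>The base point has rescaled coordinate \<open>pt 1 0\<close> for every
   \<open>n\<close>, so it goes to the centre of the ball and the maximum principle applies.\<close>
 have Phi_in: "\<Theta> (uu x) \<in> ball 0 1" if "x \<in> X" for x
  by (rule c.max_principleM[OF h\<Theta>uu _ open_ball convex_ball _ that]) (use uuH(2) \<Theta>0 in auto)
 have uuDS: "uu x \<in> DS" if "x \<in> X" for x using \<Theta>_ball[OF uuH(1)[OF that]] Phi_in[OF that] by blast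
 \<comment> \<open>For finite \<open>n\<close> the rescaled domain and \<open>DS\<close> need not
   contain each other: \<open>U'\<close> keeps the points whose coordinates lie in
   \<open>DS\<close>, and \<open>Dk\<close> the points of the ball that come from
   \<open>Om\<close>.\<close>
 define U' where "U' n = {x \<in> Mi (s n). u n x \<in> DS}" for n
 define Dk where "Dk n = {w \<in> ball 0 1. Bm (ze n) (\<delta> n) (\<Theta>' w) \<in> Om}" for n
 define phi where "phi n x = \<Theta> (u n x)" for n x
 define psi where "psi n w = g (s n) (Bm (ze n) (\<delta> n) (\<Theta>' w))" for n w
 have hBm\<Theta>: "holo (\<lambda>w. Bm (ze n) (\<delta> n) (\<Theta>' w)) (ball 0 1)" for n
  by (rule holo_compose[OF h\<Theta>' holo_Bm[where S = UNIV]]) simp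
 have oDk: "open (Dk n)" for n
 proof -
  have "Dk n = ball 0 1 \<inter> (\<lambda>w. Bm (ze n) (\<delta> n) (\<Theta>' w)) -` Om" by (auto simp: Dk_def)
  thus ?thesis
   using continuous_open_preimage[OF holo_continuous_on[OF hBm\<Theta>] open_ball c.open_Om] by simp
 qed
 have Dk_ball: "Dk n \<subseteq> ball 0 1" for n by (auto simp: Dk_def)
 have u_g: "u n (psi n w) = \<Theta>' w" if "w \<in> Dk n" for n w
  using that unfolding u_def psi_def Dk_def by (simp add: c.fg Bi_Bm[OF ze(1) \<delta>(1)])
 have "limit_charts Om X Mi f g (ball 0 1) U' Dk phi psi (\<lambda>x. \<Theta> (uu x))"
 proof
  show "open (ball (0 :: complex ^ 2) 1)" "convex (ball (0 :: complex ^ 2) 1)" "bounded (ball (0 :: complex ^ 2) 1)" by auto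
  show "c.openM (U' n)" for n unfolding U'_def by (rule c.openM_vimage_out[OF c.openM_Mi hu oDS])
  show "open (Dk n)" "Dk n \<subseteq> ball 0 1" for n by (rule oDk Dk_ball)+
  show "c.holo_out (phi n) (U' n)" for n
   unfolding phi_def
   by (rule c.holo_out_compose[OF c.holo_out_subset[OF hu] h\<Theta>]) (use DSH in \<open>auto simp: U'_def\<close>)
  show "c.holo_in (psi n) (Dk n)" for n
   unfolding psi_def
   by (rule c.holo_in_compose[OF c.holo_in_g holo_subset[OF hBm\<Theta> Dk_ball] oDk c.open_Om]) (auto simp: Dk_def)
  fix n
  show "phi n x \<in> Dk n" "psi n (phi n x) = x" if x: "x \<in> U' n" for x
  proof -
   have xM: "x \<in> Mi (s n)" and xD: "u n x \<in> DS" using x by (auto simp: U'_def)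
   have "\<Theta>' (phi n x) = u n x" unfolding phi_def by (rule \<Theta>'\<Theta>) (use xD DSH in blast)
   hence B: "Bm (ze n) (\<delta> n) (\<Theta>' (phi n x)) = f (s n) x" by (simp add: Bmu)
   have "phi n x \<in> ball 0 1" unfolding phi_def by (rule \<Theta>_ball[THEN iffD2, OF _ xD]) (use xD DSH in blast)
   thus "phi n x \<in> Dk n" unfolding Dk_def using B c.f_in[OF xM] by simp
   show "psi n (phi n x) = x" unfolding psi_def B by (rule c.gf[OF xM])
  qed
  show "psi n w \<in> U' n" "phi n (psi n w) = w" if w: "w \<in> Dk n" for w
  proof -
   have wb: "w \<in> ball 0 1" "Bm (ze n) (\<delta> n) (\<Theta>' w) \<in> Om" using w by (auto simp: Dk_def)
   show "psi n w \<in> U' n" using u_g[OF w] \<Theta>'_DS[OF wb(1)] c.g_in[OF wb(2)] by (simp add: U'_def) (simp add: psi_def)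
   show "phi n (psi n w) = w" unfolding phi_def u_g[OF w] by (rule \<Theta>\<Theta>'(1)[OF wb(1)])
  qed
 next
  show "c.exhM U'"
   unfolding c.exhM_def
  proof (intro allI ballI)
   fix i y assume y: "y \<in> Om"
   have "uu (g i y) \<in> DS" by (rule uuDS) (use c.g_in[OF y] c.Mi_X in blast)
   from luc_eventually_in[OF luc_u c.open_Om y holo_continuous_on[OF huug] oDS this]
   obtain d where d: "d > 0" "ball y d \<subseteq> Om" "\<forall>\<^sub>F n. \<forall>x\<in>ball y d. u n (g i x) \<in> DS" by blast
   from d(3) c.eventually_g_Mi[of i] have "\<forall>\<^sub>F n. g i ` ball y d \<subseteq> U' n"
    by eventually_elim (use d(2) in \<open>auto simp: U'_def\<close>)
   with d show "\<exists>r>0. ball y r \<subseteq> Om \<and> (\<forall>\<^sub>F n. g i ` ball y r \<subseteq> U' n)" by blast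
  qed
  \<comment> \<open>The product filter supplies one index and one neighbourhood of \<open>y\<close>
    simultaneously.\<close>
  show "\<exists>e>0. ball y e \<subseteq> ball 0 1 \<and> (\<forall>\<^sub>F n. ball y e \<subseteq> Dk n)" if y: "y \<in> ball 0 1" for y
  proof -
   let ?F = "sequentially \<times>\<^sub>F nhds y"
   have ev: "\<forall>\<^sub>F p in ?F. \<delta> (fst p) > 0 \<and> ze (fst p) \<in> frontier Om" using \<delta> ze by simp
   have t1: "((\<lambda>p. \<delta> (fst p)) \<longlongrightarrow> 0) ?F" "((\<lambda>p. ze (fst p)) \<longlongrightarrow> a) ?F"
    by (rule filterlim_compose[OF \<delta>(2) filterlim_fst] filterlim_compose[OF ze(2) filterlim_fst])+
   have "isCont \<Theta>' y" by (rule holo_isCont[OF h\<Theta>' y])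
   hence t2: "((\<lambda>p. \<Theta>' (snd p)) \<longlongrightarrow> \<Theta>' y) ?F"
    by (rule isCont_tendsto_compose) (rule filterlim_snd)
   note R = tendsto_rescaled[OF ev t1 t2, unfolded rho]
   have "?G * (Q (\<Theta>' y $ 2) - Re (\<Theta>' y $ 1)) < 0"
    using \<Theta>'_DS[OF y] G by (simp add: DS_def mult_less_0_iff)
   from order_tendstoD(2)[OF R(2) this] topological_tendstoD[OF R(1) open_U a_U]
   have "\<forall>\<^sub>F p in ?F. Bm (ze (fst p)) (\<delta> (fst p)) (\<Theta>' (snd p)) \<in> Om"
   proof eventually_elim
    case (elim p)
    hence "r (Bm (ze (fst p)) (\<delta> (fst p)) (\<Theta>' (snd p))) < 0"
     using \<delta>(1)[of "fst p"] by (simp add: divide_less_0_iff)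
    thus ?case using elim(2) Om_U by blast
   qed
   then obtain P1 P2 where P: "eventually P1 sequentially" "eventually P2 (nhds y)"
    "\<And>n w. P1 n \<Longrightarrow> P2 w \<Longrightarrow> Bm (ze n) (\<delta> n) (\<Theta>' w) \<in> Om"
    unfolding eventually_prod_filter by auto
   from eventually_conj[OF P(2) eventually_nhds_in_open[OF open_ball y]]
   obtain e where e: "e > 0" "\<And>w. dist w y < e \<Longrightarrow> P2 w \<and> w \<in> ball 0 1" unfolding eventually_nhds_metric by blast
   have "\<forall>\<^sub>F n. ball y e \<subseteq> Dk n"
    using P(1) by eventually_elim (use P(3) e(2) in \<open>auto simp: Dk_def dist_commute\<close>)
   with e show ?thesis by (intro exI[of _ e]) (auto simp: dist_commute)
  qed
  show "c.lucM X phi (\<lambda>x. \<Theta> (uu x))"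
   unfolding c.lucM_def c.Om_X phi_def
  proof
   fix i
   show "luc Om (\<lambda>n y. \<Theta> (u n (g i y))) (\<lambda>y. \<Theta> (uu (g i y)))"
   proof (rule luc_compose[OF luc_u luc_const oDS])
    show "(\<lambda>y. uu (g i y)) ` Om \<subseteq> DS" using uuDS c.g_in c.Mi_X by blast
    show "continuous_on DS \<Theta>" by (rule holo_continuous_on[OF holo_subset[OF h\<Theta> DSH]])
   qed (rule holo_continuous_on[OF huug])
  qed
 qed (rule Phi_in)
 thus ?thesis by (rule that)
qed

text \<open>Nearest boundary points serve as centres and the distances to them as scales. The base
  point then always has rescaled coordinate \<open>pt 1 0\<close> and cannot drift to the boundary
  of the limit domain.\<close>

theorem boundary_limit_charts:
 assumes cp: "copies_subseq Om X Mi f g s x0" and lim: "(\<lambda>n. f (s n) x0) \<longlonglongrightarrow> a"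
 obtains U' Dk phi psi Phi where "limit_charts Om X Mi f g (ball 0 1) U' Dk phi psi Phi"
proof -
 interpret c: copies_subseq Om X Mi f g s x0 by (rule cp)
 obtain c where c: "c > 0"
  "\<And>ze z. ze \<in> frontier Om \<Longrightarrow> ze \<in> ball a c \<Longrightarrow> z \<in> Om \<Longrightarrow> c * (norm (z - ze))\<^sup>2 \<le> - dr ze (z - ze)"
  by (rule boundary_convexity) (rule that)
 have "\<forall>n. \<exists>ze. ze \<in> frontier Om \<and> dist (f (s n) x0) ze \<le> dist (f (s n) x0) a \<and>
   ball (f (s n) x0) (dist (f (s n) x0) ze) \<subseteq> Om \<and> dist (f (s n) x0) ze > 0"
 proof
  fix n
  obtain ze where "ze \<in> frontier Om" "dist (f (s n) x0) ze \<le> dist (f (s n) x0) a"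
   "ball (f (s n) x0) (dist (f (s n) x0) ze) \<subseteq> Om" "dist (f (s n) x0) ze > 0"
   by (rule nearest_boundary_point[OF c.f_in[OF c.x0_Mi]]) (rule that)
  thus "\<exists>ze. ze \<in> frontier Om \<and> dist (f (s n) x0) ze \<le> dist (f (s n) x0) a \<and>
   ball (f (s n) x0) (dist (f (s n) x0) ze) \<subseteq> Om \<and> dist (f (s n) x0) ze > 0" by (intro exI conjI)
 qed
 from choice[OF this] obtain ze where "\<forall>n. ze n \<in> frontier Om \<and> dist (f (s n) x0) (ze n) \<le> dist (f (s n) x0) a \<and>
   ball (f (s n) x0) (dist (f (s n) x0) (ze n)) \<subseteq> Om \<and> dist (f (s n) x0) (ze n) > 0" ..
 hence ze: "\<And>n. ze n \<in> frontier Om" "\<And>n. dist (f (s n) x0) (ze n) \<le> dist (f (s n) x0) a"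
  "\<And>n. ball (f (s n) x0) (dist (f (s n) x0) (ze n)) \<subseteq> Om" "\<And>n. dist (f (s n) x0) (ze n) > 0" by simp_all
 define \<delta> where "\<delta> n = dist (f (s n) x0) (ze n)" for n
 have \<delta>_pos: "\<delta> n > 0" for n using ze(4) by (simp add: \<delta>_def)
 have d0: "(\<lambda>n. dist (f (s n) x0) a) \<longlonglongrightarrow> 0" by (rule tendsto_dist_iff[THEN iffD1, OF lim])
 have \<delta>0: "\<delta> \<longlonglongrightarrow> 0"
  unfolding \<delta>_def by (rule tendsto_sandwich[OF _ _ tendsto_const d0]) (use ze(2) in auto)
 have zea: "ze \<longlonglongrightarrow> a"
 proof -
  have "(\<lambda>n. dist (ze n) a) \<longlonglongrightarrow> 0"
  proof (rule tendsto_sandwich[OF _ _ tendsto_const])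
   show "\<forall>\<^sub>F n. dist (ze n) a \<le> \<delta> n + dist (f (s n) x0) a"
    using dist_triangle3[of "ze _" a "f (s _) x0"] by (simp add: \<delta>_def)
   show "(\<lambda>n. \<delta> n + dist (f (s n) x0) a) \<longlonglongrightarrow> 0" using tendsto_add[OF \<delta>0 d0] by simp
  qed auto
  thus ?thesis by (rule tendsto_dist_iff[THEN iffD2])
 qed
 \<comment> \<open>A bound for the gradients near \<open>a\<close>; dividing the convexity constant
   by it makes one Siegel domain work for all large \<open>n\<close>.\<close>
 define L where "L = norm (grad a) + 1"
 have L: "L > 0" by (simp add: L_def add_nonneg_pos)
 have "(\<lambda>n. norm (grad (ze n))) \<longlonglongrightarrow> norm (grad a)" by (intro tendsto_norm tendsto_grad zea a_U)
 from order_tendstoD(2)[OF this, of L] have "\<forall>\<^sub>F n. norm (grad (ze n)) < L" by (simp add: L_def)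
 moreover have "\<forall>\<^sub>F n. ze n \<in> ball a c"
  using zea c(1) by (simp add: tendsto_iff dist_commute)
 ultimately obtain N where N: "\<And>n. n \<ge> N \<Longrightarrow> norm (grad (ze n)) < L \<and> ze n \<in> ball a c"
  unfolding eventually_sequentially by (metis nle_le order_trans)
 interpret c1: copies_subseq Om X Mi f g "\<lambda>n. s (n + N)" x0
  by (rule c.copies_subseq_subseq) (simp add: strict_mono_def)
 define k where "k = sqrt (c / L)"
 have k: "k > 0" "k\<^sup>2 = c / L" using c(1) L by (simp_all add: k_def)
 define u where "u n x = Bi (ze (n + N)) (\<delta> (n + N)) (f (s (n + N)) x)" for n x
 have siegel: "k\<^sup>2 * (cmod (u n x $ 2))\<^sup>2 \<le> Re (u n x $ 1)" if x: "x \<in> Mi (s (n + N))" for n x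
 proof -
  let ?n = "n + N"
  have "c * (cmod (u n x $ 2))\<^sup>2 \<le> norm (grad (ze ?n)) * Re (u n x $ 1)"
   unfolding u_def
   by (rule Bi_siegel[OF ze(1) \<delta>_pos less_imp_le[OF c(1)] c(2)[OF ze(1) _ c.f_in[OF x]]]) (use N in simp)
  moreover from this have "0 \<le> norm (grad (ze ?n)) * Re (u n x $ 1)"
   using c(1) by (meson mult_nonneg_nonneg less_imp_le order_trans zero_le_power2)
  hence "0 \<le> Re (u n x $ 1)" using grad_nonzero[OF ze(1)[of ?n]] by (simp add: zero_le_mult_iff)
  hence "norm (grad (ze ?n)) * Re (u n x $ 1) \<le> L * Re (u n x $ 1)"
   using N[of ?n] by (intro mult_right_mono) auto
  ultimately have "c * (cmod (u n x $ 2))\<^sup>2 \<le> L * Re (u n x $ 1)" by linarith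
  thus ?thesis using L by (simp add: k(2) field_simps)
 qed
 have base: "f (s n) x0 = Bm (ze n) (\<delta> n) (pt 1 0)" if "n \<ge> N" for n
 proof -
  have "0 \<le> - dr (ze n) (z - ze n)" if z: "z \<in> Om" for z
  proof -
   have "c * (norm (z - ze n))\<^sup>2 \<le> - dr (ze n) (z - ze n)"
    by (rule c(2)[OF ze(1) _ z]) (use N \<open>n \<ge> N\<close> in blast)
   thus ?thesis using c(1) by (meson mult_nonneg_nonneg less_imp_le order_trans zero_le_power2)
  qed
  from nearest_normal[OF ze(1,3,4) this] show ?thesis by (simp add: Bm_def \<delta>_def cs_of_real)
 qed
 have u0: "u n x0 = pt 1 0" for n unfolding u_def by (subst base) (simp_all add: Bi_Bm ze(1) \<delta>_pos)
 have hu: "c.holo_out (u n) (Mi (s (n + N)))" for n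
  unfolding u_def by (rule c.holo_out_compose[OF c.holo_out_f holo_Bi[OF \<delta>_pos, where S = UNIV]]) simp
 have hZ: "c.holo_out (\<lambda>x. cay k (u n x)) (Mi (s (n + N)))" for n
  by (rule c.holo_out_compose[OF hu holo_cay[of "{v. v $ 1 + 1 \<noteq> 0}"]]) (use cay_cball(1)[OF siegel] in auto)
 have Zin: "cay k (u n x) \<in> closure (ball 0 1)" if "x \<in> Mi (s (n + N))" for n x
  using cay_cball(2)[OF siegel[OF that]] by simp
 have "cay k (pt 1 0) = 0" by (simp add: cay_def pt_eq_iff)
 hence Z0: "(\<lambda>n. cay k (u n x0)) \<longlonglongrightarrow> 0" by (simp add: u0)
 obtain t Psi where t: "strict_mono (t :: nat \<Rightarrow> nat)" "c.lucM X (\<lambda>n x. cay k (u (t n) x)) Psi" "c.holo_out Psi X"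
  "\<And>x. x \<in> X \<Longrightarrow> Psi x \<in> ball 0 1" "Psi x0 = 0"
  by (rule c1.maps_limit[OF hZ Zin open_ball convex_ball bounded_ball Z0]) (simp, simp, rule that)
 have sub: "strict_mono (\<lambda>n. t n + N)" using t(1) by (simp add: strict_mono_def)
 show ?thesis
 proof (rule rescaled_limit_charts[OF c.copies_subseq_subseq[OF sub], of "\<lambda>n. ze (t n + N)" "\<lambda>n. \<delta> (t n + N)" k Psi])
  show "(\<lambda>n. ze (t n + N)) \<longlonglongrightarrow> a" "(\<lambda>n. \<delta> (t n + N)) \<longlonglongrightarrow> 0"
   using LIMSEQ_subseq_LIMSEQ[OF zea sub] LIMSEQ_subseq_LIMSEQ[OF \<delta>0 sub] by (simp_all add: o_def)
  show "k\<^sup>2 * (cmod (Bi (ze (t n + N)) (\<delta> (t n + N)) (f (s (t n + N)) x) $ 2))\<^sup>2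
    \<le> Re (Bi (ze (t n + N)) (\<delta> (t n + N)) (f (s (t n + N)) x) $ 1)" if "x \<in> Mi (s (t n + N))" for n x
   using siegel[OF that] by (simp add: u_def)
  show "c.lucM X (\<lambda>n x. cay k (Bi (ze (t n + N)) (\<delta> (t n + N)) (f (s (t n + N)) x))) Psi"
   using t(2) by (simp add: u_def)
 qed (use ze(1) \<delta>_pos base k t that in auto)
qed

end

section \<open>Complex manifolds exhausted by copies of a domain\<close>

text \<open>Ties \<open>openM\<close>, \<open>holo_out\<close> and \<open>holo_in\<close> to the
  topology and the charts of \<open>M\<close>.\<close>

locale manifold_union = union_of_copies Om X Mi f g
 for Om :: "(complex ^ 'n::finite) set" and X :: "'a set" and Mi f g +
 fixes M :: "('a, 'n) cmanifold"
 assumes X: "X = points M" and openin_openM: "\<And>V. openin (mtop M) V \<Longrightarrow> openM V"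
  and openM_openin: "\<And>V. openM V \<Longrightarrow> openin (mtop M) V"
  and charts_cover: "\<And>x. x \<in> X \<Longrightarrow> \<exists>U \<phi>. (U, \<phi>) \<in> charts M \<and> x \<in> U"
  and openin_chart: "\<And>U \<phi>. (U, \<phi>) \<in> charts M \<Longrightarrow> openin (mtop M) U"
  and inj_chart: "\<And>U \<phi>. (U, \<phi>) \<in> charts M \<Longrightarrow> inj_on \<phi> U"
  and open_chart: "\<And>U \<phi>. (U, \<phi>) \<in> charts M \<Longrightarrow> open (\<phi> ` U)"
  and holo_chart: "\<And>U \<phi>. (U, \<phi>) \<in> charts M \<Longrightarrow> holo_out \<phi> U"
  and holo_inv_chart: "\<And>U \<phi>. (U, \<phi>) \<in> charts M \<Longrightarrow> holo_in (inv_into U \<phi>) (\<phi> ` U)"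
begin

lemma chart_X: "(U, \<phi>) \<in> charts M \<Longrightarrow> U \<subseteq> X"
 using openin_subset[OF openin_chart] X by simp

lemma inv_chart: "(U, \<phi>) \<in> charts M \<Longrightarrow> x \<in> U \<Longrightarrow> inv_into U \<phi> (\<phi> x) = x"
 by (rule inv_into_f_f[OF inj_chart])

lemma holo_in_chart:
 assumes G: "holo_in G S" "open S" and c: "(U, \<phi>) \<in> charts M"
 shows "open {s \<in> S. G s \<in> U}" "holo (\<lambda>s. \<phi> (G s)) {s \<in> S. G s \<in> U}"
proof -
 have U: "openM U" by (rule openin_openM[OF openin_chart[OF c]])
 show o: "open {s \<in> S. G s \<in> U}" by (rule openM_vimage_in[OF G(1) U G(2)])
 show "holo (\<lambda>s. \<phi> (G s)) {s \<in> S. G s \<in> U}"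
  by (rule holo_in_out[OF U holo_in_subset[OF G(1) o] holo_chart[OF c]]) auto
qed

lemma holo_in_continuous:
 assumes G: "holo_in G S" "open S"
 shows "continuous_map (top_of_set S) (mtop M) G"
 unfolding continuous_map_alt
proof (intro conjI allI impI)
 show "G \<in> topspace (top_of_set S) \<rightarrow> topspace (mtop M)" using holo_in_D(3)[OF G(1)] X by simp
 fix V assume "openin (mtop M) V"
 hence "open {s \<in> S. G s \<in> V}" by (intro openM_vimage_in[OF G(1) openin_openM G(2)])
 moreover have "G -` V \<inter> topspace (top_of_set S) = {s \<in> S. G s \<in> V}" by auto
 ultimately show "openin (top_of_set S) (G -` V \<inter> topspace (top_of_set S))"
  using open_subset[of "{s \<in> S. G s \<in> V}" S] by auto
qed

lemma holo_in_by_charts: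
 assumes S: "open S" and GX: "G ` S \<subseteq> X" and o: "\<And>V. openin (mtop M) V \<Longrightarrow> open {s \<in> S. G s \<in> V}"
  and h: "\<And>U \<phi>. (U, \<phi>) \<in> charts M \<Longrightarrow> holo (\<lambda>s. \<phi> (G s)) {s \<in> S. G s \<in> U}"
 shows "holo_in G S"
proof (rule holo_in_local[OF S])
 fix s assume s: "s \<in> S"
 hence "G s \<in> X" using GX by blast
 from charts_cover[OF this] obtain U \<phi> where c: "(U, \<phi>) \<in> charts M" "G s \<in> U" by blast
 let ?T = "{s \<in> S. G s \<in> U}"
 have oT: "open ?T" by (rule o[OF openin_chart[OF c(1)]])
 have "holo_in (\<lambda>t. inv_into U \<phi> (\<phi> (G t))) ?T"
  by (rule holo_in_compose[OF holo_inv_chart[OF c(1)] h[OF c(1)] oT open_chart[OF c(1)]]) auto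
 hence "holo_in G ?T" by (rule holo_in_cong) (simp add: inv_chart[OF c(1)])
 with oT s c(2) show "\<exists>T. open T \<and> s \<in> T \<and> T \<subseteq> S \<and> holo_in G T"
  by (intro exI[of _ ?T] conjI) auto
qed

lemma holo_in_disc:
 "holo_in G (ball 0 1) \<longleftrightarrow> holomorphic_disc M G"
proof
 assume G: "holo_in G (ball 0 1)"
 show "holomorphic_disc M G"
  unfolding holomorphic_disc_def
 proof (intro conjI holo_in_continuous[OF G open_ball] ballI, clarify)
  fix U \<phi> i assume c: "(U, \<phi>) \<in> charts M"
  note h = holo_in_chart[OF G open_ball c]
  show "(\<lambda>z. \<phi> (G z) $ i) holomorphic_on {z \<in> ball 0 1. G z \<in> U}"
   unfolding holo_iff_holomorphic_on[OF h(1), symmetric] by (rule holo_vec_nth[OF h(2)])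
 qed
next
 assume d: "holomorphic_disc M G"
 hence ct: "continuous_map (top_of_set (ball 0 1)) (mtop M) G" by (simp add: holomorphic_disc_def)
 show "holo_in G (ball 0 1)"
 proof (rule holo_in_by_charts[OF open_ball])
  show "G ` ball 0 1 \<subseteq> X" using continuous_map_image_subset_topspace[OF ct] X by simp
  show o: "open {s \<in> ball 0 1. G s \<in> V}" if "openin (mtop M) V" for V
   using openin_continuous_map_preimage[OF ct that] openin_open_trans[OF _ open_ball] by simp
  fix U \<phi> assume c: "(U, \<phi>) \<in> charts M"
  have "(\<lambda>z. \<phi> (G z) $ i) holomorphic_on {z \<in> ball 0 1. G z \<in> U}" for i
   using d c unfolding holomorphic_disc_def by blast
  hence "holo (\<lambda>z. \<phi> (G z) $ i) {z \<in> ball 0 1. G z \<in> U}" for i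
   by (rule iffD2[OF holo_iff_holomorphic_on[OF o[OF openin_chart[OF c]]]])
  thus "holo (\<lambda>s. \<phi> (G s)) {s \<in> ball 0 1. G s \<in> U}" by (rule holo_vec_lambda)
 qed
qed

theorem biholomorphicI:
 assumes F: "holo_out F X" "F ` X \<subseteq> D" and G: "holo_in G D" and D: "open D"
  and GF: "\<And>x. x \<in> X \<Longrightarrow> G (F x) = x" and FG: "\<And>y. y \<in> D \<Longrightarrow> F (G y) = y"
 shows "biholomorphic M (domain_manifold (D :: (complex ^ 'm::finite) set))"
proof -
 have "holomorphic_map M (domain_manifold D) F"
  unfolding holomorphic_map_def domain_manifold_def
 proof (simp, intro conjI ballI, goal_cases)
  case 1
  show ?case
   unfolding continuous_map_in_subtopology
  proof
   show "continuous_map (mtop M) euclidean F"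
    unfolding continuous_map_alt
   proof (intro conjI allI impI)
    fix T :: "(complex ^ 'm) set" assume "openin euclidean T"
    hence "openM {x \<in> X. F x \<in> T}" by (intro openM_vimage_out[OF openM_X F(1)]) simp
    moreover have "F -` T \<inter> topspace (mtop M) = {x \<in> X. F x \<in> T}" using X by auto
    ultimately show "openin (mtop M) (F -` T \<inter> topspace (mtop M))" using openM_openin by simp
   qed simp
   show "F \<in> topspace (mtop M) \<rightarrow> D" using F(2) X by auto
  qed
 next
  case (2 c)
  obtain U \<phi> where c: "c = (U, \<phi>)" "(U, \<phi>) \<in> charts M" using 2 by (cases c) auto
  have "{x \<in> U. F x \<in> D} = U" using F(2) chart_X[OF c(2)] by auto
  moreover have "holo (\<lambda>s. F (inv_into U \<phi> s)) (\<phi> ` U)" by (rule holo_out_holo[OF F(1) holo_inv_chart[OF c(2)]])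
  ultimately show ?case by (simp add: c(1) holo_vec_iff o_def)
 qed
 moreover have "holomorphic_map (domain_manifold D) M G"
  unfolding holomorphic_map_def domain_manifold_def
 proof (simp, intro conjI ballI, goal_cases)
  case 1
  show ?case by (rule holo_in_continuous[OF G D])
 next
  case (2 c)
  obtain U \<phi> where c: "c = (U, \<phi>)" "(U, \<phi>) \<in> charts M" using 2 by (cases c) auto
  have "holo (\<lambda>s. \<phi> (G (inv_into D id s))) {s \<in> D. G s \<in> U}"
   by (rule holo_cong[OF holo_in_chart(2,1)[OF G D c(2)]]) (auto simp: inv_into_f_f[of id D, simplified])
  thus ?case by (simp add: c(1) holo_vec_iff o_def)
 qed
 ultimately show ?thesis
  unfolding biholomorphic_def using GF FG X by (intro exI[of _ F] exI[of _ G]) (simp add: domain_manifold_def)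
qed

end

theorem manifold_unionI:
 fixes M :: "('a, 'n::finite) cmanifold"
 assumes M: "complex_manifold M" and iu: "increasing_union_of_copies M Mj D"
  and D: "open D" "convex D" "D \<noteq> {}"
 obtains f g where "manifold_union D (points M) Mj f g M"
proof -
 have op: "openin (mtop M) (Mj j)" and sub: "Mj j \<subseteq> Mj (Suc j)" and un: "(\<Union>j. Mj j) = points M"
  and bi: "biholomorphic (open_submanifold M (Mj j)) (domain_manifold D)" for j
  using iu by (auto simp: increasing_union_of_copies_def)
 have MX: "Mj j \<subseteq> points M" for j by (rule openin_subset[OF op])
 have "\<forall>j. \<exists>fg. holomorphic_map (open_submanifold M (Mj j)) (domain_manifold D) (fst fg) \<and>
   holomorphic_map (domain_manifold D) (open_submanifold M (Mj j)) (snd fg) \<and>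
   (\<forall>x\<in>Mj j. snd fg (fst fg x) = x) \<and> (\<forall>y\<in>D. fst fg (snd fg y) = y)"
 proof
  fix j
  have "points (open_submanifold M (Mj j)) = Mj j" "points (domain_manifold D) = D"
   using MX by (auto simp: open_submanifold_def domain_manifold_def)
  with bi[of j] show "\<exists>fg. holomorphic_map (open_submanifold M (Mj j)) (domain_manifold D) (fst fg) \<and>
   holomorphic_map (domain_manifold D) (open_submanifold M (Mj j)) (snd fg) \<and>
   (\<forall>x\<in>Mj j. snd fg (fst fg x) = x) \<and> (\<forall>y\<in>D. fst fg (snd fg y) = y)"
   unfolding biholomorphic_def by auto
 qed
 from choice[OF this] obtain fg where fg: "\<forall>j. holomorphic_map (open_submanifold M (Mj j)) (domain_manifold D) (fst (fg j)) \<and>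
   holomorphic_map (domain_manifold D) (open_submanifold M (Mj j)) (snd (fg j)) \<and>
   (\<forall>x\<in>Mj j. snd (fg j) (fst (fg j) x) = x) \<and> (\<forall>y\<in>D. fst (fg j) (snd (fg j) y) = y)" ..
 define f where "f j = fst (fg j)" for j
 define g where "g j = snd (fg j)" for j
 have hf: "holomorphic_map (open_submanifold M (Mj j)) (domain_manifold D) (f j)"
  and hg: "holomorphic_map (domain_manifold D) (open_submanifold M (Mj j)) (g j)"
  and gf: "x \<in> Mj j \<Longrightarrow> g j (f j x) = x" and fg: "y \<in> D \<Longrightarrow> f j (g j y) = y" for j x y
  using fg by (auto simp: f_def g_def)
 have cf: "continuous_map (subtopology (mtop M) (Mj j)) (top_of_set D) (f j)"
  and cg: "continuous_map (top_of_set D) (subtopology (mtop M) (Mj j)) (g j)" for j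
  using hf[of j] hg[of j] by (auto simp: holomorphic_map_def open_submanifold_def domain_manifold_def)
 have f_in: "f j x \<in> D" if "x \<in> Mj j" for j x
  using continuous_map_image_subset_topspace[OF cf[of j]] that MX by auto
 have g_in: "g j y \<in> Mj j" if "y \<in> D" for j y
  using continuous_map_image_subset_topspace[OF cg[of j]] that by auto
 have og: "open {y \<in> D. g j y \<in> V}" if V: "openin (mtop M) V" for j V
 proof -
  have "openin (subtopology (mtop M) (Mj j)) (V \<inter> Mj j)" using V by (auto simp: openin_subtopology)
  from openin_continuous_map_preimage[OF cg this] have "openin (top_of_set D) {y \<in> D. g j y \<in> V \<inter> Mj j}" by simp
  moreover have "{y \<in> D. g j y \<in> V \<inter> Mj j} = {y \<in> D. g j y \<in> V}" using g_in by auto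
  ultimately show ?thesis using openin_open_trans[OF _ D(1)] by simp
 qed
 have of: "openin (mtop M) {x \<in> Mj j. f j x \<in> T}" if T: "open T" for j T
 proof -
  have "openin (top_of_set D) (T \<inter> D)" using T by (auto simp: openin_open)
  from openin_continuous_map_preimage[OF cf this]
  have "openin (subtopology (mtop M) (Mj j)) {x \<in> topspace (mtop M) \<inter> Mj j. f j x \<in> T \<inter> D}" by simp
  moreover have "{x \<in> topspace (mtop M) \<inter> Mj j. f j x \<in> T \<inter> D} = {x \<in> Mj j. f j x \<in> T}" using MX f_in by auto
  ultimately show ?thesis using openin_trans_full[OF _ op] by simp
 qed
 have chart: "openin (mtop M) U" "open (\<phi> ` U)" "homeomorphic_map (subtopology (mtop M) U) (top_of_set (\<phi> ` U)) \<phi>"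
  if "(U, \<phi>) \<in> charts M" for U \<phi>
  using M that unfolding complex_manifold_def by auto
 have cover: "\<exists>U \<phi>. (U, \<phi>) \<in> charts M \<and> x \<in> U" if "x \<in> points M" for x
  using M that unfolding complex_manifold_def by blast
 have inj: "inj_on \<phi> U" if "(U, \<phi>) \<in> charts M" for U \<phi>
  using homeomorphic_imp_injective_map[OF chart(3)[OF that]] openin_subset[OF chart(1)[OF that]] by (simp add: inf_absorb2)
 have ochart: "open (\<phi> ` (U \<inter> V))" if c: "(U, \<phi>) \<in> charts M" and V: "openin (mtop M) V" for U \<phi> V
 proof -
  have "openin (subtopology (mtop M) U) (U \<inter> V)" using V by (auto simp: openin_subtopology)
  hence "openin (top_of_set (\<phi> ` U)) (\<phi> ` (U \<inter> V))"
   using homeomorphic_imp_open_map[OF chart(3)[OF c]] unfolding open_map_def by blast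
  thus ?thesis by (rule openin_open_trans[OF _ chart(2)[OF c]])
 qed
 have h1: "holo (\<lambda>y. \<phi> (g j y)) {y \<in> D. g j y \<in> U}" if c: "(U, \<phi>) \<in> charts M" for U \<phi> j
 proof -
  \<comment> \<open>The chart map of \<open>domain_manifold\<close> is \<open>id\<close>, so its
    inverse enters as \<open>inv_into D id\<close>, which is known to be the identity only on
    \<open>D\<close>.\<close>
  have "holo (\<lambda>y. \<phi> (g j (inv_into D id y))) {y \<in> D. g j y \<in> U \<inter> Mj j}"
  proof -
   have "(U \<inter> Mj j, \<phi>) \<in> charts (open_submanifold M (Mj j))" "(D, id) \<in> charts (domain_manifold D)"
    using c by (auto simp: open_submanifold_def domain_manifold_def)
   with hg[of j] have "holomorphic_vec_on (\<phi> \<circ> g j \<circ> inv_into D id) (id ` {y \<in> D. g j y \<in> U \<inter> Mj j})"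
    unfolding holomorphic_map_def by fast
   thus ?thesis by (simp add: holo_vec_iff o_def)
  qed
  moreover have "{y \<in> D. g j y \<in> U \<inter> Mj j} = {y \<in> D. g j y \<in> U}" using g_in by auto
  ultimately have "holo (\<lambda>y. \<phi> (g j (inv_into D id y))) {y \<in> D. g j y \<in> U}" by simp
  thus ?thesis by (rule holo_cong[OF _ og[OF chart(1)[OF c]]]) (auto simp: inv_into_f_f[of id D, simplified])
 qed
 have h2: "holo (\<lambda>s. f j (inv_into U \<phi> s)) (\<phi> ` (U \<inter> Mj j))" if c: "(U, \<phi>) \<in> charts M" for U \<phi> j
 proof -
  \<comment> \<open>The chart of the open submanifold is restricted to
    \<open>U \<inter> Mj j\<close>; on the image of this set its inverse agrees with the one of the
    full chart.\<close>
  have "holo (\<lambda>s. f j (inv_into (U \<inter> Mj j) \<phi> s)) (\<phi> ` {x \<in> U \<inter> Mj j. f j x \<in> D})"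
  proof -
   have "(U \<inter> Mj j, \<phi>) \<in> charts (open_submanifold M (Mj j))" "(D, id) \<in> charts (domain_manifold D)"
    using c by (auto simp: open_submanifold_def domain_manifold_def)
   with hf[of j] have "holomorphic_vec_on (id \<circ> f j \<circ> inv_into (U \<inter> Mj j) \<phi>) (\<phi> ` {x \<in> U \<inter> Mj j. f j x \<in> D})"
    unfolding holomorphic_map_def by fast
   thus ?thesis by (simp add: holo_vec_iff o_def)
  qed
  moreover have "{x \<in> U \<inter> Mj j. f j x \<in> D} = U \<inter> Mj j" using f_in by auto
  ultimately have "holo (\<lambda>s. f j (inv_into (U \<inter> Mj j) \<phi> s)) (\<phi> ` (U \<inter> Mj j))" by simp
  thus ?thesis
  proof (rule holo_cong[OF _ ochart[OF c op]])
   fix s assume "s \<in> \<phi> ` (U \<inter> Mj j)"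
   then obtain x where x: "x \<in> U \<inter> Mj j" "s = \<phi> x" by blast
   thus "f j (inv_into (U \<inter> Mj j) \<phi> s) = f j (inv_into U \<phi> s)"
    using inv_into_f_f[OF inj[OF c]] inv_into_f_f[OF inj_on_subset[OF inj[OF c]], of "U \<inter> Mj j"] by simp
  qed
 qed
 interpret union_of_copies D "points M" Mj f g
 proof
  show "holo (\<lambda>y. f i (g k y)) {y \<in> D. g k y \<in> Mj i}" for i k
  proof (rule holo_local)
   fix y assume y: "y \<in> {y \<in> D. g k y \<in> Mj i}"
   then obtain U \<phi> where c: "(U, \<phi>) \<in> charts M" "g k y \<in> U" using cover[of "g k y"] MX by blast
   let ?T = "{y \<in> D. g k y \<in> U \<inter> Mj i}"
   have "holo (\<lambda>y. f i (inv_into U \<phi> (\<phi> (g k y)))) ?T"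
    by (rule holo_compose[OF holo_subset[OF h1[OF c(1)]] h2[OF c(1)]]) auto
   hence "holo (\<lambda>y. f i (g k y)) ?T"
    by (rule holo_cong[OF _ og[OF openin_Int[OF chart(1)[OF c(1)] op]]]) (simp add: inv_into_f_f[OF inj[OF c(1)]])
   with y c(2) show "\<exists>T. y \<in> T \<and> holo (\<lambda>y. f i (g k y)) T" by (intro exI[of _ ?T] conjI) auto
  qed
 qed (fact D sub un f_in g_in gf fg og[OF op])+
 have "manifold_union D (points M) Mj f g M"
 proof
  show "openM V" if "openin (mtop M) V" for V
   unfolding openM_def using og[OF that] openin_subset[OF that] by blast
  show "openin (mtop M) W" if W: "openM W" for W
  proof -
   have "W = (\<Union>j. {x \<in> Mj j. f j x \<in> {y \<in> D. g j y \<in> W}})"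
   proof (intro set_eqI iffI)
    fix x assume x: "x \<in> W"
    then obtain j where j: "x \<in> Mj j" using W un unfolding openM_def by blast
    have "f j x \<in> {y \<in> D. g j y \<in> W}" using f_in[OF j] gf[OF j] x by simp
    with j show "x \<in> (\<Union>j. {x \<in> Mj j. f j x \<in> {y \<in> D. g j y \<in> W}})" by blast
   qed (auto simp: gf)
   moreover have "openin (mtop M) {x \<in> Mj j. f j x \<in> {y \<in> D. g j y \<in> W}}" for j
    by (rule of) (use W in \<open>simp add: openM_def\<close>)
   ultimately show ?thesis by (metis (no_types, lifting) openin_Union imageE)
  qed
  fix U \<phi> assume c: "(U, \<phi>) \<in> charts M"
  show "holo_out \<phi> U" unfolding holo_out_def using h1[OF c] by blast
  show "holo_in (inv_into U \<phi>) (\<phi> ` U)"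
   unfolding holo_in_def
  proof (intro conjI allI)
   show "inv_into U \<phi> ` \<phi> ` U \<subseteq> points M"
    using openin_subset[OF chart(1)[OF c]] inv_into_f_f[OF inj[OF c]] by auto
   fix i
   have "{s \<in> \<phi> ` U. inv_into U \<phi> s \<in> Mj i} = \<phi> ` (U \<inter> Mj i)"
    using inv_into_f_f[OF inj[OF c]] by auto
   thus "open {s \<in> \<phi> ` U. inv_into U \<phi> s \<in> Mj i}"
    "holo (\<lambda>s. f i (inv_into U \<phi> s)) {s \<in> \<phi> ` U. inv_into U \<phi> s \<in> Mj i}"
    using ochart[OF c op] h2[OF c] by simp_all
  qed
 qed (fact refl cover chart(1) chart(2) inj)+
 thus ?thesis by (rule that)
qed

section \<open>The Kobayashi metric and distance of the union\<close>

context manifold_union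
begin

text \<open>The tangent vector at \<open>g i y\<close> with coordinates \<open>\<xi>\<close> in the
  \<open>i\<close>-th copy, as a family over the charts; the zero entries follow the convention of
  \<open>tangent_space\<close>.\<close>

definition tangent :: "nat \<Rightarrow> complex ^ 'n \<Rightarrow> complex ^ 'n \<Rightarrow> ('a, 'n) chart \<Rightarrow> complex ^ 'n" where
 "tangent i y \<xi> c = (if c \<in> charts_at M (g i y) then cder (\<lambda>z. snd c (g i z)) y \<xi> else 0)"

context
 fixes i :: nat and y :: "complex ^ 'n"
 assumes y: "y \<in> Om"
begin

lemma g_X: "g i y \<in> X" using g_in[OF y] Mi_X by blast

lemma charts_atD:
 assumes "c \<in> charts_at M (g i y)" shows "(fst c, snd c) \<in> charts M" "g i y \<in> fst c"
 using assms by (auto simp: charts_at_def)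

lemma chart_g:
 assumes c: "c \<in> charts_at M (g i y)"
 shows "open {z \<in> Om. g i z \<in> fst c}" "holo (\<lambda>z. snd c (g i z)) {z \<in> Om. g i z \<in> fst c}" "y \<in> {z \<in> Om. g i z \<in> fst c}"
 using holo_in_chart[OF holo_in_g open_Om charts_atD(1)[OF c]] charts_atD(2)[OF c] y by auto

lemma transition_tangent:
 assumes c: "c \<in> charts_at M (g i y)" and d: "d \<in> charts_at M (g i y)"
 shows "tangent i y \<xi> d = frechet_derivative (transition c d) (at (snd c (g i y))) (tangent i y \<xi> c)"
proof -
 let ?T = "{s \<in> snd c ` fst c. inv_into (fst c) (snd c) s \<in> fst d}"
 note t = holo_in_chart[OF holo_inv_chart[OF charts_atD(1)[OF c]] open_chart[OF charts_atD(1)[OF c]] charts_atD(1)[OF d]]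
 have tr: "transition c d = (\<lambda>s. snd d (inv_into (fst c) (snd c) s))" by (simp add: transition_def o_def)
 let ?S = "{z \<in> Om. g i z \<in> fst c} \<inter> {z \<in> Om. g i z \<in> fst d}"
 have yS: "y \<in> ?S" using chart_g(3)[OF c] chart_g(3)[OF d] by blast
 have yT: "snd c (g i y) \<in> ?T" using yS by (auto simp: inv_chart[OF charts_atD(1)[OF c]])
 have "cder (\<lambda>z. snd d (g i z)) y = cder (\<lambda>z. snd d (inv_into (fst c) (snd c) (snd c (g i z)))) y"
 proof (rule cder_cong[OF open_Int[OF chart_g(1)[OF c] chart_g(1)[OF d]] yS _ holo_subset[OF chart_g(2)[OF d]]])
  fix z assume "z \<in> ?S"
  thus "snd d (g i z) = snd d (inv_into (fst c) (snd c) (snd c (g i z)))"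
   using inv_chart[OF charts_atD(1)[OF c], of "g i z"] by simp
 qed simp
 hence "cder (\<lambda>z. snd d (g i z)) y \<xi> = cder (\<lambda>z. snd d (inv_into (fst c) (snd c) (snd c (g i z)))) y \<xi>" by (rule fun_cong)
 also have "\<dots> = cder (\<lambda>s. snd d (inv_into (fst c) (snd c) s)) (snd c (g i y)) (cder (\<lambda>z. snd c (g i z)) y \<xi>)"
  by (rule cder_compose[OF chart_g(2)[OF c] t(2) chart_g(3)[OF c] yT])
 finally show ?thesis unfolding tangent_def tr if_P[OF c] if_P[OF d] .
qed

lemma tangent_in: "tangent i y \<xi> \<in> tangent_space M (g i y)"
 unfolding tangent_space_def
proof (intro CollectI conjI allI impI ballI)
 show "tangent i y \<xi> c = 0" if "c \<notin> charts_at M (g i y)" for c using that by (simp add: tangent_def)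
qed (rule transition_tangent)

lemma chart_exists: obtains c where "c \<in> charts_at M (g i y)"
proof -
 obtain U \<phi> where "(U, \<phi>) \<in> charts M" "g i y \<in> U" using charts_cover[OF g_X] by blast
 thus ?thesis by (intro that[of "(U, \<phi>)"]) (simp add: charts_at_def)
qed

text \<open>A chart read in the copy and its inverse have mutually inverse derivatives. So one entry
  of a tangent vector determines \<open>\<xi>\<close>, which makes \<open>tangent i y\<close>
  injective and onto.\<close>

lemma chart_inverse_derivative:
 assumes c: "c \<in> charts_at M (g i y)"
 defines "L \<equiv> cder (\<lambda>s. f i (inv_into (fst c) (snd c) s)) (snd c (g i y))"
 shows "cder (\<lambda>z. snd c (g i z)) y (L w) = w" "L (cder (\<lambda>z. snd c (g i z)) y \<xi>) = \<xi>"
proof -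
 let ?inv = "inv_into (fst c) (snd c)" and ?p = "snd c (g i y)"
 let ?T = "{s \<in> snd c ` fst c. ?inv s \<in> Mi i}" and ?S = "{z \<in> Om. g i z \<in> fst c}"
 have hi: "holo_in ?inv (snd c ` fst c)" by (rule holo_inv_chart[OF charts_atD(1)[OF c]])
 have inv_p: "?inv (snd c x) = x" if "x \<in> fst c" for x by (rule inv_chart[OF charts_atD(1)[OF c] that])
 have pT: "?p \<in> ?T" using inv_p[OF charts_atD(2)[OF c]] charts_atD(2)[OF c] g_in[OF y] by simp
 have fp: "f i (?inv ?p) = y" using inv_p[OF charts_atD(2)[OF c]] fg[OF y] by simp
 have in_c: "?inv s \<in> fst c" "snd c (?inv s) = s" if "s \<in> snd c ` fst c" for s
  using that by (auto simp: inv_into_into f_inv_into_f)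
 have fpS: "f i (?inv ?p) \<in> ?S" using fp chart_g(3)[OF c] by simp
 have "cder (\<lambda>z. snd c (g i z)) (f i (?inv ?p)) (L w) = cder (\<lambda>s. snd c (g i (f i (?inv s)))) ?p w"
  unfolding L_def by (rule cder_compose[OF holo_in_D(2)[OF hi] chart_g(2)[OF c] pT fpS, symmetric])
 also have "cder (\<lambda>s. snd c (g i (f i (?inv s)))) ?p = cder (\<lambda>s. s) ?p"
  by (rule cder_cong[OF holo_in_D(1)[OF hi] pT _ holo_ident, symmetric]) (use in_c gf in auto)
 also have "cder (\<lambda>s. s) ?p w = w" by (subst cder_eqI[OF has_derivative_ident]) simp
 finally show "cder (\<lambda>z. snd c (g i z)) y (L w) = w" by (simp only: fp)
 have "L (cder (\<lambda>z. snd c (g i z)) y \<xi>) = cder (\<lambda>z. f i (?inv (snd c (g i z)))) y \<xi>"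
  unfolding L_def by (rule cder_compose[OF chart_g(2)[OF c] holo_in_D(2)[OF hi] chart_g(3)[OF c] pT, symmetric])
 also have "cder (\<lambda>z. f i (?inv (snd c (g i z)))) y = cder (\<lambda>z. z) y"
  by (rule cder_cong[OF chart_g(1)[OF c] chart_g(3)[OF c] _ holo_ident, symmetric]) (use inv_p fg in auto)
 also have "cder (\<lambda>z. z) y \<xi> = \<xi>" by (subst cder_eqI[OF has_derivative_ident]) simp
 finally show "L (cder (\<lambda>z. snd c (g i z)) y \<xi>) = \<xi>" .
qed

lemma tangent_inject: assumes "tangent i y \<xi> = tangent i y \<eta>" shows "\<xi> = \<eta>"
proof -
 obtain c where c: "c \<in> charts_at M (g i y)" by (rule chart_exists)
 hence "cder (\<lambda>z. snd c (g i z)) y \<xi> = cder (\<lambda>z. snd c (g i z)) y \<eta>"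
  using fun_cong[OF assms, of c] by (simp add: tangent_def)
 from arg_cong[OF this, of "cder (\<lambda>s. f i (inv_into (fst c) (snd c) s)) (snd c (g i y))"]
 show ?thesis by (simp only: chart_inverse_derivative(2)[OF c])
qed

lemma tangent_surj: assumes v: "v \<in> tangent_space M (g i y)" obtains \<xi> where "v = tangent i y \<xi>"
proof -
 obtain c where c: "c \<in> charts_at M (g i y)" by (rule chart_exists)
 define \<xi> where "\<xi> = cder (\<lambda>s. f i (inv_into (fst c) (snd c) s)) (snd c (g i y)) (v c)"
 have vc: "tangent i y \<xi> c = v c" using chart_inverse_derivative(1)[OF c] c by (simp add: tangent_def \<xi>_def)
 have "v d = tangent i y \<xi> d" for d
 proof (cases "d \<in> charts_at M (g i y)")
  case True
  have "v d = frechet_derivative (transition c d) (at (snd c (g i y))) (v c)"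
   using v c True unfolding tangent_space_def by blast
  thus ?thesis by (simp only: transition_tangent[OF c True, of \<xi>] vc)
 next
  case False
  hence "v d = 0" using v unfolding tangent_space_def by blast
  with False show ?thesis by (simp add: tangent_def)
 qed
 thus ?thesis by (intro that) (rule ext)
qed

lemma tangent_scale_tangent: "tangent_scale a (tangent i y \<xi>) = tangent i y (cs a \<xi>)"
 using clinearD(2)[OF holoD(2)[OF chart_g(2,3)]]
 by (auto simp: fun_eq_iff tangent_scale_def tangent_def cs_vec_eq[symmetric])

lemma disc_velocity_tangent:
 assumes G: "holo_in G (ball 0 1)" and G0: "G 0 = g i y"
 shows "disc_velocity M G = tangent i y (cder (\<lambda>t. f i (G t)) 0 1)"
proof
 fix c
 show "disc_velocity M G c = tangent i y (cder (\<lambda>t. f i (G t)) 0 1) c"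
 proof (cases "c \<in> charts_at M (g i y)")
  case True
  let ?S = "{s \<in> ball 0 1. G s \<in> fst c}" and ?T = "{t \<in> ball 0 1. G t \<in> Mi i}"
  note hc = holo_in_chart[OF G open_ball charts_atD(1)[OF True]]
  have 0: "0 \<in> ?S" "0 \<in> ?T" "0 \<in> ?S \<inter> ?T" using charts_atD(2)[OF True] g_in[OF y] G0 by auto
  have "deriv (\<lambda>z. snd c (G z) $ k) 0 = cder (\<lambda>z. snd c (G z)) 0 1 $ k" for k
  proof -
   have "((\<lambda>z. snd c (G z) $ k) has_derivative (\<lambda>v. cder (\<lambda>z. snd c (G z)) 0 v $ k)) (at 0)"
    by (rule bounded_linear.has_derivative[OF bounded_linear_vec_nth holoD(1)[OF hc(2) 0(1)]])
   from cder_eqI[OF this] show ?thesis using cder_complex(2)[OF holo_vec_nth[OF hc(2)] 0(1)] by simp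
  qed
  hence "disc_velocity M G c = cder (\<lambda>z. snd c (G z)) 0 1"
   using True G0 by (simp add: disc_velocity_def vec_eq_iff)
  also have "cder (\<lambda>z. snd c (G z)) 0 = cder (\<lambda>t. snd c (g i (f i (G t)))) 0"
   by (rule cder_cong[OF open_Int[OF hc(1) holo_in_D(1)[OF G]] 0(3) _ holo_subset[OF hc(2)]]) (auto simp: gf)
  also have "\<dots> 1 = cder (\<lambda>z. snd c (g i z)) (f i (G 0)) (cder (\<lambda>t. f i (G t)) 0 1)"
   by (rule cder_compose[OF holo_in_D(2)[OF G] chart_g(2)[OF True] 0(2)]) (use chart_g(3)[OF True] G0 fg[OF y] in simp)
  finally show ?thesis using True G0 fg[OF y] by (simp add: tangent_def)
 qed (simp add: disc_velocity_def tangent_def G0)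
qed

end

end

locale manifold_limit = limit_charts Om X Mi f g D U Dk phi psi Phi + manifold_union Om X Mi f g M
 for Om :: "(complex ^ 'n::finite) set" and X :: "'a set" and Mi f g D U Dk phi psi Phi and M :: "('a, 'n) cmanifold"
begin

text \<open>By \<open>close_discs\<close> two points with the same image lie on one disc at the
  parameters \<open>0\<close> and \<open>a\<close> with \<open>a\<close> arbitrarily small, and
  \<open>artanh\<close> is continuous at zero.\<close>

lemma hyperbolic_imp_inj:
 assumes hyp: "kobayashi_hyperbolic M" shows "inj_on Phi X"
proof (rule inj_onI, rule ccontr)
 fix x y assume xy: "x \<in> X" "y \<in> X" "Phi x = Phi y" "x \<noteq> y"
 have le_e: "kobayashi_dist M x y \<le> ennreal e" if e: "e > 0" for e
 proof -
  have "isCont artanh (0::real)" by (intro continuous_intros) auto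
  hence "\<forall>\<^sub>F t in at 0. artanh t < e" using e by (intro order_tendstoD) (auto simp: isCont_def)
  then obtain d where d: "d > 0" "\<And>t. t \<noteq> 0 \<Longrightarrow> \<bar>t\<bar> < d \<Longrightarrow> artanh t < e" by (auto simp: eventually_at dist_norm)
  obtain G a where G: "holo_in G (ball 0 1)" "G 0 = x" "G a = y" "cmod a < d" "cmod a < 1"
   by (rule close_discs[OF xy(1-3) d(1)]) (rule that)
  have "a \<noteq> 0" using G(2,3) xy(4) by auto
  hence "artanh (cmod a) < e" using d(2)[of "cmod a"] G(4) by simp
  hence le: "ennreal (poincare_dist 0 a) \<le> ennreal e" by (simp add: poincare_dist_def ennreal_leI)
  \<comment> \<open>The links are indexed by \<open>i \<le> n\<close>, so \<open>n = 0\<close> is a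
    chain of one disc.\<close>
  have "kobayashi_dist M x y \<le> (\<Sum>i\<le>0::nat. ennreal (poincare_dist 0 a))"
   unfolding kobayashi_dist_def
   by (rule Inf_lower, rule CollectI,
     intro exI[of _ "0::nat"] exI[of _ "\<lambda>_. G"] exI[of _ "\<lambda>_. 0"] exI[of _ "\<lambda>_. a"])
     (use G holo_in_disc in simp)
  with le show ?thesis by simp
 qed
 have "kobayashi_dist M x y \<le> 0" by (rule ennreal_le_epsilon) (use le_e in simp)
 thus False using hyp xy X by (simp add: kobayashi_hyperbolic_def)
qed

text \<open>Along the kernel \<open>null_discs\<close> provides discs of arbitrarily large velocity;
  off the kernel \<open>disc_velocity_bound\<close> bounds the admissible \<open>\<alpha>\<close>
  from above.\<close>

lemma kobayashi_null:
 assumes y: "y \<in> Om"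
 shows "kobayashi_metric M (g i y) (tangent i y \<xi>) = 0 \<longleftrightarrow> cder (\<lambda>y. Phi (g i y)) y \<xi> = 0"
proof
 let ?L = "cder (\<lambda>y. Phi (g i y)) y"
 assume null: "?L \<xi> = 0"
 have le_e: "kobayashi_metric M (g i y) (tangent i y \<xi>) \<le> ennreal e" if e: "e > 0" for e
 proof -
  have "1 / e > 0" using e by simp
  then obtain G :: "complex \<Rightarrow> 'a" where G: "holo_in G (ball 0 1)" "G 0 = g i y" "cder (\<lambda>t. f i (G t)) 0 1 = (1 / e) *\<^sub>R \<xi>"
   by (rule null_discs[OF y null]) (rule that)
  have "disc_velocity M G = tangent_scale (complex_of_real (1 / e)) (tangent i y \<xi>)"
   unfolding disc_velocity_tangent[OF y G(1,2)] tangent_scale_tangent[OF y] G(3) cs_of_real ..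
  hence "kobayashi_metric M (g i y) (tangent i y \<xi>) \<le> ennreal (1 / (1 / e))"
   unfolding kobayashi_metric_def using G holo_in_disc e by (intro Inf_lower CollectI exI[of _ "1 / e"] exI[of _ G]) auto
  thus ?thesis by simp
 qed
 have "kobayashi_metric M (g i y) (tangent i y \<xi>) \<le> 0" by (rule ennreal_le_epsilon) (use le_e in simp)
 thus "kobayashi_metric M (g i y) (tangent i y \<xi>) = 0" by simp
next
 let ?L = "cder (\<lambda>y. Phi (g i y)) y"
 assume zero: "kobayashi_metric M (g i y) (tangent i y \<xi>) = 0"
 show "?L \<xi> = 0"
 proof (rule ccontr)
  assume nz: "?L \<xi> \<noteq> 0"
  obtain B where B: "\<And>(G :: complex \<Rightarrow> 'a) y i. holo_in G (ball 0 1) \<Longrightarrow> y \<in> Om \<Longrightarrow> G 0 = g i y \<Longrightarrow>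
   norm (cder (\<lambda>y. Phi (g i y)) y (cder (\<lambda>t. f i (G t)) 0 1)) \<le> B"
   by (rule disc_velocity_bound) (rule that)
  define C where "C = max B 1"
  have C: "C > 0" "B \<le> C" by (auto simp: C_def)
  have "ennreal (norm (?L \<xi>) / C) \<le> kobayashi_metric M (g i y) (tangent i y \<xi>)"
   unfolding kobayashi_metric_def
  proof (rule Inf_greatest, elim CollectE exE conjE)
   fix e \<alpha> G assume e: "e = ennreal (1 / \<alpha>)" and \<alpha>: "0 < \<alpha>" and G: "holomorphic_disc M G" "G 0 = g i y"
    and v: "disc_velocity M G = tangent_scale (complex_of_real \<alpha>) (tangent i y \<xi>)"
   have hG: "holo_in G (ball 0 1)" using G(1) holo_in_disc by blast
   have "tangent i y (cder (\<lambda>t. f i (G t)) 0 1) = tangent i y (cs (complex_of_real \<alpha>) \<xi>)"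
    using v by (simp only: disc_velocity_tangent[OF y hG G(2)] tangent_scale_tangent[OF y])
   hence "cder (\<lambda>t. f i (G t)) 0 1 = cs (complex_of_real \<alpha>) \<xi>" by (rule tangent_inject[OF y])
   hence "norm (?L (cs (complex_of_real \<alpha>) \<xi>)) \<le> B" using B[OF hG y G(2)] by simp
   hence "\<alpha> * norm (?L \<xi>) \<le> C"
    using \<alpha> C(2) by (simp add: linear_cmul[OF linear_cder[OF holo_Phi_g y]] cs_of_real)
   hence "norm (?L \<xi>) / C \<le> 1 / \<alpha>" using \<alpha> C(1) by (simp add: field_simps)
   thus "ennreal (norm (?L \<xi>) / C) \<le> e" unfolding e by (rule ennreal_leI)
  qed
  thus False using zero nz C(1) by (simp add: ennreal_eq_0_iff divide_le_0_iff)
 qed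
qed

end

text \<open>The map \<open>tangent\<close> identifies the null set of the metric with the kernel of
  the derivative of \<open>Phi\<close>; dimension one excludes both the trivial kernel and the whole
  space.\<close>

lemma corank_one:
 fixes Om :: "(complex ^ 2) set" and M :: "('a, 2) cmanifold"
 assumes "manifold_limit Om X Mi f g D U Dk phi psi Phi M"
  and p: "p \<in> points M" and corank: "kobayashi_corank M p = 1"
 obtains i y \<xi> \<eta> where "y \<in> Om" "\<xi> \<noteq> 0" "cder (\<lambda>y. Phi (g i y)) y \<xi> = 0" "cder (\<lambda>y. Phi (g i y)) y \<eta> \<noteq> 0"
proof -
 interpret manifold_limit Om X Mi f g D U Dk phi psi Phi M by (rule assms(1))
 interpret ts: vector_space "tangent_scale :: complex \<Rightarrow> (('a, 2) chart \<Rightarrow> complex ^ 2) \<Rightarrow> _"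
  by (rule vector_space_tangent_scale)
 have "p \<in> X" using p X by simp
 then obtain i y where y: "y \<in> Om" "p = g i y" by (rule X_E)
 let ?L = "cder (\<lambda>y. Phi (g i y)) y"
 define N where "N = {v \<in> tangent_space M p. kobayashi_metric M p v = 0}"
 have dimN: "ts.dim N = 1" using corank by (simp add: kobayashi_corank_def N_def)
 have N: "v \<in> N \<longleftrightarrow> (\<exists>\<xi>. v = tangent i y \<xi> \<and> ?L \<xi> = 0)" for v
 proof
  assume v: "v \<in> N"
  then obtain \<xi> where \<xi>: "v = tangent i y \<xi>" using tangent_surj[OF y(1)] by (auto simp: N_def y(2))
  moreover have "?L \<xi> = 0" using v kobayashi_null[OF y(1), of i \<xi>] by (simp add: N_def y(2) \<xi>)
  ultimately show "\<exists>\<xi>. v = tangent i y \<xi> \<and> ?L \<xi> = 0" by blast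
 next
  assume "\<exists>\<xi>. v = tangent i y \<xi> \<and> ?L \<xi> = 0"
  thus "v \<in> N" using kobayashi_null[OF y(1)] tangent_in[OF y(1)] by (auto simp: N_def y(2))
 qed
 have "\<exists>\<xi>. \<xi> \<noteq> 0 \<and> ?L \<xi> = 0"
 proof (rule ccontr)
  assume neg: "\<not> ?thesis"
  have t0: "tangent i y 0 = 0"
   using tangent_scale_tangent[OF y(1), of 0 i 0] by (simp add: tangent_scale_def zero_fun_def)
  have "N \<subseteq> ts.span {}"
  proof
   fix v assume "v \<in> N"
   then obtain \<xi> where \<xi>: "v = tangent i y \<xi>" "?L \<xi> = 0" using N by blast
   hence "\<xi> = 0" using neg by blast
   thus "v \<in> ts.span {}" using \<xi>(1) t0 by simp
  qed
  from ts.dim_le_card[OF this] dimN show False by simp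
 qed
 then obtain \<xi> where \<xi>: "\<xi> \<noteq> 0" "?L \<xi> = 0" by blast
 have "\<exists>\<eta>. ?L \<eta> \<noteq> 0"
 proof (rule ccontr)
  assume "\<not> ?thesis"
  \<comment> \<open>If every vector were null, a single \<open>\<beta>\<close> would span, and both
    standard vectors would be multiples of it.\<close>
  hence all: "tangent i y \<eta> \<in> N" for \<eta> using N by blast
  obtain B where B: "B \<subseteq> N" "ts.independent B" "N \<subseteq> ts.span B" "card B = ts.dim N" by (rule ts.basis_exists)
  then obtain b where b: "B = {b}" using dimN by (auto simp: card_1_singleton_iff)
  obtain \<beta> where \<beta>: "b = tangent i y \<beta>" using B(1) b N by blast
  have "\<exists>k. \<eta> = cs k \<beta>" for \<eta>
  proof -
   have "tangent i y \<eta> \<in> ts.span {b}" using B(3) all b by blast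
   then obtain k where "tangent i y \<eta> = tangent_scale k b" unfolding ts.span_singleton by blast
   hence "tangent i y \<eta> = tangent i y (cs k \<beta>)" by (simp only: \<beta> tangent_scale_tangent[OF y(1)])
   thus ?thesis using tangent_inject[OF y(1)] by blast
  qed
  then obtain k l where k: "pt 1 0 = cs k \<beta>" and l: "pt 0 1 = cs l \<beta>" by metis
  have "k * \<beta> $ 1 = 1" "k * \<beta> $ 2 = 0" "l * \<beta> $ 1 = 0" "l * \<beta> $ 2 = 1"
   using arg_cong[OF k, of "\<lambda>v. v $ 1"] arg_cong[OF k, of "\<lambda>v. v $ 2"]
    arg_cong[OF l, of "\<lambda>v. v $ 1"] arg_cong[OF l, of "\<lambda>v. v $ 2"] by (simp_all add: cs_nth)
  thus False by (metis mult_eq_0_iff zero_neq_one)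
 qed
 with y(1) \<xi> show ?thesis by (elim exE) (rule that)
qed

theorem corollary1p4:
 fixes M :: "('a, 2) cmanifold" and Mj :: "nat \<Rightarrow> 'a set" and \<Omega> :: "(complex^2) set"
 assumes "complex_manifold M"
  and "smooth_strongly_convex_domain \<Omega>"
  and "increasing_union_of_copies M Mj \<Omega>"
 shows "(kobayashi_hyperbolic M \<longrightarrow>
      biholomorphic M (domain_manifold \<Omega>) \<or>
      biholomorphic M (domain_manifold (ball 0 1 :: (complex^2) set))) \<and>
     (\<not> kobayashi_hyperbolic M \<and> (\<exists>p\<in>points M. kobayashi_corank M p = 1) \<longrightarrow>
      biholomorphic M (domain_manifold {z :: complex^2. z $ 1 \<in> ball 0 1}))"
proof -
 obtain W r where D: "\<Omega> \<noteq> {}" "open \<Omega>" "bounded \<Omega>" "convex \<Omega>"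
  and r: "smooth_defining_function \<Omega> W r"
  and hess: "\<And>x v. x \<in> frontier \<Omega> \<Longrightarrow> v \<noteq> 0 \<Longrightarrow> frechet_derivative r (at x) v = 0 \<Longrightarrow> 0 < hessian_form r x v"
  using assms(2) unfolding smooth_strongly_convex_domain_def by blast
 obtain f g where mu: "manifold_union \<Omega> (points M) Mj f g M"
  by (rule manifold_unionI[OF assms(1,3) D(2,4,1)])
 then interpret manifold_union \<Omega> "points M" Mj f g M .
 obtain y0 where y0: "y0 \<in> \<Omega>" using D(1) by blast
 \<comment> \<open>Taken in the first copy, so that it lies in all of them.\<close>
 define x0 where "x0 = g 0 y0"
 have x0: "x0 \<in> Mj n" for n using g_in[OF y0, of 0] Mi_mono[of 0 n] by (auto simp: x0_def)
 \<comment> \<open>An accumulation point of the coordinates of the base point exists in the compact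
   closure; whether it is interior or on the boundary decides between the models
   \<open>\<Omega>\<close> and the ball.\<close>
 have cl: "\<forall>n. f n x0 \<in> closure \<Omega>" using f_in[OF x0] closure_subset by blast
 have "seq_compact (closure \<Omega>)" using D(3) by (intro compact_imp_seq_compact) simp
 from this cl obtain a s where a: "a \<in> closure \<Omega>" "strict_mono s" "((\<lambda>n. f n x0) \<circ> s) \<longlonglongrightarrow> a"
  by (rule seq_compactE) (rule that)
 have a3: "(\<lambda>n. f (s n) x0) \<longlonglongrightarrow> a" using a(3) by (simp add: o_def)
 have cp: "copies_subseq \<Omega> (points M) Mj f g s x0" by unfold_locales (use a(2) x0 in auto)
 obtain D' U Dk phi psi Phi where D': "D' = \<Omega> \<or> D' = ball 0 1"
  and lc: "limit_charts \<Omega> (points M) Mj f g D' U Dk phi psi Phi"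
 proof (cases "a \<in> \<Omega>")
  case True
  obtain U Dk phi psi Phi where "limit_charts \<Omega> (points M) Mj f g \<Omega> U Dk phi psi Phi"
   by (rule copies_subseq.interior_limit_charts[OF cp D(3) a3 True])
  thus ?thesis by (intro that[of \<Omega>]) auto
 next
  case False
  interpret C2_function r W
   by unfold_locales (use r in \<open>auto simp only: smooth_defining_function_def smooth_on_def\<close>)
  have fr: "frontier \<Omega> \<subseteq> W" "a \<in> frontier \<Omega>"
   using r a(1) False D(2) by (auto simp: smooth_defining_function_def frontier_def interior_open)
  interpret strongly_convex_point r W \<Omega> a
  proof
   show "0 < hs a v v" if "v \<noteq> 0" "dr a v = 0" for v
    using hess[OF fr(2) that(1)] that(2) hessian_hs[of a v] fr by (auto simp: dr_def)
   show "\<exists>v. dr x v \<noteq> 0" if "x \<in> frontier \<Omega>" for x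
    using r that by (simp add: smooth_defining_function_def dr_def)
   show "\<Omega> \<inter> W = {x \<in> W. r x < 0}" using r by (simp add: smooth_defining_function_def)
  qed (fact D fr)+
  obtain U Dk phi psi Phi where "limit_charts \<Omega> (points M) Mj f g (ball 0 1) U Dk phi psi Phi"
   by (rule boundary_limit_charts[OF cp a3])
  thus ?thesis by (intro that[of "ball 0 1"]) auto
 qed
 interpret lc: limit_charts \<Omega> "points M" Mj f g D' U Dk phi psi Phi by (rule lc)
 have ml: "manifold_limit \<Omega> (points M) Mj f g D' U Dk phi psi Phi M" by unfold_locales
 show ?thesis
 proof (intro conjI impI)
  assume "kobayashi_hyperbolic M"
  hence inj: "inj_on Phi (points M)" by (rule manifold_limit.hyperbolic_imp_inj[OF ml])
  have im: "Phi ` points M = D'" by (rule lc.injective_limit(1)[OF inj])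
  have "biholomorphic M (domain_manifold D')"
  proof (rule biholomorphicI[OF lc.holo_Phi _ lc.injective_limit(2)[OF inj] lc.open_D])
   show "Phi ` points M \<subseteq> D'" using im by simp
   show "inv_into (points M) Phi (Phi x) = x" if "x \<in> points M" for x using inj that by simp
   show "Phi (inv_into (points M) Phi y) = y" if "y \<in> D'" for y using that im by (simp add: f_inv_into_f)
  qed
  with D' show "biholomorphic M (domain_manifold \<Omega>) \<or> biholomorphic M (domain_manifold (ball 0 1 :: (complex^2) set))"
   by auto
 next
  assume "\<not> kobayashi_hyperbolic M \<and> (\<exists>p\<in>points M. kobayashi_corank M p = 1)"
  then obtain p where p: "p \<in> points M" "kobayashi_corank M p = 1" by blast
  obtain i y \<xi> \<eta> where y: "y \<in> \<Omega>" and \<xi>: "\<xi> \<noteq> 0" "cder (\<lambda>y. Phi (g i y)) y \<xi> = 0"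
   and \<eta>: "cder (\<lambda>y. Phi (g i y)) y \<eta> \<noteq> 0"
   by (rule corank_one[OF ml p]) (rule that)
  obtain pr T I where pr: "holo_out pr (points M)" "\<And>x. x \<in> points M \<Longrightarrow> pr x \<in> ball 0 1"
   and T: "triv pr 1 T I"
   by (rule rank_one_limit[OF lc y \<xi> \<eta>]) (rule that)
  note t = trivD[OF T]
  have "{x \<in> points M. pr x \<in> ball 0 1} = points M" using pr(2) by blast
  with t(1) have hT: "holo_out T (points M)" by simp
  show "biholomorphic M (domain_manifold {z :: complex^2. z $ 1 \<in> ball 0 1})"
  proof (rule biholomorphicI[OF _ _ t(2) open_strip])
   show "holo_out (\<lambda>x. pt (pr x) (T x)) (points M)"
    using pr(1) hT unfolding holo_out_def by (intro allI holo_pt) blast+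
   show "(\<lambda>x. pt (pr x) (T x)) ` points M \<subseteq> {z. z $ 1 \<in> ball 0 1}" using pr(2) by auto
   show "I (pt (pr x) (T x)) = x" if "x \<in> points M" for x by (rule t(3)[OF that pr(2)[OF that]])
   show "pt (pr (I z)) (T (I z)) = z" if "z \<in> {z. z $ 1 \<in> ball 0 1}" for z
    using t(5,6)[of z] that by simp
  qed
 qed
qed

end
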